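(* Let $X$ be an irreducible $\frac{d}{dm}\frac{d}{ds}$-diffusion on $(0,\infty)$ stopped at $0$ with $\mathbb{P}_x[T_0<\infty]=1$ for every $x>0$, and assume that $X$ has infinitely many quasi-stationary distributions. Let $\mu$ be a probability measure on $(0,\infty)$ with $\mathbb{E}_\mu T_0^n<\infty$ for all integers $n\ge1$. For $\lambda\in(0,\lambda_0]$ consider the following conditions: (i) $\mu_t\xrightarrow[t\to\infty]{}\nu_\lambda$ weakly, where $\mu_t(dx):=\mathbb{P}_\mu[X_t\in dx\mid T_0>t]$. (ii) $\lim_{t\to\infty}\dfrac{\mathbb{P}_\mu[T_0>t+s]}{\mathbb{P}_\mu[T_0>t]}=e^{-\lambda s}$ for every $s>0$. (iii) $\lim_{n\to\infty} m^\mu_{n-1}/m^\mu_n=\lambda$, where $m_n^\mu:=\frac{1}{n!}\mathbb{E}_\mu T_0^n$. (iv) $\Phi^n\mu\xrightarrow[n\to\infty]{}\nu_\lambda$ weakly, where $\Phi$ is the renewal transform. Then the following implications hold: (i) $\Rightarrow$ (ii), (ii) $\Rightarrow$ (iii), and (iii) $\Leftrightarrow$ (iv).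
   Context: Setting: $X$ is a one-dimensional diffusion, i.e. a time-homogeneous strong Markov process with continuous paths up to its lifetime, on $I=[0,\infty)$ or $[0,\infty]$; $\mathbb{P}_x$ is its law started from $x$, $\mathbb{P}_\mu:=\int\mathbb{P}_x\,\mu(dx)$, $\mathbb{E}_\mu$ is the corresponding expectation, and $T_y$ is the first hitting time of $y$. Irreducible means $\mathbb{P}_x[T_y<\infty]>0$ for all $x\in I\setminus\{0\}$, $y\in[0,\infty)$. The point $0$ is a trap: $X_t=0$ for $t\ge T_0$. There are a Radon measure $m$ on $I\setminus\{0\}$ with full support (speed measure) and a strictly increasing continuous function $s$ on $(0,\infty)$ (scale function) such that the local generator of $X$ on $(0,\infty)$ is $\frac{d}{dm}\frac{d}{ds}$; then $X$ is called a $\frac{d}{dm}\frac{d}{ds}$-diffusion. Under these assumptions the boundary $0$ is regular or exit in Feller's classification. A probability measure $\nu$ on $(0,\infty)$ is a quasi-stationary distribution of $X$ if $\mathbb{P}_\nu[X_t\in dx\mid T_0>t]=\nu(dx)$ for all $t>0$. $\lambda_0\ge 0$ is the infimum of the spectrum of the non-negative self-adjoint operator $-\frac{d}{dm}\frac{d}{ds}$ on $L^2(dm)$ with Dirichlet boundary condition at $0$ and, if the boundary $\infty$ is regular, Neumann boundary condition at $\infty$. For $\lambda\in\mathbb{C}$, $u=\psi_\lambda$ is the unique solution of $\frac{d}{dm}\frac{d^+}{ds}u(x)=\lambda u(x)$ $(x\in(0,\infty))$, $\lim_{x\to+0}u(x)=0$, $\lim_{x\to+0}\frac{d^+}{ds}u(x)=1$,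 where $\frac{d^+}{ds}$ is the right derivative with respect to $s$. For $\lambda\in(0,\lambda_0]$, $\nu_\lambda(dx):=\lambda\psi_{-\lambda}(x)\,dm(x)$; when infinitely many quasi-stationary distributions exist, $\nu_\lambda$ is a probability measure and a quasi-stationary distribution of $X$. Renewal transform: for a probability measure $\mu$ on $(0,\infty)$ with $\mathbb{E}_\mu T_0<\infty$, $$\Phi\mu(dx):=\frac{1}{\mathbb{E}_\mu T_0}\int_0^\infty \mathbb{P}_\mu[X_t\in dx,\,T_0>t]\,dt .$$ It maps the set of probability measures on $(0,\infty)$ under which all moments of $T_0$ are finite into itself; $\Phi^n$ is its $n$-th iterate. *)

theory Defs
  imports "HOL-Probability.Probability"
begin

text \<open>
  The state space is a subset of \<open>[0,\<infinity>]\<close>, represented by the type \<^typ>\<open>ennreal\<close>, so that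
  \<open>(0,\<infinity>)\<close> is \<^term>\<open>{0<..<top} :: ennreal set\<close>. Time is also \<^typ>\<open>ennreal\<close>-valued; the
  coordinate \<open>pos X t \<omega>\<close> is meaningful only for \<open>t < life X \<omega>\<close> (in particular \<open>t < \<infinity>\<close>),
  and every use below is guarded accordingly.
\<close>

record 'w process =
  state :: "ennreal set"
  events :: "'w measure"                 (* only its space and sigma-algebra matter *)
  law :: "ennreal \<Rightarrow> 'w measure"
  pos :: "ennreal \<Rightarrow> 'w \<Rightarrow> ennreal"
  life :: "'w \<Rightarrow> ennreal"

definition hit :: "'w process \<Rightarrow> ennreal \<Rightarrow> 'w \<Rightarrow> ennreal" where
  "hit X y \<omega> = Inf {t. t < life X \<omega> \<and> pos X t \<omega> = y}"

definition nat_filt :: "'w process \<Rightarrow> ennreal \<Rightarrow> 'w measure" where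
  "nat_filt X t = sigma (space (events X))
     {{\<omega> \<in> space (events X). u < life X \<omega> \<and> pos X u \<omega> \<in> B} | u B. u \<le> t \<and> B \<in> sets borel}"

definition rc_filt :: "'w process \<Rightarrow> ennreal \<Rightarrow> 'w measure" where
  "rc_filt X t = sigma (space (events X)) (\<Inter>e\<in>{0<..}. sets (nat_filt X (t + e)))"

text \<open>
  The Markov property at \<open>\<tau>\<close> is stated for one later time only; for several later times it follows
  by applying it at \<open>\<tau> + t\<^sub>1\<close>, \<open>\<tau> + t\<^sub>2\<close>, and so on. Deterministic \<open>\<tau>\<close> give the Markov property.
\<close>

definition strong_markov :: "'w process \<Rightarrow> bool" where
  "strong_markov X \<longleftrightarrow>
     (\<forall>x\<in>state X. \<forall>\<tau> A t B.
        stopping_time (rc_filt X) \<tau> \<longrightarrow>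
        A \<in> sets (filtration.pre_sigma (space (events X)) (rc_filt X) \<tau>) \<longrightarrow>
        t < top \<longrightarrow> B \<in> sets borel \<longrightarrow>
        emeasure (law X x) {\<omega>\<in>A. \<tau> \<omega> + t < life X \<omega> \<and> pos X (\<tau> \<omega> + t) \<omega> \<in> B} =
        (\<integral>\<^sup>+\<omega>\<in>{\<omega>\<in>A. \<tau> \<omega> < life X \<omega>}.
           emeasure (law X (pos X (\<tau> \<omega>) \<omega>))
             {\<omega>'\<in>space (events X). t < life X \<omega>' \<and> pos X t \<omega>' \<in> B} \<partial>law X x))"

definition diffusion :: "'w process \<Rightarrow> bool" where
  "diffusion X \<longleftrightarrow>
     (state X = {..<top} \<or> state X = UNIV) \<and>
     law X \<in> restrict_space borel (state X) \<rightarrow>\<^sub>M prob_algebra (events X) \<and>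
     (\<forall>t<top. \<forall>B\<in>sets borel.
        {\<omega>\<in>space (events X). t < life X \<omega> \<and> pos X t \<omega> \<in> B} \<in> sets (events X)) \<and>
     (\<forall>\<omega>\<in>space (events X). \<forall>t<life X \<omega>. pos X t \<omega> \<in> state X) \<and>
     (\<forall>\<omega>\<in>space (events X). continuous_on {t. t < life X \<omega>} (\<lambda>t. pos X t \<omega>)) \<and>
     (\<forall>x\<in>state X. AE \<omega> in law X x. 0 < life X \<omega> \<and> pos X 0 \<omega> = x) \<and>
     strong_markov X"

definition irreducible_diffusion :: "'w process \<Rightarrow> bool" where
  "irreducible_diffusion X \<longleftrightarrow>
     (\<forall>x\<in>state X - {0}. \<forall>y<top.
        emeasure (law X x) {\<omega>\<in>space (events X). hit X y \<omega> < top} > 0)"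

definition stopped_at_zero :: "'w process \<Rightarrow> bool" where
  "stopped_at_zero X \<longleftrightarrow>
     (\<forall>x\<in>state X. AE \<omega> in law X x.
        \<forall>t<top. hit X 0 \<omega> \<le> t \<longrightarrow> t < life X \<omega> \<and> pos X t \<omega> = 0)"

definition has_right_sderiv ::
    "(ennreal \<Rightarrow> real) \<Rightarrow> (ennreal \<Rightarrow> 'a::real_normed_vector) \<Rightarrow> (ennreal \<Rightarrow> 'a) \<Rightarrow> bool" where
  "has_right_sderiv s u D \<longleftrightarrow>
     (\<forall>x\<in>{0<..<top}. ((\<lambda>y. (u y - u x) /\<^sub>R (s y - s x)) \<longlongrightarrow> D x) (at_right x))"

text \<open>
  \<open>dmds m s u D g\<close>: on \<open>(0,\<infinity>)\<close> the continuous function \<open>u\<close> has right derivative \<open>D\<close> with respect to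
  \<open>s\<close>, and \<open>d/dm D = g\<close>, that is, \<open>dD = g dm\<close>. Since \<open>D\<close> is a right derivative, an atom of \<open>m\<close> at \<open>z\<close>
  contributes to \<open>D z\<close>, whence the half-open interval.
\<close>

definition dmds ::
    "ennreal measure \<Rightarrow> (ennreal \<Rightarrow> real) \<Rightarrow> (ennreal \<Rightarrow> 'a::{banach, second_countable_topology}) \<Rightarrow>
       (ennreal \<Rightarrow> 'a) \<Rightarrow> (ennreal \<Rightarrow> 'a) \<Rightarrow> bool" where
  "dmds m s u D g \<longleftrightarrow>
     continuous_on {0<..<top} u \<and> has_right_sderiv s u D \<and>
     (\<forall>x y. 0 < x \<longrightarrow> x \<le> y \<longrightarrow> y < top \<longrightarrow>
        set_integrable m {x<..y} g \<and> D y - D x = (LINT z:{x<..y}|m. g z))"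

definition exit_time :: "'w process \<Rightarrow> ennreal \<Rightarrow> ennreal \<Rightarrow> 'w \<Rightarrow> ennreal" where
  "exit_time X a b \<omega> = Inf {t. life X \<omega> \<le> t \<or> pos X t \<omega> \<notin> {a<..<b}}"

text \<open>
  The local generator is Dynkin's: the limit of \<open>(E\<^sub>x[u(X\<^sub>\<tau>)] - u x) / E\<^sub>x[\<tau>]\<close>, where \<open>\<tau>\<close> is the exit
  time from \<open>(a,b)\<close> and \<open>a \<up> x\<close>, \<open>b \<down> x\<close>; as usual \<open>u\<close> is \<open>0\<close> at the cemetery.
\<close>

definition has_local_generator ::
    "'w process \<Rightarrow> (ennreal \<Rightarrow> real) \<Rightarrow> ennreal \<Rightarrow> real \<Rightarrow> bool" where
  "has_local_generator X u x l \<longleftrightarrow>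
     ((\<lambda>(a, b).
         ((LINT \<omega>:{\<omega>\<in>space (events X). exit_time X a b \<omega> < life X \<omega>}|law X x.
             u (pos X (exit_time X a b \<omega>) \<omega>)) - u x)
         / enn2real (\<integral>\<^sup>+\<omega>. exit_time X a b \<omega> \<partial>law X x)) \<longlongrightarrow> l)
       (at_left x \<times>\<^sub>F at_right x)"

definition speed_measure :: "ennreal set \<Rightarrow> ennreal measure \<Rightarrow> bool" where
  "speed_measure I m \<longleftrightarrow>
     sets m = sets borel \<and> emeasure m (- (I - {0})) = 0 \<and>
     (\<forall>K. compact K \<and> K \<subseteq> I - {0} \<longrightarrow> emeasure m K < top) \<and>
     (\<forall>U. open U \<and> U \<noteq> {} \<and> U \<subseteq> I - {0} \<longrightarrow> emeasure m U > 0)"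

definition scale_function :: "(ennreal \<Rightarrow> real) \<Rightarrow> bool" where
  "scale_function s \<longleftrightarrow> strict_mono_on {0<..<top} s \<and> continuous_on {0<..<top} s"

text \<open>
  That the local generator on \<open>(0,\<infinity>)\<close> is \<open>d/dm d/ds\<close> is equality of operators on continuous functions
  with continuous image: same domain and same values.
\<close>

definition dmds_diffusion ::
    "ennreal measure \<Rightarrow> (ennreal \<Rightarrow> real) \<Rightarrow> 'w process \<Rightarrow> bool" where
  "dmds_diffusion m s X \<longleftrightarrow>
     diffusion X \<and> speed_measure (state X) m \<and> scale_function s \<and>
     (\<forall>u g. continuous_on {0<..<top} u \<longrightarrow> continuous_on {0<..<top} g \<longrightarrow>
        ((\<forall>x\<in>{0<..<top}. has_local_generator X u x (g x)) \<longleftrightarrow> (\<exists>D. dmds m s u D g)))"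

definition infinity_regular :: "ennreal measure \<Rightarrow> (ennreal \<Rightarrow> real) \<Rightarrow> bool" where
  "infinity_regular m s \<longleftrightarrow> bdd_above (s ` {1<..<top}) \<and> emeasure m {1<..<top} < top"

definition in_L2 :: "ennreal measure \<Rightarrow> (ennreal \<Rightarrow> complex) \<Rightarrow> bool" where
  "in_L2 m f \<longleftrightarrow> f \<in> borel_measurable (restrict_space m {0<..<top}) \<and>
     set_integrable m {0<..<top} (\<lambda>x. (cmod (f x))\<^sup>2)"

definition L2_norm :: "ennreal measure \<Rightarrow> (ennreal \<Rightarrow> complex) \<Rightarrow> real" where
  "L2_norm m f = sqrt (LINT x:{0<..<top}|m. (cmod (f x))\<^sup>2)"

definition ae_eq :: "ennreal measure \<Rightarrow> (ennreal \<Rightarrow> complex) \<Rightarrow> (ennreal \<Rightarrow> complex) \<Rightarrow> bool" where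
  "ae_eq m f g \<longleftrightarrow> (AE x in m. x \<in> {0<..<top} \<longrightarrow> f x = g x)"

text \<open>
  The graph of the self-adjoint operator \<open>-d/dm d/ds\<close> on \<open>L\<^sup>2(dm)\<close>. An element of its domain is
  given by its continuous representative \<open>u\<close>; its image \<open>f\<close> matters up to null sets.
\<close>

definition sl_operator ::
    "ennreal measure \<Rightarrow> (ennreal \<Rightarrow> real) \<Rightarrow> (ennreal \<Rightarrow> complex) \<Rightarrow> (ennreal \<Rightarrow> complex) \<Rightarrow> bool" where
  "sl_operator m s u f \<longleftrightarrow>
     in_L2 m u \<and> in_L2 m f \<and>
     (u \<longlongrightarrow> 0) (at_right 0) \<and>
     (\<exists>D. dmds m s u D (\<lambda>x. - f x) \<and> (infinity_regular m s \<longrightarrow> (D \<longlongrightarrow> 0) (at_left top)))"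

definition sl_resolvent_set :: "ennreal measure \<Rightarrow> (ennreal \<Rightarrow> real) \<Rightarrow> complex set" where
  "sl_resolvent_set m s = {z.
     (\<forall>u f. sl_operator m s u f \<and> ae_eq m f (\<lambda>x. z * u x) \<longrightarrow> ae_eq m u (\<lambda>_. 0)) \<and>
     (\<exists>C. \<forall>h. in_L2 m h \<longrightarrow>
        (\<exists>u f. sl_operator m s u f \<and> ae_eq m (\<lambda>x. f x - z * u x) h \<and> L2_norm m u \<le> C * L2_norm m h))}"

definition spectral_bottom :: "ennreal measure \<Rightarrow> (ennreal \<Rightarrow> real) \<Rightarrow> real" where
  "spectral_bottom m s = Inf (Re ` (- sl_resolvent_set m s))"

text \<open>The value \<open>0\<close> off \<open>(0,\<infinity>)\<close> is a convention that makes the solution unique as a total function.\<close>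

definition psi ::
    "ennreal measure \<Rightarrow> (ennreal \<Rightarrow> real) \<Rightarrow>
       'a::{real_normed_field, banach, second_countable_topology} \<Rightarrow> ennreal \<Rightarrow> 'a" where
  "psi m s z = (THE u.
     (\<exists>D. dmds m s u D (\<lambda>x. z * u x) \<and> (D \<longlongrightarrow> 1) (at_right 0)) \<and>
     (u \<longlongrightarrow> 0) (at_right 0) \<and> (\<forall>x. x \<notin> {0<..<top} \<longrightarrow> u x = 0))"

definition nu :: "ennreal measure \<Rightarrow> (ennreal \<Rightarrow> real) \<Rightarrow> real \<Rightarrow> ennreal measure" where
  "nu m s l = density m (\<lambda>x. ennreal (l * psi m s (- l) x))"

definition prob_on_pos :: "ennreal measure \<Rightarrow> bool" where
  "prob_on_pos \<mu> \<longleftrightarrow> prob_space \<mu> \<and> sets \<mu> = sets borel \<and> emeasure \<mu> {0<..<top} = 1"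

definition law_from :: "'w process \<Rightarrow> ennreal measure \<Rightarrow> 'w measure" where
  "law_from X \<mu> = Giry_Monad.bind (restrict_space \<mu> (state X)) (law X)"

definition tail :: "'w process \<Rightarrow> ennreal measure \<Rightarrow> real \<Rightarrow> real" where
  "tail X \<mu> t = measure (law_from X \<mu>) {\<omega>\<in>space (events X). ennreal t < hit X 0 \<omega>}"

definition killed_law :: "'w process \<Rightarrow> ennreal measure \<Rightarrow> real \<Rightarrow> ennreal set \<Rightarrow> ennreal" where
  "killed_law X \<mu> t B = emeasure (law_from X \<mu>)
     {\<omega>\<in>space (events X). ennreal t < life X \<omega> \<and> pos X (ennreal t) \<omega> \<in> B \<and> ennreal t < hit X 0 \<omega>}"

definition cond_law :: "'w process \<Rightarrow> ennreal measure \<Rightarrow> real \<Rightarrow> ennreal measure" where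
  "cond_law X \<mu> t = measure_of UNIV (sets borel)
     (\<lambda>B. killed_law X \<mu> t B / ennreal (tail X \<mu> t))"

definition qsd :: "'w process \<Rightarrow> ennreal measure \<Rightarrow> bool" where
  "qsd X \<nu> \<longleftrightarrow> prob_on_pos \<nu> \<and> (\<forall>t>0. cond_law X \<nu> t = \<nu>)"

definition hit0_moment :: "'w process \<Rightarrow> ennreal measure \<Rightarrow> nat \<Rightarrow> ennreal" where
  "hit0_moment X \<mu> n = (\<integral>\<^sup>+\<omega>. hit X 0 \<omega> ^ n \<partial>law_from X \<mu>)"

definition norm_moment :: "'w process \<Rightarrow> ennreal measure \<Rightarrow> nat \<Rightarrow> real" where
  "norm_moment X \<mu> n = enn2real (hit0_moment X \<mu> n) / fact n"

definition renewal :: "'w process \<Rightarrow> ennreal measure \<Rightarrow> ennreal measure" where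
  "renewal X \<mu> = measure_of UNIV (sets borel)
     (\<lambda>B. (\<integral>\<^sup>+t\<in>{0..}. killed_law X \<mu> t B \<partial>lborel) / hit0_moment X \<mu> 1)"

definition weakly_tendsto ::
    "('i \<Rightarrow> ennreal measure) \<Rightarrow> ennreal measure \<Rightarrow> 'i filter \<Rightarrow> bool" where
  "weakly_tendsto M N F \<longleftrightarrow>
     (\<forall>f::ennreal \<Rightarrow> real. continuous_on {0<..<top} f \<and> bounded (f ` {0<..<top}) \<longrightarrow>
        ((\<lambda>i. LINT x:{0<..<top}|M i. f x) \<longlongrightarrow> (LINT x:{0<..<top}|N. f x)) F)"

end

theory Submission
  imports Defs "HOL-Real_Asymp.Real_Asymp"
begin

text \<open>
  The Green operator of the killed process has the kernel \<open>min (sig x) (sig z)\<close> with respect to \<open>m\<close>, where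
  \<open>sig\<close> is the scale function normalised to vanish at \<open>0\<close>; this follows from Dynkin's formula, and it turns the
  renewal transform into an integral operator. Two different quasi-stationary distributions would be
  orthogonal eigenfunctions of that operator, so \<open>\<infinity>\<close> is a natural boundary, which gives tightness.
  Along the iterates of the renewal transform the densities satisfy a Volterra recursion driven by the moment
  ratios, hence converge locally with these ratios; conversely a weak limit determines the ratios through the
  behaviour of the density at \<open>0\<close>. The same comparison gives the exponential decay of the tail from
  the weak convergence of the conditioned laws, and the moment ratios then follow from the tail ratios.
\<close>

text \<open>The generator is given only through an equality of domains and values, so the behaviour
  at the boundaries has to be extracted from the paths. Since 0 is hit almost surely, the expected
  occupation times of \<open>(0,b]\<close> are finite; together with the generator this forces the
  scale function to have a finite limit at 0 and \<open>sig\<close> to be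
  \<open>m\<close>-integrable near 0. The point \<open>top\<close> may be a state, so the kernel
  describes only the occupation of \<open>(0,\<infinity>)\<close> until the natural boundary is
  known; afterwards \<open>top\<close> carries no mass. The measure \<open>m\<close> may have atoms
  and only right derivatives exist. Differential equations are therefore replaced by the Volterra
  equation \<open>v = l * (sig - primitive2 v)\<close>, which arises from the kernel by
  \<open>min a b = b - max 0 (b - a)\<close>. Weak limits are tested only with a tent function and
  its Green potential. The integral of the tent under the next renewal iterate is a multiple of the
  integral of the potential under the present one; for the killed laws, the integral of the
  potential at time \<open>t\<close> is the integral over later times of the integral of the
  tent.\<close>

abbreviation Rpos :: "ennreal set" where "Rpos \<equiv> {0<..<top}"

abbreviation (input) seq_limit :: "(nat \<Rightarrow> 'a::topological_space) \<Rightarrow> 'a \<Rightarrow> bool" ("((_)/ ----> (_))" [60, 60] 60)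
  where "X ----> L \<equiv> X \<longlonglongrightarrow> L"

abbreviation "borelm \<equiv> borel_measurable borel"

section \<open>Exit times, the natural filtration and measurability\<close>

definition exit_of :: "'w process => ennreal set => 'w => ennreal" where
 "exit_of X U w = Inf {t. life X w <= t \<or> pos X t w \<notin> U}"

lemma exit_time_eq_exit_of: "exit_time X a b = exit_of X {a<..<b}"
 by (rule ext) (simp add: exit_time_def exit_of_def)

text \<open>The image of a compact time interval under a path is compact. Hence a path stays in
  \<open>U\<close> up to a given time exactly if it stays in one member of a countable family of
  closed sets, and staying in a closed set can be tested at a dense set of times.\<close>

definition compactly_exhausted :: "'a::topological_space set => bool" where
 "compactly_exhausted U \<longleftrightarrow>
  (\<exists>\<C>. countable \<C> & (\<forall>C\<in>\<C>. closed C & C <= U) & (\<forall>K. compact K & K ~= {} & K <= U --> (\<exists>C\<in>\<C>. K <= C)))"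

lemma compactly_exhausted_greaterThan: "compactly_exhausted {a::ennreal<..}"
proof -
 obtain D :: "ennreal set" where D: "countable D" "!!X. open X ==> X ~= {} ==> \<exists>d\<in>D. d \<in> X"
  using countable_dense_setE by blast
 show ?thesis unfolding compactly_exhausted_def
 proof (intro exI[of _ "(%p. {p..}) ` (D \<inter> {a<..})"] conjI ballI allI impI)
  fix K assume K: "compact K & K ~= {} & K <= {a<..}"
  obtain k where k: "k \<in> K" "!!x. x \<in> K ==> k <= x"
   using compact_attains_inf[of K] K by metis
  then have "a < k" using K by auto
  then obtain p where "p \<in> D" "a < p" "p < k"
   using D(2)[of "{a<..<k}"] dense[of a k] by (metis empty_iff greaterThanLessThan_iff open_greaterThanLessThan)
  moreover have "K <= {p..}"
  proof
   fix x assume "x \<in> K"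
   from order_less_le_trans[OF \<open>p < k\<close> k(2)[OF this]] have "p <= x" by (rule less_imp_le)
   then show "x \<in> {p..}" by simp
  qed
  ultimately show "\<exists>C\<in>(%p. {p..}) ` (D \<inter> {a<..}). K <= C" by blast
 qed (use D(1) in auto)
qed

lemma compactly_exhausted_Int:
 assumes "compactly_exhausted U" "compactly_exhausted V"
 shows "compactly_exhausted (U \<inter> V)"
proof -
 obtain \<C> where C: "countable \<C>" "\<forall>C\<in>\<C>. closed C & C <= U"
   "\<forall>K. compact K & K ~= {} & K <= U --> (\<exists>C\<in>\<C>. K <= C)"
  using assms(1) unfolding compactly_exhausted_def by (elim exE conjE)
 obtain \<D> where D: "countable \<D>" "\<forall>C\<in>\<D>. closed C & C <= V"
   "\<forall>K. compact K & K ~= {} & K <= V --> (\<exists>C\<in>\<D>. K <= C)"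
  using assms(2) unfolding compactly_exhausted_def by (elim exE conjE)
 show ?thesis unfolding compactly_exhausted_def
 proof (intro exI[of _ "(%(A, B). A \<inter> B) ` (\<C> \<times> \<D>)"] conjI ballI allI impI)
  fix K assume K: "compact K & K ~= {} & K <= U \<inter> V"
  then obtain A B where "A \<in> \<C>" "B \<in> \<D>" "K <= A" "K <= B"
   using C(3)[rule_format, of K] D(3)[rule_format, of K] by blast
  then show "\<exists>C\<in>(%(A, B). A \<inter> B) ` (\<C> \<times> \<D>). K <= C"
   by (intro bexI[of _ "A \<inter> B"]) auto
 next
  fix E assume "E \<in> (%(A, B). A \<inter> B) ` (\<C> \<times> \<D>)"
  then obtain A B where "A \<in> \<C>" "B \<in> \<D>" "E = A \<inter> B" by auto
  then show "closed E" "E <= U \<inter> V" using C(2) D(2) by (auto simp: closed_Int)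
 qed (use C(1) D(1) in auto)
qed

lemma compactly_exhausted_lessThan: "compactly_exhausted {..<b::ennreal}"
proof -
 obtain D :: "ennreal set" where D: "countable D" "!!X. open X ==> X ~= {} ==> \<exists>d\<in>D. d \<in> X"
  using countable_dense_setE by blast
 show ?thesis unfolding compactly_exhausted_def
 proof (intro exI[of _ "(%p. {..p}) ` (D \<inter> {..<b})"] conjI ballI allI impI)
  fix K assume K: "compact K & K ~= {} & K <= {..<b}"
  obtain k where k: "k \<in> K" "!!x. x \<in> K ==> x <= k"
   using compact_attains_sup[of K] K by metis
  then have "k < b" using K by auto
  then obtain p where "p \<in> D" "k < p" "p < b"
   using D(2)[of "{k<..<b}"] dense[of k b] by (metis empty_iff greaterThanLessThan_iff open_greaterThanLessThan)
  moreover have "K <= {..p}"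
  proof
   fix x assume "x \<in> K"
   from order_le_less_trans[OF k(2)[OF this] \<open>k < p\<close>] have "x <= p" by (rule less_imp_le)
   then show "x \<in> {..p}" by simp
  qed
  ultimately show "\<exists>C\<in>(%p. {..p}) ` (D \<inter> {..<b}). K <= C" by blast
 qed (use D(1) in auto)
qed

lemma compactly_exhausted_greaterThanLessThan: "compactly_exhausted {a::ennreal<..<b}"
 unfolding greaterThanLessThan_def
 by (intro compactly_exhausted_Int compactly_exhausted_greaterThan compactly_exhausted_lessThan)

locale strong_markov_process =
 fixes X :: "'w process"
 assumes diffusion: "diffusion X"
begin

abbreviation "Om \<equiv> space (events X)"

lemma state_borel [measurable]: "state X \<in> sets borel"
 using diffusion by (auto simp: diffusion_def)

lemma zero_in_state: "0 \<in> state X" and fin_in_state: "x < top ==> x \<in> state X"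
 using diffusion by (auto simp: diffusion_def)

lemma law_meas: "law X \<in> restrict_space borel (state X) \<rightarrow>\<^sub>M prob_algebra (events X)"
 using diffusion by (auto simp: diffusion_def)

lemma law_prob: "x \<in> state X ==> prob_space (law X x)"
 and sets_law: "x \<in> state X ==> sets (law X x) = sets (events X)"
proof -
 assume "x \<in> state X"
 then have "law X x \<in> space (prob_algebra (events X))"
  using measurable_space[OF law_meas] by (simp add: space_restrict_space)
 then show "prob_space (law X x)" "sets (law X x) = sets (events X)"
  by (auto simp: space_prob_algebra)
qed

lemma space_law: "x \<in> state X ==> space (law X x) = Om"
 using sets_law sets_eq_imp_space_eq by blast

lemma sets_pos:
 assumes "B \<in> sets borel" shows "{w\<in>Om. t < life X w & pos X t w \<in> B} \<in> sets (events X)"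
proof (cases "t < top")
 case True
 then show ?thesis using diffusion assms by (simp add: diffusion_def)
next
 case False
 then have "t = top" by (simp add: less_top[symmetric])
 then show ?thesis by simp
qed

lemma pos_state: "w \<in> Om ==> t < life X w ==> pos X t w \<in> state X"
 using diffusion by (auto simp: diffusion_def)

lemma pos_cont: "w \<in> Om ==> continuous_on {t. t < life X w} (%t. pos X t w)"
 using diffusion by (auto simp: diffusion_def)

lemma life_measurable [measurable]: "life X \<in> borel_measurable (events X)"
 by (rule borel_measurableI_greater) (use sets_pos[of UNIV] in auto)

lemma open_alive_pos:
 assumes "w \<in> Om" "open V" shows "open {u. u < life X w & pos X u w \<in> V}"
proof -
 have "open {t. t < life X w}" using open_lessThan[of "life X w"] by (simp add: lessThan_def)
 from continuous_open_preimage[OF pos_cont[OF assms(1)] this assms(2)]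
 have "open ({t. t < life X w} \<inter> (%t. pos X t w) -` V)" .
 also have "{t. t < life X w} \<inter> (%t. pos X t w) -` V = {u. u < life X w & pos X u w \<in> V}" by auto
 finally show ?thesis .
qed

lemma exit_less: "t < exit_of X U w ==> t < life X w & pos X t w \<in> U"
 using Inf_lower[of t "{t. life X w <= t \<or> pos X t w \<notin> U}"] unfolding exit_of_def
 by (cases "life X w <= t \<or> pos X t w \<notin> U") (auto simp: not_less[symmetric])

lemma exit_le_life: "exit_of X U w <= life X w"
 unfolding exit_of_def by (rule Inf_lower) simp

text \<open>From a position in the open set \<open>U\<close>, continuity would keep the path in
  \<open>U\<close> a little longer, and the infimum would be larger. Exit by death is excluded by
  the strict inequality with the lifetime.\<close>

lemma exit_pos:
 assumes "w \<in> Om" "open U" "exit_of X U w < life X w"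
 shows "pos X (exit_of X U w) w \<notin> U"
proof
 let ?e = "exit_of X U w"
 assume "pos X ?e w \<in> U"
 then have "?e \<in> {u. u < life X w & pos X u w \<in> U}" using assms by simp
 then obtain r where r: "?e < r" "{?e..<r} <= {u. u < life X w & pos X u w \<in> U}"
  using open_right[OF open_alive_pos[OF assms(1,2)], of ?e "life X w"] assms by auto
 have "r <= ?e" unfolding exit_of_def
 proof (rule Inf_greatest)
  fix t assume t: "t \<in> {t. life X w <= t \<or> pos X t w \<notin> U}"
  then have "?e <= t" unfolding exit_of_def by (rule Inf_lower)
  then show "r <= t" using r(2) t by (cases "t < r") (auto simp: subset_iff not_less dest: leD)
 qed
 with r show False by simp
qed

lemma less_exit_iff:
 assumes "w \<in> Om" "open U"
 shows "t < exit_of X U w \<longleftrightarrow> t < life X w & (\<forall>u\<le>t. pos X u w \<in> U)"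
proof
 assume "t < exit_of X U w"
 then show "t < life X w & (\<forall>u\<le>t. pos X u w \<in> U)" using exit_less[of _ U w] by (meson order_le_less_trans)
next
 assume *: "t < life X w & (\<forall>u\<le>t. pos X u w \<in> U)"
 show "t < exit_of X U w"
 proof (rule ccontr)
  assume "\<not> t < exit_of X U w"
  then have "exit_of X U w <= t" by simp
  then have "exit_of X U w < life X w" "pos X (exit_of X U w) w \<in> U" using * by (auto intro: order_le_less_trans)
  with exit_pos[OF assms] show False by auto
 qed
qed

text \<open>Hitting 0 is leaving the open set \<open>{0<..}\<close>, which gives
  \<open>hit X 0\<close> the measurability of exit times. The two differ only if the exit is due to
  death: then 0 is never hit, and \<open>hit\<close> is the infimum of the empty set,
  \<open>top\<close>.\<close>

lemma hit_zero_eq: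
 assumes "w \<in> Om"
 shows "hit X 0 w = (if exit_of X {0<..} w < life X w then exit_of X {0<..} w else top)"
proof (cases "exit_of X {0<..} w < life X w")
 case True
 then have "pos X (exit_of X {0<..} w) w = 0" using exit_pos[OF assms, of "{0<..}"] by auto
 then have "hit X 0 w <= exit_of X {0<..} w" unfolding hit_def using True by (intro Inf_lower) auto
 moreover have "exit_of X {0<..} w <= hit X 0 w"
  unfolding hit_def exit_of_def by (rule Inf_superset_mono) auto
 ultimately show ?thesis using True by simp
next
 case False
 have e: "{t. t < life X w & pos X t w = 0} = {}"
  using False exit_less[of _ "{0<..}" w] exit_le_life[of "{0<..}" w] by force
 show ?thesis unfolding hit_def e using False by simp
qed

lemma space_nat_filt [simp]: "space (nat_filt X t) = Om"
 unfolding nat_filt_def by (rule space_measure_of) auto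

lemma sets_nat_filt: "sets (nat_filt X t) = sigma_sets Om
  {{w \<in> Om. u < life X w & pos X u w \<in> B} | u B. u <= t & B \<in> sets borel}"
 unfolding nat_filt_def by (rule sets_measure_of) auto

lemma nat_filtI: "u <= t ==> B \<in> sets borel ==> {w \<in> Om. u < life X w & pos X u w \<in> B} \<in> sets (nat_filt X t)"
 unfolding sets_nat_filt by (rule sigma_sets.Basic) auto

lemma nat_filt_mono: "t <= t' ==> sets (nat_filt X t) <= sets (nat_filt X t')"
 unfolding sets_nat_filt by (rule sigma_sets_mono') (auto intro: order_trans)

lemma nat_filt_events: "sets (nat_filt X t) <= sets (events X)"
 unfolding sets_nat_filt by (rule sets.sigma_sets_subset) (auto intro: sets_pos)

lemma rc_gen: "(\<Inter>e\<in>{0<..}. sets (nat_filt X (t + e))) <= Pow Om"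
 using sets.space_closed[of "nat_filt X (t + 1)"] by (intro INF_lower2[of 1]) auto

lemma space_rc_filt [simp]: "space (rc_filt X t) = Om"
 unfolding rc_filt_def by (rule space_measure_of[OF rc_gen])

lemma sets_rc_filt: "sets (rc_filt X t) = sigma_sets Om (\<Inter>e\<in>{0<..}. sets (nat_filt X (t + e)))"
 unfolding rc_filt_def by (rule sets_measure_of[OF rc_gen])

lemma nat_filt_rc: "sets (nat_filt X t) <= sets (rc_filt X t)"
proof
 fix A assume "A \<in> sets (nat_filt X t)"
 then have "A \<in> sets (nat_filt X (t + e))" for e using nat_filt_mono[of t "t + e"] by auto
 then show "A \<in> sets (rc_filt X t)" unfolding sets_rc_filt by (intro sigma_sets.Basic INT_I)
qed

lemma filtration_rc: "filtration Om (rc_filt X)"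
proof
 fix i j :: ennreal assume "i <= j"
 show "sets (rc_filt X i) <= sets (rc_filt X j)"
  unfolding sets_rc_filt
 proof (rule sigma_sets_mono', rule INT_anti_mono[OF subset_refl])
  fix e show "sets (nat_filt X (i + e)) <= sets (nat_filt X (j + e))"
   by (rule nat_filt_mono) (simp add: \<open>i <= j\<close> add_right_mono)
 qed
qed simp

text \<open>Countably many closed sets and countably many times up to \<open>t\<close> decide the
  event, so no look into the future is involved.\<close>

lemma less_exit_nat_filt:
 assumes "open U" "compactly_exhausted U"
 shows "{w\<in>Om. t < exit_of X U w} \<in> sets (nat_filt X t)"
proof -
 obtain Q :: "ennreal set" where Q: "countable Q" "!!X. open X ==> X ~= {} ==> \<exists>d\<in>Q. d \<in> X"
  using countable_dense_setE by blast
 obtain \<C> where C: "countable \<C>" "!!C. C\<in>\<C> ==> closed C & C <= U"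
   "!!K. compact K ==> K ~= {} ==> K <= U ==> \<exists>C\<in>\<C>. K <= C"
  using assms unfolding compactly_exhausted_def by metis
 \<comment> \<open>The time \<open>t\<close> is added because a dense set need not contain it; for
   \<open>t = 0\<close> it is the only time available.\<close>
 let ?Q = "insert t (Q \<inter> {..t})"
 have "{w\<in>Om. t < exit_of X U w} =
  {w\<in>Om. t < life X w} \<inter> (\<Union>C\<in>\<C>. \<Inter>q\<in>?Q. {w\<in>Om. q < life X w & pos X q w \<in> C})" (is "?L = ?R")
 proof (intro set_eqI iffI)
  fix w assume "w \<in> ?L"
  then have w: "w \<in> Om" and t: "t < life X w" "!!u. u <= t ==> pos X u w \<in> U"
   using less_exit_iff[OF _ assms(1)] by auto
  have "compact ((%t. pos X t w) ` {0..t})"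
   by (intro compact_continuous_image continuous_on_subset[OF pos_cont[OF w]] compact_eq_closed[THEN iffD2]) (use t in auto)
  then obtain C where "C \<in> \<C>" "(%t. pos X t w) ` {0..t} <= C" using C(3)[of "(%t. pos X t w) ` {0..t}"] t by force
  then show "w \<in> ?R" using w t by (auto intro!: bexI[of _ C])
 next
  fix w assume "w \<in> ?R"
  then obtain C where w: "w \<in> Om" and t: "t < life X w" and "C \<in> \<C>" and q: "!!q. q \<in> ?Q ==> pos X q w \<in> C"
   by auto
  have "pos X u w \<in> U" if "u <= t" for u
  proof (rule ccontr)
   assume n: "pos X u w \<notin> U"
   let ?V = "{u. u < life X w & pos X u w \<in> - C} \<inter> {..<t}"
   have "open ?V" using open_alive_pos[OF w, of "-C"] C(2)[OF \<open>C \<in> \<C>\<close>] by (intro open_Int) auto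
   moreover have "u ~= t" using n q[of t] C(2)[OF \<open>C \<in> \<C>\<close>] by auto
   then have "u \<in> ?V" using n that t C(2)[OF \<open>C \<in> \<C>\<close>] by auto
   ultimately obtain d where "d \<in> Q" "d \<in> ?V" using Q(2)[of ?V] by auto
   then show False using q[of d] by (auto simp: less_imp_le)
  qed
  then show "w \<in> ?L" using less_exit_iff[OF w assms(1)] w t by auto
 qed
 also have "{w\<in>Om. t < life X w} = {w\<in>Om. t < life X w & pos X t w \<in> UNIV}" by simp
 also have "... \<inter> (\<Union>C\<in>\<C>. \<Inter>q\<in>?Q. {w\<in>Om. q < life X w & pos X q w \<in> C}) \<in> sets (nat_filt X t)"
 proof (intro sets.Int sets.countable_UN'' C(1))
  show "{w\<in>Om. t < life X w & pos X t w \<in> UNIV} \<in> sets (nat_filt X t)" by (rule nat_filtI) auto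
  fix C' assume "C' \<in> \<C>"
  then have "C' \<in> sets borel" using C(2) by auto
  then show "(\<Inter>q\<in>?Q. {w\<in>Om. q < life X w & pos X q w \<in> C'}) \<in> sets (nat_filt X t)"
   using Q(1) by (intro sets.countable_INT' image_subsetI nat_filtI) auto
 qed
 finally show ?thesis .
qed

lemma stopping_exit:
 assumes "open U" "compactly_exhausted U"
 shows "stopping_time (rc_filt X) (exit_of X U)"
proof
 fix t
 have "{w\<in>Om. exit_of X U w <= t} = Om - {w\<in>Om. t < exit_of X U w}" by auto
 also have "... \<in> sets (rc_filt X t)"
  using less_exit_nat_filt[OF assms, of t] nat_filt_rc[of t] sets.compl_sets[of _ "rc_filt X t"] by auto
 finally show "Measurable.pred (rc_filt X t) (%x. exit_of X U x <= t)"
  by (simp add: pred_def)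
qed

lemma exit_measurable:
 assumes "open U" "compactly_exhausted U"
 shows "exit_of X U \<in> borel_measurable (events X)"
 using less_exit_nat_filt[OF assms] nat_filt_events by (intro borel_measurableI_greater) auto

lemma hit_measurable [measurable]: "hit X 0 \<in> borel_measurable (events X)"
proof -
 have [measurable]: "exit_of X {0<..} \<in> borel_measurable (events X)"
  by (rule exit_measurable) (auto intro: compactly_exhausted_greaterThan)
 have "(%w. if exit_of X {0<..} w < life X w then exit_of X {0<..} w else top) \<in> borel_measurable (events X)"
  by measurable
 then show ?thesis by (subst measurable_cong[OF hit_zero_eq]) auto
qed

lemma strong_markov_set:
 assumes "x \<in> state X" "stopping_time (rc_filt X) ta" "t < top" "B \<in> sets borel"
 shows "emeasure (law X x) {w\<in>Om. ta w + t < life X w & pos X (ta w + t) w \<in> B} =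
    (\<integral>\<^sup>+w\<in>{w\<in>Om. ta w < life X w}.
     emeasure (law X (pos X (ta w) w)) {w'\<in>Om. t < life X w' & pos X t w' \<in> B} \<partial>law X x)"
proof -
 interpret filtration Om "rc_filt X" by (rule filtration_rc)
 have "Om \<in> sets (pre_sigma ta)"
  using assms(2) by (intro sets_pre_sigmaI) (auto simp: stopping_time_def pred_def)
 moreover have "strong_markov X" using diffusion by (simp add: diffusion_def)
 ultimately show ?thesis using assms by (intro strong_markov_def[THEN iffD1, rule_format])
qed

end

section \<open>Semigroup, Green operator and the strong Markov property for functions\<close>

context strong_markov_process
begin

text \<open>After death \<open>pos\<close> is meaningless. The value 0 keeps \<open>path t\<close>
  in the state space, so that \<open>law X (path t om)\<close> makes sense for every path.\<close>

definition path :: "ennreal => 'w => ennreal" where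
 "path t om = (if t < life X om then pos X t om else 0)"

text \<open>Dead paths count 0 and not \<open>f 0\<close>, in contrast to
  \<open>f (path t om)\<close>.\<close>

definition val :: "(ennreal => ennreal) => ennreal => 'w => ennreal" where
 "val f t om = (if t < life X om then f (pos X t om) else 0)"

definition semigroup :: "(ennreal => ennreal) => ennreal => ennreal => ennreal" where
 "semigroup f t x = (\<integral>\<^sup>+om. val f t om \<partial>law X x)"

definition green :: "(ennreal => ennreal) => ennreal => ennreal" where
 "green f x = (\<integral>\<^sup>+t\<in>{0..}. semigroup f (ennreal t) x \<partial>lborel)"

lemma path_state: "om \<in> Om ==> path t om \<in> state X"
 by (simp add: path_def pos_state zero_in_state)

lemma path_measurable [measurable]: "path t \<in> borel_measurable (events X)"
proof (rule borel_measurableI)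
 fix S :: "ennreal set" assume "open S"
 have "path t -` S \<inter> Om = {om\<in>Om. t < life X om & pos X t om \<in> S} \<union>
   (if 0 \<in> S then {om\<in>Om. life X om <= t} else {})"
  by (auto simp: path_def split: if_splits)
 also have "... \<in> sets (events X)"
  using sets_pos[of S t] \<open>open S\<close> by auto
 finally show "path t -` S \<inter> Om \<in> sets (events X)" .
qed

text \<open>Joint measurability follows from right continuity: a path is the pointwise limit of its
  values at dyadic times, and for each order these times form a countable set.\<close>

lemma path_measurable_pair [measurable]:
 "(%(t, om). path t om) \<in> borel_measurable (borel \<Otimes>\<^sub>M events X)"
proof -
 \<comment> \<open>\<open>d n t\<close> is the first dyadic point of order \<open>n\<close> strictly
   to the right of \<open>t\<close>.\<close>
 define d where "d n t = ennreal ((real_of_int \<lfloor>enn2real t * 2^n\<rfloor> + 1) / 2^n)" for n :: nat and t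
 have lim: "(%n. d n t) ----> t" if "t < top" for t
 proof -
  have "(%n. (real_of_int \<lfloor>enn2real t * 2^n\<rfloor> + 1) / 2^n) ----> enn2real t"
  proof (rule tendsto_sandwich)
   show "\<forall>\<^sub>F n in sequentially. enn2real t <= (real_of_int \<lfloor>enn2real t * 2^n\<rfloor> + 1) / 2^n"
    by (intro always_eventually allI) (simp add: field_simps, linarith)
   show "\<forall>\<^sub>F n in sequentially. (real_of_int \<lfloor>enn2real t * 2^n\<rfloor> + 1) / 2^n <= enn2real t + (1/2)^n"
    by (intro always_eventually allI) (simp add: field_simps power_divide)
   show "(%n. enn2real t + (1/2)^n) ----> enn2real t"
    by (rule tendsto_eq_intros LIMSEQ_power_zero | simp)+
  qed simp
  then have "(%n. d n t) ----> ennreal (enn2real t)" unfolding d_def by (rule tendsto_ennrealI)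
  then show ?thesis using that by (simp add: ennreal_enn2real_if less_top[symmetric])
 qed
 \<comment> \<open>The limit inferior is measurable whether or not the sequence converges; before
   the lifetime it is the limit.\<close>
 define Z where "Z = (%z. if fst z < life X (snd z) then liminf (%n. path (d n (fst z)) (snd z)) else 0)"
 have [measurable]: "(%z. path (d n (fst z)) (snd z)) \<in> borel_measurable (borel \<Otimes>\<^sub>M events X)" for n
 proof -
  have "(%z. (%k z. path (ennreal ((real_of_int k + 1) / 2^n)) (snd z)) \<lfloor>enn2real (fst z) * 2^n\<rfloor> z)
   \<in> borel_measurable (borel \<Otimes>\<^sub>M events X)"
   by (rule measurable_compose_countable) measurable
  then show ?thesis by (simp add: d_def)
 qed
 have "Z \<in> borel_measurable (borel \<Otimes>\<^sub>M events X)"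
  unfolding Z_def by measurable
 moreover have "Z z = (%(t, om). path t om) z" if "z \<in> space (borel \<Otimes>\<^sub>M events X)" for z
 proof -
  obtain t om where z': "z = (t, om)" by (cases z)
  then have "om \<in> Om" using that by (simp add: space_pair_measure)
  note z = z' this
  show ?thesis
  proof (cases "t < life X om")
   case True
   have l: "(%n. d n t) ----> t" using True by (intro lim) (simp add: order.strict_trans1 less_top order_less_le_trans)
   then have ev: "\<forall>\<^sub>F n in sequentially. d n t < life X om" using True by (rule order_tendstoD)
   have "(%n. pos X (d n t) om) ----> pos X t om"
    using continuous_on_tendsto_compose[OF pos_cont[OF z(2)] l] True ev by simp
   then have "(%n. path (d n t) om) ----> pos X t om"
    by (rule Lim_transform_eventually) (use ev in \<open>auto simp: path_def elim: eventually_mono\<close>)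
   then show ?thesis using True by (simp add: Z_def z path_def lim_imp_Liminf)
  qed (simp add: Z_def z path_def)
 qed
 ultimately show ?thesis by (subst measurable_cong[symmetric]) auto
qed

lemma val_path: "val f t om = (if t < life X om then f (path t om) else 0)"
 by (simp add: val_def path_def)

lemma val_measurable_pair:
 assumes [measurable]: "f \<in> borelm"
 shows "(%(t, om). val f t om) \<in> borel_measurable (borel \<Otimes>\<^sub>M events X)"
proof -
 have "(%z. f ((%(t, om). path t om) z)) \<in> borel_measurable (borel \<Otimes>\<^sub>M events X)" by measurable
 then have [measurable]: "(%z. f (path (fst z) (snd z))) \<in> borel_measurable (borel \<Otimes>\<^sub>M events X)"
  by (simp add: case_prod_beta)
 show ?thesis unfolding val_path case_prod_beta by measurable
qed

lemma val_measurable [measurable (raw)]: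
 assumes "f \<in> borelm" "ta \<in> borel_measurable M" "g \<in> M \<rightarrow>\<^sub>M events X"
 shows "(%om. val f (ta om) (g om)) \<in> borel_measurable M"
 using measurable_compose[OF measurable_Pair[OF assms(2,3)] val_measurable_pair[OF assms(1)]] by simp

lemma law_subprob: "law X \<in> restrict_space borel (state X) \<rightarrow>\<^sub>M subprob_algebra (events X)"
 by (rule measurable_prob_algebraD[OF law_meas])

lemma law_measurable:
 assumes "x \<in> state X" shows "f \<in> measurable (law X x) N \<longleftrightarrow> f \<in> measurable (events X) N"
 by (rule arg_cong2[where f="(\<in>)"], simp, rule measurable_cong_sets) (simp_all add: sets_law assms)

lemma semigroup_measurable_pair:
 assumes [measurable]: "f \<in> borelm"
 shows "(%(t, x). semigroup f t x) \<in> borel_measurable (borel \<Otimes>\<^sub>M restrict_space borel (state X))"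
 unfolding semigroup_def case_prod_beta
proof (rule nn_integral_measurable_subprob_algebra2)
 show "(%p. law X (snd p)) \<in> borel \<Otimes>\<^sub>M restrict_space borel (state X) \<rightarrow>\<^sub>M subprob_algebra (events X)"
  by (rule measurable_compose[OF measurable_snd law_subprob])
 show "(%(p, om). val f (fst p) om) \<in> borel_measurable ((borel \<Otimes>\<^sub>M restrict_space borel (state X)) \<Otimes>\<^sub>M events X)"
  unfolding case_prod_beta by measurable
qed

lemma semigroup_measurable [measurable (raw)]:
 assumes "f \<in> borelm" "ta \<in> borel_measurable M" "g \<in> M \<rightarrow>\<^sub>M restrict_space borel (state X)"
 shows "(%om. semigroup f (ta om) (g om)) \<in> borel_measurable M"
 using measurable_compose[OF measurable_Pair[OF assms(2,3)] semigroup_measurable_pair[OF assms(1)]] by simp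

lemma stopped_path_measurable:
 assumes [measurable]: "ta \<in> borel_measurable (events X)"
 shows "(%om. path (ta om) om) \<in> events X \<rightarrow>\<^sub>M restrict_space borel (state X)"
proof (rule measurable_restrict_space2)
 have "(%om. (ta om, om)) \<in> events X \<rightarrow>\<^sub>M borel \<Otimes>\<^sub>M events X" by measurable
 from measurable_compose[OF this path_measurable_pair]
 show "(%om. path (ta om) om) \<in> borel_measurable (events X)" by simp
qed (use path_state in auto)

text \<open>Indicators are covered by \<open>strong_markov_set\<close>, and both sides are additive,
  homogeneous and continuous along increasing sequences in \<open>f\<close>.\<close>

lemma strong_markov_fun:
 assumes x: "x \<in> state X" and st: "stopping_time (rc_filt X) ta" and [measurable]: "ta \<in> borel_measurable (events X)"
  and t: "t < top" and f: "f \<in> borelm"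
 shows "(\<integral>\<^sup>+om. val f (ta om + t) om \<partial>law X x) =
  (\<integral>\<^sup>+om. (if ta om < life X om then semigroup f t (path (ta om) om) else 0) \<partial>law X x)"
proof -
 note [measurable] = stopped_path_measurable
 note [simp] = law_measurable[OF x]
 have m2: "(%om. if ta om < life X om then semigroup f t (path (ta om) om) else 0) \<in> borel_measurable (events X)"
  if [measurable]: "f \<in> borelm" for f by measurable
 note ms = law_measurable[OF path_state]
 show ?thesis using f
 proof (induction f rule: borel_measurable_induct)
  case (cong f g)
  then have "f = g" by auto
  then show ?case using cong(4) by (simp only:)
 next
  case (set A)
  have v: "val (indicator A) u om = indicator {om\<in>Om. u < life X om & pos X u om \<in> A} om" if "om \<in> Om" for u om
   using that by (auto simp: val_def indicator_def)
  have s: "semigroup (indicator A) t y = emeasure (law X y) {om\<in>Om. t < life X om & pos X t om \<in> A}" if "y \<in> state X" for y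
  proof -
   have "semigroup (indicator A) t y = (\<integral>\<^sup>+om. indicator {om\<in>Om. t < life X om & pos X t om \<in> A} om \<partial>law X y)"
    unfolding semigroup_def by (rule nn_integral_cong) (simp add: v space_law that)
   also have "... = emeasure (law X y) {om\<in>Om. t < life X om & pos X t om \<in> A}"
    using set sets_pos[of A t] by (intro nn_integral_indicator) (simp add: sets_law that)
   finally show ?thesis .
  qed
  have m1: "{om\<in>Om. ta om + t < life X om & pos X (ta om + t) om \<in> A} \<in> sets (events X)"
  proof -
   have "(%om. val (indicator A) (ta om + t) om) \<in> borel_measurable (events X)" using set by measurable
   then have "{om\<in>Om. val (indicator A) (ta om + t) om ~= 0} \<in> sets (events X)" by measurable
   also have "{om\<in>Om. val (indicator A) (ta om + t) om ~= 0} = {om\<in>Om. ta om + t < life X om & pos X (ta om + t) om \<in> A}"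
    by (auto simp: val_def indicator_def)
   finally show ?thesis .
  qed
  have "(\<integral>\<^sup>+om. val (indicator A) (ta om + t) om \<partial>law X x) =
   (\<integral>\<^sup>+om. indicator {om\<in>Om. ta om + t < life X om & pos X (ta om + t) om \<in> A} om \<partial>law X x)"
   by (rule nn_integral_cong) (auto simp: val_def indicator_def space_law x)
  also have "... = emeasure (law X x) {om\<in>Om. ta om + t < life X om & pos X (ta om + t) om \<in> A}"
   using m1 by (intro nn_integral_indicator) (simp add: sets_law x)
  also have "... = (\<integral>\<^sup>+om\<in>{om\<in>Om. ta om < life X om}.
     emeasure (law X (pos X (ta om) om)) {om'\<in>Om. t < life X om' & pos X t om' \<in> A} \<partial>law X x)"
   using set by (intro strong_markov_set x st t) auto
  also have "... = (\<integral>\<^sup>+om. (if ta om < life X om then semigroup (indicator A) t (path (ta om) om) else 0) \<partial>law X x)"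
   by (rule nn_integral_cong) (auto simp: space_law x s path_state, simp add: path_def)
  finally show ?case .
 next
  case (mult u c)
  have "val (%x. c * u x) s om = c * val u s om" for s om by (simp add: val_def)
  moreover have "semigroup (%x. c * u x) t y = c * semigroup u t y" if "y \<in> state X" for y
   using that mult(2) unfolding semigroup_def \<open>!!s om. val (%x. c * u x) s om = c * val u s om\<close>
   by (intro nn_integral_cmult) (simp add: law_measurable)
  ultimately show ?case using mult
   by (simp add: nn_integral_cmult path_state space_law x m2 if_distrib[of "%y. c * y", symmetric] cong: nn_integral_cong)
    (subst nn_integral_cmult[symmetric], use m2 in \<open>auto intro!: nn_integral_cong simp: path_state space_law x\<close>)
 next
  case (add u v)
  have uv: "u \<in> borelm" "v \<in> borelm" by fact+
  have v: "val (%x. v x + u x) s om = val v s om + val u s om" for s om by (simp add: val_def)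
  have s: "semigroup (%x. v x + u x) t y = semigroup v t y + semigroup u t y" if "y \<in> state X" for y
   using that uv unfolding semigroup_def v
   by (intro nn_integral_add) (simp_all add: law_measurable)
  have "(\<integral>\<^sup>+om. val (%x. v x + u x) (ta om + t) om \<partial>law X x) =
   (\<integral>\<^sup>+om. (if ta om < life X om then semigroup v t (path (ta om) om) else 0) \<partial>law X x) +
   (\<integral>\<^sup>+om. (if ta om < life X om then semigroup u t (path (ta om) om) else 0) \<partial>law X x)"
   unfolding v add.IH[symmetric]
   using uv by (intro nn_integral_add) simp_all
  also have "... = (\<integral>\<^sup>+om. (if ta om < life X om then semigroup (%x. v x + u x) t (path (ta om) om) else 0) \<partial>law X x)"
   using uv by (subst nn_integral_add[symmetric]) (auto simp: m2 s path_state space_law x intro!: nn_integral_cong)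
  finally show ?case .
 next
  case (seq U)
  have U: "incseq U" "!!i. U i \<in> borelm" by fact+
  have v: "val (Sup (range U)) s om = (SUP i. val (U i) s om)" for s om by (auto simp: val_def image_comp)
  have iv: "incseq (%i. val (U i) s om)" for s om using U(1) by (auto simp: val_def incseq_def le_fun_def)
  have s: "semigroup (Sup (range U)) t y = (SUP i. semigroup (U i) t y)" if "y \<in> state X" for y
   unfolding semigroup_def v using that U
   by (intro nn_integral_monotone_convergence_SUP) (use iv in \<open>auto simp: law_measurable incseq_def le_fun_def\<close>)
  have inc: "incseq (%i. semigroup (U i) t y)" for y
   unfolding semigroup_def using iv by (auto simp: incseq_def intro!: nn_integral_mono)
  have "(\<integral>\<^sup>+om. val (Sup (range U)) (ta om + t) om \<partial>law X x) =
   (SUP i. \<integral>\<^sup>+om. (if ta om < life X om then semigroup (U i) t (path (ta om) om) else 0) \<partial>law X x)"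
   unfolding v seq.IH[symmetric] using U
   by (intro nn_integral_monotone_convergence_SUP) (use iv in \<open>auto simp: incseq_def le_fun_def\<close>)
  also have "... = (\<integral>\<^sup>+om. (SUP i. (if ta om < life X om then semigroup (U i) t (path (ta om) om) else 0)) \<partial>law X x)"
   using U by (intro nn_integral_monotone_convergence_SUP[symmetric]) (use inc in \<open>auto simp: incseq_def le_fun_def m2\<close>)
  also have "... = (\<integral>\<^sup>+om. (if ta om < life X om then semigroup (Sup (range U)) t (path (ta om) om) else 0) \<partial>law X x)"
   by (rule nn_integral_cong) (auto simp: s path_state space_law x)
  finally show ?case .
 qed
qed

lemma markov:
 assumes "x \<in> state X" "u < top" "t < top" "f \<in> borelm"
 shows "semigroup f (u + t) x = (\<integral>\<^sup>+om. (if u < life X om then semigroup f t (path u om) else 0) \<partial>law X x)"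
 unfolding semigroup_def[of f "u + t"]
 by (rule strong_markov_fun[OF assms(1) stopping_time_const _ assms(3,4)]) simp

lemma sigma_finite_law: "x \<in> state X ==> sigma_finite_measure (law X x)"
 using law_prob prob_space_imp_sigma_finite by blast

lemma Fubini_law:
 assumes "x \<in> state X" and g: "(%(t, om). g t om) \<in> borel_measurable (borel \<Otimes>\<^sub>M events X)"
 shows "(\<integral>\<^sup>+t. (\<integral>\<^sup>+om. g t om \<partial>law X x) \<partial>lborel) = (\<integral>\<^sup>+om. (\<integral>\<^sup>+(t::real). g t om \<partial>lborel) \<partial>law X x)"
proof -
 interpret law: sigma_finite_measure "law X x" by (rule sigma_finite_law) fact
 interpret pair_sigma_finite "law X x" lborel by standard
 show ?thesis
 proof (rule Fubini'[of "%om t. g t om"])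
  have "(%(om, t). g t om) \<in> borel_measurable (events X \<Otimes>\<^sub>M borel)"
   using measurable_compose[OF measurable_pair_swap' g] by (simp add: case_prod_beta)
  also have "borel_measurable (events X \<Otimes>\<^sub>M borel) = borel_measurable (law X x \<Otimes>\<^sub>M lborel)"
   by (intro measurable_cong_sets sets_pair_measure_cong) (simp_all add: sets_law assms)
  finally show "(%(om, t). g t om) \<in> borel_measurable (law X x \<Otimes>\<^sub>M lborel)" .
 qed
qed

lemma green_occupation:
 assumes "x \<in> state X" and [measurable]: "f \<in> borelm"
 shows "green f x = (\<integral>\<^sup>+om. (\<integral>\<^sup>+t\<in>{0..}. val f (ennreal t) om \<partial>lborel) \<partial>law X x)"
proof -
 have "green f x = (\<integral>\<^sup>+t. (\<integral>\<^sup>+om. val f (ennreal t) om * indicator {0..} t \<partial>law X x) \<partial>lborel)"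
  unfolding green_def semigroup_def
  by (intro nn_integral_cong nn_integral_multc[symmetric]) (simp add: law_measurable assms(1))
 also have "... = (\<integral>\<^sup>+om. (\<integral>\<^sup>+t\<in>{0..}. val f (ennreal t) om \<partial>lborel) \<partial>law X x)"
  by (rule Fubini_law[OF assms(1)]) (measurable)
 finally show ?thesis .
qed

text \<open>The form in which the strong Markov property is used: integrated over the time after
  \<open>ta\<close>. The weight \<open>w\<close> will be the indicator of \<open>{0..}\<close> for
  the Green operator and of \<open>{0..real N}\<close> for finite horizons.\<close>

lemma strong_markov_weighted:
 assumes x: "x \<in> state X" and st: "stopping_time (rc_filt X) ta" and [measurable]: "ta \<in> borel_measurable (events X)"
  and [measurable]: "f \<in> borelm" "w \<in> borelm"
 shows "(\<integral>\<^sup>+om. (\<integral>\<^sup>+t. val f (ta om + ennreal t) om * w t \<partial>lborel) \<partial>law X x) =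
  (\<integral>\<^sup>+om. (if ta om < life X om then (\<integral>\<^sup>+t. semigroup f (ennreal t) (path (ta om) om) * w t \<partial>lborel) else 0) \<partial>law X x)"
proof -
 note [measurable] = stopped_path_measurable[OF assms(3)]
 note [simp] = law_measurable[OF x]
 have "(\<integral>\<^sup>+om. (\<integral>\<^sup>+t. val f (ta om + ennreal t) om * w t \<partial>lborel) \<partial>law X x) =
  (\<integral>\<^sup>+t. (\<integral>\<^sup>+om. val f (ta om + ennreal t) om * w t \<partial>law X x) \<partial>lborel)"
  by (rule Fubini_law[OF x, symmetric]) measurable
 also have "... = (\<integral>\<^sup>+t. (\<integral>\<^sup>+om. (if ta om < life X om then semigroup f (ennreal t) (path (ta om) om) else 0) * w t \<partial>law X x) \<partial>lborel)"
  by (rule nn_integral_cong, subst (1 2) nn_integral_multc)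
   (simp_all add: strong_markov_fun[OF x st])
 also have "... = (\<integral>\<^sup>+om. (\<integral>\<^sup>+t. (if ta om < life X om then semigroup f (ennreal t) (path (ta om) om) else 0) * w t \<partial>lborel) \<partial>law X x)"
  by (rule Fubini_law[OF x]) measurable
 also have "... = (\<integral>\<^sup>+om. (if ta om < life X om then (\<integral>\<^sup>+t. semigroup f (ennreal t) (path (ta om) om) * w t \<partial>lborel) else 0) \<partial>law X x)"
  by (intro nn_integral_cong) auto
 finally show ?thesis .
qed

end

section \<open>Absorption at 0 and exits from intervals\<close>

locale killed_process = strong_markov_process X for X :: "'w process" +
 assumes stopped: "stopped_at_zero X"
  and hits_zero: "!!x. 0 < x ==> x < top ==> emeasure (law X x) {om\<in>space (events X). hit X 0 om < top} = 1"
begin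

text \<open>All exceptional null sets are collected in one property of the path, so that almost sure
  statements become pathwise ones.\<close>

definition good :: "'w => bool" where
 "good om \<longleftrightarrow> om \<in> Om & life X om = top & hit X 0 om < top & (\<forall>t<top. hit X 0 om <= t --> pos X t om = 0)"

text \<open>Finite points are good starting points by \<open>good_start_fin\<close>. The point
  \<open>top\<close> may be a state as well, and the locale assumes nothing about hitting 0 from
  there; hence the predicate.\<close>

definition good_start :: "ennreal => bool" where
 "good_start x \<longleftrightarrow> x \<in> state X & (AE om in law X x. good om)"

lemma AE_start: "x \<in> state X ==> AE om in law X x. om \<in> Om & 0 < life X om & pos X 0 om = x"
 using diffusion AE_space[of "law X x"] by (auto simp: diffusion_def space_law)

text \<open>A path that is stopped at 0 lives forever: at the later of its lifetime and its hitting
  time it would have to be alive, which contradicts a finite lifetime.\<close>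

lemma good_startI:
 assumes x: "x \<in> state X" and h: "AE om in law X x. hit X 0 om < top"
 shows "good_start x"
proof -
 have "AE om in law X x. \<forall>t<top. hit X 0 om <= t --> t < life X om & pos X t om = 0"
  using stopped x by (simp add: stopped_at_zero_def)
 with h AE_start[OF x] have "AE om in law X x. good om"
 proof eventually_elim
  case (elim om)
  have "life X om = top"
  proof (rule ccontr)
   assume "life X om ~= top"
   then have "max (life X om) (hit X 0 om) < top" using elim by (simp add: less_top)
   with elim(3)[rule_format, of "max (life X om) (hit X 0 om)"]
   have "max (life X om) (hit X 0 om) < life X om" by simp
   then show False by simp
  qed
  then show ?case using elim by (simp add: good_def)
 qed
 with x show ?thesis by (simp add: good_start_def)
qed

lemma good_start_fin: "x < top ==> good_start x"
proof -
 assume x: "x < top"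
 note st = fin_in_state[OF x]
 interpret L: prob_space "law X x" by (rule law_prob[OF st])
 show ?thesis
 proof (cases "x = 0")
  case True
  have "AE om in law X x. hit X 0 om < top"
   using AE_start[OF st]
  proof eventually_elim
   case (elim om)
   then have "hit X 0 om <= 0" unfolding hit_def using True by (intro Inf_lower) auto
   then show ?case by simp
  qed
  then show ?thesis using good_startI st by simp
 next
  case False
  then have "emeasure (law X x) {om\<in>Om. hit X 0 om < top} = 1" using x hits_zero by (simp add: zero_less_iff_neq_zero)
  then have "L.prob {om\<in>Om. hit X 0 om < top} = 1" by (simp add: measure_def)
  moreover have "{om\<in>Om. hit X 0 om < top} \<in> L.events" by (simp add: sets_law[OF st])
  ultimately have "AE om in law X x. om \<in> {om\<in>Om. hit X 0 om < top}" using L.AE_in_set_eq_1 by blast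
  then have "AE om in law X x. hit X 0 om < top" by eventually_elim auto
  then show ?thesis using good_startI st by simp
 qed
qed

lemma good_start_state: "good_start x ==> x \<in> state X"
 and good_start_AE: "good_start x ==> AE om in law X x. good om & pos X 0 om = x"
 using AE_start by (auto simp: good_start_def)

lemma good_val: "good om ==> t < top ==> val f t om = f (pos X t om)"
 and good_path: "good om ==> t < top ==> path t om = pos X t om"
 by (auto simp: good_def val_def path_def)

lemma good_less_hit: "good om ==> t < top ==> t < hit X 0 om \<longleftrightarrow> pos X t om ~= 0"
proof -
 assume g: "good om" "t < top"
 have "hit X 0 om <= t" if "pos X t om = 0"
  unfolding hit_def by (rule Inf_lower) (use that g in \<open>auto simp: good_def\<close>)
 then show ?thesis using g by (auto simp: good_def not_less[symmetric])
qed

lemma good_exit_le_hit: "good om ==> 0 \<notin> U ==> exit_of X U om <= hit X 0 om"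
 using exit_less[of "hit X 0 om" U om] by (fastforce simp: good_def not_less[symmetric])

lemma good_exit_less: "good om ==> 0 \<notin> U ==> exit_of X U om < top"
 using good_exit_le_hit[of om U] by (auto simp: good_def)

text \<open>Openness of \<open>U\<close> puts the exit position outside \<open>U\<close>, and
  continuity from the left puts it into the closure. The path does leave \<open>U\<close>, since it
  reaches 0.\<close>

lemma exit_closure:
 assumes "good om" "open U" "0 \<notin> U" "pos X 0 om \<in> U"
 shows "path (exit_of X U om) om \<in> closure U - U"
proof -
 let ?e = "exit_of X U om"
 have om: "om \<in> Om" and l: "?e < life X om" using assms good_exit_less[OF assms(1,3)] by (auto simp: good_def)
 note n = exit_pos[OF om assms(2) l]
 have "?e ~= 0" using n assms by metis
 have "pos X ?e om \<in> closure U"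
 proof (rule ccontr)
  assume *: "pos X ?e om \<notin> closure U"
  have "open {u. u < life X om & pos X u om \<in> - closure U}" by (rule open_alive_pos[OF om]) auto
  from open_left[OF this, of ?e 0] obtain r where r: "r < ?e" "{r<..?e} <= {u. u < life X om & pos X u om \<in> - closure U}"
   using * l \<open>?e ~= 0\<close> by (auto simp: zero_less_iff_neq_zero)
  obtain u where u: "r < u" "u < ?e" using dense[OF r(1)] by auto
  then have "u \<in> {r<..?e}" by auto
  then have "pos X u om \<notin> closure U" using r(2) by auto
  moreover have "pos X u om \<in> U" using exit_less[OF u(2)] by simp
  ultimately show False using closure_subset by blast
 qed
 with n l show ?thesis by (simp add: path_def)
qed

lemma exit_greaterThan:
 assumes "good om" "a < pos X 0 om"
 shows "path (exit_of X {a<..} om) om = a"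
proof -
 have "closure {a<..} <= {a..}" by (rule closure_minimal) auto
 with exit_closure[of om "{a<..}"] assms show ?thesis by (auto simp: not_less intro: antisym)
qed

lemma exit_greaterThanLessThan:
 assumes "good om" "a < pos X 0 om" "pos X 0 om < b"
 shows "path (exit_of X {a<..<b} om) om = a \<or> path (exit_of X {a<..<b} om) om = b"
proof -
 have "closure {a<..<b} <= {a..b}" by (rule closure_minimal) auto
 with exit_closure[of om "{a<..<b}"] assms show ?thesis by (force simp: not_less intro: antisym)
qed

definition before :: "(ennreal => ennreal) => ('w => ennreal) => 'w => ennreal" where
 "before f ta om = (\<integral>\<^sup>+t. val f (ennreal t) om * indicator {t. 0 <= t & ennreal t < ta om} t \<partial>lborel)"

lemma before_measurable [measurable (raw)]:
 assumes [measurable]: "f \<in> borelm" "ta \<in> borel_measurable (events X)"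
 shows "before f ta \<in> borel_measurable (events X)"
proof -
 have "(%(om, t). val f (ennreal t) om * (if 0 <= t & ennreal t < ta om then 1 else 0)) \<in> borel_measurable (events X \<Otimes>\<^sub>M lborel)"
  unfolding case_prod_beta by measurable
 from lborel.borel_measurable_nn_integral[OF this]
 show ?thesis unfolding before_def indicator_def of_bool_def by simp
qed

lemma shift_integral:
 assumes [measurable]: "f \<in> borelm" "w \<in> borelm" and "om \<in> Om" "ta < top"
 shows "(\<integral>\<^sup>+t. val f (ennreal t) om * (w (t - enn2real ta) * indicator {t. ta <= ennreal t} t * indicator {0..} t) \<partial>lborel)
  = (\<integral>\<^sup>+t. val f (ta + ennreal t) om * (w t * indicator {0..} t) \<partial>lborel)"
proof -
 define r where "r = enn2real ta"
 have r: "ta = ennreal r" "0 <= r" using assms by (auto simp: r_def ennreal_enn2real_if)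
 have [measurable]: "(%t. val f t om) \<in> borelm"
  by (rule val_measurable) (use assms(3) in auto)
 show ?thesis
  unfolding r_def[symmetric]
  by (subst nn_integral_real_affine[where c=1 and t=r])
   (auto intro!: nn_integral_cong simp: r indicator_def ennreal_plus)
qed


lemma green_path_split:
 assumes [measurable]: "f \<in> borelm" and om: "om \<in> Om" and t: "ta om < top"
 shows "(\<integral>\<^sup>+t\<in>{0..}. val f (ennreal t) om \<partial>lborel) =
  before f ta om + (\<integral>\<^sup>+t. val f (ta om + ennreal t) om * indicator {0..} t \<partial>lborel)"
proof -
 have [measurable]: "(%t. val f (ennreal t) om) \<in> borelm"
  by (rule val_measurable) (use om in auto)
 have "(\<integral>\<^sup>+t\<in>{0..}. val f (ennreal t) om \<partial>lborel) =
  (\<integral>\<^sup>+t. val f (ennreal t) om * indicator {t. 0 <= t & ennreal t < ta om} t +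
   val f (ennreal t) om * (1 * indicator {t. ta om <= ennreal t} t * indicator {0..} t) \<partial>lborel)"
  by (intro nn_integral_cong) (auto simp: indicator_def)
 also have "... = before f ta om +
  (\<integral>\<^sup>+t. val f (ennreal t) om * (1 * indicator {t. ta om <= ennreal t} t * indicator {0..} t) \<partial>lborel)"
  unfolding before_def by (rule nn_integral_add) (measurable)
 also have "(\<integral>\<^sup>+t. val f (ennreal t) om * (1 * indicator {t. ta om <= ennreal t} t * indicator {0..} t) \<partial>lborel)
   = (\<integral>\<^sup>+t. val f (ta om + ennreal t) om * (1 * indicator {0..} t) \<partial>lborel)"
  by (rule shift_integral[where w="%_. 1"]) (use om t in auto)
 finally show ?thesis by simp
qed

text \<open>Dynkin's formula for the potential: the occupation integral is cut at the exit time, and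
  the strong Markov property restarts the process at the exit position.\<close>

lemma exit_green:
 assumes x: "good_start x" and U: "open U" "compactly_exhausted U" "0 \<notin> U" and [measurable]: "f \<in> borelm"
 shows "green f x = (\<integral>\<^sup>+om. before f (exit_of X U) om \<partial>law X x) + (\<integral>\<^sup>+om. green f (path (exit_of X U om) om) \<partial>law X x)"
proof -
 note st = good_start_state[OF x]
 note [simp] = law_measurable[OF st]
 have [measurable]: "exit_of X U \<in> borel_measurable (events X)" by (rule exit_measurable[OF U(1,2)])
 have "green f x = (\<integral>\<^sup>+om. before f (exit_of X U) om +
   (\<integral>\<^sup>+t. val f (exit_of X U om + ennreal t) om * indicator {0..} t \<partial>lborel) \<partial>law X x)"
  unfolding green_occupation[OF st assms(5)]
 proof (rule nn_integral_cong_AE)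
  show "AE om in law X x. (\<integral>\<^sup>+t\<in>{0..}. val f (ennreal t) om \<partial>lborel) = before f (exit_of X U) om +
   (\<integral>\<^sup>+t. val f (exit_of X U om + ennreal t) om * indicator {0..} t \<partial>lborel)"
   using good_start_AE[OF x]
  proof eventually_elim
   case (elim om)
   then have "om \<in> Om" "exit_of X U om < top" using good_exit_less[OF _ U(3)] by (auto simp: good_def)
   then show ?case by (intro green_path_split) auto
  qed
 qed
 also have "... = (\<integral>\<^sup>+om. before f (exit_of X U) om \<partial>law X x) +
   (\<integral>\<^sup>+om. (\<integral>\<^sup>+t. val f (exit_of X U om + ennreal t) om * indicator {0..} t \<partial>lborel) \<partial>law X x)"
  by (rule nn_integral_add) (simp_all, measurable)
 also have "(\<integral>\<^sup>+om. (\<integral>\<^sup>+t. val f (exit_of X U om + ennreal t) om * indicator {0..} t \<partial>lborel) \<partial>law X x) =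
  (\<integral>\<^sup>+om. (if exit_of X U om < life X om then (\<integral>\<^sup>+t. semigroup f (ennreal t) (path (exit_of X U om) om) * indicator {0..} t \<partial>lborel) else 0) \<partial>law X x)"
  by (intro strong_markov_weighted st stopping_exit U) auto
 also have "... = (\<integral>\<^sup>+om. green f (path (exit_of X U om) om) \<partial>law X x)"
  by (rule nn_integral_cong_AE, use good_start_AE[OF x] in eventually_elim)
   (auto simp: green_def good_def good_exit_less[OF _ U(3)])
 finally show ?thesis .
qed

lemma green_measurable:
 assumes "f \<in> borelm"
 shows "green f \<in> borel_measurable (restrict_space borel (state X))"
proof -
 have "(%(x, t). semigroup f (ennreal t) x * indicator {0..} t) \<in>
   borel_measurable (restrict_space borel (state X) \<Otimes>\<^sub>M lborel)"
  using assms[measurable] unfolding case_prod_beta by measurable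
 from lborel.borel_measurable_nn_integral[OF this] show ?thesis
  unfolding green_def[abs_def] .
qed

text \<open>On its way down to 0 a continuous path has to pass through \<open>a\<close>, so the exit
  position is deterministic.\<close>

lemma exit_up_green:
 assumes x: "good_start x" "a < x" and [measurable]: "f \<in> borelm"
 shows "green f x = (\<integral>\<^sup>+om. before f (exit_of X {a<..}) om \<partial>law X x) + green f a"
proof -
 interpret L: prob_space "law X x" by (rule law_prob[OF good_start_state[OF x(1)]])
 have "(\<integral>\<^sup>+om. green f (path (exit_of X {a<..} om) om) \<partial>law X x) = (\<integral>\<^sup>+om. green f a \<partial>law X x)"
  by (rule nn_integral_cong_AE, use good_start_AE[OF x(1)] in eventually_elim) (use x(2) exit_greaterThan in auto)
 then show ?thesis
  using exit_green[OF x(1), of "{a<..}" f] by (simp add: compactly_exhausted_greaterThan L.emeasure_space_1)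
qed

lemma green_mono:
 assumes "good_start x" "a <= x" and [measurable]: "f \<in> borelm"
 shows "green f a <= green f x"
 using exit_up_green[of x a f] assms by (cases "a = x") (auto simp: less_le)

text \<open>Above the support of \<open>f\<close> nothing is collected until the path comes down to
  \<open>b\<close>.\<close>

lemma green_const_above:
 assumes x: "good_start x" "b <= x" and [measurable]: "f \<in> borelm" and f: "!!y. b < y ==> f y = 0"
 shows "green f x = green f b"
proof (cases "b = x")
 case False
 then have "b < x" using x by auto
 have "before f (exit_of X {b<..}) om = 0" for om
 proof -
  have "before f (exit_of X {b<..}) om = (\<integral>\<^sup>+(t::real). 0 \<partial>lborel)"
   unfolding before_def
   by (rule nn_integral_cong) (use exit_less[of _ "{b<..}" om] f in \<open>auto simp: indicator_def val_def\<close>)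
  then show ?thesis by simp
 qed
 with exit_up_green[OF x(1) \<open>b < x\<close> assms(3)] show ?thesis by simp
qed simp

lemma semigroup_zero:
 assumes "f 0 = 0" "t < top" shows "semigroup f t 0 = 0"
proof -
 have "AE om in law X 0. val f t om = 0"
  using good_start_AE[OF good_start_fin[of 0, OF ennreal_zero_less_top]]
 proof eventually_elim
  case (elim om)
  then have "hit X 0 om <= 0" unfolding hit_def by (intro Inf_lower) (auto simp: good_def)
  then show ?case using elim assms by (auto simp: good_def val_def)
 qed
 then have "semigroup f t 0 = (\<integral>\<^sup>+om. 0 \<partial>law X 0)"
  unfolding semigroup_def by (rule nn_integral_cong_AE)
 then show ?thesis by simp
qed

lemma green_zero: "f 0 = 0 ==> green f 0 = 0"
 by (simp add: green_def semigroup_zero)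

text \<open>All parts rest on the fact that the exit position takes only the values \<open>a\<close>
  and \<open>b\<close>; its law integrates any \<open>h\<close> by the formula
  \<open>I\<close>.\<close>

lemma exit_interval_green:
 assumes x: "a < x" "x < b" "b < top" and [measurable]: "f \<in> borelm"
 defines "ta \<equiv> exit_of X {a<..<b}"
 shows "green f x = (\<integral>\<^sup>+om. before f ta om \<partial>law X x)
   + emeasure (law X x) {om\<in>Om. path (ta om) om = b} * green f b + emeasure (law X x) {om\<in>Om. path (ta om) om = a} * green f a"
  and "emeasure (law X x) {om\<in>Om. path (ta om) om = b} + emeasure (law X x) {om\<in>Om. path (ta om) om = a} = 1"
  and "{om\<in>Om. path (ta om) om = c} \<in> sets (events X)"
  and "AE om in law X x. ta om < life X om & (path (ta om) om = a \<or> path (ta om) om = b)"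
proof -
 have gx: "good_start x" using x by (intro good_start_fin) (auto intro: less_trans)
 note st = good_start_state[OF gx]
 note [simp] = law_measurable[OF st]
 interpret L: prob_space "law X x" by (rule law_prob[OF st])
 have [measurable]: "ta \<in> borel_measurable (events X)"
  unfolding ta_def by (rule exit_measurable) (auto intro: compactly_exhausted_greaterThanLessThan)
 have [measurable]: "(%om. path (ta om) om) \<in> borel_measurable (events X)"
  using stopped_path_measurable[of ta] by (simp add: measurable_restrict_space2_iff)
 show ms: "{om\<in>Om. path (ta om) om = c} \<in> sets (events X)" for c by measurable
 show ae: "AE om in law X x. ta om < life X om & (path (ta om) om = a \<or> path (ta om) om = b)"
  using good_start_AE[OF gx]
 proof eventually_elim
  case (elim om)
  then show ?case using x exit_greaterThanLessThan[of om a b] good_exit_less[of om "{a<..<b}"]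
   by (auto simp: good_def ta_def)
 qed
 have "a ~= b" using x by auto
 have I: "(\<integral>\<^sup>+om. h (path (ta om) om) \<partial>law X x) =
  emeasure (law X x) {om\<in>Om. path (ta om) om = b} * h b + emeasure (law X x) {om\<in>Om. path (ta om) om = a} * h a" for h :: "ennreal => ennreal"
 proof -
  have "(\<integral>\<^sup>+om. h (path (ta om) om) \<partial>law X x) =
   (\<integral>\<^sup>+om. h b * indicator {om\<in>Om. path (ta om) om = b} om + h a * indicator {om\<in>Om. path (ta om) om = a} om \<partial>law X x)"
   by (rule nn_integral_cong_AE, use ae AE_start[OF st] in eventually_elim) (use \<open>a ~= b\<close> in auto)
  also have "... = h b * emeasure (law X x) {om\<in>Om. path (ta om) om = b} + h a * emeasure (law X x) {om\<in>Om. path (ta om) om = a}"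
   using ms by (subst nn_integral_add) (auto simp: nn_integral_cmult_indicator sets_law[OF st])
  finally show ?thesis by (simp add: mult.commute)
 qed
 show "green f x = (\<integral>\<^sup>+om. before f ta om \<partial>law X x)
   + emeasure (law X x) {om\<in>Om. path (ta om) om = b} * green f b + emeasure (law X x) {om\<in>Om. path (ta om) om = a} * green f a"
  using exit_green[OF gx, of "{a<..<b}" f] I[of "green f"] 
  by (simp add: compactly_exhausted_greaterThanLessThan ta_def add.assoc)
 show "emeasure (law X x) {om\<in>Om. path (ta om) om = b} + emeasure (law X x) {om\<in>Om. path (ta om) om = a} = 1"
  using I[of "%_. 1"] by (simp add: L.emeasure_space_1)
qed

end

section \<open>Finiteness of occupation times and right continuity of the Green operator\<close>

context killed_process
begin

abbreviation alive :: "ennreal => ennreal" where "alive \<equiv> indicator (- {0})"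

lemma val_mono: "(!!x. f x <= g x) ==> val f t om <= val g t om"
 by (simp add: val_def)

lemma semigroup_mono: "(!!x. f x <= g x) ==> semigroup f t x <= semigroup g t x"
 unfolding semigroup_def by (intro nn_integral_mono val_mono)

lemma semigroup_le_one:
 assumes "x \<in> state X" "!!y. f y <= 1" shows "semigroup f t x <= 1"
proof -
 interpret L: prob_space "law X x" by (rule law_prob) fact
 have "semigroup f t x <= (\<integral>\<^sup>+om. 1 \<partial>law X x)"
  unfolding semigroup_def using assms(2) by (intro nn_integral_mono) (simp add: val_def)
 then show ?thesis by (simp add: L.emeasure_space_1)
qed

text \<open>The process from \<open>b\<close> first has to come down to \<open>x\<close> and only
  then needs as long to die as the process from \<open>x\<close>.\<close>

lemma alive_semigroup_mono:
 assumes "0 < x" "x <= b" "b < top" "t < top"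
 shows "semigroup alive t x <= semigroup alive t b"
proof (cases "x = b")
 case False
 then have xb: "x < b" using assms by auto
 have gb: "good_start b" by (rule good_start_fin) fact
 note st = good_start_state[OF gb]
 interpret L: prob_space "law X b" by (rule law_prob[OF st])
 let ?ta = "exit_of X {x<..}"
 have [measurable]: "?ta \<in> borel_measurable (events X)" by (rule exit_measurable) (auto intro: compactly_exhausted_greaterThan)
 have "semigroup alive t x = (\<integral>\<^sup>+om. semigroup alive t x \<partial>law X b)" by (simp add: L.emeasure_space_1)
 also have "... = (\<integral>\<^sup>+om. (if ?ta om < life X om then semigroup alive t (path (?ta om) om) else 0) \<partial>law X b)"
  by (rule nn_integral_cong_AE, use good_start_AE[OF gb] in eventually_elim)
   (use xb exit_greaterThan[of _ x] good_exit_less[of _ "{x<..}"] in \<open>auto simp: good_def\<close>)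
 also have "... = (\<integral>\<^sup>+om. val alive (?ta om + t) om \<partial>law X b)"
  by (rule strong_markov_fun[symmetric, OF st stopping_exit]) (use assms in \<open>auto intro: compactly_exhausted_greaterThan\<close>)
 also have "... <= semigroup alive t b"
  unfolding semigroup_def
 proof (rule nn_integral_mono_AE, use good_start_AE[OF gb] in eventually_elim)
  case (elim om)
  have "?ta om + t < top" using elim good_exit_less[of om "{x<..}"] assms by (simp add: ennreal_add_less_top)
  moreover have "t <= ?ta om + t" by simp
  then have "pos X (?ta om + t) om = 0" if "pos X t om = 0"
  proof -
   have "hit X 0 om <= t" using that good_less_hit[of om t] elim assms by (auto simp: not_less)
   then have "hit X 0 om <= ?ta om + t" using \<open>t <= ?ta om + t\<close> by (rule order_trans)
   then show ?thesis using elim \<open>?ta om + t < top\<close> by (auto simp: good_def)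
  qed
  ultimately show ?case using elim assms by (auto simp: good_val indicator_def)
 qed
 finally show ?thesis .
qed simp

lemma alive_semigroup_tendsto_0:
 assumes b: "good_start b"
 shows "(%n. semigroup alive (ennreal (real n)) b) ----> 0"
proof -
 note st = good_start_state[OF b]
 interpret L: prob_space "law X b" by (rule law_prob[OF st])
 have "(%n. \<integral>\<^sup>+om. val alive (ennreal (real n)) om \<partial>law X b) ----> (\<integral>\<^sup>+om. 0 \<partial>law X b)"
 proof (rule nn_integral_dominated_convergence[where w="%_. 1"])
  show "AE om in law X b. (%n. val alive (ennreal (real n)) om) ----> 0"
   using good_start_AE[OF b]
  proof eventually_elim
   case (elim om)
   obtain N :: nat where N: "hit X 0 om < of_nat N"
    using elim ennreal_Ex_less_of_nat[of "hit X 0 om"] by (auto simp: good_def)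
   have "val alive (ennreal (real n)) om = 0" if "n \<ge> N" for n
   proof -
    have "hit X 0 om <= ennreal (real n)" using N that by (metis ennreal_of_nat_eq_real_of_nat less_imp_le of_nat_le_iff order_trans)
    then show ?thesis using elim by (auto simp: good_val) (auto simp: good_def)
   qed
   then show ?case by (intro tendsto_eventually) (auto simp: eventually_sequentially)
  qed
  show "AE om in law X b. val alive (ennreal (real n)) om <= 1" for n by (auto simp: val_def indicator_def)
 qed (simp_all add: law_measurable[OF st] L.emeasure_space_1)
 then show ?thesis by (simp add: semigroup_def)
qed

lemma alive_semigroup_antimono:
 assumes "good_start x" "t <= t'" "t' < top"
 shows "semigroup alive t' x <= semigroup alive t x"
 unfolding semigroup_def
proof (rule nn_integral_mono_AE, use good_start_AE[OF assms(1)] in eventually_elim)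
 case (elim om)
 have t: "t < top" using assms(2,3) by (rule order_le_less_trans)
 have "pos X t' om = 0" if "pos X t om = 0"
 proof -
  have "hit X 0 om <= t" using that good_less_hit[of om t] elim t by (auto simp: not_less)
  then have "hit X 0 om <= t'" using assms(2) by (rule order_trans)
  then show ?thesis using elim assms by (auto simp: good_def)
 qed
 then show ?case using elim assms t by (auto simp: good_val indicator_def)
qed

text \<open>If a finite point leads to \<open>top\<close> at time \<open>u\<close> with probability
  \<open>c > 0\<close>, then \<open>top\<close> inherits its behaviour: by the Markov property at
  \<open>u\<close>, survival from \<open>top\<close> is at most \<open>1 / c\<close> times survival
  from \<open>x\<close>, which tends to 0. So \<open>top\<close> is a good starting point as soon as
  it can be reached.\<close>

lemma AE_good_start_path:
 assumes x: "x < top" and u: "u < top"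
 shows "AE om in law X x. good_start (path u om)"
proof (cases "AE om in law X x. path u om ~= top")
 case True
 then show ?thesis by eventually_elim (auto intro: good_start_fin simp: less_top)
next
 case False
 have gx: "good_start x" by (rule good_start_fin) fact
 note st = good_start_state[OF gx]
 interpret L: prob_space "law X x" by (rule law_prob[OF st])
 note [simp] = law_measurable[OF st]
 have "\<exists>om\<in>Om. path u om = top" 
 proof (rule ccontr)
  assume no: "\<not> ?thesis"
  have "AE om in law X x. path u om ~= top"
   using AE_start[OF st] by eventually_elim (use no in auto)
  with False show False by simp
 qed
 then have tst: "top \<in> state X" using path_state by metis
 interpret T: prob_space "law X top" by (rule law_prob[OF tst])
 define c where "c = emeasure (law X x) {om\<in>Om. path u om = top}"
 have ms: "{om\<in>Om. path u om = top} \<in> sets (events X)" by measurable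
 have c: "c ~= 0" using False ms unfolding c_def
  by (subst (asm) AE_iff_measurable[where N="{om\<in>Om. path u om = top}"]) (auto simp: sets_law[OF st] space_law[OF st])
 have c1: "c <= 1" unfolding c_def by (rule L.emeasure_le_1)
 have le: "c * semigroup f t top <= semigroup f (u + t) x" if "f \<in> borelm" "t < top" for f t
 proof -
  have "c * semigroup f t top = (\<integral>\<^sup>+om. semigroup f t top * indicator {om\<in>Om. path u om = top} om \<partial>law X x)"
   using ms by (simp add: c_def nn_integral_cmult_indicator sets_law[OF st] mult.commute)
  also have "... <= (\<integral>\<^sup>+om. (if u < life X om then semigroup f t (path u om) else 0) \<partial>law X x)"
   by (rule nn_integral_mono_AE, use good_start_AE[OF gx] in eventually_elim) (auto simp: indicator_def good_def u)
  finally show ?thesis by (simp add: markov[OF st u that(2,1)])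
 qed
 \<comment> \<open>Paths from \<open>x\<close> have infinite lifetime, and since
   \<open>c > 0\<close> the same must hold from \<open>top\<close>. This separates being absorbed at
   0 from ceasing to exist, which \<open>val\<close> alone does not distinguish.\<close>
 have one: "semigroup (%_. 1) t top = 1" if t: "t < top" for t
 proof -
  have a: "semigroup (%_. 1) (u + t) x = 1"
  proof -
   have "semigroup (%_. 1) (u + t) x = (\<integral>\<^sup>+om. 1 \<partial>law X x)"
    unfolding semigroup_def
    by (rule nn_integral_cong_AE, use good_start_AE[OF gx] in eventually_elim) (auto simp: good_val u t ennreal_add_less_top)
   then show ?thesis by (simp add: L.emeasure_space_1)
  qed
  have "(\<integral>\<^sup>+om. (if u < life X om then semigroup (%_. 1) t (path u om) else 0) \<partial>law X x) \<le>
   (\<integral>\<^sup>+om. indicator (Om - {om\<in>Om. path u om = top}) om + semigroup (%_. 1) t top * indicator {om\<in>Om. path u om = top} om \<partial>law X x)"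
   by (rule nn_integral_mono) (auto simp: indicator_def space_law[OF st] semigroup_le_one path_state)
  also have "... = emeasure (law X x) (Om - {om\<in>Om. path u om = top}) + semigroup (%_. 1) t top * c"
   using ms unfolding c_def by (subst nn_integral_add) (auto simp: nn_integral_cmult_indicator sets_law[OF st])
  also have "emeasure (law X x) (Om - {om\<in>Om. path u om = top}) = 1 - c"
   using emeasure_compl[of "{om\<in>Om. path u om = top}" "law X x"] ms
   using leD[OF c1] ennreal_one_less_top
   by (cases "c = top") (simp_all add: sets_law[OF st] space_law[OF st] c_def[symmetric] L.emeasure_space_1[unfolded space_law[OF st]])
  finally have "1 <= (1 - c) + semigroup (%_. 1) t top * c"
   using a by (simp add: markov[OF st u t])
  moreover have "semigroup (%_. 1) t top <= 1" by (rule semigroup_le_one[OF tst]) simp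
  moreover have "semigroup (%_. 1) t top = 1" if h: "1 <= (1 - c) + g * c" "g <= 1" "g = semigroup (%_. 1) t top" for g
  proof -
   obtain c' where c': "c = ennreal c'" "0 < c'" "c' <= 1"
    using c c1 by (cases c) (auto simp: ennreal_eq_0_iff top_unique)
   obtain g' where g': "g = ennreal g'" "0 <= g'" "g' <= 1" using h(2) by (cases g) (auto simp: top_unique)
   have "(1 - c') + g' * c' \<ge> 0" using c' g' by (intro add_nonneg_nonneg mult_nonneg_nonneg) auto
   have "ennreal ((1 - c') + g' * c') = ennreal (1 - c') + ennreal (g' * c')"
    by (rule ennreal_plus) (use c' g' in auto)
   also have "ennreal (1 - c') = 1 - c" using ennreal_minus[of c' 1] c' by simp
   also have "ennreal (g' * c') = g * c" using ennreal_mult[of g' c'] c' g' by simp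
   finally have "ennreal 1 <= ennreal ((1 - c') + g' * c')" using h(1) by simp
   then have "1 <= (1 - c') + g' * c'" using ennreal_le_iff \<open>(1 - c') + g' * c' \<ge> 0\<close> by blast
   then have "c' * (1 - g') <= 0" by (simp add: algebra_simps)
   then have "g' = 1" using c' g' by (auto simp: mult_le_0_iff)
   then show ?thesis using h g' by simp
  qed
  ultimately show ?thesis by blast
 qed
 have "AE om in law X top. ennreal (real n) < life X om" for n
 proof -
  have "semigroup (%_. 1) (ennreal (real n)) top = (\<integral>\<^sup>+om. indicator {om\<in>Om. ennreal (real n) < life X om} om \<partial>law X top)"
   unfolding semigroup_def by (rule nn_integral_cong) (auto simp: space_law[OF tst] val_def indicator_def)
  also have "... = emeasure (law X top) {om\<in>Om. ennreal (real n) < life X om}"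
   by (rule nn_integral_indicator) (simp add: sets_law[OF tst])
  finally have "emeasure (law X top) {om\<in>Om. ennreal (real n) < life X om} = semigroup (%_. 1) (ennreal (real n)) top" ..
  also have "... = 1" by (rule one) simp
  finally have "AE om in law X top. om \<in> {om\<in>Om. ennreal (real n) < life X om}"
   using T.AE_in_set_eq_1[of "{om\<in>Om. ennreal (real n) < life X om}"] by (simp add: sets_law[OF tst] measure_def)
  then show ?thesis by eventually_elim auto
 qed
 then have life: "AE om in law X top. \<forall>n. ennreal (real n) < life X om" by (simp add: AE_all_countable)
 \<comment> \<open>\<open>A\<close> is the event of never being seen dead at an integer time; it is
   null because survival up to time \<open>n\<close> tends to 0.\<close>
 define A where "A = {om\<in>Om. \<forall>n. val alive (ennreal (real n)) om ~= 0}"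
 have A: "A \<in> sets (events X)" unfolding A_def by measurable
 have "c * emeasure (law X top) A <= semigroup alive (ennreal (real n)) x" for n
 proof -
  have "emeasure (law X top) A = (\<integral>\<^sup>+om. indicator A om \<partial>law X top)"
   using A by (simp add: sets_law[OF tst])
  also have "... <= semigroup alive (ennreal (real n)) top"
   unfolding semigroup_def A_def by (rule nn_integral_mono) (auto simp: indicator_def val_def split: if_splits)
  finally have "c * emeasure (law X top) A <= c * semigroup alive (ennreal (real n)) top"
   by (rule mult_left_mono) simp
  also have "... <= semigroup alive (u + ennreal (real n)) x" by (rule le) auto
  also have "... <= semigroup alive (ennreal (real n)) x" by (rule alive_semigroup_antimono[OF gx]) (auto simp: u ennreal_add_less_top)
  finally show ?thesis .
 qed
 with alive_semigroup_tendsto_0[OF gx] have "c * emeasure (law X top) A <= 0"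
  by (intro LIMSEQ_le_const) auto
 then have "emeasure (law X top) A = 0" using c by simp
 then have "AE om in law X top. om \<notin> A" using A by (intro AE_not_in) (simp add: null_sets_def sets_law[OF tst])
 with life AE_start[OF tst] have "AE om in law X top. hit X 0 om < top"
 proof eventually_elim
  case (elim om)
  then obtain n where "pos X (ennreal (real n)) om = 0" by (auto simp: A_def val_def indicator_def split: if_splits)
  then have "hit X 0 om <= ennreal (real n)" unfolding hit_def using elim by (intro Inf_lower) auto
  then show ?case by (rule order_le_less_trans) simp
 qed
 then have "good_start top" using good_startI tst by blast
 then have "good_start y" for y using good_start_fin[of y] by (cases "y = top") (auto simp: less_top)
 then show ?thesis by simp
qed


definition horizon :: "nat => (ennreal => ennreal) => ennreal => ennreal" where
 "horizon N f x = (\<integral>\<^sup>+t. semigroup f (ennreal t) x * indicator {0..real N} t \<partial>lborel)"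

lemma horizon_occupation:
 assumes "x \<in> state X" and [measurable]: "f \<in> borelm"
 shows "horizon N f x = (\<integral>\<^sup>+om. (\<integral>\<^sup>+t. val f (ennreal t) om * indicator {0..real N} t \<partial>lborel) \<partial>law X x)"
proof -
 have "horizon N f x = (\<integral>\<^sup>+t. (\<integral>\<^sup>+om. val f (ennreal t) om * indicator {0..real N} t \<partial>law X x) \<partial>lborel)"
  unfolding horizon_def semigroup_def
  by (intro nn_integral_cong nn_integral_multc[symmetric]) (simp add: law_measurable assms(1))
 also have "... = (\<integral>\<^sup>+om. (\<integral>\<^sup>+t. val f (ennreal t) om * indicator {0..real N} t \<partial>lborel) \<partial>law X x)"
  by (rule Fubini_law[OF assms(1)]) (measurable)
 finally show ?thesis .
qed

lemma horizon_le:
 assumes "x \<in> state X" "!!y. f y <= 1" shows "horizon N f x <= of_nat N"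
proof -
 have "horizon N f x <= (\<integral>\<^sup>+t. indicator {0..real N} t \<partial>lborel)"
  unfolding horizon_def
  using mult_right_mono[OF semigroup_le_one[OF assms]] by (intro nn_integral_mono) simp
 then show ?thesis by (simp add: ennreal_of_nat_eq_real_of_nat)
qed

text \<open>Only an inequality, in contrast to \<open>green_const_above\<close>: the time spent on
  coming down to \<open>b\<close> is lost from the horizon.\<close>

lemma horizon_above:
 assumes x: "good_start x" "b < x" and [measurable]: "f \<in> borelm" and f: "!!y. b < y ==> f y = 0"
 shows "horizon N f x <= horizon N f b"
proof -
 note st = good_start_state[OF x(1)]
 interpret L: prob_space "law X x" by (rule law_prob[OF st])
 let ?ta = "exit_of X {b<..}"
 have [measurable]: "?ta \<in> borel_measurable (events X)" by (rule exit_measurable) (auto intro: compactly_exhausted_greaterThan)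
 have "horizon N f x <= (\<integral>\<^sup>+om. (\<integral>\<^sup>+t. val f (?ta om + ennreal t) om * indicator {0..real N} t \<partial>lborel) \<partial>law X x)"
  unfolding horizon_occupation[OF st assms(3)]
 proof (rule nn_integral_mono_AE, use good_start_AE[OF x(1)] in eventually_elim)
  case (elim om)
  then have om: "om \<in> Om" and ta: "?ta om < top" using good_exit_less[of om "{b<..}"] by (auto simp: good_def)
  have v: "val f (ennreal t) om = 0" if "\<not> ?ta om <= ennreal t" for t
   using exit_less[of "ennreal t" "{b<..}" om] that f by (auto simp: val_def)
  have "(\<integral>\<^sup>+t. val f (ennreal t) om * indicator {0..real N} t \<partial>lborel) \<le>
   (\<integral>\<^sup>+t. val f (ennreal t) om * (indicator {0..real N} (t - enn2real (?ta om)) * indicator {t. ?ta om <= ennreal t} t * indicator {0..} t) \<partial>lborel)"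
  proof (rule nn_integral_mono)
   fix t :: real
   show "val f (ennreal t) om * indicator {0..real N} t \<le>
    val f (ennreal t) om * (indicator {0..real N} (t - enn2real (?ta om)) * indicator {t. ?ta om <= ennreal t} t * indicator {0..} t)"
   proof (cases "?ta om <= ennreal t & 0 <= t & t <= real N")
    case True
    then have "enn2real (?ta om) <= t" using enn2real_mono[of "?ta om" "ennreal t"] by simp
    moreover have "t - enn2real (?ta om) <= real N" using True enn2real_nonneg[of "?ta om"] by linarith
    ultimately show ?thesis using True by (simp add: indicator_def)
   next
    case False then show ?thesis using v[of t] by (auto simp: indicator_def)
   qed
  qed
  also have "... = (\<integral>\<^sup>+t. val f (?ta om + ennreal t) om * (indicator {0..real N} t * indicator {0..} t) \<partial>lborel)"
   by (rule shift_integral) (use om ta in auto)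
  also have "... = (\<integral>\<^sup>+t. val f (?ta om + ennreal t) om * indicator {0..real N} t \<partial>lborel)"
   by (intro nn_integral_cong) (auto simp: indicator_def)
  finally show ?case .
 qed
 also have "... = (\<integral>\<^sup>+om. (if ?ta om < life X om then (\<integral>\<^sup>+t. semigroup f (ennreal t) (path (?ta om) om) * indicator {0..real N} t \<partial>lborel) else 0) \<partial>law X x)"
  by (intro strong_markov_weighted st stopping_exit compactly_exhausted_greaterThan) auto
 also have "... = (\<integral>\<^sup>+om. horizon N f b \<partial>law X x)"
  by (rule nn_integral_cong_AE, use good_start_AE[OF x(1)] in eventually_elim)
   (use x(2) exit_greaterThan in \<open>auto simp: good_def horizon_def good_exit_less\<close>)
 finally show ?thesis by (simp add: L.emeasure_space_1)
qed

text \<open>After a time \<open>n\<close> by which the process started from \<open>b\<close> is dead with probability at least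
 \<open>1/2\<close>, the occupation time of \<open>(0,b]\<close> starts afresh, so its supremum \<open>S\<close> satisfies
 \<open>S <= n + S/2\<close>. Finite horizons make \<open>S\<close> finite beforehand.\<close>

lemma green_indicator_bounded:
 assumes b: "0 < b" "b < top"
 shows "\<exists>C<top. \<forall>x. good_start x --> green (indicator {0<..b}) x <= C"
proof -
 define f :: "ennreal => ennreal" where "f = indicator {0<..b}"
 have [measurable]: "f \<in> borelm" by (simp add: f_def)
 have f1: "f y <= 1" for y by (simp add: f_def indicator_def)
 have "\<forall>\<^sub>F n in sequentially. semigroup alive (ennreal (real n)) b < ennreal (1/2)"
  by (rule order_tendstoD(2)[OF alive_semigroup_tendsto_0[OF good_start_fin[OF b(2)]]]) (rule ennreal_less_zero_iff[THEN iffD2], simp)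
 from eventually_happens'[OF sequentially_bot this]
 obtain n where n': "semigroup alive (ennreal (real n)) b < ennreal (1/2)" by blast
 then have n: "semigroup alive (ennreal (real n)) b <= ennreal (1/2)" by (rule less_imp_le)
 have main: "horizon N f x <= of_nat (2 * n)" if gx: "good_start x" for N x
 proof -
  define S where "S = (SUP x\<in>{x. good_start x}. horizon N f x)"
  have le_S: "horizon N f y <= S" if "good_start y" for y unfolding S_def by (rule SUP_upper) (use that in auto)
  have z: "horizon N f 0 = 0" unfolding horizon_def by (simp add: semigroup_zero f_def)
  have 1: "horizon N f x <= of_nat n + S * ennreal (1/2)" if x: "0 < x" "x <= b" for x
  proof -
   have xt: "x < top" using x b by order
   have gx: "good_start x" by (rule good_start_fin) fact
   note st = good_start_state[OF gx]
   note [simp] = law_measurable[OF st]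
   let ?n = "ennreal (real n)"
   have "horizon N f x <= (\<integral>\<^sup>+t. indicator {0..real n} t + semigroup f (ennreal t) x * (indicator {0..real N} (t - real n) * indicator {real n..} t) \<partial>lborel)"
    unfolding horizon_def
    using semigroup_le_one[OF st f1] by (intro nn_integral_mono) (auto simp: indicator_def)
   also have "... = (\<integral>\<^sup>+t. indicator {0..real n} t \<partial>lborel) + (\<integral>\<^sup>+t. semigroup f (ennreal t) x * (indicator {0..real N} (t - real n) * indicator {real n..} t) \<partial>lborel)"
    by (rule nn_integral_add) (auto intro!: borel_measurable_times_ennreal semigroup_measurable simp: st space_restrict_space)
   also have "(\<integral>\<^sup>+t. semigroup f (ennreal t) x * (indicator {0..real N} (t - real n) * indicator {real n..} t) \<partial>lborel)
    = (\<integral>\<^sup>+t. semigroup f (?n + ennreal t) x * indicator {0..real N} t \<partial>lborel)"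
    by (subst nn_integral_real_affine[where c=1 and t="real n"])
     (auto intro!: nn_integral_cong borel_measurable_times_ennreal semigroup_measurable simp: indicator_def ennreal_plus st space_restrict_space)
   also have "... = (\<integral>\<^sup>+t. (\<integral>\<^sup>+om. val f (?n + ennreal t) om * indicator {0..real N} t \<partial>law X x) \<partial>lborel)"
    unfolding semigroup_def by (intro nn_integral_cong nn_integral_multc[symmetric]) simp
   also have "... = (\<integral>\<^sup>+om. (\<integral>\<^sup>+t. val f (?n + ennreal t) om * indicator {0..real N} t \<partial>lborel) \<partial>law X x)"
    by (rule Fubini_law[OF st]) measurable
   also have "... = (\<integral>\<^sup>+om. (if ?n < life X om then (\<integral>\<^sup>+t. semigroup f (ennreal t) (path ?n om) * indicator {0..real N} t \<partial>lborel) else 0) \<partial>law X x)"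
    by (intro strong_markov_weighted st stopping_time_const) auto
   \<comment> \<open>A path that is dead at time \<open>n\<close> contributes nothing; any other
     path starts afresh from a good point and contributes at most \<open>S\<close>.\<close>
   also have "... <= (\<integral>\<^sup>+om. S * val alive ?n om \<partial>law X x)"
   proof (rule nn_integral_mono_AE, use good_start_AE[OF gx] AE_good_start_path[OF xt, of ?n, simplified] in eventually_elim)
    case (elim om)
    then show ?case using le_S[of "path ?n om"] z
     by (cases "path ?n om = 0") (auto simp: horizon_def[symmetric] val_path good_def)
   qed
   also have "... = S * semigroup alive ?n x"
    unfolding semigroup_def by (rule nn_integral_cmult) simp
   also have "... <= S * ennreal (1/2)"
    using alive_semigroup_mono[OF x b(2), of ?n] n by (intro mult_left_mono) auto
   finally show ?thesis by (simp add: ennreal_of_nat_eq_real_of_nat add_mono)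
  qed
  have 2: "horizon N f x <= of_nat n + S * ennreal (1/2)" if gx: "good_start x" for x
  proof -
   consider "x = 0" | "0 < x" "x <= b" | "b < x" by (metis linorder_not_less zero_less_iff_neq_zero)
   then show ?thesis
   proof cases
    case 3
    have "horizon N f x <= horizon N f b" by (rule horizon_above[OF gx 3]) (auto simp: f_def indicator_def)
    also note 1[OF b(1) order_refl]
    finally show ?thesis .
   next
    case 2 then show ?thesis by (rule 1)
   qed (simp add: z)
  qed
  have S: "S <= of_nat n + S * ennreal (1/2)" unfolding S_def[of ]
   using 2 by (intro SUP_least) (simp add: S_def)
  have "S <= of_nat N" unfolding S_def using horizon_le[OF good_start_state f1] by (intro SUP_least) auto
  then obtain s where s: "S = ennreal s" "0 <= s" by (cases S) (auto simp: top_unique)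
  have "S * ennreal (1/2) = ennreal (s * (1/2))"
   unfolding s(1) by (rule ennreal_mult[symmetric]) (use s in auto)
  moreover have "ennreal (real n + s * (1/2)) = ennreal (real n) + ennreal (s * (1/2))"
   by (rule ennreal_plus) (use s in auto)
  ultimately have "ennreal s <= ennreal (real n + s * (1/2))"
   using S unfolding s(1) by (simp only: ennreal_of_nat_eq_real_of_nat)
  then have "s <= real n + s * (1/2)" by (subst (asm) ennreal_le_iff) (use s in auto)
  then have "s <= 2 * real n" by simp
  then have "S <= of_nat (2 * n)" using s by (simp add: ennreal_of_nat_eq_real_of_nat ennreal_leI)
  with le_S[OF gx] show ?thesis by order
 qed
 show ?thesis
 proof (intro exI[of _ "of_nat (2 * n)"] conjI allI impI)
  show "of_nat (2 * n) < (top::ennreal)" by (rule of_nat_less_top)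
  fix x assume gx: "good_start x"
  note st = good_start_state[OF gx]
  have [measurable]: "(%t. semigroup f (ennreal t) x) \<in> borelm"
   by (rule semigroup_measurable) (auto simp: st space_restrict_space)
  have "green f x = (\<integral>\<^sup>+t. (SUP N. semigroup f (ennreal t) x * indicator {0..real N} t) \<partial>lborel)"
   unfolding green_def
  proof (rule nn_integral_cong)
   fix t :: real
   obtain N :: nat where "t <= real N" using real_arch_simple by blast
   then have "semigroup f (ennreal t) x * indicator {0..} t <= (SUP N. semigroup f (ennreal t) x * indicator {0..real N} t)"
    by (intro SUP_upper2[of N]) (auto simp: indicator_def)
   moreover have "(SUP N. semigroup f (ennreal t) x * indicator {0..real N} t) <= semigroup f (ennreal t) x * indicator {0..} t"
    by (rule SUP_least) (auto simp: indicator_def)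
   ultimately show "semigroup f (ennreal t) x * indicator {0..} t = (SUP N. semigroup f (ennreal t) x * indicator {0..real N} t)"
    by (rule antisym)
  qed
  also have "... = (SUP N. horizon N f x)"
   unfolding horizon_def
   by (rule nn_integral_monotone_convergence_SUP) (auto simp: incseq_def le_fun_def indicator_def)
  also have "... <= of_nat (2 * n)" using main[OF gx] by (rule SUP_least)
  finally show "green (indicator {0<..b}) x <= of_nat (2 * n)" by (simp add: f_def)
 qed
qed

lemma green_cmult_le:
 assumes "!!y. f y <= c * g y" and x: "x \<in> state X" and [measurable]: "g \<in> borelm"
 shows "green f x <= c * green g x"
proof -
 have [measurable]: "(%t. semigroup g (ennreal t) x) \<in> borelm"
  by (rule semigroup_measurable) (auto simp: x space_restrict_space)
 have "semigroup f t x <= c * semigroup g t x" for t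
 proof -
  have "semigroup f t x <= (\<integral>\<^sup>+om. c * val g t om \<partial>law X x)"
   unfolding semigroup_def using assms(1) by (intro nn_integral_mono) (simp add: val_def)
  then show ?thesis unfolding semigroup_def by (simp add: nn_integral_cmult law_measurable x)
 qed
 then have "green f x <= (\<integral>\<^sup>+t. c * (semigroup g (ennreal t) x * indicator {0..} t) \<partial>lborel)"
  unfolding green_def by (intro nn_integral_mono) (auto simp: indicator_def)
 then show ?thesis unfolding green_def by (simp add: nn_integral_cmult)
qed

text \<open>Seen from a fixed \<open>z\<close> above \<open>x\<close>, the value
  \<open>green f y\<close> is \<open>green f z\<close> minus the occupation before leaving
  \<open>(y,\<infinity>)\<close>, and these exit times increase to the one for \<open>x\<close> as
  \<open>y\<close> decreases to \<open>x\<close>. The case \<open>x = 0\<close> is included and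
  supplies the boundary value of the Green function.\<close>

lemma green_right_tendsto:
 assumes x: "x < top" and [measurable]: "f \<in> borelm"
  and fin: "!!z. z < top ==> green f z < top"
 shows "(green f \<longlongrightarrow> green f x) (at_right x)"
proof -
 obtain z where z: "x < z" "z < top" using x dense by blast
 have gz: "good_start z" by (rule good_start_fin) fact
 note st = good_start_state[OF gz]
 show ?thesis
 proof (rule tendsto_at_right_sequentially[OF z(1)])
  fix S assume S: "!!n. x < S n" "!!n. S n < z" "decseq S" "S ----> x"
  let ?B = "%y. \<integral>\<^sup>+om. before f (exit_of X {y<..}) om \<partial>law X z"
  have em [measurable]: "exit_of X {y<..} \<in> borel_measurable (events X)" for y
   by (rule exit_measurable) (auto intro: compactly_exhausted_greaterThan)
  have mono: "exit_of X {S n<..} om <= exit_of X {S m<..} om" if "n <= m" for n m om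
   unfolding exit_of_def using decseqD[OF S(3) that] by (intro Inf_superset_mono) (auto simp: not_less intro: order_trans)
  have inc: "before f (exit_of X {S n<..}) om <= before f (exit_of X {S m<..}) om" if "n <= m" for n m om
   unfolding before_def using mono[OF that] by (intro nn_integral_mono) (auto simp: indicator_def intro: order_less_le_trans)
  have "AE om in law X z. (SUP n. before f (exit_of X {S n<..}) om) = before f (exit_of X {x<..}) om"
   using good_start_AE[OF gz]
  proof eventually_elim
   case (elim om)
   then have om: "om \<in> Om" by (simp add: good_def)
   have [measurable]: "(%t. val f (ennreal t) om) \<in> borelm"
    by (rule val_measurable) (use om in auto)
   have sup: "(SUP n. indicator {t. 0 <= t & ennreal t < exit_of X {S n<..} om} t) =
     (indicator {t. 0 <= t & ennreal t < exit_of X {x<..} om} t :: ennreal)" for t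
   proof (rule antisym)
    have "exit_of X {S n<..} om <= exit_of X {x<..} om" for n
     unfolding exit_of_def using S(1)[of n] by (intro Inf_superset_mono) (auto simp: not_less intro: order_trans less_imp_le)
    then show "(SUP n. indicator {t. 0 <= t & ennreal t < exit_of X {S n<..} om} t) \<le>
     (indicator {t. 0 <= t & ennreal t < exit_of X {x<..} om} t :: ennreal)"
     by (intro SUP_least) (auto simp: indicator_def intro: order_less_le_trans)
    show "(indicator {t. 0 <= t & ennreal t < exit_of X {x<..} om} t :: ennreal) \<le>
     (SUP n. indicator {t. 0 <= t & ennreal t < exit_of X {S n<..} om} t)"
    proof (cases "0 <= t & ennreal t < exit_of X {x<..} om")
     case True
     then have t: "ennreal t < life X om" "!!u. u <= ennreal t ==> x < pos X u om"
      using less_exit_iff[OF om, of "{x<..}" "ennreal t"] by auto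
     \<comment> \<open>The minimum of the path up to time \<open>t\<close> lies strictly above
       \<open>x\<close>, hence above some \<open>S n\<close>.\<close>
     have "compact ((%t. pos X t om) ` {0..ennreal t})"
      by (intro compact_continuous_image continuous_on_subset[OF pos_cont[OF om]] compact_eq_closed[THEN iffD2]) (use t in auto)
     then obtain u where u: "u <= ennreal t" "!!v. v <= ennreal t ==> pos X u om <= pos X v om"
      using compact_attains_inf[of "(%t. pos X t om) ` {0..ennreal t}"] by auto
     obtain n where "S n < pos X u om"
      using order_tendstoD(2)[OF S(4) t(2)[OF u(1)]] by (auto simp: eventually_sequentially)
     then have "ennreal t < exit_of X {S n<..} om"
      using less_exit_iff[OF om, of "{S n<..}" "ennreal t"] t(1) u(2) by (auto intro: order_less_le_trans)
     then show ?thesis using True by (intro SUP_upper2[of n]) auto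
    qed auto
   qed
   have "before f (exit_of X {x<..}) om = (\<integral>\<^sup>+t. (SUP n. val f (ennreal t) om * indicator {t. 0 <= t & ennreal t < exit_of X {S n<..} om} t) \<partial>lborel)"
    unfolding before_def by (simp add: sup SUP_mult_left_ennreal[symmetric])
   also have "... = (SUP n. before f (exit_of X {S n<..}) om)"
    unfolding before_def
    by (rule nn_integral_monotone_convergence_SUP) 
     (use mono in \<open>auto simp: incseq_def le_fun_def indicator_def intro: order_less_le_trans\<close>)
   finally show ?case by simp
  qed
  then have "?B x = (\<integral>\<^sup>+om. (SUP n. before f (exit_of X {S n<..}) om) \<partial>law X z)"
   by (intro nn_integral_cong_AE) auto
  also have "... = (SUP n. ?B (S n))"
   by (rule nn_integral_monotone_convergence_SUP) (use inc in \<open>auto simp: incseq_def le_fun_def law_measurable[OF st]\<close>)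
  finally have B: "?B x = (SUP n. ?B (S n))" .
  have "(%n. ?B (S n)) ----> ?B x"
   unfolding B by (rule LIMSEQ_SUP) (use inc in \<open>auto simp: incseq_def intro!: nn_integral_mono\<close>)
  moreover have "?B x ~= top"
   using exit_up_green[OF gz z(1), of f] fin[OF z(2)] by auto
  ultimately have "(%n. green f z - ?B (S n)) ----> green f z - ?B x"
   by (intro tendsto_diff_ennreal tendsto_const) (use fin[OF z(2)] in auto)
  moreover have "green f y = green f z - ?B y" if "y < z" for y
  proof -
   have e: "green f z = ?B y + green f y" by (rule exit_up_green[OF gz that]) simp
   have "?B y ~= top" using fin[OF z(2)] unfolding e by auto
   then show ?thesis unfolding e by simp
  qed
  ultimately show "(%n. green f (S n)) ----> green f x" using S(2) z(1) by simp
 qed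
qed

end

section \<open>Calculus of the operator d/dm d/ds\<close>

lemma at_left_nontrivial: "a < c ==> at_left c ~= bot" for a c :: "'a::{dense_order, linorder_topology}"
 by (auto simp: trivial_limit_def eventually_at_left dest: dense)

lemma at_right_nontrivial: "c < a ==> at_right c ~= bot" for a c :: "'a::{dense_order, linorder_topology}"
 by (auto simp: trivial_limit_def eventually_at_right dest: dense)

lemma pos: "x < z ==> 0 < z" for z :: ennreal
 by (rule order_le_less_trans[OF zero_le])

locale speed_scale =
 fixes I :: "ennreal set" and m :: "ennreal measure" and s :: "ennreal => real"
 assumes speed: "speed_measure I m" and scale: "scale_function s" and subset_I: "Rpos <= I"
begin

lemma sets_m [measurable_cong]: "sets m = sets borel"
 using speed by (simp add: speed_measure_def)

lemma space_m [simp]: "space m = UNIV"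
 using sets_eq_imp_space_eq[OF sets_m] by simp

lemma m_finite: "0 < x ==> y < top ==> emeasure m {x<..y} < top"
proof -
 assume xy: "0 < x" "y < top"
 have "compact {x..y}" by (simp add: compact_eq_closed)
 moreover have "{x..y} <= I - {0}"
 proof
  fix z assume "z \<in> {x..y}"
  then have "0 < z" "z < top" using xy by (auto intro: order_less_le_trans order_le_less_trans)
  then show "z \<in> I - {0}" using subset_I by auto
 qed
 ultimately have "emeasure m {x..y} < top" using speed by (auto simp: speed_measure_def)
 moreover have "emeasure m {x<..y} <= emeasure m {x..y}" by (rule emeasure_mono) (auto simp: sets_m)
 ultimately show ?thesis by (simp add: order_le_less_trans)
qed

lemma m_open_pos: "open U ==> U ~= {} ==> U <= Rpos ==> 0 < emeasure m U"
 using speed subset_I unfolding speed_measure_def by (metis Diff_empty Diff_insert0 greaterThanLessThan_iff less_irrefl order_trans subset_Diff_insert subset_iff)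

lemma s_less: "0 < x ==> x < y ==> y < top ==> s x < s y"
proof -
 assume "0 < x" "x < y" "y < top"
 then have "x \<in> Rpos" "y \<in> Rpos" by auto
 then show ?thesis using scale \<open>x < y\<close> by (auto simp: scale_function_def strict_mono_on_def)
qed

lemma s_le: "0 < x ==> x <= y ==> y < top ==> s x <= s y"
 using s_less[of x y] by (cases "x = y") (auto simp: less_le)

lemma s_cont: "continuous_on Rpos s"
 using scale by (simp add: scale_function_def)

lemma at_cont:
 assumes "continuous_on Rpos (u :: ennreal => 'b::topological_space)" "0 < x" "x < top"
 shows "(u \<longlongrightarrow> u x) (at x)"
 using continuous_on_interior[OF assms(1), of x] assms by (simp add: interior_open isCont_def)

lemma has_right_sderiv_lin:
 fixes u v :: "ennreal => real"
 assumes "has_right_sderiv s u D" "has_right_sderiv s v E"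
 shows "has_right_sderiv s (%x. a * u x + b * v x + c) (%x. a * D x + b * E x)"
 unfolding has_right_sderiv_def
proof
 fix x assume x: "x \<in> {0<..<top::ennreal}"
 have "((%y. a * ((u y - u x) /\<^sub>R (s y - s x)) + b * ((v y - v x) /\<^sub>R (s y - s x))) \<longlongrightarrow> a * D x + b * E x) (at_right x)"
  using assms x by (intro tendsto_intros) (auto simp: has_right_sderiv_def)
 then show "((%y. (a * u y + b * v y + c - (a * u x + b * v x + c)) /\<^sub>R (s y - s x)) \<longlongrightarrow> a * D x + b * E x) (at_right x)"
  by (simp add: algebra_simps)
qed

text \<open>A mean value inequality for right derivatives. With slack \<open>e\<close>, the bound
  holds on a maximal interval \<open>[a,c]\<close>: continuity carries it to the supremum
  \<open>c\<close>, and the right derivative at \<open>c\<close> would carry it beyond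
  \<open>c\<close> if \<open>c < b\<close>.\<close>

lemma right_sderiv_bound:
 fixes V :: "ennreal => real"
 assumes V: "continuous_on Rpos V" and D: "has_right_sderiv s V D"
  and ab: "0 < a" "a <= b" "b < top" and C: "!!x. a <= x ==> x < b ==> \<bar>D x\<bar> <= C"
 shows "\<bar>V b - V a\<bar> <= C * (s b - s a)"
proof -
 have *: "\<bar>V b - V a\<bar> <= (C + e) * (s b - s a)" if e: "0 < e" for e
 proof -
  define T where "T = {x. \<bar>V x - V a\<bar> <= (C + e) * (s x - s a)}"
  define E where "E = {x\<in>{a..b}. {a..x} <= T}"
  define c where "c = Sup E"
  have aE: "a \<in> E" using ab by (auto simp: E_def T_def)
  have ac: "a <= c" unfolding c_def by (rule Sup_upper[OF aE])
  have cb: "c <= b" unfolding c_def by (rule Sup_least) (auto simp: E_def)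
  have c0: "0 < c" "c < top" using ab ac cb by (auto intro: order_less_le_trans order_le_less_trans)
  have below: "y \<in> T" if "a <= y" "y < c" for y
  proof -
   have "\<exists>x\<in>E. y < x" using that unfolding c_def by (simp add: less_Sup_iff)
   then obtain x where "x \<in> E" "y < x" by auto
   then show ?thesis using that by (auto simp: E_def)
  qed
  have cT: "c \<in> T"
  proof (cases "c = a")
   case True then show ?thesis by (simp add: T_def)
  next
   case False
   then have "a < c" using ac by auto
   have nt: "at_left c ~= bot" using \<open>a < c\<close> by (rule at_left_nontrivial)
   have "(V \<longlongrightarrow> V c) (at_left c)" "(s \<longlongrightarrow> s c) (at_left c)"
    using at_cont[OF V c0] at_cont[OF s_cont c0] by (auto intro: tendsto_mono[OF at_le])
   then have "((%y. \<bar>V y - V a\<bar>) \<longlongrightarrow> \<bar>V c - V a\<bar>) (at_left c)" "((%y. (C + e) * (s y - s a)) \<longlongrightarrow> (C + e) * (s c - s a)) (at_left c)"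
    by (auto intro!: tendsto_intros)
   moreover have "\<forall>\<^sub>F y in at_left c. \<bar>V y - V a\<bar> <= (C + e) * (s y - s a)"
    unfolding eventually_at_left[OF \<open>a < c\<close>] using below \<open>a < c\<close> by (auto simp: T_def intro!: exI[of _ a])
   ultimately show ?thesis using tendsto_le[OF nt] by (simp add: T_def)
  qed
  have cE: "c \<in> E" using below cT ac cb unfolding E_def by (auto simp: order_le_less)
  have "c = b"
  proof (rule ccontr)
   assume "c ~= b"
   then have "c < b" using cb by auto
   have "((%y. \<bar>(V y - V c) /\<^sub>R (s y - s c)\<bar>) \<longlongrightarrow> \<bar>D c\<bar>) (at_right c)"
    using D c0 by (intro tendsto_intros) (auto simp: has_right_sderiv_def)
   then have "\<forall>\<^sub>F y in at_right c. \<bar>(V y - V c) /\<^sub>R (s y - s c)\<bar> < C + e"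
    by (rule order_tendstoD) (use C[OF ac \<open>c < b\<close>] e in auto)
   then obtain d where d: "c < d" "!!y. c < y ==> y < d ==> \<bar>(V y - V c) /\<^sub>R (s y - s c)\<bar> < C + e"
    using eventually_at_right[OF \<open>c < b\<close>] by auto
   obtain y where y: "c < y" "y < min d b" using dense[of c "min d b"] d(1) \<open>c < b\<close> by auto
   have yT: "z \<in> T" if z: "c < z" "z <= y" for z
   proof -
    have "z < top" "z < d" using z y ab by (auto intro: order_le_less_trans order_less_trans)
    then have sc: "s c < s z" using s_less[OF c0(1) z(1)] by simp
    have "\<bar>V z - V c\<bar> <= (C + e) * (s z - s c)"
     using d(2)[OF z(1) \<open>z < d\<close>] sc by (simp add: abs_mult divide_inverse[symmetric] mult.commute pos_divide_less_eq abs_of_pos)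
    moreover have "\<bar>V c - V a\<bar> <= (C + e) * (s c - s a)" using cT by (simp add: T_def)
    ultimately have "\<bar>V z - V a\<bar> <= (C + e) * (s z - s c) + (C + e) * (s c - s a)" by linarith
    then show ?thesis by (simp add: T_def algebra_simps)
   qed
   have "y \<in> E" unfolding E_def using y ac yT cE by (auto simp: E_def) (metis atLeastAtMost_iff leI subsetD)
   then have "y <= c" unfolding c_def by (rule Sup_upper)
   with y show False by simp
  qed
  then show ?thesis using cT by (simp add: T_def)
 qed
 show ?thesis
 proof (rule field_le_epsilon)
  fix e :: real assume "0 < e"
  have sp: "s b - s a \<ge> 0" using s_le[OF ab] by simp
  define e' where "e' = e / (s b - s a + 1)"
  have "\<bar>V b - V a\<bar> <= (C + e') * (s b - s a)" using *[of e'] sp \<open>0 < e\<close> by (simp add: e'_def)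
  also have "... = C * (s b - s a) + e' * (s b - s a)" by (simp add: algebra_simps)
  also have "e' * (s b - s a) <= e" using sp \<open>0 < e\<close> by (simp add: e'_def field_simps)
  finally show "\<bar>V b - V a\<bar> <= C * (s b - s a) + e" by simp
 qed
qed


lemma right_sderiv_unique:
 fixes u v :: "ennreal => real"
 assumes "continuous_on Rpos u" "continuous_on Rpos v" "has_right_sderiv s u D" "has_right_sderiv s v E"
  and "0 < a" "a <= b" "b < top" and "!!x. a <= x ==> x < b ==> D x = E x"
 shows "u b - u a = v b - v a"
proof -
 have "\<bar>(1 * u b + (-1) * v b + 0) - (1 * u a + (-1) * v a + 0)\<bar> <= 0 * (s b - s a)"
  by (rule right_sderiv_bound[OF _ has_right_sderiv_lin[OF assms(3,4)]]) (use assms in \<open>auto intro!: continuous_intros\<close>)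
 then show ?thesis by simp
qed

lemma dmds_lin:
 fixes u v :: "ennreal => real"
 assumes u: "dmds m s u D g" and v: "dmds m s v E h"
 shows "dmds m s (%x. a * u x + b * v x + c) (%x. a * D x + b * E x) (%x. a * g x + b * h x)"
 unfolding dmds_def
proof (intro conjI allI impI)
 show "has_right_sderiv s (%x. a * u x + b * v x + c) (%x. a * D x + b * E x)"
  using u v by (intro has_right_sderiv_lin) (auto simp: dmds_def)
 show "continuous_on Rpos (%x. a * u x + b * v x + c)"
  using u v by (auto simp: dmds_def intro!: continuous_intros)
 fix x y :: ennreal assume xy: "0 < x" "x <= y" "y < top"
 have i: "set_integrable m {x<..y} g" "set_integrable m {x<..y} h"
  and e: "D y - D x = (LINT z:{x<..y}|m. g z)" "E y - E x = (LINT z:{x<..y}|m. h z)"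
  using u v xy by (auto simp: dmds_def)
 then have i': "set_integrable m {x<..y} (%z. a * g z)" "set_integrable m {x<..y} (%z. b * h z)" by auto
 then show "set_integrable m {x<..y} (%x. a * g x + b * h x)" by (rule set_integral_add)
 have "(LINT z:{x<..y}|m. a * g z + b * h z) = a * (D y - D x) + b * (E y - E x)"
  unfolding e by (subst set_integral_add(2)[OF i']) simp
 then show "a * D y + b * E y - (a * D x + b * E x) = (LINT z:{x<..y}|m. a * g z + b * h z)" by (simp add: algebra_simps)
qed

lemma dmds_s: "dmds m s s (%_. 1) (%_. 0)"
proof -
 have "((%y. (s y - s x) /\<^sub>R (s y - s x)) \<longlongrightarrow> 1) (at_right x)" if x: "x \<in> Rpos" for x
 proof (rule tendsto_eventually)
  have "x < top" using x by auto
  show "\<forall>\<^sub>F y in at_right x. (s y - s x) /\<^sub>R (s y - s x) = 1"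
   unfolding eventually_at_right[OF \<open>x < top\<close>]
  proof (intro exI[of _ top] conjI allI impI)
   fix y assume "x < y" "y < top"
   then have "s x < s y" using x by (intro s_less) auto
   then show "(s y - s x) /\<^sub>R (s y - s x) = 1" by simp
  qed (use x in auto)
 qed
 then show ?thesis by (simp add: dmds_def has_right_sderiv_def s_cont set_integrable_def set_lebesgue_integral_def)
qed

definition primitive :: "(ennreal => real) => ennreal => real" where
 "primitive g x = (LINT z:{0<..x}|m. g z)"

text \<open>The integral of \<open>primitive g\<close> with respect to \<open>ds\<close> from 0 to
  \<open>x\<close>, with the order of integration exchanged; no integration against \<open>s\<close>
  is required in this form.\<close>

definition primitive2 :: "(ennreal => real) => ennreal => real" where
 "primitive2 g x = (LINT z:{0<..x}|m. (s x - s z) * g z)"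

text \<open>Integrability of \<open>g\<close> alone does not suffice at this stage, because
  \<open>s\<close> may still be unbounded near 0.\<close>

definition loc_int :: "(ennreal => real) => bool" where
 "loc_int g \<longleftrightarrow> (\<forall>x<top. set_integrable m {0<..x} g & set_integrable m {0<..x} (%z. s z * g z))"

lemma loc_intD: 
 assumes "loc_int g" "y < top" "A \<in> sets borel" "A <= {0<..y}"
 shows "set_integrable m A g" "set_integrable m A (%z. s z * g z)" "set_integrable m A (%z. (c - s z) * g z)"
proof -
 show 1: "set_integrable m A g"
  by (rule set_integrable_subset[of _ "{0<..y}"]) (use assms in \<open>auto simp: loc_int_def sets_m\<close>)
 show 2: "set_integrable m A (%z. s z * g z)"
  by (rule set_integrable_subset[of _ "{0<..y}"]) (use assms in \<open>auto simp: loc_int_def sets_m\<close>)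
 have "set_integrable m A (%z. c * g z - s z * g z)"
  using 1 2 by (intro set_integral_diff(1)) auto
 then show "set_integrable m A (%z. (c - s z) * g z)" by (simp add: left_diff_distrib)
qed

lemma Ioc_split: "x <= y ==> {0<..y} = {0<..x} \<union> {x<..y}" "{0<..x} \<inter> {x<..y} = {}" for x y :: ennreal
 by (auto intro: pos order_trans)

lemma primitive_diff:
 assumes g: "loc_int g" and xy: "x <= y" "y < top"
 shows "primitive g y - primitive g x = (LINT z:{x<..y}|m. g z)"
proof -
 have "{x<..y} <= {0<..y}" "{0<..x} <= {0<..y}" using xy by (auto intro: pos)
 then have "(LINT z:{0<..x} \<union> {x<..y}|m. g z) = (LINT z:{0<..x}|m. g z) + (LINT z:{x<..y}|m. g z)"
  using loc_intD[OF g xy(2)] by (intro set_integral_Un) auto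
 then show ?thesis using Ioc_split(1)[OF xy(1)] by (simp add: primitive_def)
qed

lemma primitive2_diff:
 assumes g: "loc_int g" and xy: "x <= y" "y < top"
 shows "primitive2 g y - primitive2 g x = (s y - s x) * primitive g x + (LINT z:{x<..y}|m. (s y - s z) * g z)"
proof -
 have sub: "{x<..y} <= {0<..y}" "{0<..x} <= {0<..y}" using xy by (auto intro: pos)
 note D = loc_intD[OF g xy(2)]
 have "(LINT z:{0<..x} \<union> {x<..y}|m. (s y - s z) * g z) = (LINT z:{0<..x}|m. (s y - s z) * g z) + (LINT z:{x<..y}|m. (s y - s z) * g z)"
  using D(3) sub by (intro set_integral_Un) auto
 moreover have "(LINT z:{0<..x}|m. (s y - s z) * g z) - (LINT z:{0<..x}|m. (s x - s z) * g z) = (LINT z:{0<..x}|m. (s y - s x) * g z)"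
 proof -
  have "(LINT z:{0<..x}|m. (s y - s z) * g z) - (LINT z:{0<..x}|m. (s x - s z) * g z) = (LINT z:{0<..x}|m. (s y - s z) * g z - (s x - s z) * g z)"
   using D(3) sub by (intro set_integral_diff(2)[symmetric]) auto
  then show ?thesis by (simp add: left_diff_distrib)
 qed
 ultimately show ?thesis using Ioc_split(1)[OF xy(1)] by (simp add: primitive2_def primitive_def)
qed

lemma tail_integral_bound:
 assumes g: "loc_int g" and xy: "0 < x" "x <= y" "y < top"
 shows "\<bar>LINT z:{x<..y}|m. (s y - s z) * g z\<bar> <= (s y - s x) * (LINT z:{x<..y}|m. \<bar>g z\<bar>)"
proof -
 have "{x<..y} <= {0<..y}" using xy by (auto intro: pos)
 note D = loc_intD[OF g xy(3) _ this]
 have "\<bar>LINT z:{x<..y}|m. (s y - s z) * g z\<bar> <= (LINT z:{x<..y}|m. \<bar>(s y - s z) * g z\<bar>)"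
  using set_integral_norm_bound[OF D(3), of "s y"] by simp
 also have "... <= (LINT z:{x<..y}|m. (s y - s x) * \<bar>g z\<bar>)"
 proof (rule set_integral_mono)
  fix z assume z: "z \<in> {x<..y}"
  then have "s x <= s z" "s z <= s y" using xy by (auto intro!: s_le intro: order_less_trans order_le_less_trans)
  then show "\<bar>(s y - s z) * g z\<bar> <= (s y - s x) * \<bar>g z\<bar>" by (auto simp: abs_mult intro!: mult_right_mono)
 qed (use set_integrable_abs[OF D(3), of "s y"] set_integrable_abs[OF D(1)] in auto)
 finally show ?thesis by simp
qed

lemma Ioc_integral_tendsto_0:
 assumes g: "!!y. y < top ==> set_integrable m {0<..y} (g :: ennreal => real)" and x: "x < top"
 shows "((%y. LINT z:{x<..y}|m. g z) \<longlongrightarrow> 0) (at_right x)"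
proof -
 obtain b where b: "x < b" "b < top" using x dense by blast
 show ?thesis
 proof (rule tendsto_at_right_sequentially[OF b(1)])
  fix S assume S: "!!n. x < S n" "!!n. S n < b" "decseq S" "S ----> x"
  have sub: "{x<..b} <= {0<..b}" by (auto intro: pos)
  have i: "set_integrable m {x<..b} g" by (rule set_integrable_subset[OF g[OF b(2)]]) (use sub in \<open>auto simp: sets_m\<close>)
  have "(%n. \<integral>z. indicat_real {x<..S n} z *\<^sub>R g z \<partial>m) ----> (\<integral>z. 0 \<partial>m)"
  proof (rule integral_dominated_convergence[where w="%z. \<bar>indicat_real {x<..b} z *\<^sub>R g z\<bar>"])
   show "integrable m (%z. \<bar>indicat_real {x<..b} z *\<^sub>R g z\<bar>)"
    using i by (intro integrable_abs) (simp add: set_integrable_def)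
   show "AE z in m. (%n. indicat_real {x<..S n} z *\<^sub>R g z) ----> 0"
   proof (rule AE_I2, rule tendsto_eventually)
    fix z show "\<forall>\<^sub>F n in sequentially. indicat_real {x<..S n} z *\<^sub>R g z = 0"
    proof (cases "x < z")
     case True
     from order_tendstoD(2)[OF S(4) True] show ?thesis by eventually_elim (auto simp: indicator_def)
    qed auto
   qed
   show "AE z in m. norm (indicat_real {x<..S n} z *\<^sub>R g z) <= \<bar>indicat_real {x<..b} z *\<^sub>R g z\<bar>" for n
    using S(2)[of n] by (intro AE_I2) (auto simp: indicator_def)
   show "(%z. indicat_real {x<..S n} z *\<^sub>R g z) \<in> borel_measurable m" for n
   proof -
    have "set_integrable m {x<..S n} g"
     by (rule set_integrable_subset[OF i]) (use S(2)[of n] in \<open>auto simp: sets_m\<close>)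
    then show ?thesis by (simp add: set_integrable_def borel_measurable_integrable)
   qed
  qed simp
  then show "(%n. LINT z:{x<..S n}|m. g z) ----> 0" by (simp add: set_lebesgue_integral_def)
 qed
qed

lemma primitive2_lipschitz:
 assumes g: "loc_int g" and xy: "0 < x" "x <= y" "y <= b" "b < top"
 shows "\<bar>primitive2 g y - primitive2 g x\<bar> <= (s y - s x) * (LINT z:{0<..b}|m. \<bar>g z\<bar>)"
proof -
 have y: "y < top" using xy by order
 have sub: "{x<..y} <= {0<..b}" "{0<..x} <= {0<..b}" "{0<..y} <= {0<..b}" using xy by (auto intro: pos order_trans)
 note D = set_integrable_abs[OF loc_intD(1)[OF g xy(4)]]
 have s: "0 <= s y - s x" using s_le[OF xy(1,2) y] by simp
 have 1: "(LINT z:{0<..y}|m. \<bar>g z\<bar>) = (LINT z:{0<..x}|m. \<bar>g z\<bar>) + (LINT z:{x<..y}|m. \<bar>g z\<bar>)"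
  unfolding Ioc_split(1)[OF xy(2)] using D sub by (intro set_integral_Un) auto
 have sub': "{y<..b} <= {0<..b}" using pos by auto
 have "(LINT z:{0<..b}|m. \<bar>g z\<bar>) = (LINT z:{0<..y}|m. \<bar>g z\<bar>) + (LINT z:{y<..b}|m. \<bar>g z\<bar>)"
  unfolding Ioc_split(1)[OF xy(3)] using D sub sub' by (intro set_integral_Un) auto
 moreover have "0 <= (LINT z:{y<..b}|m. \<bar>g z\<bar>)"
  unfolding set_lebesgue_integral_def by (rule integral_nonneg_AE) (auto simp: indicator_def)
 ultimately have 2: "(LINT z:{0<..y}|m. \<bar>g z\<bar>) <= (LINT z:{0<..b}|m. \<bar>g z\<bar>)" by linarith
 have 3: "\<bar>primitive g x\<bar> <= (LINT z:{0<..x}|m. \<bar>g z\<bar>)"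
  unfolding primitive_def using set_integral_norm_bound[OF loc_intD(1)[OF g xy(4) _ sub(2)]] by simp
 have "\<bar>primitive2 g y - primitive2 g x\<bar> <= \<bar>(s y - s x) * primitive g x\<bar> + (s y - s x) * (LINT z:{x<..y}|m. \<bar>g z\<bar>)"
  unfolding primitive2_diff[OF g xy(2) y] using tail_integral_bound[OF g xy(1,2) y] by linarith
 also have "... = (s y - s x) * (\<bar>primitive g x\<bar> + (LINT z:{x<..y}|m. \<bar>g z\<bar>))" using s by (simp add: abs_mult distrib_left)
 also have "... <= (s y - s x) * (LINT z:{0<..b}|m. \<bar>g z\<bar>)" using 1 2 3 s by (intro mult_left_mono) auto
 finally show ?thesis .
qed

text \<open>The difference quotient at \<open>x\<close> deviates from \<open>primitive g x\<close>
  by at most the integral of \<open>\<bar>g\<bar>\<close> over \<open>(x,y]\<close>. This vanishes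
  as \<open>y\<close> decreases to \<open>x\<close>, even if \<open>m\<close> has an atom at
  \<open>x\<close>.\<close>

lemma dmds_primitive2:
 assumes g: "loc_int g"
 shows "dmds m s (primitive2 g) (primitive g) g"
 unfolding dmds_def
proof (intro conjI allI impI)
 fix x y :: ennreal assume xy: "0 < x" "x <= y" "y < top"
 have "{x<..y} <= {0<..y}" by (auto intro: pos)
 then show "set_integrable m {x<..y} g" using loc_intD(1)[OF g xy(3)] by auto
 show "primitive g y - primitive g x = (LINT z:{x<..y}|m. g z)" by (rule primitive_diff[OF g xy(2,3)])
next
 show "has_right_sderiv s (primitive2 g) (primitive g)"
  unfolding has_right_sderiv_def
 proof
  fix x :: ennreal assume "x \<in> Rpos"
  then have x: "0 < x" "x < top" by auto
  let ?q = "%y. (primitive2 g y - primitive2 g x) /\<^sub>R (s y - s x)"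
  have "((%y. ?q y - primitive g x) \<longlongrightarrow> 0) (at_right x)"
  proof (rule Lim_null_comparison)
   show "((%y. LINT z:{x<..y}|m. \<bar>g z\<bar>) \<longlongrightarrow> 0) (at_right x)"
    using g x by (intro Ioc_integral_tendsto_0 set_integrable_abs) (auto simp: loc_int_def)
   show "\<forall>\<^sub>F y in at_right x. norm (?q y - primitive g x) <= (LINT z:{x<..y}|m. \<bar>g z\<bar>)"
    unfolding eventually_at_right[OF x(2)]
   proof (intro exI[of _ top] conjI allI impI)
    fix y assume y: "x < y" "y < top"
    have s: "0 < s y - s x" using s_less[OF x(1) y] by simp
    have "?q y - primitive g x = (LINT z:{x<..y}|m. (s y - s z) * g z) / (s y - s x)"
     using s primitive2_diff[OF g less_imp_le[OF y(1)] y(2)] by (simp add: field_simps)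
    then show "norm (?q y - primitive g x) <= (LINT z:{x<..y}|m. \<bar>g z\<bar>)"
     using tail_integral_bound[OF g x(1) less_imp_le[OF y(1)] y(2)] s by (simp add: abs_of_pos pos_divide_le_eq mult.commute)
   qed (use x in auto)
  qed
  then show "(?q \<longlongrightarrow> primitive g x) (at_right x)" by (rule LIM_zero_cancel)
 qed
next
 show "continuous_on Rpos (primitive2 g)"
 proof (rule continuous_at_imp_continuous_on, rule ballI)
  fix x :: ennreal assume "x \<in> Rpos"
  then have x: "0 < x" "x < top" by auto
  obtain b where b: "x < b" "b < top" using x dense by blast
  define L where "L = (LINT z:{0<..b}|m. \<bar>g z\<bar>)"
  have "((%y. primitive2 g y - primitive2 g x) \<longlongrightarrow> 0) (at x)"
  proof (rule Lim_null_comparison)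
   have "((%y. \<bar>s y - s x\<bar> * L) \<longlongrightarrow> \<bar>s x - s x\<bar> * L) (at x)"
    by (intro tendsto_intros at_cont[OF s_cont x])
   then show "((%y. \<bar>s y - s x\<bar> * L) \<longlongrightarrow> 0) (at x)" by simp
   have "\<forall>\<^sub>F y in at x. y \<in> {0<..<b}"
    using b x by (intro eventually_at_in_open') auto
   then show "\<forall>\<^sub>F y in at x. norm (primitive2 g y - primitive2 g x) <= \<bar>s y - s x\<bar> * L"
   proof eventually_elim
    case (elim y)
    show ?case
    proof (cases "x <= y")
     case True
     then have "s x <= s y" using x elim b by (intro s_le) auto
     then show ?thesis using primitive2_lipschitz[OF g x(1) True, of b] elim b by (auto simp: L_def less_imp_le)
    next
     case False
     then have yx: "y <= x" by simp
     then have "s y <= s x" using x elim b by (intro s_le) auto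
     then show ?thesis using primitive2_lipschitz[OF g _ yx, of b] elim b
      by (auto simp: L_def less_imp_le abs_minus_commute)
    qed
   qed
  qed
  then show "isCont (primitive2 g) x" unfolding isCont_def by (rule LIM_zero_cancel)
 qed
qed

end

lemma enn2real_tendsto: "x < top ==> (enn2real \<longlongrightarrow> enn2real x) (at x)"
 by (rule tendsto_enn2real) (auto simp: less_top[symmetric])

lemma continuous_on_enn2real: "continuous_on Rpos enn2real"
 unfolding continuous_on_def by (auto intro: tendsto_mono[OF at_le enn2real_tendsto])

lemma borel_measurable_continuous_Ioo:
 fixes u :: "ennreal => real"
 assumes "continuous_on Rpos u"
 shows "u \<in> borelm"
proof -
 have [measurable]: "(%x. indicator Rpos x *\<^sub>R u x) \<in> borelm"
  by (rule borel_measurable_continuous_on_indicator[OF _ assms]) auto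
 have "u x = indicator Rpos x *\<^sub>R u x + (if x = 0 then u 0 else 0) + (if x = top then u top else 0)" for x
  by (auto simp: indicator_def less_top[symmetric] zero_less_iff_neq_zero)
 then have "u = (%x. indicator Rpos x *\<^sub>R u x + (if x = 0 then u 0 else 0) + (if x = top then u top else 0))" by auto
 also have "... \<in> borelm" by measurable
 finally show ?thesis .
qed

context speed_scale
begin

lemma loc_intI:
 assumes [measurable]: "g \<in> borelm" and B: "!!z. \<bar>g z\<bar> <= B" and e: "0 < e" "!!z. z <= e ==> g z = 0"
 shows "loc_int g"
 unfolding loc_int_def
proof (intro allI impI)
 fix x :: ennreal assume x: "x < top"
 have [measurable]: "s \<in> borelm" by (rule borel_measurable_continuous_Ioo[OF s_cont])
 have fin: "integrable m (indicat_real {e<..x})"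
  using m_finite[OF e(1) x] by (intro integrable_real_indicator) (auto simp: sets_m)
 have B0: "0 <= B" using B[of 0] by linarith
 have "set_integrable m {0<..x} g"
  unfolding set_integrable_def
 proof (rule Bochner_Integration.integrable_bound[OF integrable_mult_right[OF fin, of B]])
  show "AE z in m. norm (indicat_real {0<..x} z *\<^sub>R g z) <= norm (B * indicat_real {e<..x} z)"
  proof (rule AE_I2)
   fix z show "norm (indicat_real {0<..x} z *\<^sub>R g z) <= norm (B * indicat_real {e<..x} z)"
    using B[of z] e(2)[of z] B0 by (cases "z <= e") (auto simp: indicator_def)
  qed
 qed measurable
 moreover have "set_integrable m {0<..x} (%z. s z * g z)"
  unfolding set_integrable_def
 proof (rule Bochner_Integration.integrable_bound[OF integrable_mult_right[OF fin, of "(\<bar>s e\<bar> + \<bar>s x\<bar>) * B"]])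
  show "AE z in m. norm (indicat_real {0<..x} z *\<^sub>R (s z * g z)) <= norm ((\<bar>s e\<bar> + \<bar>s x\<bar>) * B * indicat_real {e<..x} z)"
  proof (rule AE_I2)
   fix z show "norm (indicat_real {0<..x} z *\<^sub>R (s z * g z)) <= norm ((\<bar>s e\<bar> + \<bar>s x\<bar>) * B * indicat_real {e<..x} z)"
   proof (cases "z <= e \<or> \<not> z <= x")
    case False
    then have "s e <= s z" "s z <= s x" using e x by (auto intro!: s_le intro: order_le_less_trans order_less_trans)
    then have "\<bar>s z\<bar> <= \<bar>s e\<bar> + \<bar>s x\<bar>" by linarith
    then have "\<bar>s z\<bar> * \<bar>g z\<bar> <= (\<bar>s e\<bar> + \<bar>s x\<bar>) * B" using B[of z] by (intro mult_mono) auto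
    then show ?thesis using False B0 by (auto simp: indicator_def abs_mult)
   qed (use e(2)[of z] in \<open>auto simp: indicator_def\<close>)
  qed
 qed measurable
 ultimately show "set_integrable m {0<..x} g & set_integrable m {0<..x} (%z. s z * g z)" by simp
qed

text \<open>A local test function whose generator is 1 at \<open>x\<close>. Value and right
  derivative vanish at \<open>x\<close>, so that to the right of \<open>x\<close> it is of smaller
  order than \<open>s b - s x\<close>.\<close>

lemma unit_generator_solution:
 assumes x: "0 < x" "x < top"
 shows "\<exists>g u D. continuous_on Rpos g & dmds m s u D g & g x = 1 & u x = 0 &
  (\<forall>\<^sub>F b in at_right x. u b <= s b - s x)"
proof -
 obtain e where e: "0 < e" "e < x" using x dense by blast
 \<comment> \<open>A ramp from 0 at \<open>e\<close> to 1 at \<open>x\<close>; it vanishes near 0,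
   where integrability is not yet known.\<close>
 define g :: "ennreal => real" where "g z = (if z = top then 0 else min 1 (max 0 ((enn2real z - enn2real e) / (enn2real x - enn2real e))))" for z
 have ex: "enn2real e < enn2real x" using e x by (subst enn2real_less_iff) auto
 have g01: "0 <= g z" "g z <= 1" for z by (auto simp: g_def)
 have cont: "continuous_on Rpos g"
 proof (subst continuous_on_cong[OF refl])
  show "continuous_on Rpos (%z. min 1 (max 0 ((enn2real z - enn2real e) / (enn2real x - enn2real e))))"
   using ex by (intro continuous_intros continuous_on_enn2real) auto
 qed (auto simp: g_def)
 have g0: "g z = 0" if "z <= e" for z
 proof -
  have "enn2real z <= enn2real e" using that e x by (intro enn2real_mono) (auto intro: order_less_trans)
  then have "(enn2real z - enn2real e) / (enn2real x - enn2real e) <= 0" using ex by (simp add: divide_nonpos_pos)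
  then show ?thesis by (auto simp: g_def)
 qed
 have li: "loc_int g"
  by (rule loc_intI[of g 1 e]) (use g01 g0 e borel_measurable_continuous_Ioo[OF cont] in auto)
 \<comment> \<open>The multiple of \<open>s\<close> removes the right derivative at
   \<open>x\<close>, the constant removes the value.\<close>
 define u where "u z = 1 * primitive2 g z + (- primitive g x) * s z + (primitive g x * s x - primitive2 g x)" for z
 have "dmds m s u (%z. 1 * primitive g z + (- primitive g x) * 1) (%z. 1 * g z + (- primitive g x) * 0)"
  unfolding u_def[abs_def] by (rule dmds_lin[OF dmds_primitive2[OF li] dmds_s])
 then have d: "dmds m s u (%z. primitive g z + (- primitive g x)) g" by simp
 have "g x = 1" using ex x by (simp add: g_def)
 have ux: "u x = 0" by (simp add: u_def)
 have ii: "set_integrable m {0<..y} (%z. \<bar>g z\<bar>)" if "y < top" for y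
  using li that by (intro set_integrable_abs) (auto simp: loc_int_def)
 have "\<forall>\<^sub>F b in at_right x. (LINT z:{x<..b}|m. \<bar>g z\<bar>) < 1"
  by (rule order_tendstoD(2)[OF Ioc_integral_tendsto_0[OF ii x(2)]]) simp_all
 moreover have "\<forall>\<^sub>F b in at_right x. x < b & b < top"
  unfolding eventually_at_right[OF x(2)] using x by auto
 ultimately have "\<forall>\<^sub>F b in at_right x. u b <= s b - s x"
 proof eventually_elim
  case (elim b)
  have ub: "u b = I" if "primitive2 g b - primitive2 g x = (s b - s x) * primitive g x + I" for I
   using that by (simp add: u_def algebra_simps)
  have "u b = (LINT z:{x<..b}|m. (s b - s z) * g z)"
   by (rule ub, rule primitive2_diff[OF li]) (use elim in auto)
  also have "... <= (s b - s x) * (LINT z:{x<..b}|m. \<bar>g z\<bar>)"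
   using tail_integral_bound[OF li x(1) less_imp_le, of b] elim by simp
  also have "... <= (s b - s x) * 1"
   using elim s_less[OF x(1), of b] by (intro mult_left_mono) auto
  finally show ?case by simp
 qed
 then show ?thesis using cont d \<open>g x = 1\<close> ux by blast
qed

end

section \<open>Dynkin's generator and exits from short intervals\<close>

locale dmds_process = killed_process X for X :: "'w process" +
 fixes m :: "ennreal measure" and s :: "ennreal => real"
 assumes dmds_diffusion: "dmds_diffusion m s X"

sublocale dmds_process \<subseteq> speed_scale "state X" m s
proof
 show "Rpos <= state X" using fin_in_state by auto
qed (use dmds_diffusion in \<open>auto simp: dmds_diffusion_def\<close>)

context dmds_process
begin

definition up_prob :: "ennreal => ennreal => ennreal => real" where
 "up_prob x a b = measure (law X x) {w\<in>Om. path (exit_of X {a<..<b} w) w = b}"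

definition mean_exit :: "ennreal => ennreal => ennreal => ennreal" where
 "mean_exit x a b = (\<integral>\<^sup>+w. exit_of X {a<..<b} w \<partial>law X x)"

lemma up_prob_bounds:
 assumes "a < x" "x < b" "b < top"
 shows "0 <= up_prob x a b" "up_prob x a b <= 1"
  "emeasure (law X x) {w\<in>Om. path (exit_of X {a<..<b} w) w = b} = ennreal (up_prob x a b)"
  "emeasure (law X x) {w\<in>Om. path (exit_of X {a<..<b} w) w = a} = ennreal (1 - up_prob x a b)"
proof -
 have "x < top" using assms by order
 then interpret L: prob_space "law X x" by (intro law_prob fin_in_state)
 show "0 <= up_prob x a b" "up_prob x a b <= 1" by (auto simp: up_prob_def)
 then show e: "emeasure (law X x) {w\<in>Om. path (exit_of X {a<..<b} w) w = b} = ennreal (up_prob x a b)"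
  by (simp add: up_prob_def L.emeasure_eq_measure)
 have "emeasure (law X x) {w\<in>Om. path (exit_of X {a<..<b} w) w = b} + emeasure (law X x) {w\<in>Om. path (exit_of X {a<..<b} w) w = a} = 1"
  by (rule exit_interval_green(2)[OF assms, of "%_. 0"]) simp
 then have "measure (law X x) {w\<in>Om. path (exit_of X {a<..<b} w) w = b} + measure (law X x) {w\<in>Om. path (exit_of X {a<..<b} w) w = a} = 1"
  by (simp add: L.emeasure_eq_measure flip: ennreal_plus)
 then show "emeasure (law X x) {w\<in>Om. path (exit_of X {a<..<b} w) w = a} = ennreal (1 - up_prob x a b)"
  by (simp add: up_prob_def L.emeasure_eq_measure)
qed

lemma exit_expectation:
 assumes x: "a < x" "x < b" "b < top" and [measurable]: "u \<in> borelm"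
 shows "(LINT w:{w\<in>Om. exit_time X a b w < life X w}|law X x. u (pos X (exit_time X a b w) w)) =
  up_prob x a b * u b + (1 - up_prob x a b) * u a"
proof -
 let ?ta = "exit_of X {a<..<b}"
 have xt: "x < top" using x by order
 note st = fin_in_state[OF xt]
 interpret L: prob_space "law X x" by (rule law_prob[OF st])
 have [measurable]: "?ta \<in> borel_measurable (events X)"
  by (rule exit_measurable) (auto intro: compactly_exhausted_greaterThanLessThan)
 have [measurable]: "(%w. path (?ta w) w) \<in> borel_measurable (events X)"
  using stopped_path_measurable[of ?ta] by (simp add: measurable_restrict_space2_iff)
 have ms: "{w\<in>Om. path (?ta w) w = c} \<in> sets (law X x)" for c
  unfolding sets_law[OF st] by measurable
 have ab: "a ~= b" using x by auto
 have "(LINT w:{w\<in>Om. exit_time X a b w < life X w}|law X x. u (pos X (exit_time X a b w) w))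
  = (\<integral>w. indicat_real {w\<in>Om. ?ta w < life X w} w * u (path (?ta w) w) \<partial>law X x)"
  unfolding set_lebesgue_integral_def exit_time_eq_exit_of
  by (rule Bochner_Integration.integral_cong) (auto simp: indicator_def path_def)
 also have "... = (\<integral>w. u b * indicat_real {w\<in>Om. path (?ta w) w = b} w + u a * indicat_real {w\<in>Om. path (?ta w) w = a} w \<partial>law X x)"
 proof (rule integral_cong_AE)
  show "AE w in law X x. indicat_real {w\<in>Om. ?ta w < life X w} w * u (path (?ta w) w) =
   u b * indicat_real {w\<in>Om. path (?ta w) w = b} w + u a * indicat_real {w\<in>Om. path (?ta w) w = a} w"
   using exit_interval_green(4)[OF x borel_measurable_const[of 0]] AE_start[OF st]
   by eventually_elim (use ab in \<open>auto simp: indicator_def\<close>)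
 qed (use ms in \<open>auto simp: law_measurable[OF st]\<close>)
 also have "... = u b * up_prob x a b + u a * measure (law X x) {w\<in>Om. path (?ta w) w = a}"
  using ms by (subst Bochner_Integration.integral_add) (auto simp: up_prob_def L.emeasure_eq_measure intro!: integrable_real_indicator)
 also have "measure (law X x) {w\<in>Om. path (?ta w) w = a} = 1 - up_prob x a b"
  using up_prob_bounds[OF x] by (simp add: measure_def)
 finally show ?thesis by (simp add: mult.commute)
qed

text \<open>A path leaves a short interval through one of its endpoints, so Dynkin's quotient
  depends only on \<open>up_prob\<close> and \<open>mean_exit\<close>.\<close>

lemma generator_iff:
 assumes x: "0 < x" "x < top" and u: "u \<in> borelm"
 shows "has_local_generator X u x l \<longleftrightarrow>
  ((%(a, b). (up_prob x a b * u b + (1 - up_prob x a b) * u a - u x) / enn2real (mean_exit x a b)) \<longlongrightarrow> l)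
   (at_left x \<times>\<^sub>F at_right x)"
 unfolding has_local_generator_def
proof (rule tendsto_cong)
 have "\<forall>\<^sub>F a in at_left x. a < x" unfolding eventually_at_left[OF x(1)] using x by auto
 moreover have "\<forall>\<^sub>F b in at_right x. x < b & b < top" unfolding eventually_at_right[OF x(2)] using x by auto
 ultimately have "\<forall>\<^sub>F p in at_left x \<times>\<^sub>F at_right x. fst p < x & x < snd p & snd p < top"
  unfolding eventually_prod_filter by fastforce
 then show "\<forall>\<^sub>F p in at_left x \<times>\<^sub>F at_right x.
  (case p of (a, b) => ((LINT w:{w \<in> Om. exit_time X a b w < life X w}|law X x. u (pos X (exit_time X a b w) w)) - u x) /
     enn2real (\<integral>\<^sup>+ w. exit_time X a b w \<partial>law X x)) =
  (case p of (a, b) => (up_prob x a b * u b + (1 - up_prob x a b) * u a - u x) / enn2real (mean_exit x a b))"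
  by eventually_elim (auto simp: exit_expectation[OF _ _ _ u, unfolded exit_time_eq_exit_of] mean_exit_def exit_time_eq_exit_of)
qed

lemma dmds_generator:
 assumes x: "0 < x" "x < top" and d: "dmds m s u D g" and g: "continuous_on Rpos g"
 shows "((%(a, b). (up_prob x a b * u b + (1 - up_prob x a b) * u a - u x) / enn2real (mean_exit x a b)) \<longlongrightarrow> g x)
   (at_left x \<times>\<^sub>F at_right x)"
proof -
 have u: "continuous_on Rpos u" using d by (simp add: dmds_def)
 have "has_local_generator X u x (g x)"
  using dmds_diffusion d g u x unfolding dmds_diffusion_def by (metis greaterThanLessThan_iff)
 then show ?thesis using generator_iff[OF x borel_measurable_continuous_Ioo[OF u]] by simp
qed

text \<open>An infinite mean is sent to 0 by \<open>enn2real\<close>, and division by 0 gives 0. A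
  function whose generator is 1 at \<open>x\<close> excludes both degenerate cases, so the mean exit
  time is eventually positive and finite.\<close>

lemma mean_exit_pos:
 assumes x: "0 < x" "x < top"
 shows "\<forall>\<^sub>F p in at_left x \<times>\<^sub>F at_right x. 0 < enn2real (mean_exit x (fst p) (snd p))"
proof -
 obtain g u D where g: "continuous_on Rpos g" "dmds m s u D g" "g x = 1"
   "u x = 0" "\<forall>\<^sub>F b in at_right x. u b <= s b - s x"
  using unit_generator_solution[OF x] by (elim exE conjE) (rule that; assumption)
 have "\<forall>\<^sub>F p in at_left x \<times>\<^sub>F at_right x. 0 < (case p of (a, b) => (up_prob x a b * u b + (1 - up_prob x a b) * u a - u x) / enn2real (mean_exit x a b))"
  by (rule order_tendstoD(1)[OF dmds_generator[OF x g(2,1)]]) (simp add: g)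
 then show ?thesis
 proof eventually_elim
  case (elim p)
  then have "enn2real (mean_exit x (fst p) (snd p)) ~= 0" by (auto simp: case_prod_beta)
  then show ?case using enn2real_nonneg[of "mean_exit x (fst p) (snd p)"] by linarith
 qed
qed

text \<open>Regularity of \<open>x\<close> for the left half-line: with \<open>b\<close> fixed and \<open>a \<up> x\<close>, the generator applied
 to \<open>s\<close> bounds the probability of exit at \<open>b\<close> by \<open>s x - s a\<close> plus a quarter of the mean exit time, and
 applied to a solution of \<open>d/dm d/ds u = 1\<close> near \<open>x\<close> it bounds the mean exit time by the former.\<close>

lemma left_exit:
 assumes x: "0 < x" "x < top"
 obtains b where "x < b" "b < top" "((%a. up_prob x a b) \<longlongrightarrow> 0) (at_left x)"
  "((%a. enn2real (mean_exit x a b)) \<longlongrightarrow> 0) (at_left x)" "\<forall>\<^sub>F a in at_left x. mean_exit x a b < top"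
proof -
 obtain g u D where g: "continuous_on Rpos g" "dmds m s u D g" "g x = 1" "u x = 0" "\<forall>\<^sub>F b in at_right x. u b <= s b - s x"
  using unit_generator_solution[OF x] by (elim exE conjE) (rule that; assumption)
 define E where "E a b = enn2real (mean_exit x a b)" for a b
 define p where "p a b = up_prob x a b" for a b
 have 1: "((%q. (p (fst q) (snd q) * u (snd q) + (1 - p (fst q) (snd q)) * u (fst q)) / E (fst q) (snd q)) \<longlongrightarrow> 1) (at_left x \<times>\<^sub>F at_right x)"
  using dmds_generator[OF x g(2,1)] unfolding g(3,4) case_prod_beta p_def E_def by simp
 have 2: "((%q. (p (fst q) (snd q) * s (snd q) + (1 - p (fst q) (snd q)) * s (fst q) - s x) / E (fst q) (snd q)) \<longlongrightarrow> 0) (at_left x \<times>\<^sub>F at_right x)"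
  using dmds_generator[OF x dmds_s] unfolding case_prod_beta p_def E_def by simp
 \<comment> \<open>The limits are 1 and 0. The thresholds \<open>3/4\<close> and \<open>1/4\<close>
   leave half of the mean exit time after absorption, whence the factor 2 in
   \<open>key\<close>.\<close>
 have "\<forall>\<^sub>F q in at_left x \<times>\<^sub>F at_right x. 3/4 < (p (fst q) (snd q) * u (snd q) + (1 - p (fst q) (snd q)) * u (fst q)) / E (fst q) (snd q)"
  by (rule order_tendstoD(1)[OF 1]) simp
 moreover have "\<forall>\<^sub>F q in at_left x \<times>\<^sub>F at_right x. (p (fst q) (snd q) * s (snd q) + (1 - p (fst q) (snd q)) * s (fst q) - s x) / E (fst q) (snd q) < 1/4"
  by (rule order_tendstoD(2)[OF 2]) simp
 ultimately have "\<forall>\<^sub>F q in at_left x \<times>\<^sub>F at_right x. 0 < E (fst q) (snd q) &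
   3/4 * E (fst q) (snd q) <= p (fst q) (snd q) * u (snd q) + (1 - p (fst q) (snd q)) * u (fst q) &
   p (fst q) (snd q) * s (snd q) + (1 - p (fst q) (snd q)) * s (fst q) - s x <= 1/4 * E (fst q) (snd q)"
  using mean_exit_pos[OF x]
 proof eventually_elim
  case (elim q)
  then have E: "0 < E (fst q) (snd q)" by (simp add: E_def)
  show ?case using elim(1,2) E by (simp add: pos_less_divide_eq pos_divide_less_eq)
 qed
 then obtain A B where AB: "eventually A (at_left x)" "eventually B (at_right x)"
  "!!a b. A a ==> B b ==> 0 < E a b & 3/4 * E a b <= p a b * u b + (1 - p a b) * u a & p a b * s b + (1 - p a b) * s a - s x <= 1/4 * E a b"
  unfolding eventually_prod_filter by auto
 have "\<forall>\<^sub>F b in at_right x. x < b & b < top" unfolding eventually_at_right[OF x(2)] using x by auto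
 with AB(2) g(5) have "\<forall>\<^sub>F b in at_right x. B b & u b <= s b - s x & x < b & b < top" by eventually_elim auto
 \<comment> \<open>From here on \<open>b\<close> is fixed: the product filter provides the estimates
   for this one \<open>b\<close> and all \<open>a\<close> close to \<open>x\<close>.\<close>
 from eventually_happens'[OF at_right_nontrivial[OF x(2)] this]
 obtain b where b: "B b" "u b <= s b - s x" "x < b" "b < top" by auto
 have ev: "\<forall>\<^sub>F a in at_left x. A a & 0 < a & a < x"
  using AB(1) unfolding eventually_at_left[OF x(1)] using x by (auto elim!: exE) (metis max_less_iff_conj)
 have key: "0 < E a b & E a b <= 2 * ((s x - s a) + \<bar>u a\<bar>) & 0 <= p a b & p a b <= (s x - s a + E a b) / (s b - s x)" if a: "A a" "0 < a" "a < x" for a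
 proof -
  have p: "0 <= p a b" "p a b <= 1" using up_prob_bounds[OF a(3) b(3,4)] by (auto simp: p_def)
  have sa: "s a < s x" "s x < s b" using s_less a x b by auto
  note K = AB(3)[OF a(1) b(1)]
  have "p a b * (s b - s a) <= (s x - s a) + 1/4 * E a b" using K by (simp add: algebra_simps)
  moreover have "p a b * (s b - s x) <= p a b * (s b - s a)" using p sa by (intro mult_left_mono) auto
  ultimately have pb: "p a b * (s b - s x) <= (s x - s a) + 1/4 * E a b" by linarith
  have "p a b * u b <= p a b * (s b - s x)" using p b by (intro mult_left_mono) auto
  moreover have "(1 - p a b) * u a <= (1 - p a b) * \<bar>u a\<bar>" using p by (intro mult_left_mono) auto
  moreover have "(1 - p a b) * \<bar>u a\<bar> <= 1 * \<bar>u a\<bar>" using p by (intro mult_right_mono) auto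
  ultimately have "3/4 * E a b <= (s x - s a) + 1/4 * E a b + \<bar>u a\<bar>" using K pb by linarith
  moreover have "p a b <= (s x - s a + E a b) / (s b - s x)" using pb K sa by (simp add: pos_le_divide_eq)
  ultimately show ?thesis using K p by auto
 qed
 have uc: "continuous_on Rpos u" using g(2) by (simp add: dmds_def)
 have lim: "(s \<longlongrightarrow> s x) (at_left x)" "(u \<longlongrightarrow> 0) (at_left x)"
  using at_cont[OF s_cont x] at_cont[OF uc x] g(4) by (auto intro: tendsto_mono[OF at_le])
 have E0: "((%a. E a b) \<longlongrightarrow> 0) (at_left x)"
 proof (rule tendsto_sandwich)
  show "\<forall>\<^sub>F a in at_left x. 0 <= E a b" by (simp add: E_def)
  show "\<forall>\<^sub>F a in at_left x. E a b <= 2 * ((s x - s a) + \<bar>u a\<bar>)" using ev by eventually_elim (use key in auto)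
  show "((%a. 2 * (s x - s a + \<bar>u a\<bar>)) \<longlongrightarrow> 0) (at_left x)"
   by (rule tendsto_eq_intros lim refl | simp)+
 qed simp
 have p0: "((%a. p a b) \<longlongrightarrow> 0) (at_left x)"
 proof (rule tendsto_sandwich)
  show "\<forall>\<^sub>F a in at_left x. 0 <= p a b" by (simp add: p_def up_prob_def)
  show "\<forall>\<^sub>F a in at_left x. p a b <= (s x - s a + E a b) / (s b - s x)" using ev by eventually_elim (use key in auto)
  show "((%a. (s x - s a + E a b) / (s b - s x)) \<longlongrightarrow> 0) (at_left x)"
   using s_less[OF x(1) b(3,4)] by (auto intro!: tendsto_eq_intros lim E0)
 qed simp
 have "\<forall>\<^sub>F a in at_left x. mean_exit x a b < top"
  using ev
 proof eventually_elim
  case (elim a)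
  \<comment> \<open>An infinite mean would have been turned into 0 by
    \<open>enn2real\<close>.\<close>
  then have "E a b ~= 0" using key[of a] by auto
  then show ?case by (cases "mean_exit x a b = top") (auto simp: E_def less_top[symmetric])
 qed
 then show ?thesis using that b(3,4) p0 E0 by (simp add: p_def E_def)
qed

end

section \<open>The Green operator as an inverse of the generator\<close>

context dmds_process
begin

lemma before_bounds:
 assumes g: "good w" and U: "0 \<notin> U"
 shows "(!!z. z \<in> U ==> f z <= C) ==> before f (exit_of X U) w <= C * exit_of X U w"
  and "(!!z. z \<in> U ==> c <= f z) ==> c * exit_of X U w <= before f (exit_of X U) w"
proof -
 let ?ta = "exit_of X U w"
 have t: "?ta < top" by (rule good_exit_less[OF g U])
 then obtain r where r: "?ta = ennreal r" "0 <= r" by (cases ?ta) auto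
 have I: "(\<integral>\<^sup>+t. indicator {t. 0 <= t & ennreal t < ?ta} t \<partial>lborel) = ?ta"
 proof -
  have "{t. 0 <= t & ennreal t < ?ta} = {0..<r}" unfolding r by (auto simp: ennreal_less_iff)
  then show ?thesis using r by simp
 qed
 have ms: "{t. 0 <= t & ennreal t < ?ta} \<in> sets lborel" by measurable
 have v: "val f (ennreal t) w = f (pos X (ennreal t) w) & pos X (ennreal t) w \<in> U" if "ennreal t < ?ta" for t
  using exit_less[OF that] by (simp add: val_def)
 show "before f (exit_of X U) w <= C * ?ta" if *: "!!z. z \<in> U ==> f z <= C"
 proof -
  have "before f (exit_of X U) w <= (\<integral>\<^sup>+t. C * indicator {t. 0 <= t & ennreal t < ?ta} t \<partial>lborel)"
   unfolding before_def by (rule nn_integral_mono) (use v * in \<open>auto simp: indicator_def\<close>)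
  then show ?thesis using ms by (simp add: nn_integral_cmult I del: nn_integral_indicator nn_integral_cmult_indicator)
 qed
 show "c * ?ta <= before f (exit_of X U) w" if *: "!!z. z \<in> U ==> c <= f z"
 proof -
  have "(\<integral>\<^sup>+t. c * indicator {t. 0 <= t & ennreal t < ?ta} t \<partial>lborel) <= before f (exit_of X U) w"
   unfolding before_def by (rule nn_integral_mono) (use v * in \<open>auto simp: indicator_def\<close>)
  then show ?thesis using ms by (simp add: nn_integral_cmult I del: nn_integral_indicator nn_integral_cmult_indicator)
 qed
qed

lemma mean_before_bounds:
 assumes x: "a < x" "x < b" "b < top"
 shows "(!!z. a < z ==> z < b ==> f z <= C) ==> (\<integral>\<^sup>+w. before f (exit_of X {a<..<b}) w \<partial>law X x) <= C * mean_exit x a b"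
  and "(!!z. a < z ==> z < b ==> c <= f z) ==> c * mean_exit x a b <= (\<integral>\<^sup>+w. before f (exit_of X {a<..<b}) w \<partial>law X x)"
proof -
 have xt: "x < top" using x by order
 note gx = good_start_fin[OF xt]
 note st = fin_in_state[OF xt]
 have [measurable]: "exit_of X {a<..<b} \<in> borel_measurable (law X x)"
  unfolding law_measurable[OF st] by (rule exit_measurable) (auto intro: compactly_exhausted_greaterThanLessThan)
 show "(\<integral>\<^sup>+w. before f (exit_of X {a<..<b}) w \<partial>law X x) <= C * mean_exit x a b" if "!!z. a < z ==> z < b ==> f z <= C"
  unfolding mean_exit_def
  by (subst nn_integral_cmult[symmetric], simp, rule nn_integral_mono_AE, use good_start_AE[OF gx] in eventually_elim)
   (rule before_bounds(1), use that in auto)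
 show "c * mean_exit x a b <= (\<integral>\<^sup>+w. before f (exit_of X {a<..<b}) w \<partial>law X x)" if "!!z. a < z ==> z < b ==> c <= f z"
  unfolding mean_exit_def
  by (subst nn_integral_cmult[symmetric], simp, rule nn_integral_mono_AE, use good_start_AE[OF gx] in eventually_elim)
   (rule before_bounds(2), use that in auto)
qed

lemma green_decomposition:
 assumes x: "a < x" "x < b" "b < top" and [measurable]: "f \<in> borelm" and fin: "!!z. z < top ==> green f z < top"
 shows "enn2real (green f x) = enn2real (\<integral>\<^sup>+w. before f (exit_of X {a<..<b}) w \<partial>law X x)
  + up_prob x a b * enn2real (green f b) + (1 - up_prob x a b) * enn2real (green f a)"
  and "(\<integral>\<^sup>+w. before f (exit_of X {a<..<b}) w \<partial>law X x) < top"
proof -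
 let ?B = "\<integral>\<^sup>+w. before f (exit_of X {a<..<b}) w \<partial>law X x"
 have t: "x < top" "a < top" using x by order+
 note p = up_prob_bounds[OF x]
 have e: "green f x = ?B + ennreal (up_prob x a b) * green f b + ennreal (1 - up_prob x a b) * green f a"
  using exit_interval_green(1)[OF x, of f] p by simp
 have "?B ~= top" using fin[OF t(1)] unfolding e by auto
 then show "?B < top" by (simp add: less_top)
 obtain r u v where "?B = ennreal r" "0 <= r" "green f b = ennreal u" "0 <= u" "green f a = ennreal v" "0 <= v"
  using \<open>?B < top\<close> fin[OF x(3)] fin[OF t(2)] by (metis ennreal_cases less_irrefl)
 moreover from this have "green f x = ennreal (r + up_prob x a b * u + (1 - up_prob x a b) * v)"
  using p(1,2) unfolding e by (simp add: ennreal_mult ennreal_plus)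
 then have "enn2real (green f x) = r + up_prob x a b * u + (1 - up_prob x a b) * v"
  using p(1,2) \<open>0 <= r\<close> \<open>0 <= u\<close> \<open>0 <= v\<close> by (simp only:) (intro enn2real_ennreal add_nonneg_nonneg mult_nonneg_nonneg, auto)
 ultimately show "enn2real (green f x) = enn2real ?B
  + up_prob x a b * enn2real (green f b) + (1 - up_prob x a b) * enn2real (green f a)"
  by simp
qed

text \<open>With \<open>b\<close> fixed, the increment from \<open>a\<close> to \<open>x\<close> is
  the mean occupation before exit from \<open>(a,b)\<close> plus \<open>up_prob x a b\<close> times
  an increment of \<open>u\<close>; both vanish by \<open>left_exit\<close>. Monotone convergence is
  available only from the right.\<close>

lemma green_left_tendsto:
 assumes x: "0 < x" "x < top" and [measurable]: "f \<in> borelm"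
  and fin: "!!z. z < top ==> green f z < top" and K: "!!z. f z <= ennreal K"
 shows "((%a. enn2real (green f a)) \<longlongrightarrow> enn2real (green f x)) (at_left x)"
proof -
 obtain b where b: "x < b" "b < top" "((%a. up_prob x a b) \<longlongrightarrow> 0) (at_left x)"
  "((%a. enn2real (mean_exit x a b)) \<longlongrightarrow> 0) (at_left x)" "\<forall>\<^sub>F a in at_left x. mean_exit x a b < top"
  using left_exit[OF x] by blast
 define u where "u z = enn2real (green f z)" for z
 have K': "!!z. f z <= ennreal \<bar>K\<bar>" using K by (meson abs_ge_self ennreal_leI order_trans)
 have "((%a. u a - u x) \<longlongrightarrow> 0) (at_left x)"
 proof (rule Lim_null_comparison)
  show "((%a. \<bar>K\<bar> * enn2real (mean_exit x a b) + up_prob x a b * u b) \<longlongrightarrow> 0) (at_left x)"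
   by (rule tendsto_eq_intros b refl | simp)+
  have "\<forall>\<^sub>F a in at_left x. 0 < a & a < x" unfolding eventually_at_left[OF x(1)] using x by auto
  with b(5) show "\<forall>\<^sub>F a in at_left x. norm (u a - u x) <= \<bar>K\<bar> * enn2real (mean_exit x a b) + up_prob x a b * u b"
  proof eventually_elim
   case (elim a)
   then have ax: "a < x" by simp
   note d = green_decomposition[OF ax b(1,2) assms(3) fin]
   note p = up_prob_bounds[OF ax b(1,2)]
   have "green f a <= green f x" using ax x by (intro green_mono good_start_fin) auto
   then have au: "u a <= u x" unfolding u_def using fin[OF x(2)] by (rule enn2real_mono)
   have "(\<integral>\<^sup>+w. before f (exit_of X {a<..<b}) w \<partial>law X x) <= ennreal \<bar>K\<bar> * mean_exit x a b"
    by (rule mean_before_bounds(1)[OF ax b(1,2)]) (rule K')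
   then have "enn2real (\<integral>\<^sup>+w. before f (exit_of X {a<..<b}) w \<partial>law X x) <= \<bar>K\<bar> * enn2real (mean_exit x a b)"
    using enn2real_mono[of _ "ennreal \<bar>K\<bar> * mean_exit x a b"] elim by (simp add: ennreal_mult_less_top enn2real_mult)
   moreover have "u x - u a = enn2real (\<integral>\<^sup>+w. before f (exit_of X {a<..<b}) w \<partial>law X x) + up_prob x a b * (u b - u a)"
    using d(1) by (simp add: u_def algebra_simps)
   moreover have "up_prob x a b * (u b - u a) <= up_prob x a b * u b"
    using p by (intro mult_left_mono) (auto simp: u_def)
   ultimately show ?case using au by simp
  qed
 qed
 then show ?thesis unfolding u_def by (rule LIM_zero_cancel)
qed

lemma green_continuous:
 assumes [measurable]: "f \<in> borelm"
  and fin: "!!z. z < top ==> green f z < top" and K: "!!z. f z <= ennreal K"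
 shows "continuous_on Rpos (%x. enn2real (green f x))"
proof (rule continuous_at_imp_continuous_on, rule ballI)
 fix x :: ennreal assume "x \<in> Rpos"
 then have x: "0 < x" "x < top" by auto
 have "((%a. enn2real (green f a)) \<longlongrightarrow> enn2real (green f x)) (at_right x)"
  by (rule tendsto_enn2real[OF _ enn2real_nonneg]) (use green_right_tendsto[OF x(2) assms(1) fin] fin[OF x(2)] in \<open>auto simp: ennreal_enn2real_if\<close>)
 with green_left_tendsto[OF x assms] show "isCont (%x. enn2real (green f x)) x"
  unfolding isCont_def by (rule filterlim_split_at)
qed

text \<open>By \<open>green_decomposition\<close> the numerator of Dynkin's quotient is minus the
  mean occupation integral of \<open>ph\<close> before exit, which lies between
  \<open>ph x - e/2\<close> and \<open>ph x + e/2\<close> times the mean exit time. The equality of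
  domains then turns the value of the generator into a differential equation.\<close>

lemma green_dmds:
 fixes ph :: "ennreal => real"
 assumes ph: "continuous_on Rpos ph" "!!z. 0 <= ph z" "!!z. ph z <= K"
  and fin: "!!z. z < top ==> green (%z. ennreal (ph z)) z < top"
 shows "\<exists>D. dmds m s (%x. enn2real (green (%z. ennreal (ph z)) x)) D (%x. - ph x)"
proof -
 define f where "f z = ennreal (ph z)" for z
 define u where "u x = enn2real (green f x)" for x
 have [measurable]: "ph \<in> borelm" by (rule borel_measurable_continuous_Ioo[OF ph(1)])
 have [measurable]: "f \<in> borelm" unfolding f_def[abs_def] by measurable
 have f_eq: "(%z. ennreal (ph z)) = f" by (simp add: f_def[abs_def])
 note fin' = fin[unfolded f_eq]
 have uc: "continuous_on Rpos u"
  unfolding u_def[abs_def] by (rule green_continuous[where K=K]) (use fin' ph in \<open>auto simp: f_def ennreal_leI\<close>)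
 have "has_local_generator X u x (- ph x)" if xI: "x \<in> Rpos" for x
 proof -
  have x: "0 < x" "x < top" using xI by auto
  show ?thesis
   unfolding generator_iff[OF x borel_measurable_continuous_Ioo[OF uc]]
  proof (rule tendstoI)
   fix e :: real assume e: "0 < e"
   have "\<forall>\<^sub>F z in at x. dist (ph z) (ph x) < e / 2" using at_cont[OF ph(1) x] e by (intro tendstoD) auto
   then have "\<forall>\<^sub>F z in nhds x. \<bar>ph z - ph x\<bar> <= e / 2"
    using e unfolding eventually_nhds_conv_at by (auto simp: dist_real_def elim: eventually_mono)
   then obtain S where S: "open S" "x \<in> S" "!!z. z \<in> S ==> \<bar>ph z - ph x\<bar> <= e / 2" unfolding eventually_nhds by auto
   obtain l where l: "l < x" "{l<..x} <= S" using open_left[OF S(1,2) x(1)] by auto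
   obtain r where r: "x < r" "{x..<r} <= S" using open_right[OF S(1,2) x(2)] by auto
   have "\<forall>\<^sub>F a in at_left x. l < a & a < x" unfolding eventually_at_left[OF x(1)] using l by auto
   moreover have "\<forall>\<^sub>F b in at_right x. x < b & b < r & b < top"
    unfolding eventually_at_right[OF x(2)] using r x by (intro exI[of _ r]) (auto intro: order_less_le_trans[OF _ top_greatest])
   ultimately have "\<forall>\<^sub>F p in at_left x \<times>\<^sub>F at_right x. (l < fst p & fst p < x) & (x < snd p & snd p < r & snd p < top)"
    unfolding eventually_prod_filter fst_conv snd_conv by blast
   with mean_exit_pos[OF x] show "\<forall>\<^sub>F p in at_left x \<times>\<^sub>F at_right x. dist (case p of (a, b) =>
     (up_prob x a b * u b + (1 - up_prob x a b) * u a - u x) / enn2real (mean_exit x a b)) (- ph x) < e"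
   proof eventually_elim
    case (elim p)
    define a b where "a = fst p" and "b = snd p"
    have ab: "a < x" "x < b" "b < top" "l < a" "b < r" using elim by (auto simp: a_def b_def)
    have E: "0 < enn2real (mean_exit x a b)" using elim by (simp add: a_def b_def)
    then have Et: "mean_exit x a b < top" by (cases "mean_exit x a b = top") (auto simp: less_top[symmetric])
    let ?B = "\<integral>\<^sup>+w. before f (exit_of X {a<..<b}) w \<partial>law X x"
    note d = green_decomposition[OF ab(1-3) \<open>f \<in> borelm\<close> fin']
    have cl: "\<bar>ph z - ph x\<bar> <= e / 2" if "a < z" "z < b" for z
    proof (rule S(3))
     have "l < z" "z < r" using that ab by order+
     then show "z \<in> S" using l(2) r(2) by (cases "z <= x") auto
    qed
    have "?B <= ennreal (ph x + e/2) * mean_exit x a b"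
    proof (rule mean_before_bounds(1)[OF ab(1-3)])
     fix z assume "a < z" "z < b"
     from cl[OF this] show "f z <= ennreal (ph x + e/2)" unfolding f_def by (intro ennreal_leI) linarith
    qed
    then have "enn2real ?B <= enn2real (ennreal (ph x + e/2) * mean_exit x a b)"
     using Et by (intro enn2real_mono) (auto simp: ennreal_mult_less_top)
    then have up: "enn2real ?B <= (ph x + e/2) * enn2real (mean_exit x a b)" using ph(2)[of x] e by (simp add: enn2real_mult del: ennreal_plus)
    have "ennreal (ph x - e/2) * mean_exit x a b <= ?B"
    proof (rule mean_before_bounds(2)[OF ab(1-3)])
     fix z assume "a < z" "z < b"
     from cl[OF this] show "ennreal (ph x - e/2) <= f z" unfolding f_def by (intro ennreal_leI) linarith
    qed
    then have "enn2real (ennreal (ph x - e/2) * mean_exit x a b) <= enn2real ?B"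
     using d(2) by (intro enn2real_mono)
    then have lo: "(ph x - e/2) * enn2real (mean_exit x a b) <= enn2real ?B"
    proof (cases "0 <= ph x - e/2")
     \<comment> \<open>A negative factor is truncated to 0 by \<open>ennreal\<close>, but then the
       estimate is trivial.\<close>
     case False
     then have "(ph x - e/2) * enn2real (mean_exit x a b) <= 0" by (intro mult_nonpos_nonneg) auto
     also have "0 <= enn2real ?B" by simp
     finally show ?thesis .
    qed (simp add: enn2real_mult)
    have q: "(up_prob x a b * u b + (1 - up_prob x a b) * u a - u x) = - enn2real ?B" using d(1) by (simp add: u_def)
    have "enn2real ?B / enn2real (mean_exit x a b) <= ph x + e/2" "ph x - e/2 <= enn2real ?B / enn2real (mean_exit x a b)"
     using up lo E by (simp_all add: pos_divide_le_eq pos_le_divide_eq)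
    then have "\<bar>- enn2real ?B / enn2real (mean_exit x a b) + ph x\<bar> <= e / 2"
     unfolding minus_divide_left[symmetric] by linarith
    then show ?case using e by (simp add: case_prod_beta q[unfolded a_def b_def] a_def b_def dist_real_def)
   qed
  qed
 qed
 then have "\<exists>D. dmds m s u D (%x. - ph x)"
  using dmds_diffusion uc continuous_on_minus[OF ph(1)] unfolding dmds_diffusion_def by blast
 then show ?thesis unfolding u_def[abs_def] f_eq .
qed

lemma green_compact_finite:
 assumes b: "0 < b" "b < top"
 obtains C where "0 <= C" "!!ph K x. (!!z. 0 <= ph z) ==> (!!z. ph z <= K) ==> (!!z. b < z \<or> z = 0 ==> ph z = 0) ==> x < top ==>
  green (%z. ennreal (ph z)) x <= ennreal (K * C)"
proof -
 obtain C where C: "C < top" "!!x. good_start x ==> green (indicator {0<..b}) x <= C"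
  using green_indicator_bounded[OF b] by blast
 obtain c where c: "C = ennreal c" "0 <= c" using C(1) by (cases C) auto
 show ?thesis
 proof (rule that[OF c(2)])
  fix ph :: "ennreal => real" and K :: real and x :: ennreal assume ph: "!!z. 0 <= ph z" "!!z. ph z <= K" "!!z. b < z \<or> z = 0 ==> ph z = 0" and x: "x < top"
  have "0 <= K" using ph(1,2)[of 0] by linarith
  have "green (%z. ennreal (ph z)) x <= ennreal K * green (indicator {0<..b}) x"
   by (rule green_cmult_le) (use ph x in \<open>auto simp: indicator_def ennreal_leI fin_in_state not_le zero_less_iff_neq_zero\<close>)
  also have "... <= ennreal K * C" by (intro mult_left_mono C(2) good_start_fin x) auto
  also have "... = ennreal (K * c)" using c \<open>0 <= K\<close> by (simp add: ennreal_mult)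
  finally show "green (%z. ennreal (ph z)) x <= ennreal (K * c)" .
 qed
qed

end

section \<open>The Green kernel\<close>

definition tent :: "ennreal => ennreal => real" where
 "tent b z = (if z = top then 0 else max 0 (min (enn2real z) (enn2real b - enn2real z)))"

text \<open>Positivity exactly on \<open>(0,b)\<close> is the reason for this shape: a strict
  inequality between densities near 0 survives integration against a tent.\<close>

lemma tent:
 assumes b: "0 < b" "b < top"
 shows "continuous_on Rpos (tent b)" "0 <= tent b z" "tent b z <= enn2real b" "b <= z \<or> z = 0 ==> tent b z = 0"
  "0 < z ==> z < b ==> 0 < tent b z"
proof -
 show "continuous_on Rpos (tent b)"
 proof (subst continuous_on_cong[OF refl])
  show "continuous_on Rpos (%z. max 0 (min (enn2real z) (enn2real b - enn2real z)))"
   by (intro continuous_intros continuous_on_enn2real)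
 qed (auto simp: tent_def)
 show "0 <= tent b z" by (simp add: tent_def)
 show "tent b z <= enn2real b" by (simp add: tent_def min_le_iff_disj)
 show "tent b z = 0" if "b <= z \<or> z = 0"
 proof (cases "z = top")
  case False
  then have "b <= z ==> enn2real b <= enn2real z" by (intro enn2real_mono) (auto simp: less_top)
  then show ?thesis using that by (auto simp: tent_def)
 qed (simp add: tent_def)
 show "0 < tent b z" if "0 < z" "z < b"
 proof -
  have z: "z < top" using that b by order
  then have "enn2real z < enn2real b" "0 < enn2real z" using that b by (auto simp: enn2real_less_iff enn2real_positive_iff)
  then show ?thesis using z by (auto simp: tent_def)
 qed
qed

context dmds_process
begin

text \<open>Beyond \<open>b\<close> the function \<open>u\<close> is constant, so its right
  derivative vanishes at \<open>b\<close>; together with \<open>dD = - ph dm\<close> this determines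
  \<open>D\<close>, and \<open>D\<close> determines the increments of \<open>u\<close>. The lower
  end \<open>e\<close> stays positive because nothing is known yet about \<open>s\<close> near
  0.\<close>

lemma green_increment:
 fixes ph :: "ennreal => real"
 assumes ph: "continuous_on Rpos ph" "!!z. 0 <= ph z" "!!z. ph z <= K" "!!z. b <= z \<or> z = 0 ==> ph z = 0"
  and b: "b < top" and x: "0 < e" "e <= x" "x <= b"
 defines "u \<equiv> %x. enn2real (green (%z. ennreal (ph z)) x)"
 shows "set_integrable m {e<..b} (%z. (min (s x) (s z) - s e) * ph z)"
  "u x - u e = (LINT z:{e<..b}|m. (min (s x) (s z) - s e) * ph z)"
proof -
 have b0: "0 < b" using x by order
 obtain C where C: "!!x. x < top ==> green (%z. ennreal (ph z)) x <= ennreal (K * C)"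
  using green_compact_finite[OF b0 b] ph by (metis less_imp_le)
 have "\<exists>D. dmds m s u D (%x. - ph x)"
  unfolding u_def by (rule green_dmds[OF ph(1-3)]) (rule order_le_less_trans[OF C ennreal_less_top])
 then obtain D where D: "dmds m s u D (%x. - ph x)" by blast
 have [measurable]: "ph \<in> borelm" by (rule borel_measurable_continuous_Ioo[OF ph(1)])
 have [measurable]: "s \<in> borelm" by (rule borel_measurable_continuous_Ioo[OF s_cont])
 have ub: "u y = u b" if "b <= y" "y < top" for y
  unfolding u_def by (rule arg_cong[where f=enn2real], rule green_const_above) (use that ph(4)[OF disjI1[OF less_imp_le]] good_start_fin in auto)
 have "D b = 0"
 proof (rule tendsto_unique[OF at_right_nontrivial[OF b]])
  show "((%y. (u y - u b) /\<^sub>R (s y - s b)) \<longlongrightarrow> D b) (at_right b)"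
   using D b0 b by (auto simp: dmds_def has_right_sderiv_def)
  show "((%y. (u y - u b) /\<^sub>R (s y - s b)) \<longlongrightarrow> 0) (at_right b)"
  proof (rule tendsto_eventually, unfold eventually_at_right[OF b], intro exI[of _ top] conjI allI impI)
   fix y assume "b < y" "y < top"
   then show "(u y - u b) /\<^sub>R (s y - s b) = 0" using ub[of y] by simp
  qed (rule b)
 qed
 have Dz: "D z = (LINT y:{z<..b}|m. ph y)" if "0 < z" "z <= b" for z
 proof -
  have "D b - D z = (LINT y:{z<..b}|m. - ph y)" using D that b by (auto simp: dmds_def)
  then show ?thesis using \<open>D b = 0\<close> by (simp add: set_lebesgue_integral_def)
 qed
 \<comment> \<open>The cut at \<open>e\<close> makes \<open>ph\<close> locally integrable up to 0
   and does not affect \<open>D\<close> on \<open>[e,b]\<close>.\<close>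
 define g where "g z = (if e < z then ph z else 0)" for z
 have K0: "0 <= K" using ph(2,3)[of 0] by linarith
 have li: "loc_int g"
  by (rule loc_intI[where B=K and e=e]) (use ph x K0 in \<open>auto simp: g_def[abs_def]\<close>)
 note dv = dmds_lin[OF dmds_s dmds_primitive2[OF li], of "primitive g b" "-1" 0]
 have "u x - u e = (primitive g b * s x + (-1) * primitive2 g x + 0) - (primitive g b * s e + (-1) * primitive2 g e + 0)"
 proof (rule right_sderiv_unique)
  show "continuous_on Rpos u" "has_right_sderiv s u D" using D by (auto simp: dmds_def)
  show "continuous_on Rpos (%x. primitive g b * s x + (-1) * primitive2 g x + 0)"
   "has_right_sderiv s (%x. primitive g b * s x + (-1) * primitive2 g x + 0) (%x. primitive g b * 1 + (-1) * primitive g x)"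
   using dv by (auto simp: dmds_def)
  fix z assume z: "e <= z" "z < x"
  then have "0 < z" "z <= b" using x by order+
  then have "D z = (LINT y:{z<..b}|m. g y)"
   unfolding Dz[OF \<open>0 < z\<close> \<open>z <= b\<close>] using z by (intro set_lebesgue_integral_cong) (auto simp: g_def sets_m)
  then show "D z = primitive g b * 1 + (-1) * primitive g z" using primitive_diff[OF li \<open>z <= b\<close> b] by simp
 qed (use x b in auto)
 moreover have "primitive2 g e = 0"
  unfolding primitive2_def set_lebesgue_integral_def
  by (subst Bochner_Integration.integral_cong[where g="%_. 0"]) (auto simp: indicator_def g_def)
 ultimately have eq: "u x - u e = (s x - s e) * primitive g b - primitive2 g x" by (simp add: algebra_simps)
 have sub: "{0<..x} <= {0<..b}" using x by auto
 have xt: "x < top" using x b by order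
 have i1: "integrable m (%z. indicat_real {0<..b} z * ((s x - s e) * g z))"
 proof -
  have "integrable m (%z. indicat_real {0<..b} z *\<^sub>R g z)"
   using loc_intD(1)[OF li b, of "{0<..b}"] by (auto simp: set_integrable_def)
  from integrable_mult_right[OF this, of "s x - s e"] show ?thesis by (simp add: mult.left_commute)
 qed
 have i2: "integrable m (%z. indicat_real {0<..x} z * ((s x - s z) * g z))"
  using loc_intD(3)[OF li b _ sub, of "s x"] by (simp add: set_integrable_def)
 have pw: "indicat_real {0<..b} z * ((s x - s e) * g z) - indicat_real {0<..x} z * ((s x - s z) * g z)
  = indicat_real {e<..b} z *\<^sub>R ((min (s x) (s z) - s e) * ph z)" for z
 proof (cases "e < z & z <= b")
  case True
  then have z: "0 < z" "z < top" using x b by (auto intro: pos order_le_less_trans)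
  show ?thesis
  proof (cases "z <= x")
   case True
   then have "s z <= s x" using z xt by (intro s_le)
   then show ?thesis using True \<open>e < z & z <= b\<close> z by (simp add: g_def min_def algebra_simps indicator_def)
  next
   case False
   then have "s x <= s z" using z x by (intro s_le) auto
   then show ?thesis using False \<open>e < z & z <= b\<close> z by (simp add: g_def min_def algebra_simps indicator_def)
  qed
 next
  case False
  then have "ph z = 0 \<or> z <= e" using ph(4)[OF disjI1[OF less_imp_le], of z] by (auto simp: not_le not_less)
  then show ?thesis by (auto simp: g_def indicator_def)
 qed
 show "set_integrable m {e<..b} (%z. (min (s x) (s z) - s e) * ph z)"
  unfolding set_integrable_def pw[symmetric] using i1 i2 by (rule Bochner_Integration.integrable_diff)
 have "(s x - s e) * primitive g b = (\<integral>z. indicat_real {0<..b} z * ((s x - s e) * g z) \<partial>m)"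
  unfolding primitive_def set_lebesgue_integral_def by (subst integral_mult_right_zero[symmetric]) (simp add: algebra_simps)
 moreover have "primitive2 g x = (\<integral>z. indicat_real {0<..x} z * ((s x - s z) * g z) \<partial>m)"
  unfolding primitive2_def set_lebesgue_integral_def by simp
 ultimately show "u x - u e = (LINT z:{e<..b}|m. (min (s x) (s z) - s e) * ph z)"
  unfolding eq set_lebesgue_integral_def pw[symmetric] using Bochner_Integration.integral_diff[OF i1 i2] by simp
qed

definition s0 :: real where "s0 = Inf (s ` Rpos)"

definition sig :: "ennreal => real" where "sig x = s x - s0"

text \<open>An increment of the Green function from \<open>e\<close> to \<open>x\<close> is at least
  \<open>(s x - s e) * ka\<close>, while the Green function is finite and nonnegative. Thus certain
  absorption at 0 makes 0 accessible in the sense of the scale.\<close>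

lemma s_bdd_below: "bdd_below (s ` Rpos)"
proof -
 \<comment> \<open>Any finite points \<open>0 < x < b\<close> would serve.\<close>
 define b x :: ennreal where "b = 2" and "x = 1"
 have bx: "0 < b" "b < top" "0 < x" "x < b" by (simp_all add: b_def x_def)
 define u where "u x = enn2real (green (%z. ennreal (tent b z)) x)" for x
 define ka where "ka = (LINT z:{x<..b}|m. tent b z)"
 have fin: "emeasure m {x<..b} < top" by (rule m_finite[OF bx(3,2)])
 have [measurable]: "tent b \<in> borelm" by (rule borel_measurable_continuous_Ioo[OF tent(1)[OF bx(1,2)]])
 have ti: "set_integrable m {x<..b} (tent b)"
  unfolding set_integrable_def
 proof (rule Bochner_Integration.integrable_bound[OF integrable_mult_right[OF integrable_real_indicator[OF _ fin[folded infinity_ennreal_def]], of "enn2real b"]])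
  show "AE z in m. norm (indicat_real {x<..b} z *\<^sub>R tent b z) <= norm (enn2real b * indicat_real {x<..b} z)"
   using tent(2,3)[OF bx(1,2)] by (intro AE_I2) (auto simp: indicator_def)
 qed (auto simp: sets_m)
 have "ka ~= 0"
 proof
  assume "ka = 0"
  then have "AE z in m. indicat_real {x<..b} z *\<^sub>R tent b z = 0"
   unfolding ka_def set_lebesgue_integral_def
   by (subst (asm) integral_nonneg_eq_0_iff_AE) (use ti tent(2)[OF bx(1,2)] in \<open>auto simp: set_integrable_def\<close>)
  then have "AE z in m. z \<notin> {x<..<b}"
  proof eventually_elim
   case (elim z)
   show ?case
   proof
    assume "z \<in> {x<..<b}"
    then have "0 < tent b z" "z \<in> {x<..b}" using tent(5)[OF bx(1,2), of z] pos[of x z] by auto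
    with elim show False by simp
   qed
  qed
  then have "emeasure m {x<..<b} = 0" by (subst (asm) AE_iff_measurable[of "{x<..<b}"]) (auto simp: sets_m)
  moreover have "0 < emeasure m {x<..<b}"
  proof (rule m_open_pos)
   show "{x<..<b} ~= {}" using dense[OF bx(4)] by auto
   show "{x<..<b} <= Rpos" using bx by (auto intro: pos order_less_trans)
  qed auto
  ultimately show False by simp
 qed
 moreover have "0 <= ka" unfolding ka_def set_lebesgue_integral_def
  using tent(2)[OF bx(1,2)] by (intro integral_nonneg_AE) (auto simp: indicator_def)
 ultimately have ka: "0 < ka" by simp
 have low: "s x - u x / ka <= s e" if e: "0 < e" "e <= x" for e
 proof -
  have xb: "x <= b" using bx by simp
  note G1 = green_increment(1)[OF tent(1-4)[OF bx(1,2)] bx(2) e xb]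
  have G2: "u x - u e = (LINT z:{e<..b}|m. (min (s x) (s z) - s e) * tent b z)"
   unfolding u_def by (rule green_increment(2)[OF tent(1-4)[OF bx(1,2)] bx(2) e xb])
  have eb: "e < b" using e bx by order
  have sub: "{x<..b} <= {e<..b}" using e by auto
  have "(s x - s e) * ka = (LINT z:{x<..b}|m. (s x - s e) * tent b z)" by (simp add: ka_def)
  also have "... <= (LINT z:{e<..b}|m. (min (s x) (s z) - s e) * tent b z)"
   unfolding set_lebesgue_integral_def
  proof (rule integral_mono)
   show "integrable m (%z. indicat_real {x<..b} z *\<^sub>R ((s x - s e) * tent b z))"
    using integrable_mult_right[OF ti[unfolded set_integrable_def], of "s x - s e"] by (simp add: algebra_simps)
   show "integrable m (%z. indicat_real {e<..b} z *\<^sub>R ((min (s x) (s z) - s e) * tent b z))"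
    using G1 by (simp add: set_integrable_def)
   fix z
   show "indicat_real {x<..b} z *\<^sub>R ((s x - s e) * tent b z) <= indicat_real {e<..b} z *\<^sub>R ((min (s x) (s z) - s e) * tent b z)"
   proof (cases "e < z & z <= b")
    case True
    then have z: "0 < z" "z < top" using bx by (auto intro: pos order_le_less_trans)
    have "s e <= s z" "s e <= s x" using True e z bx by (auto intro!: s_le intro: order_less_trans)
    moreover have "s x <= s z" if "x < z" using that z bx by (intro s_le) auto
    ultimately show ?thesis using True tent(2)[OF bx(1,2), of z] by (auto simp: indicator_def min_def)
   qed (use sub in \<open>auto simp: indicator_def\<close>)
  qed
  also have "... = u x - u e" by (simp add: G2)
  also have "... <= u x" by (simp add: u_def)
  finally have "s x - s e <= u x / ka" using ka by (simp add: pos_le_divide_eq)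
  then show ?thesis by simp
 qed
 show ?thesis
 proof (rule bdd_belowI2[where m="s x - u x / ka"])
  fix e assume "e \<in> {0<..<top::ennreal}"
  then have e: "0 < e" "e < top" by auto
  show "s x - u x / ka <= s e"
  proof (cases "e <= x")
   case False
   then have "s x <= s e" using bx e by (intro s_le) auto
   moreover have "0 <= u x / ka" using ka by (simp add: u_def)
   ultimately show ?thesis by linarith
  qed (use low e in auto)
 qed
qed

lemma s0_less: "0 < x ==> x < top ==> s0 < s x"
proof -
 assume x: "0 < x" "x < top"
 obtain y where y: "0 < y" "y < x" using x dense by blast
 have "s0 <= s y" unfolding s0_def using y x by (intro cInf_lower s_bdd_below) (auto intro!: imageI)
 also have "s y < s x" by (rule s_less) (use x y in auto)
 finally show ?thesis .
qed

lemma sig_pos: "0 < x ==> x < top ==> 0 < sig x"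
 using s0_less by (simp add: sig_def)

lemma sig_mono: "0 < x ==> x <= y ==> y < top ==> sig x <= sig y"
 using s_le by (simp add: sig_def)

lemma s_tendsto_s0: "(s \<longlongrightarrow> s0) (at_right 0)"
proof (rule order_tendstoI)
 fix l assume "l < s0"
 show "\<forall>\<^sub>F x in at_right 0. l < s x"
  unfolding eventually_at_right[OF ennreal_zero_less_top] using s0_less \<open>l < s0\<close> by (intro exI[of _ top]) (auto intro: less_trans)
next
 fix l assume "s0 < l"
 then obtain y where y: "0 < y" "y < top" "s y < l"
  unfolding s0_def by (subst (asm) cInf_less_iff) (use s_bdd_below in \<open>auto intro!: exI[of _ 1]\<close>)
 show "\<forall>\<^sub>F x in at_right 0. s x < l"
  unfolding eventually_at_right[OF ennreal_zero_less_top]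
 proof (intro exI[of _ y] conjI allI impI)
  fix x assume "0 < x" "x < y"
  then have "s x <= s y" using y by (intro s_le) auto
  then show "s x < l" using y by simp
 qed (use y in auto)
qed

lemma sig_tendsto_0: "(sig \<longlongrightarrow> 0) (at_right 0)"
 using tendsto_diff[OF s_tendsto_s0 tendsto_const[of s0]] by (simp add: sig_def[abs_def])

lemma sig_cont: "continuous_on Rpos sig"
 unfolding sig_def[abs_def] by (intro continuous_intros s_cont)

lemma sig_measurable [measurable]: "sig \<in> borelm"
 by (rule borel_measurable_continuous_Ioo[OF sig_cont])

text \<open>The Green function of the process killed at 0 with respect to the speed measure. It is
  set to 0 off \<open>(0,\<infinity>)\<close>, so a possible mass at \<open>top\<close> is left
  out.\<close>

definition kern :: "ennreal => ennreal => ennreal" where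
 "kern x z = (if x \<in> Rpos & z \<in> Rpos then ennreal (min (sig x) (sig z)) else 0)"

lemma kern_measurable [measurable (raw)]:
 assumes [measurable]: "f \<in> borel_measurable M" "g \<in> borel_measurable M"
 shows "(%w. kern (f w) (g w)) \<in> borel_measurable M"
 unfolding kern_def by measurable

lemma kern_sym: "kern x z = kern z x"
 by (auto simp: kern_def min.commute)

text \<open>Limit \<open>e\<close> to 0 in \<open>green_increment\<close>. On the left the Green
  function tends to its value 0 at 0; on the right \<open>s e\<close> decreases to
  \<open>s0\<close>, and monotone convergence applies.\<close>

lemma green_formula_cont:
 fixes ph :: "ennreal => real"
 assumes ph: "continuous_on Rpos ph" "!!z. 0 <= ph z" "!!z. ph z <= K" "!!z. b <= z \<or> z = 0 ==> ph z = 0"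
  and b: "b < top" and x: "0 < x" "x < top"
 shows "green (%z. ennreal (ph z)) x = (\<integral>\<^sup>+z. kern x z * ennreal (ph z) \<partial>m)"
proof -
 have [measurable]: "ph \<in> borelm" by (rule borel_measurable_continuous_Ioo[OF ph(1)])
 have [measurable]: "s \<in> borelm" by (rule borel_measurable_continuous_Ioo[OF s_cont])
 define u where "u x = enn2real (green (%z. ennreal (ph z)) x)" for x
 have main: "green (%z. ennreal (ph z)) x = (\<integral>\<^sup>+z. kern x z * ennreal (ph z) \<partial>m)" if x: "0 < x" "x <= b" for x
 proof -
  have b0: "0 < b" and xt: "x < top" using x b by order+
  obtain C where C: "!!x. x < top ==> green (%z. ennreal (ph z)) x <= ennreal (K * C)"
   using green_compact_finite[OF b0 b] ph by (metis less_imp_le)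
  have fin: "green (%z. ennreal (ph z)) y < top" if "y < top" for y by (rule order_le_less_trans[OF C[OF that] ennreal_less_top])
  have gu: "green (%z. ennreal (ph z)) y = ennreal (u y)" if "y < top" for y
   using fin[OF that] by (simp add: u_def ennreal_enn2real_if)
  define S where "S n = ennreal (enn2real x / real (n + 2))" for n :: nat
  have xr: "x = ennreal (enn2real x)" "0 < enn2real x" using x xt by (auto simp: ennreal_enn2real_if enn2real_positive_iff)
  have S: "0 < S n" "S n <= x" for n
  proof -
   show "0 < S n" using xr(2) by (simp add: S_def)
   have "enn2real x / real (n + 2) <= enn2real x" using xr(2) by (simp add: field_simps)
   then show "S n <= x" unfolding S_def by (subst (2) xr(1)) (rule ennreal_leI)
  qed
  have Sdec: "S k <= S n" if "n <= k" for n k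
   unfolding S_def using xr(2) that by (intro ennreal_leI divide_left_mono) auto
  have "(%n. enn2real x / real (n + 2)) ----> 0"
   by (rule LIMSEQ_ignore_initial_segment[OF lim_const_over_n])
  then have "S ----> ennreal 0" unfolding S_def[abs_def] by (rule tendsto_ennrealI)
  then have Slim: "filterlim S (at_right 0) sequentially"
   using S(1) by (auto simp: filterlim_at zero_less_iff_neq_zero intro!: always_eventually)
  have "(green (%z. ennreal (ph z)) \<longlongrightarrow> green (%z. ennreal (ph z)) 0) (at_right 0)"
   by (rule green_right_tendsto) (use fin in auto)
  also have "green (%z. ennreal (ph z)) 0 = 0" by (rule green_zero) (use ph(4) in auto)
  finally have "((%y. enn2real (green (%z. ennreal (ph z)) y)) \<longlongrightarrow> enn2real 0) (at_right 0)"
   by (intro tendsto_enn2real) auto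
  then have "(u \<longlongrightarrow> 0) (at_right 0)" by (simp add: u_def[abs_def])
  from tendsto_diff[OF tendsto_const filterlim_compose[OF this Slim], of "u x"]
  have "(%n. u x - u (S n)) ----> u x" by simp
  then have l1: "(%n. ennreal (u x - u (S n))) ----> ennreal (u x)" by (rule tendsto_ennrealI)
  define h where "h n z = ennreal ((min (s x) (s z) - s (S n)) * ph z) * indicator {S n<..b} z" for n z
  have sS: "s (S n) <= s x" "z \<in> {S n<..b} ==> s (S n) <= s z" for n z
   using S[of n] xt b by (auto intro!: s_le intro: order_le_less_trans)
  have eq: "ennreal (u x - u (S n)) = (\<integral>\<^sup>+z. h n z \<partial>m)" for n
  proof -
   note G1 = green_increment(1)[OF ph b S(1)[of n] S(2)[of n] x(2)]
   have G2: "u x - u (S n) = (LINT z:{S n<..b}|m. (min (s x) (s z) - s (S n)) * ph z)"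
    unfolding u_def by (rule green_increment(2)[OF ph b S(1)[of n] S(2)[of n] x(2)])
   have nn: "0 <= indicat_real {S n<..b} z *\<^sub>R ((min (s x) (s z) - s (S n)) * ph z)" for z
    using sS[of n] sS(2)[of z n] ph(2)[of z] by (auto simp: indicator_def)
   have "(\<integral>\<^sup>+z. ennreal (indicat_real {S n<..b} z *\<^sub>R ((min (s x) (s z) - s (S n)) * ph z)) \<partial>m) = ennreal (u x - u (S n))"
    unfolding G2 set_lebesgue_integral_def
    by (rule nn_integral_eq_integral) (use G1 nn in \<open>auto simp: set_integrable_def\<close>)
   then show ?thesis unfolding h_def by (auto simp: indicator_def cong: nn_integral_cong intro!: nn_integral_cong elim!: trans[OF sym])
  qed
  have l2: "(%n. \<integral>\<^sup>+z. h n z \<partial>m) ----> (\<integral>\<^sup>+z. kern x z * ennreal (ph z) \<partial>m)"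
  proof (rule nn_integral_LIMSEQ)
   show "incseq h"
   proof (rule incseq_SucI, rule le_funI)
    fix n z
    have "S (Suc n) <= S n" by (rule Sdec) simp
    show "h n z <= h (Suc n) z"
    proof (cases "z \<in> {S n<..b}")
     case True
     then have "z \<in> {S (Suc n)<..b}" using \<open>S (Suc n) <= S n\<close> by auto
     moreover have "s (S (Suc n)) <= s (S n)"
      using \<open>S (Suc n) <= S n\<close> S[of "Suc n"] S[of n] xt by (intro s_le) (auto intro: order_le_less_trans)
     ultimately show ?thesis using True ph(2)[of z] by (auto simp: h_def intro!: ennreal_leI mult_right_mono)
    qed (simp add: h_def)
   qed
   show "h n \<in> borel_measurable m" for n unfolding h_def[abs_def] by measurable
   show "(%n. h n z) ----> kern x z * ennreal (ph z)" for z
   proof (cases "0 < z & z < b")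
    case True
    then have z: "z < top" using b by auto
    have "\<forall>\<^sub>F n in sequentially. S n < z"
     using order_tendstoD(2)[OF \<open>S ----> ennreal 0\<close>] True by auto
    then have ev: "\<forall>\<^sub>F n in sequentially. ennreal ((min (s x) (s z) - s (S n)) * ph z) = h n z"
     by eventually_elim (use True in \<open>auto simp: h_def\<close>)
    have "(%n. (min (s x) (s z) - s (S n)) * ph z) ----> (min (s x) (s z) - s0) * ph z"
     by (intro tendsto_intros filterlim_compose[OF s_tendsto_s0 Slim])
    then have "(%n. ennreal ((min (s x) (s z) - s (S n)) * ph z)) ----> ennreal ((min (s x) (s z) - s0) * ph z)"
     by (rule tendsto_ennrealI)
    moreover have "min (s x) (s z) - s0 = min (sig x) (sig z)" by (simp add: sig_def min_def)
    then have "ennreal ((min (s x) (s z) - s0) * ph z) = kern x z * ennreal (ph z)"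
     using x xt z True sig_pos[of x] sig_pos[of z] ph(2)[of z] by (simp add: kern_def ennreal_mult)
    ultimately show ?thesis using ev by (auto intro: Lim_transform_eventually)
   next
    case False
    then have "ph z = 0" using ph(4)[of z] by (auto simp: not_less zero_less_iff_neq_zero)
    then show ?thesis by (simp add: h_def)
   qed
  qed
  show ?thesis using LIMSEQ_unique[OF l1] l2 gu[OF xt] by (simp add: eq)
 qed
 show ?thesis
 proof (cases "x <= b")
  case True then show ?thesis by (intro main x)
 next
  case False
  \<comment> \<open>Beyond the support of \<open>ph\<close> both sides keep their value at
    \<open>b\<close>.\<close>
  then have bx: "b < x" by simp
  show ?thesis
  proof (cases "b = 0")
   case True
   then have "ph z = 0" for z using ph(4)[of z] by simp
   then show ?thesis by (simp add: green_def semigroup_def val_def)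
  next
   case False
   then have b0: "0 < b" by (simp add: zero_less_iff_neq_zero)
   have "green (%z. ennreal (ph z)) x = green (%z. ennreal (ph z)) b"
    using bx ph(4)[OF disjI1[OF less_imp_le]] by (intro green_const_above good_start_fin x) auto
   also have "... = (\<integral>\<^sup>+z. kern b z * ennreal (ph z) \<partial>m)" by (rule main[OF b0 order_refl])
   also have "... = (\<integral>\<^sup>+z. kern x z * ennreal (ph z) \<partial>m)"
   proof (rule nn_integral_cong)
    fix z
    show "kern b z * ennreal (ph z) = kern x z * ennreal (ph z)"
    proof (cases "0 < z & z < b")
     case True
     then have "sig z <= sig b" "sig z <= sig x" using bx x b by (auto intro!: sig_mono)
     then show ?thesis using True x b b0 by (simp add: kern_def min_absorb2)
    next
     case False
     then have "ph z = 0" using ph(4)[of z] by (auto simp: not_less zero_less_iff_neq_zero)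
     then show ?thesis by simp
    qed
   qed
   finally show ?thesis .
  qed
 qed
qed

end

text \<open>The point \<open>top\<close> is adjoined so that countably many generators with
  \<open>c < top\<close> cover the whole space, as the uniqueness theorem for measures requires. The
  two measures to be compared give \<open>top\<close> no mass.\<close>

lemma sets_borel_ennreal_eq:
 "sets (borel :: ennreal measure) = sigma_sets UNIV ((%c. insert top {..<c}) ` {..<top})" (is "_ = sigma_sets UNIV ?E")
proof
 have "?E <= sets borel" by auto
 then show "sigma_sets UNIV ?E <= sets borel" using sets.sigma_sets_subset[of ?E borel] by simp
 interpret sigma_algebra UNIV "sigma_sets UNIV ?E" by (rule sigma_algebra_sigma_sets) auto
 have b: "insert top {..<c} \<in> sigma_sets UNIV ?E" if "c < top" for c by (rule sigma_sets.Basic) (use that in auto)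
 have t: "{top} \<in> sigma_sets UNIV ?E" using b[of 0] by (simp add: lessThan_def)
 have l: "{..<c} \<in> sigma_sets UNIV ?E" if "c < top" for c
 proof -
  have "{..<c} = insert top {..<c} - {top}" using that by auto
  then show ?thesis using Diff[OF b[OF that] t] by simp
 qed
 have "{..<c} \<in> sigma_sets UNIV ?E" for c :: ennreal
 proof (cases "c = top")
  case True
  have "{..<top::ennreal} = - {top}" by (auto simp: less_top[symmetric])
  then show ?thesis using Diff[OF top t] True by (simp add: Compl_eq_Diff_UNIV)
 qed (use l in \<open>simp add: less_top\<close>)
 then have "range lessThan <= sigma_sets UNIV ?E" by auto
 then have "sigma_sets UNIV (range lessThan) <= sigma_sets UNIV ?E" by (rule sigma_sets_subset)
 moreover have "sets (borel :: ennreal measure) = sigma_sets UNIV (range lessThan)"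
  unfolding borel_Iio by simp
 ultimately show "sets (borel :: ennreal measure) <= sigma_sets UNIV ?E" by simp
qed

definition ramp :: "ennreal => nat => ennreal => real" where
 "ramp c n z = (if z = top \<or> z = 0 then 0 else max 0 (min 1 (real n * (enn2real c - enn2real z))))"

lemma ramp:
 assumes c: "c < top"
 shows "continuous_on Rpos (ramp c n)" "0 <= ramp c n z" "ramp c n z <= 1" "c <= z \<or> z = 0 ==> ramp c n z = 0"
  "n <= k ==> ramp c n z <= ramp c k z" "(SUP n. ennreal (ramp c n z)) = indicator {0<..<c} z"
proof -
 show "continuous_on Rpos (ramp c n)"
 proof (subst continuous_on_cong[OF refl])
  show "continuous_on Rpos (%z. max 0 (min 1 (real n * (enn2real c - enn2real z))))"
   by (intro continuous_intros continuous_on_enn2real)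
 qed (auto simp: ramp_def)
 show "0 <= ramp c n z" and le1: "ramp c n z <= 1" for n by (auto simp: ramp_def)
 show z: "ramp c n z = 0" if "c <= z \<or> z = 0" for n
 proof (cases "z = top \<or> z = 0")
  case False
  then have "enn2real c <= enn2real z" using that by (intro enn2real_mono) (auto simp: less_top)
  then have "real n * (enn2real c - enn2real z) <= 0" by (intro mult_nonneg_nonpos) auto
  then show ?thesis by (auto simp: ramp_def)
 qed (simp add: ramp_def)
 show mono: "ramp c n z <= ramp c k z" if "n <= k" for n k
 proof (cases "z < c")
  case True
  then have "enn2real z <= enn2real c" using c by (intro enn2real_mono) auto
  then have "real n * (enn2real c - enn2real z) <= real k * (enn2real c - enn2real z)" using that by (intro mult_right_mono) auto
  then show ?thesis by (auto simp: ramp_def)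
 next
  case False then show ?thesis using z[of n] z[of k] by (simp add: not_less)
 qed
 show "(SUP n. ennreal (ramp c n z)) = indicator {0<..<c} z"
 proof (cases "0 < z & z < c")
  case True
  then have zt: "z < top" using c by (auto intro: order_less_trans)
  then have d: "0 < enn2real c - enn2real z" using True c by (simp add: enn2real_less_iff)
  obtain n :: nat where "1 / (enn2real c - enn2real z) <= real n" using real_arch_simple by blast
  then have "1 <= real n * (enn2real c - enn2real z)" using d by (simp add: pos_divide_le_eq)
  then have "ramp c n z = 1" using True zt by (auto simp: ramp_def)
  then have "1 <= (SUP n. ennreal (ramp c n z))" by (intro SUP_upper2[of n]) auto
  moreover have "(SUP n. ennreal (ramp c n z)) <= 1"
   using ennreal_leI[OF le1] by (intro SUP_least) simp
  ultimately have "(SUP n. ennreal (ramp c n z)) = 1" by (rule antisym[rotated])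
  then show ?thesis using True by simp
 next
  case False
  then have "c <= z \<or> z = 0" by (auto simp: not_less zero_less_iff_neq_zero)
  then show ?thesis using z False by (auto simp: indicator_def)
 qed
qed

context strong_markov_process
begin

text \<open>The potential measure of the process started at \<open>x\<close>, obtained as the image
  of time and law under the path, so that its additivity is automatic.\<close>

definition occ_measure :: "ennreal => ennreal measure" where
 "occ_measure x = distr (density (lborel \<Otimes>\<^sub>M law X x) (%p. if 0 <= fst p & ennreal (fst p) < life X (snd p) then 1 else 0)) borel
  (%p. path (ennreal (fst p)) (snd p))"

lemma sets_occ_measure [simp, measurable_cong]: "sets (occ_measure x) = sets borel"
 by (simp add: occ_measure_def)

lemma nn_integral_occ_measure:
 assumes st: "x \<in> state X" and [measurable]: "f \<in> borelm"
 shows "(\<integral>\<^sup>+z. f z \<partial>occ_measure x) = green f x"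
proof -
 note [measurable_cong] = sets_law[OF st]
 interpret L: sigma_finite_measure "law X x" by (rule sigma_finite_law[OF st])
 have [measurable]: "(%p. path (ennreal (fst p)) (snd p)) \<in> borel_measurable (lborel \<Otimes>\<^sub>M law X x)"
 proof -
  have "(%p. (ennreal (fst p), snd p)) \<in> lborel \<Otimes>\<^sub>M law X x \<rightarrow>\<^sub>M borel \<Otimes>\<^sub>M events X" by measurable
  from measurable_compose[OF this path_measurable_pair] show ?thesis by simp
 qed
 have [measurable]: "(%p. if 0 <= fst p & ennreal (fst p) < life X (snd p) then 1 else 0 :: ennreal) \<in> borel_measurable (lborel \<Otimes>\<^sub>M law X x)"
  by measurable
 have "(\<integral>\<^sup>+z. f z \<partial>occ_measure x) = (\<integral>\<^sup>+p. (if 0 <= fst p & ennreal (fst p) < life X (snd p) then 1 else 0) * f (path (ennreal (fst p)) (snd p)) \<partial>(lborel \<Otimes>\<^sub>M law X x))"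
  unfolding occ_measure_def by (subst nn_integral_distr) (auto simp: nn_integral_density)
 also have "... = (\<integral>\<^sup>+t. (\<integral>\<^sup>+w. (if 0 <= t & ennreal t < life X w then 1 else 0) * f (path (ennreal t) w) \<partial>law X x) \<partial>lborel)"
  by (subst L.nn_integral_fst[symmetric]) simp_all
 also have "... = green f x"
  unfolding green_def semigroup_def val_path
  by (intro nn_integral_cong) (auto simp: indicator_def intro!: nn_integral_cong)
 finally show ?thesis .
qed

end

context dmds_process
begin

text \<open>Both sides are integrals of \<open>f\<close> against a measure. These agree on the
  continuous functions \<open>ramp c n\<close>, hence on the intervals \<open>(0,c)\<close>, where
  they are finite by \<open>green_indicator_bounded\<close>.\<close>

lemma green_formula:
 assumes x: "0 < x" "x < top" and [measurable]: "f \<in> borelm"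
 shows "green (%z. f z * indicator Rpos z) x = (\<integral>\<^sup>+z. kern x z * f z \<partial>m)"
proof -
 note st = fin_in_state[OF x(2)]
 define M1 where "M1 = density (occ_measure x) (indicator Rpos)"
 define M2 where "M2 = density m (kern x)"
 have n1: "(\<integral>\<^sup>+z. g z \<partial>M1) = green (%z. g z * indicator Rpos z) x" if [measurable]: "g \<in> borelm" for g
  unfolding M1_def by (subst nn_integral_density) (auto simp: nn_integral_occ_measure[OF st] mult.commute)
 have n2: "(\<integral>\<^sup>+z. g z \<partial>M2) = (\<integral>\<^sup>+z. kern x z * g z \<partial>m)" if [measurable]: "g \<in> borelm" for g
  unfolding M2_def by (subst nn_integral_density) auto
 have s12: "sets M1 = sets borel" "sets M2 = sets borel" by (auto simp: M1_def M2_def sets_m)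
 have *: "emeasure M1 (insert top {..<c}) = emeasure M2 (insert top {..<c}) & emeasure M1 (insert top {..<c}) ~= \<infinity>" if c: "c < top" for c
 proof -
  have mr [measurable]: "ramp c n \<in> borelm" for n
   by (rule borel_measurable_continuous_Ioo[OF ramp(1)[OF c]])
  have r: "ennreal (ramp c n z) * indicator Rpos z = ennreal (ramp c n z)" for n z
  proof (cases "z \<in> Rpos")
   case False
   then have "z = top \<or> z = 0" by (metis greaterThanLessThan_iff less_top zero_less_iff_neq_zero)
   then have "ramp c n z = 0" by (simp only: ramp_def if_True)
   then show ?thesis by simp
  qed simp
  have inc: "incseq (%n z. ennreal (ramp c n z))"
   using ramp(5)[OF c] by (auto simp: incseq_def le_fun_def intro!: ennreal_leI)
  have "(\<integral>\<^sup>+z. ennreal (ramp c n z) \<partial>M1) = (\<integral>\<^sup>+z. ennreal (ramp c n z) \<partial>M2)" for n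
  proof -
   have "(\<integral>\<^sup>+z. ennreal (ramp c n z) \<partial>M1) = green (%z. ennreal (ramp c n z)) x"
    using n1[of "%z. ennreal (ramp c n z)"] by (simp add: r)
   also have "... = (\<integral>\<^sup>+z. kern x z * ennreal (ramp c n z) \<partial>m)"
    by (rule green_formula_cont[OF ramp(1-4)[OF c] c x])
   finally show ?thesis by (simp add: n2)
  qed
  then have "(SUP n. \<integral>\<^sup>+z. ennreal (ramp c n z) \<partial>M1) = (SUP n. \<integral>\<^sup>+z. ennreal (ramp c n z) \<partial>M2)" by simp
  then have "(\<integral>\<^sup>+z. (SUP n. ennreal (ramp c n z)) \<partial>M1) = (\<integral>\<^sup>+z. (SUP n. ennreal (ramp c n z)) \<partial>M2)"
   using inc s12 by (subst (1 2) nn_integral_monotone_convergence_SUP) (auto cong: measurable_cong_sets)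
  then have "emeasure M1 {0<..<c} = emeasure M2 {0<..<c}" by (simp add: ramp(6)[OF c] s12)
  moreover have e: "emeasure M (insert top {..<c}) = emeasure M {0<..<c}" if "M = M1 \<or> M = M2" for M
  proof (rule emeasure_eq_AE)
   show "AE z in M. z \<in> insert top {..<c} \<longleftrightarrow> z \<in> {0<..<c}"
   proof -
    have t: "0 < (indicator Rpos z :: ennreal) ==> z \<in> insert top {..<c} \<longleftrightarrow> z \<in> {0<..<c}" for z
     by (cases "0 < z & z < top") (auto simp: indicator_def)
    have k: "0 < kern x z ==> 0 < (indicator Rpos z :: ennreal)" for z
     by (auto simp: kern_def split: if_splits)
    show ?thesis using that
    proof
     assume "M = M1" show ?thesis unfolding \<open>M = M1\<close> M1_def by (subst AE_density, simp, rule AE_I2, rule impI, rule t)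
    next
     assume "M = M2" show ?thesis unfolding \<open>M = M2\<close> M2_def by (subst AE_density, simp, rule AE_I2, rule impI, rule t, rule k)
    qed
   qed
  next
   have sM: "sets M = sets borel" using that s12 by (elim disjE) simp_all
   show "insert top {..<c} \<in> sets M" "{0<..<c} \<in> sets M" unfolding sM by simp_all
  qed
  moreover have "emeasure M1 {0<..<c} < top"
  proof (cases "0 < c")
   case True
   obtain C where C: "C < top" "!!x. good_start x ==> green (indicator {0<..c}) x <= C"
    using green_indicator_bounded[OF True c] by blast
   have "emeasure M1 {0<..<c} = green (%z. indicator {0<..<c} z * indicator Rpos z) x"
    using n1[of "indicator {0<..<c}"] s12 by simp
   also have "... <= 1 * green (indicator {0<..c}) x"
    by (rule green_cmult_le[OF _ st]) (auto simp: indicator_def)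
   also have "... <= C" using C(2)[OF good_start_fin[OF x(2)]] by simp
   finally show ?thesis using C(1) by (rule order_le_less_trans)
  next
   case False
   then have "c = 0" by (simp add: zero_less_iff_neq_zero)
   then have "{0<..<c} = {}" by auto
   then show ?thesis by simp
  qed
  ultimately show ?thesis by (auto simp: less_top[symmetric])
 qed
 have "M1 = M2"
 proof (rule measure_eqI_generator_eq[where E="(%c. insert top {..<c}) ` {..<top}" and \<Omega>=UNIV and A="%n. insert top {..<of_nat n}"])
  show "Int_stable ((%c. insert top {..<c::ennreal}) ` {..<top})"
  proof (rule Int_stableI)
   fix a b assume "a \<in> (%c. insert top {..<c::ennreal}) ` {..<top}" "b \<in> (%c. insert top {..<c::ennreal}) ` {..<top}"
   then obtain c d where "a = insert top {..<c}" "b = insert top {..<d}" "c < top" "d < top" by auto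
   then have "a \<inter> b = insert top {..<min c d}" "min c d < top" by (auto simp: min_def)
   then show "a \<inter> b \<in> (%c. insert top {..<c}) ` {..<top}" by blast
  qed
  show "sets M1 = sigma_sets UNIV ((%c. insert top {..<c}) ` {..<top})" "sets M2 = sigma_sets UNIV ((%c. insert top {..<c}) ` {..<top})"
   using s12 sets_borel_ennreal_eq by auto
  show "range (%n. insert top {..<of_nat n}) <= (%c. insert top {..<c::ennreal}) ` {..<top}" by (auto simp: of_nat_less_top)
  show "(\<Union>i. insert top {..<of_nat i :: ennreal}) = UNIV"
  proof (rule UNIV_eq_I[symmetric])
   fix x :: ennreal
   have "x = top \<or> (\<exists>n. x < of_nat n)" using ennreal_Ex_less_of_nat[of x] less_top[of x] by blast
   then show "x \<in> (\<Union>i. insert top {..<of_nat i})" by blast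
  qed
  show "emeasure M1 (insert top {..<of_nat i}) ~= \<infinity>" for i using *[OF of_nat_less_top] by blast
 qed (use * in auto)
 then show ?thesis using n1[of f] n2[of f] by simp
qed

end

section \<open>The Volterra operator and its Gronwall weight\<close>

context dmds_process
begin

definition scale_mass :: "ennreal => real" where
 "scale_mass y = enn2real (\<integral>\<^sup>+z. ennreal (sig z) * indicator {0<..<y} z \<partial>m)"

text \<open>The integral is the potential of \<open>(0,y)\<close> seen from \<open>y\<close>, where
  the kernel equals \<open>sig z\<close>. Its finiteness is Feller's condition that 0 is regular or
  exit.\<close>

lemma scale_mass_finite: "y < top ==> (\<integral>\<^sup>+z. ennreal (sig z) * indicator {0<..<y} z \<partial>m) < top"
proof (cases "0 < y")
 case True
 assume y: "y < top"
 obtain C where C: "C < top" "!!x. good_start x ==> green (indicator {0<..y}) x <= C"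
  using green_indicator_bounded[OF True y] by blast
 have "(\<integral>\<^sup>+z. ennreal (sig z) * indicator {0<..<y} z \<partial>m) = (\<integral>\<^sup>+z. kern y z * indicator {0<..<y} z \<partial>m)"
  using True y sig_mono by (intro nn_integral_cong) (auto simp: kern_def indicator_def min_absorb2 less_imp_le)
 also have "... = green (%z. indicator {0<..<y} z * indicator Rpos z) y"
  by (rule green_formula[symmetric, OF True y]) simp
 also have "... <= 1 * green (indicator {0<..y}) y"
  by (rule green_cmult_le) (auto simp: indicator_def fin_in_state[OF y])
 also have "... <= C" using C(2)[OF good_start_fin[OF y]] by simp
 finally show ?thesis using C(1) by (rule order_le_less_trans)
next
 case False
 then have "y = 0" by (simp add: zero_less_iff_neq_zero)
 then have "indicator {0<..<y} z = (0::ennreal)" for z by auto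
 then show ?thesis by simp
qed

lemma scale_mass_eq: "y < top ==> (\<integral>\<^sup>+z. ennreal (sig z) * indicator {0<..<y} z \<partial>m) = ennreal (scale_mass y)"
 using scale_mass_finite[of y] by (simp add: scale_mass_def ennreal_enn2real_if)

lemma scale_mass_nonneg [simp]: "0 <= scale_mass y"
 by (simp add: scale_mass_def)

lemma scale_mass_mono: "x <= y ==> y < top ==> scale_mass x <= scale_mass y"
 unfolding scale_mass_def by (intro enn2real_mono nn_integral_mono scale_mass_finite) (auto simp: indicator_def)

text \<open>The point \<open>top\<close> is set apart because \<open>scale_mass top\<close> may come
  from an infinite integral, which \<open>enn2real\<close> turns into 0.\<close>

definition weight :: "real => ennreal => real" where
 "weight c y = (if y = top then 0 else exp (c * scale_mass y))"

lemma weight_ge_1: "0 <= c ==> y < top ==> 1 <= weight c y"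
 by (auto simp: weight_def)

lemma weight_nonneg [simp]: "0 <= weight c y"
 by (simp add: weight_def)

lemma weight_mono: "0 <= c ==> x <= y ==> y < top ==> weight c x <= weight c y"
 using scale_mass_mono[of x y] by (auto simp: weight_def intro!: mult_left_mono order_le_less_trans) 

text \<open>By monotonicity the superlevel sets below \<open>top\<close> are intervals, with or
  without their infimum.\<close>

lemma scale_mass_measurable [measurable]: "(%y. if y = top then 0 else scale_mass y) \<in> borelm"
proof -
 have "{x. a < (if x = top then 0 else scale_mass x)} \<in> sets borel" for a
 proof -
  have "{x. x < top & a < scale_mass x} \<in> sets borel"
  proof -
   define A where "A = {x. x < top & a < scale_mass x}"
   have up: "y \<in> A" if "x \<in> A" "x <= y" "y < top" for x y
    using that scale_mass_mono[of x y] by (auto simp: A_def)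
   have "A = (if Inf A \<in> A then {Inf A..<top} else {Inf A<..<top})"
   proof (intro set_eqI iffI)
    fix x assume "x \<in> A"
    then have "Inf A <= x" "x < top" by (auto intro: Inf_lower simp: A_def)
    then show "x \<in> (if Inf A \<in> A then {Inf A..<top} else {Inf A<..<top})" using \<open>x \<in> A\<close> by (cases "x = Inf A") (auto simp: order_le_less)
   next
    fix x assume x: "x \<in> (if Inf A \<in> A then {Inf A..<top} else {Inf A<..<top})"
    show "x \<in> A"
    proof (cases "Inf A \<in> A")
     case True then show ?thesis using x up[of "Inf A" x] by auto
    next
     case False
     then have "Inf A < x" "x < top" using x by auto
     then have "\<exists>y\<in>A. y < x" by (simp add: Inf_less_iff)
     then show ?thesis using up \<open>x < top\<close> by (auto intro: less_imp_le)
    qed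
   qed
   moreover have "(if Inf A \<in> A then {Inf A..<top} else {Inf A<..<top}) \<in> sets (borel :: ennreal measure)" by simp
   ultimately show ?thesis unfolding A_def[symmetric] by metis
  qed
  moreover have "{x. a < (if x = top then 0 else scale_mass x)} = {x. x < top & a < scale_mass x} \<union> (if a < 0 then {top} else {})"
   by (auto simp: less_top split: if_splits)
  ultimately show ?thesis by simp
 qed
 then show ?thesis by (intro borel_measurableI_greater) simp
qed

lemma weight_measurable [measurable]: "weight c \<in> borelm"
proof -
 have "weight c = (%y. if y = top then 0 else exp (c * (if y = top then 0 else scale_mass y)))"
  by (auto simp: weight_def)
 also have "... \<in> borelm" by measurable
 finally show ?thesis .
qed

text \<open>The set is an interval ending at \<open>y\<close>. From any of its points
  \<open>z\<close> on, the mass is \<open>scale_mass y - scale_mass z\<close>, which is below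
  \<open>scale_mass y - t\<close>; an atom makes \<open>scale_mass\<close> jump over
  \<open>t\<close>, so equality may fail.\<close>

lemma scale_mass_superlevel:
 assumes y: "y < top" and t: "0 <= t"
 shows "(\<integral>\<^sup>+z. ennreal (sig z) * indicator {z. 0 < z & z < y & t < scale_mass z} z \<partial>m) <= ennreal (scale_mass y - t)"
proof -
 define M where "M = density m (%z. ennreal (sig z))"
 have sM: "sets M = sets borel" by (simp add: M_def sets_m)
 have eM: "emeasure M A = (\<integral>\<^sup>+z. ennreal (sig z) * indicator A z \<partial>m)" if "A \<in> sets borel" for A
  unfolding M_def using that by (intro emeasure_density) (auto simp: sets_m)
 define A where "A = {z. 0 < z & z < y & t < scale_mass z}"
 have seg: "emeasure M {z..<y} <= ennreal (scale_mass y - t)" if z: "z \<in> A" for z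
 proof -
  have zy: "0 < z" "z < y" "z < top" using z y by (auto simp: A_def intro: order_less_trans)
  have "emeasure M {0<..<z} + emeasure M {z..<y} = emeasure M ({0<..<z} \<union> {z..<y})"
   by (rule plus_emeasure) (auto simp: sM)
  also have "{0<..<z} \<union> {z..<y} = {0<..<y}" using zy by (auto intro: order_less_trans order_less_le_trans)
  finally have "ennreal (scale_mass z) + emeasure M {z..<y} = ennreal (scale_mass y)"
   using scale_mass_eq zy y by (simp add: eM)
  then have "emeasure M {z..<y} = ennreal (scale_mass y) - ennreal (scale_mass z)"
   by (metis ennreal_add_diff_cancel_left ennreal_neq_top)
  also have "... = ennreal (scale_mass y - scale_mass z)" by (simp add: ennreal_minus)
  also have "... <= ennreal (scale_mass y - t)" using z by (intro ennreal_leI) (auto simp: A_def)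
  finally show ?thesis .
 qed
 have up: "{z..<y} <= A" if "z \<in> A" for z
 proof
  fix x assume x: "x \<in> {z..<y}"
  then have "scale_mass z <= scale_mass x" using y by (intro scale_mass_mono) (auto intro: order_less_trans)
  then show "x \<in> A" using x that by (auto simp: A_def intro: order_less_le_trans)
 qed
 have "emeasure M A <= ennreal (scale_mass y - t)"
 proof (cases "A = {}")
  case False
  show ?thesis
  proof (cases "Inf A \<in> A")
   case True
   have "A <= {Inf A..<y}" by (auto intro: Inf_lower simp: A_def)
   then have "emeasure M A <= emeasure M {Inf A..<y}" by (rule emeasure_mono) (simp add: sM)
   with seg[OF True] show ?thesis by (rule order_trans[rotated])
  next
   case nA: False
   obtain u where u: "!!n. u n \<in> A" "u ----> Inf A"
    using Inf_as_limit[OF False] by blast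
   \<comment> \<open>Running minima turn a sequence that tends to the infimum into a decreasing one,
     so that the intervals increase.\<close>
   define v where "v n = Min (u ` {..n})" for n
   have vA: "v n \<in> A" for n
   proof -
    have "v n \<in> u ` {..n}" unfolding v_def by (rule Min_in) auto
    then show ?thesis using u(1) by auto
   qed
   have vd: "v k <= v n" if "n <= k" for n k unfolding v_def using that by (intro Min_antimono) auto
   have "A = (\<Union>n. {v n..<y})"
   proof
    show "(\<Union>n. {v n..<y}) <= A" using up[OF vA] by auto
    show "A <= (\<Union>n. {v n..<y})"
    proof
     fix a assume a: "a \<in> A"
     then have "Inf A < a" using nA Inf_lower[of a A] by (auto simp: order_le_less)
     from order_tendstoD(2)[OF u(2) this] obtain n where "u n < a" by (auto simp: eventually_sequentially)
     moreover have "v n <= u n" unfolding v_def by (rule Min_le) auto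
     ultimately have "a \<in> {v n..<y}" using a by (auto simp: A_def)
     then show "a \<in> (\<Union>n. {v n..<y})" by blast
    qed
   qed
   then have "emeasure M A = (SUP n. emeasure M {v n..<y})"
    using vd by (simp, subst SUP_emeasure_incseq) (auto simp: sM incseq_def intro: order_trans)
   also have "... <= ennreal (scale_mass y - t)" using seg[OF vA] by (rule SUP_least)
   finally show ?thesis .
  qed
 qed simp
 moreover have "A \<in> sets borel"
 proof -
  have "A = {z. 0 < z & z < y & t < (if z = top then 0 else scale_mass z)}" using y by (auto simp: A_def)
  also have "... \<in> sets borel" by measurable
  finally show ?thesis .
 qed
 ultimately show ?thesis by (simp add: eM A_def)
qed

text \<open>The Gronwall weight for the operator \<open>u \<mapsto> \<integral>\<^sub>0\<^sup>y (s y - s z) u z dm z\<close>. The measure may have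
 atoms, so \<open>exp (c F)\<close> with \<open>F\<close> the mass of \<open>(0,y)\<close> is only a supersolution: the layer cake formula
 reduces this to the bound above for the mass of \<open>{F > t}\<close>.\<close>

lemma weight_integral_bound:
 assumes c: "0 < c" and y: "y < top"
 shows "(\<integral>\<^sup>+z. ennreal (sig z * weight c z) * indicator {0<..<y} z \<partial>m) <= ennreal ((exp (c * scale_mass y) - 1) / c)"
proof -
 define F where "F z = (if z = top then 0 else scale_mass z)" for z
 have [measurable]: "F \<in> borelm" unfolding F_def[abs_def] by (rule scale_mass_measurable)
 define M where "M = density m (%z. ennreal (sig z) * indicator {0<..<y} z)"
 have sM [measurable_cong]: "sets M = sets borel" by (simp add: M_def sets_m)
 have nM: "(\<integral>\<^sup>+z. h z \<partial>M) = (\<integral>\<^sup>+z. ennreal (sig z) * indicator {0<..<y} z * h z \<partial>m)" if [measurable]: "h \<in> borelm" for h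
  unfolding M_def by (subst nn_integral_density) auto
 have "emeasure M UNIV = ennreal (scale_mass y)"
  using nM[of "%_. 1"] scale_mass_eq[OF y] sets_eq_imp_space_eq[OF sM] by simp
 then interpret M: finite_measure M using sets_eq_imp_space_eq[OF sM] by (intro finite_measureI) simp
 interpret P: pair_sigma_finite M lborel by standard
 let ?g = "%t. ennreal (c * exp (c * t))"
 have e: "ennreal (weight c z) = 1 + (\<integral>\<^sup>+t. ?g t * indicator {t. 0 <= t & t < F z} t \<partial>lborel)" if z: "z < top" for z
 proof -
  have "(\<integral>\<^sup>+t. ?g t * indicator {t. 0 <= t & t < F z} t \<partial>lborel) = (\<integral>\<^sup>+t. ?g t * indicator {0..F z} t \<partial>lborel)"
   by (rule nn_integral_cong_AE, rule AE_mp[OF AE_lborel_singleton[of "F z"]]) (auto simp: indicator_def)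
  also have "... = ennreal (exp (c * F z) - exp (c * 0))"
   by (rule nn_integral_FTC_Icc) (use c in \<open>auto intro!: derivative_eq_intros simp: F_def\<close>)
  finally show ?thesis using z c by (simp add: F_def weight_def flip: ennreal_1 ennreal_plus)
 qed
 have "(\<integral>\<^sup>+z. ennreal (sig z * weight c z) * indicator {0<..<y} z \<partial>m) = (\<integral>\<^sup>+z. ennreal (weight c z) \<partial>M)"
 proof -
  have "(\<integral>\<^sup>+z. ennreal (weight c z) \<partial>M) = (\<integral>\<^sup>+z. ennreal (sig z) * indicator {0<..<y} z * ennreal (weight c z) \<partial>m)"
   by (rule nM) measurable
  also have "... = (\<integral>\<^sup>+z. ennreal (sig z * weight c z) * indicator {0<..<y} z \<partial>m)"
  proof (rule nn_integral_cong)
   fix z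
   have "0 <= sig z" if "0 < z" "z < y" using that y sig_pos[of z] by (auto intro: order_less_trans less_imp_le)
   then show "ennreal (sig z) * indicator {0<..<y} z * ennreal (weight c z) = ennreal (sig z * weight c z) * indicator {0<..<y} z"
    by (auto simp: indicator_def ennreal_mult)
  qed
  finally show ?thesis ..
 qed
 also have "... = (\<integral>\<^sup>+z. 1 + (\<integral>\<^sup>+t. ?g t * indicator {t. 0 <= t & t < F z} t \<partial>lborel) \<partial>M)"
 proof (rule nn_integral_cong_AE)
  have "AE z in M. z < top" unfolding M_def using y
   by (subst AE_density) (auto intro!: AE_I2 simp: indicator_def split: if_splits)
  then show "AE z in M. ennreal (weight c z) = 1 + (\<integral>\<^sup>+t. ?g t * indicator {t. 0 <= t & t < F z} t \<partial>lborel)"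
   by eventually_elim (rule e)
 qed
 also have "... = ennreal (scale_mass y) + (\<integral>\<^sup>+z. (\<integral>\<^sup>+t. ?g t * indicator {t. 0 <= t & t < F z} t \<partial>lborel) \<partial>M)"
  by (subst nn_integral_add) (auto simp: indicator_def \<open>emeasure M UNIV = _\<close> sets_eq_imp_space_eq[OF sM])
 also have "(\<integral>\<^sup>+z. (\<integral>\<^sup>+t. ?g t * indicator {t. 0 <= t & t < F z} t \<partial>lborel) \<partial>M) =
   (\<integral>\<^sup>+t. (\<integral>\<^sup>+z. ?g t * indicator {t. 0 <= t & t < F z} t \<partial>M) \<partial>lborel)"
  by (rule P.Fubini'[symmetric]) (simp add: indicator_def case_prod_beta)
 also have "... <= (\<integral>\<^sup>+t. ennreal (c * exp (c * t) * (scale_mass y - t)) * indicator {0..scale_mass y} t \<partial>lborel)"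
 proof (rule nn_integral_mono)
  fix t :: real
  show "(\<integral>\<^sup>+z. ?g t * indicator {t. 0 <= t & t < F z} t \<partial>M) <= ennreal (c * exp (c * t) * (scale_mass y - t)) * indicator {0..scale_mass y} t"
  proof (cases "0 <= t")
   case t: True
   have eq: "(\<integral>\<^sup>+z. ?g t * indicator {t. 0 <= t & t < F z} t \<partial>M) = ?g t * (\<integral>\<^sup>+z. indicator {z. t < F z} z \<partial>M)"
    using t by (subst nn_integral_cmult[symmetric]) (auto intro!: nn_integral_cong simp: indicator_def)
   have "(\<integral>\<^sup>+z. indicator {z. t < F z} z \<partial>M) = (\<integral>\<^sup>+z. ennreal (sig z) * indicator {z. 0 < z & z < y & t < scale_mass z} z \<partial>m)"
    using y by (subst nM) (auto intro!: nn_integral_cong simp: indicator_def F_def)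
   also have "... <= ennreal (scale_mass y - t)" by (rule scale_mass_superlevel[OF y t])
   finally have 1: "(\<integral>\<^sup>+z. ?g t * indicator {t. 0 <= t & t < F z} t \<partial>M) <= ?g t * ennreal (scale_mass y - t)"
    unfolding eq by (rule mult_left_mono) simp
   show ?thesis
   proof (cases "t <= scale_mass y")
    case True
    then show ?thesis using 1 t c by (simp add: ennreal_mult[symmetric])
   next
    case False
    then have "ennreal (scale_mass y - t) = 0" by (simp add: ennreal_neg)
    then show ?thesis using 1 by simp
   qed
  qed simp
 qed
 \<comment> \<open>An antiderivative of \<open>c * exp (c * t) * (F - t)\<close> is
   \<open>exp (c * t) * (F - t) + exp (c * t) / c\<close>, where \<open>F\<close> stands for
   \<open>scale_mass y\<close>.\<close>
 also have "... = ennreal ((exp (c * scale_mass y) * (scale_mass y - scale_mass y) + exp (c * scale_mass y) / c) - (exp (c * 0) * (scale_mass y - 0) + exp (c * 0) / c))"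
  by (rule nn_integral_FTC_Icc) (use c in \<open>auto intro!: derivative_eq_intros simp: field_simps\<close>)
 also have "ennreal (scale_mass y) + ... = ennreal ((exp (c * scale_mass y) - 1) / c)"
 proof -
  have "c * scale_mass y <= exp (c * scale_mass y) - 1" using exp_ge_add_one_self[of "c * scale_mass y"] by linarith
  then have "c * scale_mass y / c <= (exp (c * scale_mass y) - 1) / c" using c by (intro divide_right_mono) auto
  then have "0 <= exp (c * scale_mass y) / c - scale_mass y - 1 / c" using c by (simp add: diff_divide_distrib)
  then show ?thesis using c by (simp add: diff_divide_distrib flip: ennreal_plus)
 qed
 finally show ?thesis by simp
qed

end

context dmds_process
begin

text \<open>The class in which the Volterra equation is solved: growth at most like
  \<open>sig\<close> on bounded intervals. Such functions are \<open>m\<close>-integrable near 0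
  because \<open>sig\<close> is.\<close>

definition sig_bounded :: "(ennreal => real) => bool" where
 "sig_bounded u \<longleftrightarrow> u \<in> borelm & (\<forall>y<top. \<exists>B. \<forall>z. 0 < z & z <= y --> \<bar>u z\<bar> <= B * sig z)"

lemma sig_boundedD:
 assumes "sig_bounded u" "y < top"
 obtains B where "0 <= B" "!!z. 0 < z ==> z <= y ==> \<bar>u z\<bar> <= B * sig z"
proof -
 obtain B where B: "!!z. 0 < z ==> z <= y ==> \<bar>u z\<bar> <= B * sig z" using assms unfolding sig_bounded_def by blast
 show ?thesis
 proof (rule that[of "\<bar>B\<bar>"])
  fix z assume z: "0 < z" "z <= y"
  then have "0 < sig z" using assms(2) by (intro sig_pos) (auto intro: order_le_less_trans)
  then have "B * sig z <= \<bar>B\<bar> * sig z" by (intro mult_right_mono) auto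
  then show "\<bar>u z\<bar> <= \<bar>B\<bar> * sig z" using B[OF z] by linarith
 qed simp
qed

lemma sig_integrable: "y < top ==> set_integrable m {0<..y} sig"
proof -
 assume y: "y < top"
 obtain b where b: "y < b" "b < top" using y dense by blast
 have "(\<integral>\<^sup>+z. ennreal (norm (indicat_real {0<..y} z *\<^sub>R sig z)) \<partial>m) <= (\<integral>\<^sup>+z. ennreal (sig z) * indicator {0<..<b} z \<partial>m)"
 proof (rule nn_integral_mono)
  fix z
  show "ennreal (norm (indicat_real {0<..y} z *\<^sub>R sig z)) <= ennreal (sig z) * indicator {0<..<b} z"
  proof (cases "0 < z & z <= y")
   case True
   then have "z < b" "z < top" using b y by (auto intro: order_le_less_trans)
   then show ?thesis using True sig_pos[of z] by simp
  qed auto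
 qed
 also have "... < top" by (rule scale_mass_finite[OF b(2)])
 finally have "(\<integral>\<^sup>+z. ennreal (norm (indicat_real {0<..y} z *\<^sub>R sig z)) \<partial>m) < \<infinity>" by simp
 then show ?thesis unfolding set_integrable_def by (intro integrableI_bounded) (auto simp: sets_m)
qed

lemma sig_bounded_loc_int:
 assumes u: "sig_bounded u"
 shows "loc_int u"
 unfolding loc_int_def
proof (intro allI impI)
 fix x :: ennreal assume x: "x < top"
 obtain B where B: "0 <= B" "!!z. 0 < z ==> z <= x ==> \<bar>u z\<bar> <= B * sig z" using sig_boundedD[OF u x] by blast
 have [measurable]: "u \<in> borelm" using u by (simp add: sig_bounded_def)
 have [measurable]: "s \<in> borelm" by (rule borel_measurable_continuous_Ioo[OF s_cont])
 have i: "integrable m (%z. indicat_real {0<..x} z * sig z)" using sig_integrable[OF x] by (simp add: set_integrable_def)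
 have pos': "0 < sig z" if "0 < z" "z <= x" for z using that x by (intro sig_pos) (auto intro: order_le_less_trans)
 have "set_integrable m {0<..x} u" unfolding set_integrable_def
 proof (rule Bochner_Integration.integrable_bound[OF integrable_mult_right[OF i, of B]])
  show "AE z in m. norm (indicat_real {0<..x} z *\<^sub>R u z) <= norm (B * (indicat_real {0<..x} z * sig z))"
  proof (rule AE_I2)
   fix z show "norm (indicat_real {0<..x} z *\<^sub>R u z) <= norm (B * (indicat_real {0<..x} z * sig z))"
    using B(1) B(2)[of z] pos'[of z] by (cases "0 < z & z <= x") (auto simp: abs_mult)
  qed
 qed measurable
 moreover have "set_integrable m {0<..x} (%z. s z * u z)" unfolding set_integrable_def
 proof (rule Bochner_Integration.integrable_bound[OF integrable_mult_right[OF i, of "(\<bar>s0\<bar> + \<bar>s x\<bar>) * B"]])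
  show "AE z in m. norm (indicat_real {0<..x} z *\<^sub>R (s z * u z)) <= norm ((\<bar>s0\<bar> + \<bar>s x\<bar>) * B * (indicat_real {0<..x} z * sig z))"
  proof (rule AE_I2)
   fix z show "norm (indicat_real {0<..x} z *\<^sub>R (s z * u z)) <= norm ((\<bar>s0\<bar> + \<bar>s x\<bar>) * B * (indicat_real {0<..x} z * sig z))"
   proof (cases "0 < z & z <= x")
    case True
    then have "s0 <= s z" "s z <= s x" using pos'[of z] x by (auto intro!: s_le simp: sig_def)
    then have "\<bar>s z\<bar> <= \<bar>s0\<bar> + \<bar>s x\<bar>" by linarith
    then have "\<bar>s z\<bar> * \<bar>u z\<bar> <= (\<bar>s0\<bar> + \<bar>s x\<bar>) * (B * sig z)" using B(2)[of z] True by (intro mult_mono) auto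
    then show ?thesis using True B(1) pos'[of z] by (auto simp: abs_mult)
   qed auto
  qed
 qed measurable
 ultimately show "set_integrable m {0<..x} u & set_integrable m {0<..x} (%z. s z * u z)" by simp
qed

text \<open>The factor \<open>s y - s z\<close> is at most \<open>sig y\<close>; what remains is
  \<open>weight_integral_bound\<close>, whose \<open>1 / c\<close> is the gain that makes a large
  \<open>c\<close> produce a contraction.\<close>

lemma primitive2_weight:
 assumes u: "u \<in> borelm" and y: "0 < y" "y < top" and c: "0 < c" and B: "0 <= B"
  and ub: "!!z. 0 < z ==> z <= y ==> \<bar>u z\<bar> <= B * (sig z * weight c z)"
 shows "\<bar>primitive2 u y\<bar> <= B / c * (sig y * weight c y)"
proof -
 note [measurable] = u
 have [measurable]: "s \<in> borelm" by (rule borel_measurable_continuous_Ioo[OF s_cont])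
 have sy: "0 < sig y" by (rule sig_pos[OF y])
 have "ennreal \<bar>primitive2 u y\<bar> <= (\<integral>\<^sup>+z. ennreal \<bar>indicat_real {0<..y} z * ((s y - s z) * u z)\<bar> \<partial>m)"
 proof (cases "integrable m (%z. indicat_real {0<..y} z * ((s y - s z) * u z))")
  case True
  then show ?thesis unfolding primitive2_def set_lebesgue_integral_def
   using integral_norm_bound_ennreal[OF True] by simp
 next
  \<comment> \<open>The Bochner integral of a function that is not integrable is 0.\<close>
  case False
  then show ?thesis unfolding primitive2_def set_lebesgue_integral_def by (simp add: not_integrable_integral_eq)
 qed
 also have "... <= (\<integral>\<^sup>+z. ennreal (sig y * B) * (ennreal (sig z * weight c z) * indicator {0<..<y} z) \<partial>m)"
 proof (rule nn_integral_mono)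
  fix z
  show "ennreal \<bar>indicat_real {0<..y} z * ((s y - s z) * u z)\<bar> <= ennreal (sig y * B) * (ennreal (sig z * weight c z) * indicator {0<..<y} z)"
  proof (cases "0 < z & z < y")
   case True
   then have z: "z < top" using y by (auto intro: order_less_trans)
   have sz: "0 < sig z" "sig z <= sig y" using sig_pos[of z] sig_mono[of z y] True y z by auto
   have "\<bar>(s y - s z) * u z\<bar> <= sig y * (B * (sig z * weight c z))"
    unfolding abs_mult using True sz ub[of z] by (intro mult_mono) (auto simp: sig_def)
   moreover have "z \<in> {0<..y}" using True by auto
   ultimately show ?thesis using True sz sy B by (simp add: ennreal_mult[symmetric] ennreal_leI mult.assoc)
  next
   case False
   then have e: "indicat_real {0<..y} z * ((s y - s z) * u z) = 0" by (auto simp: indicator_def order_le_less)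
   show ?thesis unfolding e by simp
  qed
 qed
 also have "... = ennreal (sig y * B) * (\<integral>\<^sup>+z. ennreal (sig z * weight c z) * indicator {0<..<y} z \<partial>m)"
  by (rule nn_integral_cmult) simp
 also have "... <= ennreal (sig y * B) * ennreal ((exp (c * scale_mass y) - 1) / c)"
  by (intro mult_left_mono weight_integral_bound c y) simp
 also have "... <= ennreal (sig y * B) * ennreal (weight c y / c)"
  using c y by (intro mult_left_mono ennreal_leI) (auto simp: weight_def divide_right_mono)
 also have "... = ennreal (B / c * (sig y * weight c y))"
  using sy B c by (subst ennreal_mult[symmetric]) (auto simp: field_simps)
 finally show ?thesis using sy B c by (subst (asm) ennreal_le_iff) auto
qed

lemma primitive2_sub:
 assumes "loc_int u" "loc_int v" "y < top"
 shows "primitive2 (%z. u z - v z) y = primitive2 u y - primitive2 v y"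
 using loc_intD(3)[OF assms(1,3), of "{0<..y}" "s y"] loc_intD(3)[OF assms(2,3), of "{0<..y}" "s y"]
 unfolding primitive2_def by (subst set_integral_diff(2)[symmetric]) (auto simp: right_diff_distrib)

lemma primitive2_measurable:
 assumes "sig_bounded u" shows "(%y. if y \<in> Rpos then primitive2 u y else 0) \<in> borelm"
proof (rule borel_measurable_continuous_Ioo)
 have "continuous_on Rpos (primitive2 u)"
  using dmds_primitive2[OF sig_bounded_loc_int[OF assms]] by (simp add: dmds_def)
 then show "continuous_on Rpos (%y. if y \<in> Rpos then primitive2 u y else 0)"
  by (rule continuous_on_eq) auto
qed

lemma real_recursion_tendsto_0:
 fixes a e :: "nat => real"
 assumes a: "!!n. 0 <= a n" "!!n. a (Suc n) <= e n + a n / 2" and e: "e ----> 0"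
 shows "a ----> 0"
proof (rule LIMSEQ_I)
 fix r :: real assume r: "0 < r"
 obtain N where N: "!!n. n \<ge> N ==> norm (e n) < r / 4"
  using LIMSEQ_D[OF e, of "r / 4"] r by auto
 have b: "a (N + k) <= r / 2 + a N * (1/2)^k" for k
 proof (induction k)
  case (Suc k)
  have "e (N + k) < r / 4" using N[of "N + k"] by auto
  then have "a (N + Suc k) <= r / 4 + (r / 2 + a N * (1/2)^k) / 2"
  proof -
   have x: "p <= r / 4 + (r / 2 + X) / 2" if "p <= q + t / 2" "q < r / 4" "t <= r / 2 + X" for p q t X :: real
    using that by (simp add: field_simps)
   show ?thesis unfolding add_Suc_right by (rule x[OF a(2)]) (use Suc.IH \<open>e (N + k) < r / 4\<close> in auto)
  qed
  also have "... = r / 2 + a N * (1/2)^Suc k" by (simp add: add_divide_distrib)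
  finally show ?case .
 qed (use r in simp)
 have "(%k. a N * (1/2)^k) ----> a N * 0" by (intro tendsto_intros LIMSEQ_power_zero) simp
 then have "\<forall>\<^sub>F k in sequentially. a N * (1/2)^k < r / 2" using r by (intro order_tendstoD(2)) auto
 then obtain K where K: "!!k. k \<ge> K ==> a N * (1/2)^k < r / 2" by (auto simp: eventually_sequentially)
 show "\<exists>no. \<forall>n\<ge>no. norm (a n - 0) < r"
 proof (intro exI[of _ "N + K"] allI impI)
  fix n assume n: "N + K <= n"
  then obtain k where k: "n = N + k" "K <= k" by (metis add.assoc le_Suc_ex le_add1)
  show "norm (a n - 0) < r" using b[of k] K[OF k(2)] a(1)[of n] k by simp
 qed
qed

text \<open>In the norm \<open>sup |u|/(sig weight)\<close> the operator \<open>l primitive2\<close> is a contraction with factor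
 \<open>1/2\<close>, so solutions of perturbed recursions converge to the fixed point.\<close>

lemma volterra_convergence:
 assumes l: "0 < l" and v: "sig_bounded v" "!!y. 0 < y ==> y < top ==> v y = l * (sig y - primitive2 v y)"
  and w: "!!n. w n \<in> borelm" "!!n y. 0 < y ==> y < top ==> w (Suc n) y = rt n * (sig y - primitive2 (w n) y)"
  and bd: "!!y. y < top ==> \<exists>B. \<forall>n z. 0 < z & z <= y --> \<bar>w n z\<bar> <= B * sig z"
  and rt: "rt ----> l" and y: "0 < y" "y < top"
 shows "(%n. w n y) ----> v y"
proof -
 \<comment> \<open>By \<open>primitive2_weight\<close> the operator \<open>l primitive2\<close> has
   norm at most \<open>l / c\<close>.\<close>
 define c where "c = 2 * l"
 have c: "0 < c" using l by (simp add: c_def)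
 have sp: "0 < sig z" if "0 < z" "z <= y" for z using that y by (intro sig_pos) (auto intro: order_le_less_trans)
 have wg: "1 <= weight c z" if "z <= y" for z using that y c by (intro weight_ge_1) (auto intro: order_le_less_trans)
 obtain B where B: "0 <= B" "!!z. 0 < z ==> z <= y ==> \<bar>v z\<bar> <= B * sig z" using sig_boundedD[OF v(1) y(2)] by blast
 obtain B' where B': "!!n z. 0 < z ==> z <= y ==> \<bar>w n z\<bar> <= B' * sig z" using bd[OF y(2)] by blast
 have wsb: "sig_bounded (w n)" for n using w(1)[of n] bd unfolding sig_bounded_def by meson
 have B'0: "0 <= B'"
 proof (rule ccontr)
  assume "\<not> 0 <= B'"
  then have "B' * sig y < 0" using sp[OF y(1) order_refl] by (simp add: mult_neg_pos)
  then show False using B'[OF y(1) order_refl, of 0] by linarith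
 qed
 have sw: "sig z <= sig z * weight c z" if "0 < z" "z <= y" for z
  using mult_left_mono[OF wg[OF that(2)], of "sig z"] sp[OF that] by simp
 define e where "e n = \<bar>rt n - l\<bar> * (1 + B' / c)" for n
 \<comment> \<open>A numerical majorant of the weighted distance between \<open>w n\<close> and
   \<open>v\<close>: the error of the factor enters through \<open>e\<close>, the rest is
   halved.\<close>
 define a where "a = rec_nat (B + B') (%n x. e n + x / 2)"
 have a0: "a 0 = B + B'" and aS: "a (Suc n) = e n + a n / 2" for n by (simp_all add: a_def)
 have e0: "0 <= e n" for n using B'0 c by (auto simp: e_def)
 have an: "0 <= a n" for n by (induction n) (use e0 B B'0 in \<open>auto simp: a0 aS\<close>)
 have key: "\<bar>w n z - v z\<bar> <= a n * (sig z * weight c z)" if z: "0 < z" "z <= y" for n z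
  using z
 proof (induction n arbitrary: z)
  case 0
  have "\<bar>w 0 z - v z\<bar> <= (B + B') * sig z" using B(2)[OF 0] B'[OF 0, of 0] by (simp add: algebra_simps)
  also have "... <= (B + B') * (sig z * weight c z)" using sw[OF 0] B(1) B'0 by (intro mult_left_mono) auto
  finally show ?case by (simp add: a0)
 next
  case (Suc n)
  have zt: "z < top" using Suc.prems y by (auto intro: order_le_less_trans)
  have le: "x <= y" if "x <= z" for x by (rule order_trans[OF that Suc.prems(2)])
  have d1: "\<bar>primitive2 (w n) z\<bar> <= B' / c * (sig z * weight c z)"
  proof (rule primitive2_weight[OF w(1) Suc.prems(1) zt c B'0])
   fix x assume x: "0 < x" "x <= z"
   have "\<bar>w n x\<bar> <= B' * sig x" using x le by (intro B') auto
   also have "... <= B' * (sig x * weight c x)" using sw[OF x(1) le[OF x(2)]] B'0 by (intro mult_left_mono) auto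
   finally show "\<bar>w n x\<bar> <= B' * (sig x * weight c x)" .
  qed
  have d2: "\<bar>primitive2 (%x. w n x - v x) z\<bar> <= a n / c * (sig z * weight c z)"
  proof (rule primitive2_weight[OF _ Suc.prems(1) zt c an])
   show "(%x. w n x - v x) \<in> borelm" using w(1)[of n] v(1) by (intro borel_measurable_diff) (simp_all add: sig_bounded_def)
  qed (use Suc.IH le in auto)
  have "w (Suc n) z - v z = (rt n - l) * (sig z - primitive2 (w n) z) - l * primitive2 (%x. w n x - v x) z"
   unfolding w(2)[OF Suc.prems(1) zt] v(2)[OF Suc.prems(1) zt]
    primitive2_sub[OF sig_bounded_loc_int[OF wsb] sig_bounded_loc_int[OF v(1)] zt]
   by (simp add: algebra_simps)
  also have "\<bar>...\<bar> <= \<bar>rt n - l\<bar> * (sig z + \<bar>primitive2 (w n) z\<bar>) + l * \<bar>primitive2 (%x. w n x - v x) z\<bar>"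
  proof -
   have "\<bar>(rt n - l) * (sig z - primitive2 (w n) z)\<bar> <= \<bar>rt n - l\<bar> * (sig z + \<bar>primitive2 (w n) z\<bar>)"
    unfolding abs_mult using sp[OF Suc.prems] by (intro mult_left_mono) auto
   moreover have "\<bar>l * primitive2 (%x. w n x - v x) z\<bar> = l * \<bar>primitive2 (%x. w n x - v x) z\<bar>" using l by (simp add: abs_mult)
   ultimately show ?thesis by linarith
  qed
  also have "... <= \<bar>rt n - l\<bar> * (sig z * weight c z + B' / c * (sig z * weight c z)) + l * (a n / c * (sig z * weight c z))"
   using d1 d2 sw[OF Suc.prems] l by (intro add_mono mult_left_mono) auto
  also have "... = a (Suc n) * (sig z * weight c z)"
   using l unfolding aS e_def c_def by (simp add: field_simps)
  finally show ?case .
 qed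
 have "(%n. \<bar>rt n - l\<bar> * (1 + B' / c)) ----> \<bar>l - l\<bar> * (1 + B' / c)" by (intro tendsto_intros rt)
 then have "e ----> 0" by (simp add: e_def[abs_def])
 then have "a ----> 0" using an aS by (intro real_recursion_tendsto_0[of a e]) auto
 then have "(%n. a n * (sig y * weight c y)) ----> 0" by (rule tendsto_mult_left_zero)
 then have "(%n. w n y - v y) ----> 0"
  by (rule Lim_null_comparison[rotated]) (use key[OF y(1) order_refl] in auto)
 then show ?thesis by (rule LIM_zero_cancel)
qed

text \<open>A second solution is a constant sequence that satisfies the recursion, so it converges
  to the first.\<close>

lemma volterra_unique:
 assumes "0 < l" "sig_bounded v" "!!y. 0 < y ==> y < top ==> v y = l * (sig y - primitive2 v y)"
  "sig_bounded w" "!!y. 0 < y ==> y < top ==> w y = l * (sig y - primitive2 w y)" "0 < y" "y < top"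
 shows "w y = v y"
proof -
 have "(%n::nat. w y) ----> v y"
  by (rule volterra_convergence[where w="%_. w" and rt="%_. l", OF assms(1-3)])
   (use assms in \<open>auto simp: sig_bounded_def\<close>)
 then show ?thesis by (simp add: LIMSEQ_const_iff)
qed

text \<open>Picard iteration from 0. In the weighted norm the first increment is at most
  \<open>l\<close> and each further one is halved, whence the uniform bound
  \<open>2 * l\<close>.\<close>

lemma volterra_exists:
 assumes l: "0 < l"
 shows "\<exists>v. sig_bounded v & (\<forall>y. 0 < y & y < top --> v y = l * (sig y - primitive2 v y))"
proof -
 define c where "c = 2 * l"
 have c: "0 < c" using l by (simp add: c_def)
 have sp: "0 < sig z" if "0 < z" "z < top" for z using that by (intro sig_pos) auto
 have wg: "1 <= weight c z" if "z < top" for z using that c by (intro weight_ge_1) auto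
 have sw: "sig z <= sig z * weight c z" if "0 < z" "z < top" for z
  using mult_left_mono[OF wg[OF that(2)], of "sig z"] sp[OF that] by simp
 define T where "T u y = (if y \<in> Rpos then l * (sig y - primitive2 u y) else 0)" for u y
 define u where "u = rec_nat (%_. 0) (%_. T)"
 have u0: "u 0 = (%_. 0)" and uS: "u (Suc n) = T (u n)" for n by (simp_all add: u_def)
 have bound_sb: "sig_bounded f" if f: "f \<in> borelm" "!!z. 0 < z ==> z < top ==> \<bar>f z\<bar> <= B * (sig z * weight c z)" "0 <= B" for f B
  unfolding sig_bounded_def
 proof (intro conjI allI impI f(1))
  fix y :: ennreal assume y: "y < top"
  show "\<exists>B. \<forall>z. 0 < z & z <= y --> \<bar>f z\<bar> <= B * sig z"
  proof (intro exI[of _ "B * weight c y"] allI impI)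
   fix z assume z: "0 < z & z <= y"
   then have zt: "z < top" using y by (auto intro: order_le_less_trans)
   have "\<bar>f z\<bar> <= B * (sig z * weight c z)" using f(2) z zt by auto
   also have "... <= B * (sig z * weight c y)"
    using z y c sp[of z] zt f(3) by (intro mult_left_mono weight_mono) auto
   finally show "\<bar>f z\<bar> <= B * weight c y * sig z" by (simp add: mult_ac)
  qed
 qed
 have main: "u n \<in> borelm & (\<forall>z. 0 < z & z < top --> \<bar>u n z\<bar> <= 2 * l * (sig z * weight c z)) &
   (\<forall>z. 0 < z & z < top --> \<bar>u (Suc n) z - u n z\<bar> <= l * (1/2)^n * (sig z * weight c z))" for n
 proof (induction n)
  case 0
  have "primitive2 (%_. 0) y = 0" for y by (simp add: primitive2_def set_lebesgue_integral_def)
  then show ?case using l sp sw by (auto simp: u0 uS T_def abs_mult less_imp_le)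
 next
  case (Suc n)
  have sbn: "sig_bounded (u n)" by (rule bound_sb[where B="2 * l"]) (use Suc l in auto)
  have m: "u (Suc n) \<in> borelm"
  proof -
   have "u (Suc n) = (%y. if y \<in> Rpos then l * (sig y - (if y \<in> Rpos then primitive2 (u n) y else 0)) else 0)"
    by (auto simp: uS T_def)
   also have "... \<in> borelm" using primitive2_measurable[OF sbn] by measurable
   finally show ?thesis .
  qed
  have b: "\<bar>u (Suc n) z\<bar> <= 2 * l * (sig z * weight c z)" if z: "0 < z" "z < top" for z
  proof -
   have "\<bar>primitive2 (u n) z\<bar> <= 2 * l / c * (sig z * weight c z)"
    by (rule primitive2_weight) (use z c l Suc in \<open>auto intro: order_le_less_trans\<close>)
   then have "\<bar>primitive2 (u n) z\<bar> <= sig z * weight c z" using l by (simp add: c_def)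
   then have "\<bar>sig z - primitive2 (u n) z\<bar> <= 2 * (sig z * weight c z)" using sw[OF z] sp[OF z] by linarith
   then have "l * \<bar>sig z - primitive2 (u n) z\<bar> <= l * (2 * (sig z * weight c z))" using l by (intro mult_left_mono) auto
   then show ?thesis using l z by (simp add: uS T_def abs_mult)
  qed
  have sbS: "sig_bounded (u (Suc n))" by (rule bound_sb[where B="2 * l"]) (use m b l in auto)
  have "\<bar>u (Suc (Suc n)) z - u (Suc n) z\<bar> <= l * (1/2)^(Suc n) * (sig z * weight c z)" if z: "0 < z" "z < top" for z
  proof -
   have d: "\<bar>primitive2 (%x. u (Suc n) x - u n x) z\<bar> <= l * (1/2)^n / c * (sig z * weight c z)"
    by (rule primitive2_weight) (use z c l Suc m in \<open>auto intro: order_le_less_trans\<close>)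
   have "u (Suc (Suc n)) z - u (Suc n) z = - l * primitive2 (%x. u (Suc n) x - u n x) z"
    using z unfolding uS[of "Suc n"] primitive2_sub[OF sig_bounded_loc_int[OF sbS] sig_bounded_loc_int[OF sbn] z(2)]
    by (simp add: T_def uS[of n] algebra_simps)
   then have "\<bar>u (Suc (Suc n)) z - u (Suc n) z\<bar> = l * \<bar>primitive2 (%x. u (Suc n) x - u n x) z\<bar>" using l by (simp add: abs_mult)
   also have "... <= l * (l * (1/2)^n / c * (sig z * weight c z))" by (rule mult_left_mono[OF d]) (use l in simp)
   finally have "\<bar>u (Suc (Suc n)) z - u (Suc n) z\<bar> <= l * (l * (1/2)^n / c * (sig z * weight c z))" .
   then show ?thesis using l by (simp add: c_def field_simps)
  qed
  then show ?case using m b by blast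
 qed
 have um [measurable]: "u n \<in> borelm" for n using main by blast
 have ub: "\<bar>u n z\<bar> <= 2 * l * (sig z * weight c z)" if "0 < z" "z < top" for n z using main that by blast
 have sbn: "sig_bounded (u n)" for n by (rule bound_sb[where B="2 * l"]) (use ub l in auto)
 have conv: "convergent (%n. u n z)" for z
 proof (cases "z \<in> Rpos")
  case True
  have "summable (%n. u (Suc n) z - u n z)"
  proof (rule summable_comparison_test'[where N=0])
   show "summable (%n. l * (1/2)^n * (sig z * weight c z))"
    by (intro summable_mult summable_mult2 summable_geometric) simp
   show "norm (u (Suc n) z - u n z) <= l * (1/2)^n * (sig z * weight c z)" for n using main True by auto
  qed
  moreover have "(\<Sum>i<n. u (Suc i) z - u i z) = u n z" for n
   using sum_lessThan_telescope[of "%i. u i z" n] by (simp add: u0)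
  ultimately show ?thesis using summable_LIMSEQ[of "%n. u (Suc n) z - u n z"]
   by (auto simp: convergent_def)
 next
  case False
  then have "u n z = 0" for n by (cases n) (auto simp: u0 uS T_def)
  then show ?thesis by (simp add: convergent_const)
 qed
 define v where "v z = lim (%n. u n z)" for z
 have vl: "(%n. u n z) ----> v z" for z using conv unfolding v_def convergent_LIMSEQ_iff by blast
 have vm [measurable]: "v \<in> borelm"
  by (rule borel_measurable_LIMSEQ_real[OF _ um]) (use vl in auto)
 have vb: "\<bar>v z\<bar> <= 2 * l * (sig z * weight c z)" if "0 < z" "z < top" for z
  by (rule LIMSEQ_le_const2[OF tendsto_rabs[OF vl]]) (use ub[OF that] in auto)
 have sbv: "sig_bounded v" by (rule bound_sb[where B="2 * l"]) (use vb l in auto)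
 have uv: "\<bar>u n z - v z\<bar> <= 2 * l * (1/2)^n * (sig z * weight c z)" if z: "0 < z" "z < top" for n z
 proof -
  \<comment> \<open>The coefficient is the geometric sum of the increments from \<open>n\<close> to
    \<open>n + k\<close>.\<close>
  have "\<bar>u n z - u (n + k) z\<bar> <= 2 * l * ((1/2)^n - (1/2)^(n + k)) * (sig z * weight c z)" for k
  proof (induction k)
   case (Suc k)
   have "\<bar>u (Suc (n + k)) z - u (n + k) z\<bar> <= l * (1/2)^(n + k) * (sig z * weight c z)" using main z by blast
   then show ?case using Suc by (simp add: algebra_simps abs_if split: if_splits)
  qed simp
  moreover have "2 * l * ((1/2)^n - (1/2)^(n + k)) * (sig z * weight c z) <= 2 * l * (1/2)^n * (sig z * weight c z)" for k
   using l sp[OF z] by (intro mult_right_mono mult_left_mono) auto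
  ultimately have "\<bar>u n z - u (n + k) z\<bar> <= 2 * l * (1/2)^n * (sig z * weight c z)" for k by (meson order_trans)
  moreover have "(%k. \<bar>u n z - u (n + k) z\<bar>) ----> \<bar>u n z - v z\<bar>"
   using LIMSEQ_ignore_initial_segment[OF vl[of z], of n] by (intro tendsto_intros) (simp add: add.commute)
  ultimately show ?thesis by (intro LIMSEQ_le_const2) auto
 qed
 have "v y = l * (sig y - primitive2 v y)" if y: "0 < y" "y < top" for y
 proof -
  have "(%n. primitive2 (u n) y - primitive2 v y) ----> 0"
  proof (rule Lim_null_comparison)
   have "(%n. 2 * l * (1/2)^n / c * (sig y * weight c y)) ----> 2 * l * 0 / c * (sig y * weight c y)"
    using c by (intro tendsto_intros LIMSEQ_power_zero) auto
   then show "(%n. 2 * l * (1/2)^n / c * (sig y * weight c y)) ----> 0" by simp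
   show "\<forall>\<^sub>F n in sequentially. norm (primitive2 (u n) y - primitive2 v y) <= 2 * l * (1/2)^n / c * (sig y * weight c y)"
   proof (intro always_eventually allI)
    fix n
    have "\<bar>primitive2 (%x. u n x - v x) y\<bar> <= 2 * l * (1/2)^n / c * (sig y * weight c y)"
     by (rule primitive2_weight) (use y c l uv in \<open>auto intro: order_le_less_trans\<close>)
    then show "norm (primitive2 (u n) y - primitive2 v y) <= 2 * l * (1/2)^n / c * (sig y * weight c y)"
     by (simp add: primitive2_sub[OF sig_bounded_loc_int[OF sbn] sig_bounded_loc_int[OF sbv] y(2)])
   qed
  qed
  then have "(%n. primitive2 (u n) y) ----> primitive2 v y" by (rule LIM_zero_cancel)
  then have "(%n. l * (sig y - primitive2 (u n) y)) ----> l * (sig y - primitive2 v y)" by (intro tendsto_intros)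
  then have "(%n. u (Suc n) y) ----> l * (sig y - primitive2 v y)" using y by (simp add: uS T_def)
  then show ?thesis using LIMSEQ_unique[OF LIMSEQ_Suc[OF vl]] by blast
 qed
 then show ?thesis using sbv by blast
qed

end

section \<open>The function psi as the solution of the Volterra equation\<close>

context dmds_process
begin

lemma dmds_cong:
 fixes u u' :: "ennreal => real"
 assumes d: "dmds m s u D g" and u: "!!x. 0 < x ==> x < top ==> u x = u' x" and g: "!!x. 0 < x ==> x < top ==> g x = g' x"
 shows "dmds m s u' D g'"
 unfolding dmds_def
proof (intro conjI allI impI)
 have "continuous_on Rpos u" using d by (simp add: dmds_def)
 then show "continuous_on Rpos u'" by (rule continuous_on_eq) (use u in auto)
 show "has_right_sderiv s u' D" unfolding has_right_sderiv_def
 proof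
  fix x assume x: "x \<in> {0<..<top::ennreal}"
  have "((%y. (u y - u x) /\<^sub>R (s y - s x)) \<longlongrightarrow> D x) (at_right x)" using d x by (simp add: dmds_def has_right_sderiv_def)
  moreover have "\<forall>\<^sub>F y in at_right x. (u y - u x) /\<^sub>R (s y - s x) = (u' y - u' x) /\<^sub>R (s y - s x)"
  proof (subst eventually_at_right[of x top], use x in simp, intro exI[of _ top] conjI allI impI)
   fix y assume "x < y" "y < top"
   then show "(u y - u x) /\<^sub>R (s y - s x) = (u' y - u' x) /\<^sub>R (s y - s x)" using u[of y] u[of x] x by (auto intro: order_less_trans)
  qed (use x in auto)
  ultimately show "((%y. (u' y - u' x) /\<^sub>R (s y - s x)) \<longlongrightarrow> D x) (at_right x)" by (rule Lim_transform_eventually)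
 qed
 fix x y :: ennreal assume xy: "0 < x" "x <= y" "y < top"
 have i: "set_integrable m {x<..y} g" "D y - D x = (LINT z:{x<..y}|m. g z)" using d xy by (auto simp: dmds_def)
 have e: "indicat_real {x<..y} z *\<^sub>R g z = indicat_real {x<..y} z *\<^sub>R g' z" for z
  using g[of z] xy by (cases "z \<in> {x<..y}") (auto intro: pos order_le_less_trans)
 show "set_integrable m {x<..y} g'" "D y - D x = (LINT z:{x<..y}|m. g' z)"
  using i unfolding set_integrable_def set_lebesgue_integral_def e by auto
qed

text \<open>For \<open>z <= e\<close> the factor \<open>s e - s z\<close> is at most
  \<open>sig e\<close>, and the integral of \<open>\<bar>w\<bar>\<close> over \<open>(0,e]\<close>
  vanishes as \<open>e\<close> tends to 0. So \<open>primitive2 w\<close> is of smaller order than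
  \<open>sig\<close>, which fixes the slope of solutions at 0.\<close>

lemma primitive2_small:
 assumes w: "sig_bounded w" and e: "0 < e" "e < top"
 shows "\<bar>primitive2 w e\<bar> <= sig e * (LINT z:{0<..e}|m. \<bar>w z\<bar>)"
proof -
 note D = loc_intD[OF sig_bounded_loc_int[OF w] e(2), of "{0<..e}"]
 have "\<bar>primitive2 w e\<bar> <= (LINT z:{0<..e}|m. \<bar>(s e - s z) * w z\<bar>)"
  unfolding primitive2_def using set_integral_norm_bound[OF D(3), of "s e"] by simp
 also have "... <= (LINT z:{0<..e}|m. sig e * \<bar>w z\<bar>)"
 proof (rule set_integral_mono)
  fix z assume z: "z \<in> {0<..e}"
  then have "0 < sig z" "s z <= s e" using e by (auto intro!: s_le sig_pos intro: order_le_less_trans)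
  then show "\<bar>(s e - s z) * w z\<bar> <= sig e * \<bar>w z\<bar>" by (auto simp: abs_mult sig_def intro!: mult_right_mono)
 qed (use set_integrable_abs[OF D(3), of "s e"] set_integrable_abs[OF D(1)] in auto)
 finally show ?thesis by simp
qed

lemma abs_integral_tendsto_0:
 assumes w: "sig_bounded w"
 shows "((%e. LINT z:{0<..e}|m. \<bar>w z\<bar>) \<longlongrightarrow> 0) (at_right 0)"
 using sig_bounded_loc_int[OF w] by (intro Ioc_integral_tendsto_0 set_integrable_abs) (auto simp: loc_int_def)

lemma eventually_at_right_0: "\<forall>\<^sub>F e in at_right (0::ennreal). 0 < e & e < top"
 unfolding eventually_at_right[OF ennreal_zero_less_top] by (auto intro!: exI[of _ top])

lemma primitive_tendsto_0:
 assumes w: "sig_bounded w"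
 shows "(primitive w \<longlongrightarrow> 0) (at_right 0)"
proof (rule Lim_null_comparison[OF _ abs_integral_tendsto_0[OF w]])
 show "\<forall>\<^sub>F e in at_right 0. norm (primitive w e) <= (LINT z:{0<..e}|m. \<bar>w z\<bar>)"
  using eventually_at_right_0
 proof eventually_elim
  case (elim e)
  then show ?case unfolding primitive_def
   using set_integral_norm_bound[OF loc_intD(1)[OF sig_bounded_loc_int[OF w], of e "{0<..e}"]] by simp
 qed
qed

lemma primitive2_ratio_tendsto_0:
 assumes w: "sig_bounded w"
 shows "((%e. primitive2 w e / sig e) \<longlongrightarrow> 0) (at_right 0)"
proof (rule Lim_null_comparison[OF _ abs_integral_tendsto_0[OF w]])
 show "\<forall>\<^sub>F e in at_right 0. norm (primitive2 w e / sig e) <= (LINT z:{0<..e}|m. \<bar>w z\<bar>)"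
  using eventually_at_right_0
 proof eventually_elim
  case (elim e)
  then show ?case using primitive2_small[OF w, of e] sig_pos[of e] by (simp add: pos_divide_le_eq mult.commute)
 qed
qed

lemma primitive2_tendsto_0:
 assumes w: "sig_bounded w"
 shows "(primitive2 w \<longlongrightarrow> 0) (at_right 0)"
proof -
 have "((%e. primitive2 w e / sig e * sig e) \<longlongrightarrow> 0 * 0) (at_right 0)"
  by (intro tendsto_mult primitive2_ratio_tendsto_0 w sig_tendsto_0)
 then have t: "((%e. primitive2 w e / sig e * sig e) \<longlongrightarrow> 0) (at_right 0)" by simp
 show ?thesis
  by (rule Lim_transform_eventually[OF t], use eventually_at_right_0 in eventually_elim)
   (use sig_pos in force)
qed

text \<open>Near 0 the derivative is below 2, and the mean value inequality together with the
  boundary value 0 gives the bound \<open>2 * sig\<close>. On a compact remainder \<open>u\<close>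
  is bounded and \<open>sig\<close> is bounded away from 0.\<close>

lemma sig_bounded_of_dmds:
 assumes d: "dmds m s u D g" and D: "(D \<longlongrightarrow> 1) (at_right 0)" and u0: "(u \<longlongrightarrow> 0) (at_right 0)"
 shows "sig_bounded (u :: ennreal => real)"
proof -
 have uc: "continuous_on Rpos u" and ur: "has_right_sderiv s u D" using d by (auto simp: dmds_def)
 have nt: "at_right (0::ennreal) ~= bot" by (rule at_right_nontrivial[OF ennreal_zero_less_top])
 have "\<forall>\<^sub>F x in at_right 0. \<bar>D x\<bar> < 2" by (rule order_tendstoD(2)[OF tendsto_rabs[OF D]]) simp
 with eventually_at_right_0 have "\<forall>\<^sub>F x in at_right 0. \<bar>D x\<bar> < 2 & x < top" by eventually_elim auto
 then obtain b0 where b0: "0 < b0" "!!x. 0 < x ==> x < b0 ==> \<bar>D x\<bar> < 2 & x < top"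
  unfolding eventually_at_right[OF ennreal_zero_less_top] by blast
 obtain b where b: "0 < b" "b < b0" using dense[OF b0(1)] by blast
 have bt: "b < top" using b0(2)[OF b] by simp
 have near: "\<bar>u x\<bar> <= 2 * sig x" if x: "0 < x" "x <= b" for x
 proof (rule tendsto_le[OF nt])
  show "((%e. \<bar>u x - u e\<bar>) \<longlongrightarrow> \<bar>u x\<bar>) (at_right 0)" using tendsto_rabs[OF tendsto_diff[OF tendsto_const u0, of "u x"]] by simp
  show "((%e. 2 * (s x - s e)) \<longlongrightarrow> 2 * sig x) (at_right 0)" unfolding sig_def by (intro tendsto_intros s_tendsto_s0)
  show "\<forall>\<^sub>F e in at_right 0. \<bar>u x - u e\<bar> <= 2 * (s x - s e)"
   unfolding eventually_at_right[OF x(1)]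
  proof (intro exI[of _ x] conjI allI impI x(1))
   fix e assume e: "0 < e" "e < x"
   show "\<bar>u x - u e\<bar> <= 2 * (s x - s e)"
   proof (rule right_sderiv_bound[OF uc ur e(1) less_imp_le[OF e(2)]])
    show "x < top" using x bt by order
    fix z assume "e <= z" "z < x"
    then have "0 < z" "z < b0" using e x b by order+
    then show "\<bar>D z\<bar> <= 2" using b0(2)[of z] by simp
   qed
  qed
 qed
 show ?thesis unfolding sig_bounded_def
 proof (intro conjI allI impI borel_measurable_continuous_Ioo[OF uc])
  fix y :: ennreal assume y: "y < top"
  have "compact (u ` {b..y})"
   by (intro compact_continuous_image continuous_on_subset[OF uc] compact_eq_closed[THEN iffD2])
    (use b y in \<open>auto intro: order_less_le_trans order_le_less_trans\<close>)
  then have "\<exists>C. \<forall>z\<in>{b..y}. \<bar>u z\<bar> <= C"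
   using compact_imp_bounded[of "u ` {b..y}"] by (auto simp: bounded_iff)
  then obtain C where "\<forall>z\<in>{b..y}. \<bar>u z\<bar> <= C" by blast
  then have C: "!!z. b <= z ==> z <= y ==> \<bar>u z\<bar> <= C" by simp
  have sb: "0 < sig b" by (rule sig_pos[OF b(1) bt])
  show "\<exists>B. \<forall>z. 0 < z & z <= y --> \<bar>u z\<bar> <= B * sig z"
  proof (intro exI[of _ "2 + \<bar>C\<bar> / sig b"] allI impI)
   fix z assume z: "0 < z & z <= y"
   then have zt: "z < top" using y by (auto intro: order_le_less_trans)
   have sz: "0 < sig z" using z zt by (intro sig_pos) auto
   show "\<bar>u z\<bar> <= (2 + \<bar>C\<bar> / sig b) * sig z"
   proof (cases "z <= b")
    case True
    have "0 <= \<bar>C\<bar> / sig b * sig z" using sb sz by simp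
    then show ?thesis using near[of z] z True by (simp add: distrib_right)
   next
    case False
    then have "sig b <= sig z" using b zt by (intro sig_mono) auto
    then have "\<bar>C\<bar> * sig b <= \<bar>C\<bar> * sig z" by (intro mult_left_mono) auto
    then have "\<bar>C\<bar> <= \<bar>C\<bar> / sig b * sig z" using sb by (simp add: pos_le_divide_eq)
    moreover have "\<bar>u z\<bar> <= C" using C z False by auto
    ultimately show ?thesis using sz by (simp add: distrib_right)
   qed
  qed
 qed
qed

text \<open>Integrating any candidate of the definite description twice from 0 shows that
  \<open>l\<close> times it solves the Volterra equation, whose solution is unique among
  \<open>sig_bounded\<close> functions. Hence \<open>v\<close> is \<open>l\<close> times
  \<open>psi\<close>, the density of \<open>nu\<close>.\<close>

lemma psi_eq:
 assumes l: "0 < l" and v: "sig_bounded v" "!!y. 0 < y ==> y < top ==> v y = l * (sig y - primitive2 v y)"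
 shows "psi m s (- l) = (%y. if y \<in> Rpos then v y / l else 0)"
proof -
 define p where "p y = (if y \<in> Rpos then v y / l else 0)" for y
 note li = sig_bounded_loc_int[OF v(1)]
 note nt = at_right_nontrivial[OF ennreal_zero_less_top]
 have pv: "p y = sig y - primitive2 v y" if "0 < y" "y < top" for y using that v(2)[OF that] l by (simp add: p_def)
 have E1: "dmds m s p (%x. 1 * 1 + (-1) * primitive v x) (%x. - l * p x)"
 proof (rule dmds_cong[OF dmds_lin[OF dmds_s dmds_primitive2[OF li], of 1 "-1" "- s0"]])
  fix x :: ennreal assume x: "0 < x" "x < top"
  show "1 * s x + (-1) * primitive2 v x + - s0 = p x" by (simp add: pv[OF x] sig_def)
  show "1 * 0 + (-1) * v x = - l * p x" using l x by (simp add: p_def)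
 qed
 have E2: "((%x. 1 * 1 + (-1) * primitive v x) \<longlongrightarrow> 1) (at_right 0)"
  using tendsto_diff[OF tendsto_const[of 1] primitive_tendsto_0[OF v(1)]] by simp
 have "((%y. sig y - primitive2 v y) \<longlongrightarrow> 0 - 0) (at_right 0)"
  by (intro tendsto_diff sig_tendsto_0 primitive2_tendsto_0 v(1))
 then have t: "((%y. sig y - primitive2 v y) \<longlongrightarrow> 0) (at_right 0)" by simp
 have E3: "(p \<longlongrightarrow> 0) (at_right 0)"
  by (rule Lim_transform_eventually[OF t], use eventually_at_right_0 in eventually_elim) (simp add: pv)
 have "psi m s (- l) = p"
  unfolding psi_def
 proof (rule the_equality)
  show "(\<exists>D. dmds m s p D (%x. - l * p x) & (D \<longlongrightarrow> 1) (at_right 0)) & (p \<longlongrightarrow> 0) (at_right 0) & (\<forall>x. x \<notin> Rpos --> p x = 0)"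
   using E1 E2 E3 by (auto simp: p_def)
 next
  fix u :: "ennreal => real"
  assume "(\<exists>D. dmds m s u D (%x. - l * u x) & (D \<longlongrightarrow> 1) (at_right 0)) & (u \<longlongrightarrow> 0) (at_right 0) & (\<forall>x. x \<notin> Rpos --> u x = 0)"
  then obtain D where d: "dmds m s u D (%x. - l * u x)" and D: "(D \<longlongrightarrow> 1) (at_right 0)" and u0: "(u \<longlongrightarrow> 0) (at_right 0)"
   and uz: "!!x. x \<notin> Rpos ==> u x = 0" by blast
  have usb: "sig_bounded u" by (rule sig_bounded_of_dmds[OF d D u0])
  define w where "w x = l * u x" for x
  have wsb: "sig_bounded w" unfolding sig_bounded_def
  proof (intro conjI allI impI)
   show "w \<in> borelm" using usb unfolding w_def[abs_def] sig_bounded_def by (intro borel_measurable_times) auto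
   fix y :: ennreal assume y: "y < top"
   obtain B where B: "0 <= B" "!!z. 0 < z ==> z <= y ==> \<bar>u z\<bar> <= B * sig z" using sig_boundedD[OF usb y] by blast
   show "\<exists>B. \<forall>z. 0 < z & z <= y --> \<bar>w z\<bar> <= B * sig z"
    using B(2) l by (intro exI[of _ "l * B"]) (auto simp: w_def abs_mult mult.assoc intro!: mult_left_mono)
  qed
  note lw = sig_bounded_loc_int[OF wsb]
  have const: "D x + primitive w x = D y + primitive w y" if "0 < x" "x <= y" "y < top" for x y
  proof -
   have "D y - D x = (LINT z:{x<..y}|m. - w z)" using d that by (simp add: dmds_def w_def)
   also have "... = - (LINT z:{x<..y}|m. w z)" by (simp add: set_lebesgue_integral_def)
   finally show ?thesis using primitive_diff[OF lw that(2,3)] by simp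
  qed
  \<comment> \<open>The sum of \<open>D\<close> and \<open>primitive w\<close> is constant, and its
    limit at 0 is 1.\<close>
  have D1: "D x = 1 - primitive w x" if x: "0 < x" "x < top" for x
  proof -
   have "((%e. D e + primitive w e) \<longlongrightarrow> 1 + 0) (at_right 0)" by (intro tendsto_add D primitive_tendsto_0 wsb)
   moreover have "((%e. D e + primitive w e) \<longlongrightarrow> D x + primitive w x) (at_right 0)"
    by (rule tendsto_eventually) (use const[OF _ less_imp_le x(2)] x in \<open>auto simp: eventually_at_right[OF x(1)] intro!: exI[of _ x]\<close>)
   ultimately show ?thesis using tendsto_unique[OF nt] by fastforce
  qed
  have "w y = v y" if y: "0 < y" "y < top" for y
  proof (rule volterra_unique[OF l v wsb _ y])
   fix x :: ennreal assume x: "0 < x" "x < top"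
   note dl = dmds_lin[OF dmds_s dmds_primitive2[OF lw], of 1 "-1" "0"]
   have inc: "u x - u e = (1 * s x + (-1) * primitive2 w x + 0) - (1 * s e + (-1) * primitive2 w e + 0)" if e: "0 < e" "e <= x" for e
    by (rule right_sderiv_unique[where D=D and E="%x. 1 * 1 + (-1) * primitive w x"])
     (use d dl e x D1 in \<open>auto simp: dmds_def intro: order_less_le_trans order_less_trans\<close>)
   have "((%e. u x - u e) \<longlongrightarrow> u x - 0) (at_right 0)" by (intro tendsto_diff tendsto_const u0)
   moreover have "((%e. (1 * s x + (-1) * primitive2 w x + 0) - (1 * s e + (-1) * primitive2 w e + 0)) \<longlongrightarrow>
     (1 * s x + (-1) * primitive2 w x + 0) - (1 * s0 + (-1) * 0 + 0)) (at_right 0)"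
    by (intro tendsto_intros s_tendsto_s0 primitive2_tendsto_0 wsb)
   then have "((%e. u x - u e) \<longlongrightarrow> (1 * s x + (-1) * primitive2 w x + 0) - (1 * s0 + (-1) * 0 + 0)) (at_right 0)"
    by (rule Lim_transform_eventually) (use inc x in \<open>auto simp: eventually_at_right[OF x(1)] intro!: exI[of _ x] less_imp_le\<close>)
   ultimately have "u x - 0 = (1 * s x + (-1) * primitive2 w x + 0) - (1 * s0 + (-1) * 0 + 0)" by (rule tendsto_unique[OF nt])
   then have "u x = sig x - primitive2 w x" by (simp add: sig_def)
   then show "w x = l * (sig x - primitive2 w x)" by (simp add: w_def)
  qed
  then have "u y = v y / l" if "0 < y" "y < top" for y using that l by (simp add: w_def eq_divide_eq mult.commute)
  then show "u = p" using uz by (auto simp: p_def fun_eq_iff)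
 qed
 then show ?thesis by (simp add: p_def[abs_def])
qed

text \<open>The limit of \<open>v / sig\<close> at 0 is what later allows the eigenvalue to be read
  off from the density.\<close>

lemma psi_properties:
 assumes l: "0 < l"
 shows "\<exists>v. sig_bounded v & (\<forall>y. 0 < y & y < top --> v y = l * (sig y - primitive2 v y)) &
  (\<forall>y. l * psi m s (- l) y = (if y \<in> Rpos then v y else 0)) & ((%y. v y / sig y) \<longlongrightarrow> l) (at_right 0)"
proof -
 obtain v where v: "sig_bounded v" "!!y. 0 < y ==> y < top ==> v y = l * (sig y - primitive2 v y)"
  using volterra_exists[OF l] by blast
 have "((%y. l * (1 - primitive2 v y / sig y)) \<longlongrightarrow> l * (1 - 0)) (at_right 0)"
  by (intro tendsto_intros primitive2_ratio_tendsto_0 v(1))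
 then have t: "((%y. l * (1 - primitive2 v y / sig y)) \<longlongrightarrow> l) (at_right 0)" by simp
 have "((%y. v y / sig y) \<longlongrightarrow> l) (at_right 0)"
 proof (rule Lim_transform_eventually[OF t], use eventually_at_right_0 in eventually_elim)
  case (elim y)
  then show ?case using v(2)[of y] sig_pos[of y] by (simp add: field_simps)
 qed
 then show ?thesis using v psi_eq[OF l v] l by (intro exI[of _ v]) auto
qed

end

section \<open>Initial laws, killed laws and their potentials\<close>

lemma prob_on_posD:
 assumes "prob_on_pos mu"
 shows "prob_space mu" "sets mu = sets borel" "AE x in mu. 0 < x & x < top"
proof -
 show p: "prob_space mu" and s: "sets mu = sets borel" using assms by (auto simp: prob_on_pos_def)
 interpret prob_space mu by fact
 have "measure mu Rpos = 1" using assms by (simp add: prob_on_pos_def measure_def)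
 then have "AE x in mu. x \<in> Rpos" using AE_in_set_eq_1[of "Rpos"] s by simp
 then show "AE x in mu. 0 < x & x < top" by eventually_elim auto
qed

context dmds_process
begin

text \<open>Initial laws live on the whole of \<open>ennreal\<close>, the kernel
  \<open>law X\<close> only on the state space. Sending the null set outside
  \<open>(0,\<infinity>)\<close> to the point 1 makes \<open>law X (proj x)\<close> measurable in
  \<open>x\<close> everywhere.\<close>

definition proj :: "ennreal => ennreal" where "proj x = (if x \<in> Rpos then x else 1)"

lemma proj: "0 < proj x" "proj x < top" "0 < x ==> x < top ==> proj x = x"
 by (auto simp: proj_def)

lemma proj_state: "proj x \<in> state X"
 by (rule fin_in_state[OF proj(2)])

lemma proj_measurable [measurable]: "proj \<in> borel \<rightarrow>\<^sub>M restrict_space borel (state X)"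
proof (rule measurable_restrict_space2)
 show "proj \<in> borelm" unfolding proj_def[abs_def] by measurable
qed (use proj_state in auto)

lemma law_from_facts:
 assumes mu: "prob_on_pos mu"
 shows "sets (law_from X mu) = sets (events X)" "space (law_from X mu) = Om"
  "!!g. g \<in> borel_measurable (events X) ==> (\<integral>\<^sup>+om. g om \<partial>law_from X mu) = (\<integral>\<^sup>+x. (\<integral>\<^sup>+om. g om \<partial>law X (proj x)) \<partial>mu)"
  "prob_space (law_from X mu)"
proof -
 note P = prob_on_posD[OF mu]
 interpret pr: prob_space mu by (rule P)
 have sp: "space mu = UNIV" using sets_eq_imp_space_eq[OF P(2)] by simp
 define R where "R = restrict_space mu (state X)"
 have sR: "sets R = sets (restrict_space borel (state X))" unfolding R_def by (intro sets_restrict_space_cong P)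
 have spR: "space R = state X" unfolding R_def by (simp add: space_restrict_space sp)
 have L: "law X \<in> R \<rightarrow>\<^sub>M subprob_algebra (events X)"
  using law_subprob measurable_cong_sets[OF sR refl] by blast
 show s1: "sets (law_from X mu) = sets (events X)"
  unfolding law_from_def R_def[symmetric] by (rule sets_bind) (use spR zero_in_state sets_law in auto)
 show s2: "space (law_from X mu) = Om" by (rule sets_eq_imp_space_eq[OF s1])
 show nn: "(\<integral>\<^sup>+om. g om \<partial>law_from X mu) = (\<integral>\<^sup>+x. (\<integral>\<^sup>+om. g om \<partial>law X (proj x)) \<partial>mu)" if "g \<in> borel_measurable (events X)" for g
 proof -
  have "(\<integral>\<^sup>+om. g om \<partial>law_from X mu) = (\<integral>\<^sup>+x. (\<integral>\<^sup>+om. g om \<partial>law X x) \<partial>R)"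
   unfolding law_from_def R_def[symmetric] by (rule nn_integral_bind[OF that L])
  also have "... = (\<integral>\<^sup>+x. (\<integral>\<^sup>+om. g om \<partial>law X x) * indicator (state X) x \<partial>mu)"
   unfolding R_def by (rule nn_integral_restrict_space) (simp add: P(2) sp)
  also have "... = (\<integral>\<^sup>+x. (\<integral>\<^sup>+om. g om \<partial>law X (proj x)) \<partial>mu)"
   by (rule nn_integral_cong_AE, use P(3) in eventually_elim) (auto simp: proj(3) fin_in_state)
  finally show ?thesis .
 qed
 have "emeasure (law_from X mu) Om = (\<integral>\<^sup>+om. 1 \<partial>law_from X mu)" by (simp add: s2)
 also have "... = (\<integral>\<^sup>+x. (\<integral>\<^sup>+om. 1 \<partial>law X (proj x)) \<partial>mu)" by (rule nn) simp
 also have "... = (\<integral>\<^sup>+x. 1 \<partial>mu)"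
  using prob_space.emeasure_space_1[OF law_prob[OF proj_state]] by simp
 also have "... = 1" by (simp add: pr.emeasure_space_1)
 finally show "prob_space (law_from X mu)" by (intro prob_spaceI) (simp add: s2)
qed

text \<open>The law of the position at time \<open>t\<close> on survival, as an image measure, so
  that \<open>killed_law\<close> inherits countable additivity.\<close>

definition kmeas :: "ennreal measure => real => ennreal measure" where
 "kmeas mu t = distr (density (law_from X mu) (%om. if ennreal t < life X om & ennreal t < hit X 0 om then 1 else 0)) borel (path (ennreal t))"

lemma sets_kmeas [simp, measurable_cong]: "sets (kmeas mu t) = sets borel"
 by (simp add: kmeas_def)

lemma kmeas_law_from:
 assumes mu: "prob_on_pos mu" and [measurable]: "f \<in> borelm"
 shows "(\<integral>\<^sup>+z. f z \<partial>kmeas mu t) = (\<integral>\<^sup>+om. (if ennreal t < life X om & ennreal t < hit X 0 om then 1 else 0) * f (path (ennreal t) om) \<partial>law_from X mu)"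
proof -
 note [measurable_cong] = law_from_facts(1)[OF mu]
 show ?thesis unfolding kmeas_def by (subst nn_integral_distr) (auto simp: nn_integral_density)
qed

lemma nn_integral_kmeas:
 assumes mu: "prob_on_pos mu" and f [measurable]: "f \<in> borelm"
 shows "(\<integral>\<^sup>+z. f z \<partial>kmeas mu t) = (\<integral>\<^sup>+x. semigroup (%z. f z * alive z) (ennreal t) (proj x) \<partial>mu)"
 unfolding kmeas_law_from[OF assms]
proof (subst law_from_facts(3)[OF mu], measurable, rule nn_integral_cong)
 fix x
 show "(\<integral>\<^sup>+om. (if ennreal t < life X om & ennreal t < hit X 0 om then 1 else 0) * f (path (ennreal t) om) \<partial>law X (proj x)) =
  semigroup (%z. f z * alive z) (ennreal t) (proj x)"
  unfolding semigroup_def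
 proof (rule nn_integral_cong_AE, use good_start_AE[OF good_start_fin[OF proj(2)], of x] in eventually_elim)
  case (elim om)
  then show ?case using good_less_hit[of om "ennreal t"] by (auto simp: good_val good_path indicator_def) (auto simp: good_def)
 qed
qed

lemma killed_law_kmeas:
 assumes mu: "prob_on_pos mu" and B: "B \<in> sets borel"
 shows "killed_law X mu t B = emeasure (kmeas mu t) B"
proof -
 have ms: "{om\<in>Om. ennreal t < life X om & pos X (ennreal t) om \<in> B & ennreal t < hit X 0 om} \<in> sets (events X)"
 proof -
  have "{om\<in>Om. ennreal t < life X om & pos X (ennreal t) om \<in> B} \<inter> {om\<in>Om. ennreal t < hit X 0 om} \<in> sets (events X)"
   by (intro sets.Int sets_pos B) measurable
  also have "{om\<in>Om. ennreal t < life X om & pos X (ennreal t) om \<in> B} \<inter> {om\<in>Om. ennreal t < hit X 0 om} =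
   {om\<in>Om. ennreal t < life X om & pos X (ennreal t) om \<in> B & ennreal t < hit X 0 om}" by auto
  finally show ?thesis .
 qed
 have "killed_law X mu t B = (\<integral>\<^sup>+om. indicator {om\<in>Om. ennreal t < life X om & pos X (ennreal t) om \<in> B & ennreal t < hit X 0 om} om \<partial>law_from X mu)"
  unfolding killed_law_def using ms by (simp add: law_from_facts(1)[OF mu])
 also have "... = (\<integral>\<^sup>+z. indicator B z \<partial>kmeas mu t)"
  using B by (subst kmeas_law_from[OF mu]) (auto intro!: nn_integral_cong simp: indicator_def path_def law_from_facts(2)[OF mu])
 finally show ?thesis using B by simp
qed

lemma tail_kmeas:
 assumes mu: "prob_on_pos mu"
 shows "ennreal (tail X mu t) = emeasure (kmeas mu t) UNIV" "0 <= tail X mu t" "tail X mu t <= 1"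
  "ennreal (tail X mu t) = (\<integral>\<^sup>+x. semigroup alive (ennreal t) (proj x) \<partial>mu)"
proof -
 interpret L: prob_space "law_from X mu" by (rule law_from_facts(4)[OF mu])
 show "0 <= tail X mu t" "tail X mu t <= 1" by (auto simp: tail_def)
 have "ennreal (tail X mu t) = (\<integral>\<^sup>+om. indicator {om\<in>Om. ennreal t < hit X 0 om} om \<partial>law_from X mu)"
  unfolding tail_def L.emeasure_eq_measure[symmetric] by (simp add: law_from_facts(1)[OF mu])
 also have "... = (\<integral>\<^sup>+x. semigroup alive (ennreal t) (proj x) \<partial>mu)"
 proof (subst law_from_facts(3)[OF mu], measurable, rule nn_integral_cong)
  fix x
  show "(\<integral>\<^sup>+om. indicator {om\<in>Om. ennreal t < hit X 0 om} om \<partial>law X (proj x)) = semigroup alive (ennreal t) (proj x)"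
   unfolding semigroup_def
  proof (rule nn_integral_cong_AE, use good_start_AE[OF good_start_fin[OF proj(2)], of x] in eventually_elim)
   case (elim om)
   then show ?case using good_less_hit[of om "ennreal t"] by (auto simp: good_val indicator_def) (auto simp: good_def)
  qed
 qed
 finally show a: "ennreal (tail X mu t) = (\<integral>\<^sup>+x. semigroup alive (ennreal t) (proj x) \<partial>mu)" .
 show "ennreal (tail X mu t) = emeasure (kmeas mu t) UNIV"
  unfolding a using nn_integral_kmeas[OF mu, of "%_. 1" t] sets_eq_imp_space_eq[OF sets_kmeas] by simp
qed

lemma cond_law_eq:
 assumes mu: "prob_on_pos mu"
 shows "cond_law X mu t = scale_measure (inverse (ennreal (tail X mu t))) (kmeas mu t)" (is "_ = ?S")
proof -
 have "cond_law X mu t = measure_of UNIV (sets borel) (emeasure ?S)"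
  unfolding cond_law_def
  by (rule measure_of_eq) (auto simp: killed_law_kmeas[OF mu] divide_ennreal_def mult.commute sets.sigma_sets_eq[of borel, simplified])
 also have "... = measure_of (space ?S) (sets ?S) (emeasure ?S)"
  using sets_eq_imp_space_eq[OF sets_kmeas] by (simp add: space_scale_measure)
 finally show ?thesis by (simp only: measure_of_of_measure)
qed

text \<open>The renewal transform before normalisation: integration against the time integral of the
  killed laws, see \<open>time_integral_kmeas\<close>.\<close>

definition pot :: "ennreal measure => (ennreal => ennreal) => ennreal" where
 "pot mu f = (\<integral>\<^sup>+x. green (%z. f z * alive z) (proj x) \<partial>mu)"

lemma time_integral_kmeas:
 assumes mu: "prob_on_pos mu" and [measurable]: "f \<in> borelm"
 shows "(\<integral>\<^sup>+t\<in>{0..}. (\<integral>\<^sup>+z. f z \<partial>kmeas mu t) \<partial>lborel) = pot mu f"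
proof -
 interpret pr: prob_space mu by (rule prob_on_posD[OF mu])
 interpret P: pair_sigma_finite mu lborel by standard
 note [measurable_cong] = prob_on_posD(2)[OF mu]
 have [measurable]: "(%z. f z * alive z) \<in> borelm" by measurable
 have "(\<integral>\<^sup>+t\<in>{0..}. (\<integral>\<^sup>+z. f z \<partial>kmeas mu t) \<partial>lborel) =
  (\<integral>\<^sup>+t. (\<integral>\<^sup>+x. semigroup (%z. f z * alive z) (ennreal t) (proj x) * indicator {0..} t \<partial>mu) \<partial>lborel)"
  by (rule nn_integral_cong, subst nn_integral_kmeas[OF mu], simp, subst nn_integral_multc) auto
 also have "... = (\<integral>\<^sup>+x. (\<integral>\<^sup>+t. semigroup (%z. f z * alive z) (ennreal t) (proj x) * indicator {0..} t \<partial>lborel) \<partial>mu)"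
  by (rule P.Fubini'[of "%x t. semigroup (%z. f z * alive z) (ennreal t) (proj x) * indicator {0..} t"])
   (unfold case_prod_beta, measurable)
 finally show ?thesis by (simp add: pot_def green_def)
qed

text \<open>The density with respect to \<open>m\<close> of the potential of \<open>mu\<close>
  inside \<open>(0,\<infinity>)\<close>, see \<open>pot_interior\<close>.\<close>

definition U :: "ennreal measure => ennreal => ennreal" where "U mu z = (\<integral>\<^sup>+x. kern x z \<partial>mu)"

lemma sigma_finite_m: "sigma_finite_measure m"
proof
 let ?A = "insert {0} (insert {top} (range (%n::nat. {ennreal (1 / real (n + 1))<..of_nat (n + 1)})))"
 have 0: "emeasure m {0} ~= \<infinity>"
 proof -
  have "emeasure m {0} <= emeasure m (- (state X - {0}))" by (rule emeasure_mono) (auto simp: sets_m)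
  then show ?thesis using speed by (auto simp: speed_measure_def top_unique)
 qed
 have t: "emeasure m {top} ~= \<infinity>"
 proof (cases "top \<in> state X")
  case True
  have "compact {top::ennreal}" by simp
  moreover have "{top} <= state X - {0}" using True by auto
  ultimately have "emeasure m {top} < top" using speed unfolding speed_measure_def by blast
  then show ?thesis by simp
 next
  case False
  have "emeasure m {top} <= emeasure m (- (state X - {0}))" by (rule emeasure_mono) (use False in \<open>auto simp: sets_m\<close>)
  then show ?thesis using speed by (auto simp: speed_measure_def top_unique)
 qed
 show "\<exists>A. countable A & A <= sets m & \<Union> A = space m & (\<forall>a\<in>A. emeasure m a ~= \<infinity>)"
 proof (intro exI[of _ ?A] conjI ballI)
  show "\<Union> ?A = space m"
   unfolding space_m
  proof (rule UNIV_eq_I[symmetric])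
   fix x :: ennreal
   show "x \<in> \<Union> ?A"
   proof (cases "0 < x & x < top")
    case True
    then obtain r where r: "x = ennreal r" "0 < r" by (cases x) auto
    obtain n1 :: nat where n1: "1 / r < real n1" using reals_Archimedean2 by blast
    obtain n2 :: nat where n2: "r < real n2" using reals_Archimedean2 by blast
    define n where "n = n1 + n2"
    have "1 / r < 1 + real n" using n1 by (simp add: n_def)
    then have "1 / (1 + real n) < r" using r(2) by (simp add: field_simps)
    moreover have "x <= 1 + of_nat n"
    proof -
     have "x <= ennreal (1 + real n)" unfolding r using n2 by (intro ennreal_leI) (simp add: n_def)
     then show ?thesis by (simp add: ennreal_of_nat_eq_real_of_nat)
    qed
    ultimately have "x \<in> {ennreal (1 / real (n + 1))<..of_nat (n + 1)}" using r by (simp add: ennreal_less_iff)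
    then show ?thesis by blast
   next
    case False
    then have "x = 0 \<or> x = top" by (metis less_top zero_less_iff_neq_zero)
    then show ?thesis by blast
   qed
  qed
  fix a assume "a \<in> ?A"
  then show "emeasure m a ~= \<infinity>"
  proof (elim insertE rangeE)
   fix n assume "a = {ennreal (1 / real (n + 1))<..of_nat (n + 1)}"
   then show ?thesis using m_finite[of "ennreal (1 / real (n + 1))" "of_nat (n + 1)"] of_nat_less_top[of "n + 1"] by simp
  qed (use 0 t in auto)
 qed (auto simp: sets_m)
qed

lemma U_measurable:
 assumes "prob_on_pos mu" shows "U mu \<in> borelm"
proof -
 interpret pr: prob_space mu by (rule prob_on_posD[OF assms])
 note [measurable_cong] = prob_on_posD(2)[OF assms]
 show ?thesis unfolding U_def[abs_def] by measurable
qed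

lemma U_symmetric:
 assumes mu: "prob_on_pos mu" and [measurable]: "f \<in> borelm"
 shows "(\<integral>\<^sup>+x. (\<integral>\<^sup>+z. kern x z * f z \<partial>m) \<partial>mu) = (\<integral>\<^sup>+z. U mu z * f z \<partial>m)"
proof -
 interpret pr: prob_space mu by (rule prob_on_posD[OF mu])
 interpret M: sigma_finite_measure m by (rule sigma_finite_m)
 interpret P: pair_sigma_finite m mu by standard
 note [measurable_cong] = prob_on_posD(2)[OF mu]
 have "(\<integral>\<^sup>+x. (\<integral>\<^sup>+z. kern x z * f z \<partial>m) \<partial>mu) = (\<integral>\<^sup>+z. (\<integral>\<^sup>+x. kern x z * f z \<partial>mu) \<partial>m)"
  by (rule P.Fubini'[of "%z x. kern x z * f z"]) (unfold case_prod_beta, measurable)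
 then show ?thesis unfolding U_def by (simp add: nn_integral_multc)
qed

lemma pot_interior:
 assumes mu: "prob_on_pos mu" and [measurable]: "f \<in> borelm"
 shows "pot mu (%z. f z * indicator Rpos z) = (\<integral>\<^sup>+z. U mu z * f z \<partial>m)"
proof -
 have "f z * indicator Rpos z * alive z = f z * indicator Rpos z" for z
  by (auto simp: indicator_def)
 then have "pot mu (%z. f z * indicator Rpos z) = (\<integral>\<^sup>+x. green (%z. f z * indicator Rpos z) (proj x) \<partial>mu)"
  by (simp add: pot_def)
 also have "... = (\<integral>\<^sup>+x. (\<integral>\<^sup>+z. kern (proj x) z * f z \<partial>m) \<partial>mu)"
  by (simp add: green_formula[OF proj(1,2)])
 also have "... = (\<integral>\<^sup>+x. (\<integral>\<^sup>+z. kern x z * f z \<partial>m) \<partial>mu)"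
  by (rule nn_integral_cong_AE, use prob_on_posD(3)[OF mu] in eventually_elim) (simp add: proj(3))
 finally show ?thesis by (simp add: U_symmetric[OF mu])
qed

lemma U_le_sig:
 assumes mu: "prob_on_pos mu" and z: "0 < z" "z < top"
 shows "U mu z <= ennreal (sig z)" "0 < U mu z"
proof -
 interpret pr: prob_space mu by (rule prob_on_posD[OF mu])
 note [measurable_cong] = prob_on_posD(2)[OF mu]
 have "U mu z <= (\<integral>\<^sup>+x. ennreal (sig z) \<partial>mu)"
  unfolding U_def by (rule nn_integral_mono) (auto simp: kern_def intro!: ennreal_leI)
 then show "U mu z <= ennreal (sig z)" by (simp add: pr.emeasure_space_1)
 show "0 < U mu z"
 proof (rule ccontr)
  assume "\<not> 0 < U mu z"
  then have "(\<integral>\<^sup>+x. kern x z \<partial>mu) = 0" by (simp add: U_def zero_less_iff_neq_zero)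
  then have "AE x in mu. kern x z = 0" by (subst (asm) nn_integral_0_iff_AE) auto
  with prob_on_posD(3)[OF mu] have "AE x in mu. False"
  proof eventually_elim
   case (elim x)
   then show ?case using sig_pos[of x] sig_pos[OF z] z by (auto simp: kern_def ennreal_eq_0_iff)
  qed
  then show False by simp
 qed
qed

text \<open>In \<open>min (sig x) (sig z) = sig z - max 0 (sig z - sig x)\<close> the first term
  integrates to \<open>sig z\<close>, as \<open>mu\<close> is a probability measure, and the second
  to \<open>primitive2 w z\<close>. This is the origin of the Volterra recursion for the renewal
  transform.\<close>

lemma U_density:
 assumes mu: "prob_on_pos mu" and eq: "mu = density m (%z. ennreal (w z))" and w: "sig_bounded w" "!!z. 0 <= w z"
  and z: "0 < z" "z < top"
 shows "enn2real (U mu z) = sig z - primitive2 w z"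
proof -
 interpret pr: prob_space mu by (rule prob_on_posD[OF mu])
 note [measurable_cong] = prob_on_posD(2)[OF mu]
 have [measurable]: "w \<in> borelm" using w by (simp add: sig_bounded_def)
 have [measurable]: "s \<in> borelm" by (rule borel_measurable_continuous_Ioo[OF s_cont])
 have nonneg: "0 <= indicat_real {0<..z} x * ((s z - s x) * w x)" for x
  using s_le[of x z] z w(2)[of x] by (cases "0 < x & x <= z") auto
 have i: "integrable m (%x. indicat_real {0<..z} x * ((s z - s x) * w x))"
  using loc_intD(3)[OF sig_bounded_loc_int[OF w(1)] z(2), of "{0<..z}" "s z"] by (simp add: set_integrable_def)
 have dp: "(\<integral>\<^sup>+x. ennreal (indicat_real {0<..z} x * ((s z - s x) * w x)) \<partial>m) = ennreal (primitive2 w z)"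
  unfolding primitive2_def set_lebesgue_integral_def using nn_integral_eq_integral[OF i] nonneg by simp
 have dp0: "0 <= primitive2 w z"
  unfolding primitive2_def set_lebesgue_integral_def using nonneg by (intro integral_nonneg_AE) simp
 have "ennreal (sig z) = (\<integral>\<^sup>+x. ennreal (sig z) \<partial>mu)" by (simp add: pr.emeasure_space_1)
 also have "... = (\<integral>\<^sup>+x. kern x z + ennreal (sig z - sig x) * indicator {0<..z} x \<partial>mu)"
 proof (rule nn_integral_cong_AE, use prob_on_posD(3)[OF mu] in eventually_elim)
  case (elim x)
  show ?case
  proof (cases "x <= z")
   case True
   then have "sig x <= sig z" "0 < sig x" using elim z by (auto intro: sig_mono sig_pos)
   then show ?thesis using True elim z by (simp add: kern_def min_absorb1 flip: ennreal_plus)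
  next
   case False
   then have "sig z <= sig x" using elim z by (intro sig_mono) auto
   then show ?thesis using False elim z by (simp add: kern_def min_absorb2)
  qed
 qed
 also have "... = U mu z + (\<integral>\<^sup>+x. ennreal (sig z - sig x) * indicator {0<..z} x \<partial>mu)"
  unfolding U_def by (rule nn_integral_add) auto
 also have "(\<integral>\<^sup>+x. ennreal (sig z - sig x) * indicator {0<..z} x \<partial>mu) = ennreal (primitive2 w z)"
  unfolding dp[symmetric]
 proof (subst eq, subst nn_integral_density, measurable, rule nn_integral_cong)
  fix x show "ennreal (w x) * (ennreal (sig z - sig x) * indicator {0<..z} x) = ennreal (indicat_real {0<..z} x * ((s z - s x) * w x))"
   using s_le[of x z] z w(2)[of x] by (cases "0 < x & x <= z") (auto simp: sig_def ennreal_mult mult.commute)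
 qed
 finally have *: "ennreal (sig z) = U mu z + ennreal (primitive2 w z)" .
 have "U mu z < top" using U_le_sig(1)[OF mu z] by (rule order_le_less_trans) simp
 then obtain u where u: "U mu z = ennreal u" "0 <= u" by (cases "U mu z") auto
 then have "ennreal (sig z) = ennreal (u + primitive2 w z)" using * dp0 by simp
 then have "sig z = u + primitive2 w z" using u dp0 sig_pos[OF z] by (subst (asm) ennreal_inj) auto
 then show ?thesis using u by simp
qed

end

section \<open>Quasi-stationary distributions and the natural boundary\<close>

context dmds_process
begin

lemma pot_bounded:
 assumes mu: "prob_on_pos mu" and b: "0 < b" "b < top"
 shows "pot mu (indicator {0<..<b}) < top"
proof -
 obtain C where C: "C < top" "!!x. good_start x ==> green (indicator {0<..b}) x <= C"
  using green_indicator_bounded[OF b] by blast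
 interpret pr: prob_space mu by (rule prob_on_posD[OF mu])
 have "pot mu (indicator {0<..<b}) <= (\<integral>\<^sup>+x. C \<partial>mu)"
  unfolding pot_def
 proof (rule nn_integral_mono)
  fix x
  have "green (%z. indicator {0<..<b} z * alive z) (proj x) <= 1 * green (indicator {0<..b}) (proj x)"
   by (rule green_cmult_le) (auto simp: indicator_def proj_state)
  then show "green (%z. indicator {0<..<b} z * alive z) (proj x) <= C"
   using C(2)[OF good_start_fin[OF proj(2)], of x] by simp
 qed
 also have "... = C" by (simp add: pr.emeasure_space_1)
 finally show ?thesis using C(1) by (rule order_le_less_trans)
qed

lemma ex_Ioo_pos:
 assumes mu: "prob_on_pos mu"
 obtains b where "0 < b" "b < top" "emeasure mu {0<..<b} ~= 0"
proof (rule ccontr)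
 note P = prob_on_posD[OF mu]
 interpret pr: prob_space mu by (rule P)
 note T = that
 assume no: "\<not> thesis"
 have Z: "emeasure mu {0<..<b} = 0" if "0 < b" "b < top" for b using T[OF that] no by blast
 have "AE x in mu. x \<notin> {0<..<of_nat (Suc n)}" for n
 proof (rule AE_not_in, rule null_setsI)
  show "emeasure mu {0<..<of_nat (Suc n)} = 0" by (rule Z[OF _ of_nat_less_top]) (rule of_nat_0_less_iff[THEN iffD2, OF zero_less_Suc])
  show "{0<..<of_nat (Suc n)} \<in> sets mu" unfolding P(2) by measurable
 qed
 then have "AE x in mu. \<forall>n. x \<notin> {0<..<of_nat (Suc n)}" unfolding AE_all_countable by blast
 with P(3) have "AE x in mu. False"
 proof eventually_elim
  case (elim x)
  then obtain n where "x < of_nat n" using ennreal_Ex_less_of_nat by blast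
  then have "x < of_nat (Suc n)" by (rule order_less_le_trans) simp
  then show ?case using elim by auto
 qed
 then show False by simp
qed

lemma qsd_kmeas:
 assumes q: "qsd X \<nu>" and t: "0 < t"
 shows "0 < tail X \<nu> t" "kmeas \<nu> t = scale_measure (ennreal (tail X \<nu> t)) \<nu>"
proof -
 have \<nu>: "prob_on_pos \<nu>" and c: "cond_law X \<nu> t = \<nu>" using q t by (auto simp: qsd_def)
 interpret pr: prob_space \<nu> by (rule prob_on_posD[OF \<nu>])
 note tk = tail_kmeas[OF \<nu>, of t]
 have e: "inverse (ennreal (tail X \<nu> t)) * emeasure (kmeas \<nu> t) B = emeasure \<nu> B" for B
  using cond_law_eq[OF \<nu>, of t] unfolding c by (metis emeasure_scale_measure)
 have su: "space \<nu> = UNIV" using sets_eq_imp_space_eq[OF prob_on_posD(2)[OF \<nu>]] by simp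
 show tp: "0 < tail X \<nu> t"
 proof (rule ccontr)
  assume "\<not> 0 < tail X \<nu> t"
  then have "emeasure (kmeas \<nu> t) UNIV = 0" using tk by simp
  then have "emeasure \<nu> UNIV = 0" using e[of UNIV] by simp
  then show False using pr.emeasure_space_1 su by simp
 qed
 show "kmeas \<nu> t = scale_measure (ennreal (tail X \<nu> t)) \<nu>"
 proof (rule measure_eqI)
  fix B
  have "ennreal (tail X \<nu> t) * inverse (ennreal (tail X \<nu> t)) = 1"
   using tp by (simp add: inverse_ennreal ennreal_mult[symmetric])
  then show "emeasure (kmeas \<nu> t) B = emeasure (scale_measure (ennreal (tail X \<nu> t)) \<nu>) B"
   by (simp add: e[symmetric] mult.assoc[symmetric])
 qed (simp add: prob_on_posD(2)[OF \<nu>])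
qed

text \<open>Integrating \<open>kmeas \<nu> t = tail t * \<nu>\<close> over time shows that the
  potential of \<open>\<nu>\<close> is \<open>C\<close> times \<open>\<nu>\<close>, where
  \<open>C\<close> is the integral of the tail, that is, the mean of \<open>T_0\<close>. So
  \<open>c = 1 / C\<close>; that \<open>C\<close> is finite and positive is part of the
  proof.\<close>

lemma qsd_density:
 assumes q: "qsd X \<nu>"
 obtains c where "0 < c" "\<nu> = density m (%z. ennreal c * U \<nu> z)"
proof -
 have \<nu>: "prob_on_pos \<nu>" using q by (simp add: qsd_def)
 note P = prob_on_posD[OF \<nu>]
 define C where "C = (\<integral>\<^sup>+t\<in>{0..}. ennreal (tail X \<nu> t) \<partial>lborel)"
 have ms: "(%t. \<integral>\<^sup>+x. semigroup alive (ennreal t) (proj x) \<partial>\<nu>) \<in> borelm"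
 proof -
  interpret pr: prob_space \<nu> by (rule P)
  note [measurable_cong] = P(2)
  show ?thesis by measurable
 qed
 have [measurable]: "(%t. ennreal (tail X \<nu> t)) \<in> borelm"
  using ms by (simp add: tail_kmeas(4)[OF \<nu>])
 have main: "(\<integral>\<^sup>+z. U \<nu> z * f z \<partial>m) = C * (\<integral>\<^sup>+z. f z * indicator Rpos z \<partial>\<nu>)" if f[measurable]: "f \<in> borelm" for f
 proof -
  have "(\<integral>\<^sup>+z. U \<nu> z * f z \<partial>m) = (\<integral>\<^sup>+t\<in>{0..}. (\<integral>\<^sup>+z. f z * indicator Rpos z \<partial>kmeas \<nu> t) \<partial>lborel)"
   by (simp add: time_integral_kmeas[OF \<nu>] pot_interior[OF \<nu>])
  also have "... = (\<integral>\<^sup>+t. (ennreal (tail X \<nu> t) * indicator {0..} t) * (\<integral>\<^sup>+z. f z * indicator Rpos z \<partial>\<nu>) \<partial>lborel)"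
  \<comment> \<open>Quasi-stationarity concerns \<open>t > 0\<close>, so the null set containing
    only 0 is removed.\<close>
  proof (rule nn_integral_cong_AE, rule AE_mp[OF AE_lborel_singleton[of 0]], rule AE_I2, rule impI)
   fix t :: real assume "t ~= 0"
   show "(\<integral>\<^sup>+z. f z * indicator Rpos z \<partial>kmeas \<nu> t) * indicator {0..} t =
    (ennreal (tail X \<nu> t) * indicator {0..} t) * (\<integral>\<^sup>+z. f z * indicator Rpos z \<partial>\<nu>)"
   proof (cases "0 < t")
    case True
    have "(%z. f z * indicator Rpos z) \<in> borel_measurable \<nu>" using P(2) f by (simp cong: measurable_cong_sets)
    then show ?thesis using True by (simp add: qsd_kmeas(2)[OF q True] nn_integral_scale_measure)
   qed (use \<open>t ~= 0\<close> in simp)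
  qed
  also have "... = C * (\<integral>\<^sup>+z. f z * indicator Rpos z \<partial>\<nu>)"
   unfolding C_def by (rule nn_integral_multc) simp
  finally show ?thesis .
 qed
 \<comment> \<open>A bounded interval charged by \<open>\<nu>\<close> has a finite expected
   occupation time, which is \<open>C\<close> times its mass.\<close>
 obtain b where b: "0 < b" "b < top" "emeasure \<nu> {0<..<b} ~= 0" by (rule ex_Ioo_pos[OF \<nu>])
 have ib: "(\<integral>\<^sup>+z. indicator {0<..<b} z * indicator Rpos z \<partial>\<nu>) = emeasure \<nu> {0<..<b}"
 proof -
  have "{0<..<b} \<inter> Rpos = {0<..<b}" using b by auto
  then show ?thesis using P(2) by (simp add: indicator_inter_arith[symmetric])
 qed
 have "(\<integral>\<^sup>+z. U \<nu> z * indicator {0<..<b} z \<partial>m) < top"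
 proof -
  have "{0<..<b} \<inter> Rpos = {0<..<b}" using b by auto
  then have "(%z. indicator {0<..<b} z * indicator Rpos z :: ennreal) = indicator {0<..<b}"
   by (auto simp: indicator_inter_arith[symmetric])
  then show ?thesis using pot_interior[OF \<nu>, of "indicator {0<..<b}"] pot_bounded[OF \<nu> b(1,2)] by simp
 qed
 then have Ct: "C ~= top" using main[of "indicator {0<..<b}"] b(3) by (auto simp: ib ennreal_top_mult)
 have C0: "C ~= 0"
 proof
  assume "C = 0"
  then have "AE t in lborel. ennreal (tail X \<nu> t) * indicator {0..} t = 0" unfolding C_def by (subst (asm) nn_integral_0_iff_AE) auto
  then have "AE t in lborel. t \<notin> {0<..<1::real}"
  proof eventually_elim
   case (elim t)
   then show ?case using qsd_kmeas(1)[OF q, of t] by (auto simp: indicator_def ennreal_eq_0_iff split: if_splits)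
  qed
  then have "emeasure lborel {0<..<1::real} = 0" by (subst (asm) AE_iff_measurable[of "{0<..<1}"]) auto
  then show False by simp
 qed
 obtain c where c: "C = ennreal c" "0 < c" using Ct C0 by (cases C) (auto simp: ennreal_eq_0_iff less_le)
 show ?thesis
 proof (rule that[of "1 / c"])
  show "0 < 1 / c" using c by simp
  show "\<nu> = density m (%z. ennreal (1 / c) * U \<nu> z)"
  proof (rule measure_eqI)
   fix B assume "B \<in> sets \<nu>"
   then have B: "B \<in> sets borel" using P(2) by simp
   note [measurable] = U_measurable[OF \<nu>]
   have "emeasure (density m (%z. ennreal (1 / c) * U \<nu> z)) B = (\<integral>\<^sup>+z. ennreal (1 / c) * (U \<nu> z * indicator B z) \<partial>m)"
    using B by (subst emeasure_density) (auto simp: sets_m mult.assoc)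
   also have "... = ennreal (1 / c) * (C * (\<integral>\<^sup>+z. indicator B z * indicator Rpos z \<partial>\<nu>))"
    using B by (subst nn_integral_cmult) (auto simp: main)
   also have "(\<integral>\<^sup>+z. indicator B z * indicator Rpos z \<partial>\<nu>) = (\<integral>\<^sup>+z. indicator B z \<partial>\<nu>)"
    by (rule nn_integral_cong_AE, use P(3) in eventually_elim) auto
   also have "... = emeasure \<nu> B" using B P(2) by simp
   also have "ennreal (1 / c) * (C * emeasure \<nu> B) = emeasure \<nu> B"
    using c by (simp add: mult.assoc[symmetric] ennreal_mult[symmetric])
   finally show "emeasure \<nu> B = emeasure (density m (%z. ennreal (1 / c) * U \<nu> z)) B" ..
  qed (simp add: P(2) sets_m)
 qed
qed

lemma U_real:
 assumes "prob_on_pos mu"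
 shows "U mu z < top" "ennreal (enn2real (U mu z)) = U mu z"
proof -
 show "U mu z < top"
 proof (cases "0 < z & z < top")
  case True
  then show ?thesis using U_le_sig(1)[OF assms, of z] by (auto intro: order_le_less_trans)
 next
  case False
  then have "kern x z = 0" for x by (auto simp: kern_def)
  then show ?thesis by (simp add: U_def)
 qed
 then show "ennreal (enn2real (U mu z)) = U mu z" by (simp add: ennreal_enn2real_if)
qed

lemma U_sig_bounded:
 assumes mu: "prob_on_pos mu" and c: "0 <= c"
 shows "sig_bounded (%z. c * enn2real (U mu z))" "0 < z ==> z < top ==> c * enn2real (U mu z) <= c * sig z"
proof -
 note [measurable] = U_measurable[OF mu]
 have le: "enn2real (U mu z) <= sig z" if "0 < z" "z < top" for z
  using enn2real_mono[OF U_le_sig(1)[OF mu that]] sig_pos[OF that] by simp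
 then show "0 < z ==> z < top ==> c * enn2real (U mu z) <= c * sig z" using c by (intro mult_left_mono) auto
 show "sig_bounded (%z. c * enn2real (U mu z))"
  unfolding sig_bounded_def
 proof (intro conjI allI impI)
  show "(%z. c * enn2real (U mu z)) \<in> borelm" by measurable
  fix y :: ennreal assume "y < top"
  then show "\<exists>B. \<forall>z. 0 < z & z <= y --> \<bar>c * enn2real (U mu z)\<bar> <= B * sig z"
   using le c by (intro exI[of _ c]) (auto simp: abs_mult intro!: mult_left_mono order_le_less_trans)
 qed
qed

lemma density_U_real:
 assumes mu: "prob_on_pos mu" and c: "0 <= c"
 shows "density m (%z. ennreal c * U mu z) = density m (%z. ennreal (c * enn2real (U mu z)))"
 using U_real(2)[OF mu] c by (simp add: ennreal_mult)

text \<open>With the same constant \<open>c\<close>, both densities solve the same Volterra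
  equation.\<close>

lemma qsd_unique:
 assumes q: "qsd X \<nu>" "qsd X \<nu>'" and c: "0 < c" "\<nu> = density m (%z. ennreal c * U \<nu> z)" "\<nu>' = density m (%z. ennreal c * U \<nu>' z)"
 shows "\<nu> = \<nu>'"
proof -
 have \<nu>: "prob_on_pos \<nu>" "prob_on_pos \<nu>'" using q by (auto simp: qsd_def)
 have v: "c * enn2real (U mu y) = c * (sig y - primitive2 (%z. c * enn2real (U mu z)) y)"
  if "prob_on_pos mu" "mu = density m (%z. ennreal c * U mu z)" "0 < y" "y < top" for mu y
  using U_density[OF that(1) _ U_sig_bounded(1)[OF that(1)] _ that(3,4), of c] that(2) density_U_real[OF that(1), of c] c by simp
 have e: "c * enn2real (U \<nu> y) = c * enn2real (U \<nu>' y)" for y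
 proof (cases "0 < y & y < top")
  case True
  show ?thesis
   by (rule volterra_unique[OF c(1) U_sig_bounded(1)[OF \<nu>(2)] v[OF \<nu>(2) c(3)] U_sig_bounded(1)[OF \<nu>(1)] v[OF \<nu>(1) c(2)]])
    (use True c in auto)
 next
  case False
  then have "kern x y = 0" for x by (auto simp: kern_def)
  then show ?thesis by (simp add: U_def)
 qed
 have "\<nu> = density m (%z. ennreal (c * enn2real (U \<nu> z)))" using c(2) density_U_real[OF \<nu>(1), of c] c(1) by simp
 also have "... = \<nu>'" using c(3) density_U_real[OF \<nu>(2), of c] c(1) e by simp
 finally show ?thesis .
qed

lemma two_qsds:
 assumes inf: "infinite {\<nu>. qsd X \<nu>}"
 obtains \<nu> \<nu>' c c' where "qsd X \<nu>" "qsd X \<nu>'" "0 < c" "0 < c'" "c ~= c'"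
  "\<nu> = density m (%z. ennreal c * U \<nu> z)" "\<nu>' = density m (%z. ennreal c' * U \<nu>' z)"
proof -
 obtain \<nu> where 1: "qsd X \<nu>" using inf by (metis (mono_tags, lifting) Collect_empty_eq finite.emptyI)
 have "infinite ({\<nu>. qsd X \<nu>} - {\<nu>})" using inf by simp
 then obtain \<nu>' where 2: "qsd X \<nu>'" "\<nu>' ~= \<nu>" by (metis (mono_tags, lifting) Diff_iff all_not_in_conv finite.emptyI insertCI mem_Collect_eq)
 obtain c where c: "0 < c" "\<nu> = density m (%z. ennreal c * U \<nu> z)" by (rule qsd_density[OF 1])
 obtain c' where c': "0 < c'" "\<nu>' = density m (%z. ennreal c' * U \<nu>' z)" by (rule qsd_density[OF 2(1)])
 have "c ~= c'" using qsd_unique[OF 1 2(1) c(1) c(2)] c' 2(2) by metis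
 then show ?thesis using that 1 2 c c' by blast
qed

end

context dmds_process
begin

text \<open>As a function of the scale, \<open>kern x\<close> is increasing and concave with value 0
  at 0, and averages over \<open>x\<close> inherit this. The second inequality says that
  \<open>U mu / sig\<close> decreases.\<close>

lemma U_mono_concave:
 assumes mu: "prob_on_pos mu" and xy: "0 < x" "x <= y" "y < top"
 shows "U mu x <= U mu y" "ennreal (sig x) * U mu y <= ennreal (sig y) * U mu x"
proof -
 note P = prob_on_posD[OF mu]
 interpret pr: prob_space mu by (rule P)
 note [measurable_cong] = P(2)
 have s: "0 < sig x" "sig x <= sig y" using xy by (auto intro: sig_pos sig_mono order_le_less_trans)
 have xt: "x < top" "0 < y" using xy by order+
 have k: "kern u x <= kern u y" "ennreal (sig x) * kern u y <= ennreal (sig y) * kern u x" if "0 < u" "u < top" for u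
 proof -
  have su: "0 < sig u" by (rule sig_pos[OF that])
  show "kern u x <= kern u y" using that xy xt s by (auto simp: kern_def intro!: ennreal_leI)
  have "sig x * min (sig u) (sig y) <= sig y * min (sig u) (sig x)"
  proof (cases "sig u <= sig x")
   case True
   then have "min (sig u) (sig y) = sig u" "min (sig u) (sig x) = sig u" using s by auto
   then show ?thesis using s su by (simp add: mult_right_mono)
  next
   case False
   then have a: "min (sig u) (sig x) = sig x" by simp
   show ?thesis unfolding a using mult_left_mono[of "min (sig u) (sig y)" "sig y" "sig x"] s by (simp add: mult.commute)
  qed
  then show "ennreal (sig x) * kern u y <= ennreal (sig y) * kern u x"
   using that xy xt s su by (simp add: kern_def ennreal_mult[symmetric] ennreal_leI)
 qed
 show "U mu x <= U mu y" unfolding U_def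
  by (rule nn_integral_mono_AE, use P(3) in eventually_elim) (use k(1) in auto)
 show "ennreal (sig x) * U mu y <= ennreal (sig y) * U mu x" unfolding U_def
  by (subst (1 2) nn_integral_cmult[symmetric], measurable, rule nn_integral_mono_AE, use P(3) in eventually_elim) (use k(2) in auto)
qed

text \<open>If \<open>sig\<close> is \<open>m\<close>-integrable, its mass beyond some
  \<open>a\<close> is small. The part of \<open>mu\<close> below \<open>a\<close> contributes at
  most \<open>sig a\<close> to \<open>U mu R\<close>, the part beyond at most half of
  \<open>U mu R\<close> itself.\<close>

lemma qsd_bounded_density:
 assumes mu: "prob_on_pos mu" and c: "0 < c" and eq: "mu = density m (%z. ennreal c * U mu z)"
  and fin: "(\<integral>\<^sup>+z. ennreal (sig z) * indicator Rpos z \<partial>m) < top"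
 shows "\<exists>B<top. \<forall>z. 0 < z & z < top --> U mu z <= B"
proof -
 note P = prob_on_posD[OF mu]
 interpret pr: prob_space mu by (rule P)
 note [measurable_cong] = P(2)
 note [measurable] = U_measurable[OF mu]
 have "(%n. \<integral>\<^sup>+z. ennreal (sig z) * indicator {of_nat n<..<top} z \<partial>m) ----> (\<integral>\<^sup>+z. 0 \<partial>m)"
 proof (rule nn_integral_dominated_convergence[where w="%z. ennreal (sig z) * indicator Rpos z"])
  show "AE z in m. (%n. ennreal (sig z) * indicator {of_nat n<..<top} z) ----> 0"
  proof (rule AE_I2, rule tendsto_eventually)
   fix z
   show "\<forall>\<^sub>F n in sequentially. ennreal (sig z) * indicator {of_nat n<..<top} z = 0"
   proof (cases "z < top")
    case True
    then obtain N :: nat where N: "z < of_nat N" using ennreal_Ex_less_of_nat by blast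
    have "\<not> of_nat n < z" if "N <= n" for n
    proof -
     have "(of_nat N :: ennreal) <= of_nat n" using that by simp
     with N have "z < of_nat n" by (rule order_less_le_trans)
     then show ?thesis by simp
    qed
    then show ?thesis unfolding eventually_sequentially by (intro exI[of _ N]) auto
   qed auto
  qed
  show "AE z in m. ennreal (sig z) * indicator {of_nat n<..<top} z <= ennreal (sig z) * indicator Rpos z" for n
   by (rule AE_I2) (auto simp: indicator_def intro: pos)
 qed (use fin in auto)
 \<comment> \<open>This threshold cancels the factor \<open>c\<close> of the density up to
   \<open>1/2\<close>.\<close>
 moreover have "(\<integral>\<^sup>+z. 0 \<partial>m) < ennreal (1 / (2 * c))"
 proof -
  have "0 < 1 / (2 * c)" using c by simp
  then have "0 < ennreal (1 / (2 * c))" by (rule ennreal_less_zero_iff[THEN iffD2])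
  then show ?thesis by (simp only: nn_integral_const mult_zero_left)
 qed
 ultimately have "\<forall>\<^sub>F n in sequentially. (\<integral>\<^sup>+z. ennreal (sig z) * indicator {of_nat n<..<top} z \<partial>m) < ennreal (1 / (2 * c))"
  by (rule order_tendstoD(2))
 then obtain n0 where n0: "!!n. n0 <= n ==> (\<integral>\<^sup>+z. ennreal (sig z) * indicator {of_nat n<..<top} z \<partial>m) < ennreal (1 / (2 * c))"
  by (auto simp: eventually_sequentially)
 define n where "n = Suc n0"
 define a :: ennreal where "a = of_nat n"
 have a: "0 < a" "a < top" unfolding a_def n_def by (rule of_nat_0_less_iff[THEN iffD2, OF zero_less_Suc], rule of_nat_less_top)
 have small: "(\<integral>\<^sup>+z. ennreal (sig z) * indicator {a<..<top} z \<partial>m) <= ennreal (1 / (2 * c))"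
  unfolding a_def by (rule less_imp_le, rule n0) (simp add: n_def)
 have "U mu R <= ennreal (2 * sig a)" if R: "0 < R" "R < top" for R
 proof -
  have "U mu R <= (\<integral>\<^sup>+x. ennreal (sig a) + kern x R * indicator {a<..<top} x \<partial>mu)"
   unfolding U_def
  proof (rule nn_integral_mono_AE, use P(3) in eventually_elim)
   case (elim x)
   show ?case
   proof (cases "a < x")
    case False
    then have "sig x <= sig a" using elim a by (intro sig_mono) auto
    then show ?thesis using False elim by (auto simp: kern_def intro!: ennreal_leI)
   qed (use elim in simp)
  qed
  also have "... = ennreal (sig a) + (\<integral>\<^sup>+x. kern x R * indicator {a<..<top} x \<partial>mu)"
   by (subst nn_integral_add) (auto simp: pr.emeasure_space_1)
  also have "(\<integral>\<^sup>+x. kern x R * indicator {a<..<top} x \<partial>mu) = (\<integral>\<^sup>+x. ennreal c * U mu x * (kern x R * indicator {a<..<top} x) \<partial>m)"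
   by (subst eq, subst nn_integral_density) auto
  also have "... <= (\<integral>\<^sup>+x. (ennreal c * U mu R) * (ennreal (sig x) * indicator {a<..<top} x) \<partial>m)"
  proof (rule nn_integral_mono)
   fix x
   \<comment> \<open>Monotonicity of \<open>U mu\<close> covers \<open>x <= R\<close>, where the
     kernel is \<open>sig x\<close>; the decrease of \<open>U mu / sig\<close> covers the
     rest.\<close>
   have "U mu x * kern x R <= U mu R * ennreal (sig x)" if x: "0 < x" "x < top"
   proof (cases "x <= R")
    case True
    then show ?thesis using U_mono_concave(1)[OF mu x(1) True R(2)] by (intro mult_mono) (auto simp: kern_def intro!: ennreal_leI)
   next
    case False
    then have "R <= x" by simp
    have "U mu x * kern x R <= U mu x * ennreal (sig R)" by (intro mult_left_mono) (auto simp: kern_def intro!: ennreal_leI)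
    also have "... <= U mu R * ennreal (sig x)" using U_mono_concave(2)[OF mu R(1) \<open>R <= x\<close> x(2)] by (simp add: mult.commute)
    finally show ?thesis .
   qed
   then show "ennreal c * U mu x * (kern x R * indicator {a<..<top} x) <= (ennreal c * U mu R) * (ennreal (sig x) * indicator {a<..<top} x)"
    by (cases "a < x & x < top") (auto simp: mult.assoc intro!: mult_left_mono pos)
  qed
  also have "... <= (ennreal c * U mu R) * ennreal (1 / (2 * c))"
   by (subst nn_integral_cmult) (auto intro!: mult_left_mono small)
  finally have *: "U mu R <= ennreal (sig a) + (ennreal c * U mu R) * ennreal (1 / (2 * c))" by (simp add: add_left_mono)
  obtain r where r: "U mu R = ennreal r" "0 <= r" using U_real(1)[OF mu, of R] by (cases "U mu R") auto
  have "(ennreal c * ennreal r) * ennreal (1 / (2 * c)) = ennreal (r / 2)"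
   using c r by (simp add: ennreal_mult[symmetric])
  then have "ennreal r <= ennreal (sig a + r / 2)" using * r sig_pos[OF a] by (simp add: r)
  then have "r <= sig a + r / 2" using sig_pos[OF a] r(2) by (subst (asm) ennreal_le_iff) auto
  then show ?thesis unfolding r by (intro ennreal_leI) simp
 qed
 then show ?thesis by (intro exI[of _ "ennreal (2 * sig a)"]) auto
qed

text \<open>The two densities are eigenfunctions of the symmetric operator with kernel \<open>kern\<close> for
 different eigenvalues, so they would be orthogonal if the product were integrable.\<close>

lemma natural_boundary:
 assumes inf: "infinite {\<nu>. qsd X \<nu>}"
 shows "(\<integral>\<^sup>+z. ennreal (sig z) * indicator Rpos z \<partial>m) = top"
proof (rule ccontr)
 assume "(\<integral>\<^sup>+z. ennreal (sig z) * indicator Rpos z \<partial>m) ~= top"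
 then have fin: "(\<integral>\<^sup>+z. ennreal (sig z) * indicator Rpos z \<partial>m) < top" by (simp add: less_top)
 obtain \<nu> \<nu>' c c' where q: "qsd X \<nu>" "qsd X \<nu>'" and c: "0 < c" "0 < c'" "c ~= c'"
  and e: "\<nu> = density m (%z. ennreal c * U \<nu> z)" "\<nu>' = density m (%z. ennreal c' * U \<nu>' z)"
  by (rule two_qsds[OF inf])
 have p: "prob_on_pos \<nu>" "prob_on_pos \<nu>'" using q by (auto simp: qsd_def)
 interpret pr: prob_space \<nu> by (rule prob_on_posD[OF p(1)])
 note [measurable] = U_measurable[OF p(1)] U_measurable[OF p(2)]
 note [measurable_cong] = prob_on_posD(2)[OF p(1)]
 obtain B where B: "B < top" "!!z. 0 < z ==> z < top ==> U \<nu>' z <= B"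
  using qsd_bounded_density[OF p(2) c(2) e(2) fin] by blast
 define I where "I = (\<integral>\<^sup>+z. U \<nu> z * U \<nu>' z \<partial>m)"
 have I1: "ennreal c * I = (\<integral>\<^sup>+z. U \<nu>' z \<partial>\<nu>)"
  using arg_cong[OF e(1), of "%M. nn_integral M (U \<nu>')"]
  by (simp add: I_def nn_integral_density mult.assoc nn_integral_cmult)
 \<comment> \<open>Boundedness of the second density makes the pairing finite; otherwise both
   expressions for it could be infinite without contradiction.\<close>
 have "(\<integral>\<^sup>+z. U \<nu>' z \<partial>\<nu>) <= (\<integral>\<^sup>+z. B \<partial>\<nu>)"
  by (rule nn_integral_mono_AE, use prob_on_posD(3)[OF p(1)] in eventually_elim) (use B in auto)
 then have fI: "ennreal c * I < top" using I1 B(1) by (auto simp: pr.emeasure_space_1 intro: order_le_less_trans)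
 have "(\<integral>\<^sup>+z. U \<nu>' z \<partial>\<nu>) = (\<integral>\<^sup>+z. (\<integral>\<^sup>+x. kern x z \<partial>\<nu>') \<partial>\<nu>)" by (simp add: U_def)
 also have "... = (\<integral>\<^sup>+z. (\<integral>\<^sup>+x. kern z x * (ennreal c' * U \<nu>' x) \<partial>m) \<partial>\<nu>)"
 proof (rule nn_integral_cong)
  fix z
  show "(\<integral>\<^sup>+x. kern x z \<partial>\<nu>') = (\<integral>\<^sup>+x. kern z x * (ennreal c' * U \<nu>' x) \<partial>m)"
   by (subst e(2), subst nn_integral_density) (auto simp: kern_sym[of z] mult.commute)
 qed
 also have "... = (\<integral>\<^sup>+x. U \<nu> x * (ennreal c' * U \<nu>' x) \<partial>m)" by (rule U_symmetric[OF p(1)]) measurable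
 also have "... = ennreal c' * I" unfolding I_def by (subst nn_integral_cmult[symmetric]) (auto simp: mult_ac)
 finally have I2: "ennreal c * I = ennreal c' * I" using I1 by simp
 have "I ~= 0"
 proof
  assume "I = 0"
  then have "(\<integral>\<^sup>+z. U \<nu>' z \<partial>\<nu>) = 0" using I1 by simp
  then have "AE z in \<nu>. U \<nu>' z = 0" by (subst (asm) nn_integral_0_iff_AE) auto
  with prob_on_posD(3)[OF p(1)] have "AE z in \<nu>. False"
   by eventually_elim (use U_le_sig(2)[OF p(2)] in force)
  then show False by simp
 qed
 moreover have "I ~= top" using fI c by (auto simp: ennreal_mult_top)
 ultimately obtain r where r: "I = ennreal r" "0 < r" by (cases I) (auto simp: ennreal_eq_0_iff less_le)
 then have "c * r = c' * r" using I2 c by (simp add: ennreal_mult[symmetric])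
 then show False using r c by simp
qed

text \<open>If \<open>top\<close> is a state, \<open>m\<close> is finite near it, so a divergent
  integral of \<open>sig\<close> makes \<open>sig\<close> unbounded. A path from \<open>x\<close> to
  \<open>top\<close> has to pass every level \<open>c\<close> before being absorbed; comparing the
  potentials of an interval \<open>(b,c)\<close> seen from \<open>x\<close> and from
  \<open>c\<close> bounds the probability of this by \<open>sig x / sig b\<close>.\<close>

lemma no_mass_at_top:
 assumes nat: "(\<integral>\<^sup>+z. ennreal (sig z) * indicator Rpos z \<partial>m) = top" and x: "0 < x" "x < top" and t: "t < top"
 shows "semigroup (indicator {top}) t x = 0"
proof (cases "top \<in> state X")
 case False
 have nt: "pos X t om ~= top" if "om \<in> Om" "t < life X om" for om
  using pos_state[OF that] False by metis
 have "semigroup (indicator {top}) t x = (\<integral>\<^sup>+om. 0 \<partial>law X x)"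
  unfolding semigroup_def
  by (rule nn_integral_cong) (use nt space_law[OF fin_in_state[OF x(2)]] in \<open>auto simp: val_def indicator_def\<close>)
 then show ?thesis by simp
next
 case True
 have mt: "emeasure m {b<..<top} < top" if "0 < b" for b
 proof -
  have "emeasure m {b<..<top} <= emeasure m {b..top}" by (rule emeasure_mono) (auto simp: sets_m)
  moreover have "{b..top} <= state X - {0}"
  proof
   fix x assume "x \<in> {b..top}"
   then have "0 < x" using that by auto
   then show "x \<in> state X - {0}" using True fin_in_state[of x] by (cases "x = top") (auto simp: less_top[symmetric])
  qed
  moreover have "compact {b..top}" by (simp add: compact_eq_closed)
  ultimately show ?thesis using speed unfolding speed_measure_def by (meson order_le_less_trans)
 qed
 have unb: "\<exists>b. x < b & b < top & K < sig b" for K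
 proof (rule ccontr)
  assume no: "\<not> ?thesis"
  obtain y where y: "x < y" "y < top" using x dense by blast
  have "0 < y" using y x by order
  have le: "sig z <= \<bar>K\<bar>" if "y <= z" "z < top" for z
  proof -
   have "x < z" using y that by order
   then show ?thesis using no that by force
  qed
  have "(\<integral>\<^sup>+z. ennreal (sig z) * indicator Rpos z \<partial>m) \<le>
   (\<integral>\<^sup>+z. ennreal (sig z) * indicator {0<..<y} z + ennreal \<bar>K\<bar> * indicator {x<..<top} z \<partial>m)"
  proof (rule nn_integral_mono)
   fix z show "ennreal (sig z) * indicator Rpos z <= ennreal (sig z) * indicator {0<..<y} z + ennreal \<bar>K\<bar> * indicator {x<..<top} z"
   proof (cases "0 < z & z < top")
    case True
    show ?thesis
    proof (cases "z < y")
     case False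
     then have "x < z" using y by auto
     then show ?thesis using False True le[of z] by (auto intro!: ennreal_leI)
    qed (use True in simp)
   qed simp
  qed
  also have "... = (\<integral>\<^sup>+z. ennreal (sig z) * indicator {0<..<y} z \<partial>m) + ennreal \<bar>K\<bar> * emeasure m {x<..<top}"
   by (subst nn_integral_add) (auto simp: nn_integral_cmult_indicator sets_m)
  also have "... < top" using scale_mass_finite[OF y(2)] mt[OF x(1)] by (simp add: ennreal_mult_less_top)
  finally show False using nat by simp
 qed
 have bound: "semigroup (indicator {top}) t x * ennreal (sig b) <= ennreal (sig x)" if b: "x < b" "b < top" for b
 proof -
  obtain c where c: "b < c" "c < top" using b dense by blast
  have xc: "0 < x" "x < c" "c < top" using x b c by order+
  have b0: "0 < b" using x b by order
  \<comment> \<open>The mass of the target interval appears on both sides and cancels, being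
    positive and finite.\<close>
  define M where "M = emeasure m {b<..<c}"
  have Mt: "M < top" unfolding M_def
   using order_le_less_trans[OF emeasure_mono[of "{b<..<c}" "{b<..<top}" m] mt[OF b0]] c by (force simp: sets_m)
  have M0: "0 < M" unfolding M_def
  proof (rule m_open_pos)
   show "{b<..<c} ~= {}" using dense[OF c(1)] by auto
   show "{b<..<c} <= Rpos" using c by (auto intro: pos order_less_trans)
  qed simp
  define f :: "ennreal => ennreal" where "f = indicator {b<..<c}"
  have [measurable]: "f \<in> borelm" by (simp add: f_def)
  have fI: "(%z. f z * indicator Rpos z) = f"
   using c by (auto simp: f_def indicator_def fun_eq_iff intro: pos order_less_trans)
  have gx: "green f x = ennreal (sig x) * M"
  proof -
   have "green f x = (\<integral>\<^sup>+z. kern x z * f z \<partial>m)" using green_formula[OF x, of f] by (simp add: fI)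
   also have "... = (\<integral>\<^sup>+z. ennreal (sig x) * indicator {b<..<c} z \<partial>m)"
   proof (rule nn_integral_cong)
    fix z show "kern x z * f z = ennreal (sig x) * indicator {b<..<c} z"
    proof (cases "b < z & z < c")
     case True
     then have "x < z" "0 < z" "z < top" using b c x by (auto intro: pos order_less_trans)
     then have "sig x <= sig z" using x by (intro sig_mono) auto
     then show ?thesis using True x \<open>0 < z\<close> \<open>z < top\<close> by (simp add: kern_def f_def min_absorb1)
    qed (auto simp: f_def)
   qed
   finally show ?thesis by (simp add: nn_integral_cmult_indicator M_def sets_m)
  qed
  have gc: "ennreal (sig b) * M <= green f c"
  proof -
   have c0: "0 < c" using xc by order
   have "ennreal (sig b) * M = (\<integral>\<^sup>+z. ennreal (sig b) * indicator {b<..<c} z \<partial>m)" by (simp add: nn_integral_cmult_indicator M_def sets_m)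
   also have "... <= (\<integral>\<^sup>+z. kern c z * f z \<partial>m)"
   proof (rule nn_integral_mono)
    fix z show "ennreal (sig b) * indicator {b<..<c} z <= kern c z * f z"
    proof (cases "b < z & z < c")
     case True
     then have z: "0 < z" "z < top" using c by (auto intro: pos order_less_trans)
     have "sig b <= sig z" "sig b <= sig c" using True b0 z c by (auto intro!: sig_mono)
     then show ?thesis using True c0 c z by (simp add: kern_def f_def ennreal_leI)
    qed (auto simp: f_def)
   qed
   also have "... = green f c" using green_formula[OF c0 c(2), of f] by (simp add: fI)
   finally show ?thesis .
  qed
  let ?ta = "exit_of X {0<..<c}"
  let ?p = "emeasure (law X x) {om\<in>Om. path (?ta om) om = c}"
  have "?p * (ennreal (sig b) * M) <= ?p * green f c" by (intro mult_left_mono gc) simp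
  also have "... <= green f x"
   using exit_interval_green(1)[OF xc(1-3), of f] by (simp add: add_increasing2 add_increasing)
  also have "... = ennreal (sig x) * M" by (rule gx)
  finally have "?p * (ennreal (sig b) * M) <= ennreal (sig x) * M" .
  then have pM: "?p * ennreal (sig b) <= ennreal (sig x)"
  proof -
   obtain r where r: "M = ennreal r" "0 < r" using M0 Mt by (cases M) auto
   have "ennreal r * ennreal (1 / r) = 1" using r by (simp add: ennreal_mult[symmetric])
   then have c1: "q * M * ennreal (1 / r) = q" for q unfolding r by (simp add: mult.assoc)
   have "?p * ennreal (sig b) * M <= ennreal (sig x) * M"
    using \<open>?p * (ennreal (sig b) * M) <= ennreal (sig x) * M\<close> by (simp only: mult.assoc)
   from mult_right_mono[OF this, of "ennreal (1 / r)"]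
   have "?p * ennreal (sig b) * M * ennreal (1 / r) <= ennreal (sig x) * M * ennreal (1 / r)" by simp
   then show ?thesis by (simp only: c1)
  qed
  have "semigroup (indicator {top}) t x <= (\<integral>\<^sup>+om. indicator {om\<in>Om. path (?ta om) om = c} om \<partial>law X x)"
   unfolding semigroup_def
  proof (rule nn_integral_mono_AE, use good_start_AE[OF good_start_fin[OF x(2)]] exit_interval_green(4)[OF xc(1-3) borel_measurable_const[of 0]] in eventually_elim)
   case (elim om)
   then have g: "good om" and om: "om \<in> Om" by (auto simp: good_def)
   show ?case
   proof (cases "pos X t om = top")
    case T: True
    have le: "?ta om <= t" using exit_less[of t "{0<..<c}" om] T by (force simp: not_less[symmetric])
    \<comment> \<open>A path that leaves through 0 stays there and cannot be at \<open>top\<close>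
      at time \<open>t\<close>.\<close>
    have "path (?ta om) om ~= 0"
    proof
     assume z: "path (?ta om) om = 0"
     have tat: "?ta om < top" using le t by (rule order_le_less_trans)
     have "hit X 0 om <= ?ta om" using good_less_hit[OF g tat] z good_path[OF g tat] by (auto simp: not_less)
     then have "hit X 0 om <= t" using le by (rule order_trans)
     then show False using g t T by (auto simp: good_def)
    qed
    then show ?thesis using elim om by (auto simp: val_def indicator_def)
   qed (use g t in \<open>simp add: good_val\<close>)
  qed
  also have "... = ?p" using exit_interval_green(3)[OF xc(1-3) borel_measurable_const[of 0], of c]
   by (simp add: sets_law[OF fin_in_state[OF x(2)]])
  finally have "semigroup (indicator {top}) t x <= ?p" .
  then have "semigroup (indicator {top}) t x * ennreal (sig b) <= ?p * ennreal (sig b)" by (rule mult_right_mono) simp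
  with pM show ?thesis by (rule order_trans[rotated])
 qed
 show ?thesis
 proof (rule ccontr)
  assume "semigroup (indicator {top}) t x ~= 0"
  moreover have "semigroup (indicator {top}) t x <= 1" by (rule semigroup_le_one[OF fin_in_state[OF x(2)]]) (simp add: indicator_def)
  ultimately obtain r where r: "semigroup (indicator {top}) t x = ennreal r" "0 < r"
   by (cases "semigroup (indicator {top}) t x") (auto simp: ennreal_eq_0_iff less_le top_unique)
  obtain b where b: "x < b" "b < top" "sig x / r < sig b" using unb[of "sig x / r"] by blast
  have sb: "0 < sig b" using b x by (intro sig_pos) (auto intro: order_less_trans)
  have "ennreal (r * sig b) <= ennreal (sig x)" using bound[OF b(1,2)] r sb by (simp add: ennreal_mult)
  then have "r * sig b <= sig x" using sig_pos[OF x] by (subst (asm) ennreal_le_iff) auto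
  then show False using b(3) r by (simp add: pos_divide_less_eq mult.commute)
 qed
qed

end

section \<open>Tail moments and the renewal transform\<close>

locale natural_process = dmds_process +
 assumes natural: "(\<integral>\<^sup>+z. ennreal (sig z) * indicator Rpos z \<partial>m) = top"
begin

lemma AE_not_top:
 assumes x: "0 < x" "x < top" and t: "t < top"
 shows "AE w in law X x. t < life X w --> pos X t w ~= top"
proof -
 have [measurable_cong]: "sets (law X x) = sets (events X)" by (rule sets_law[OF fin_in_state[OF x(2)]])
 have [measurable]: "val (indicator {top}) t \<in> borel_measurable (events X)" by (intro val_measurable) (use t in auto)
 have "AE w in law X x. val (indicator {top}) t w = 0"
  using no_mass_at_top[OF natural x t] unfolding semigroup_def by (subst (asm) nn_integral_0_iff_AE) auto
 then show ?thesis by eventually_elim (auto simp: val_def split: if_splits)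
qed

text \<open>The value of \<open>f\<close> at \<open>top\<close> becomes irrelevant, which makes the
  kernel formula hold for the whole killed process.\<close>

lemma semigroup_interior:
 assumes x: "0 < x" "x < top" and t: "t < top" and fg: "!!z. z < top ==> f z = g z"
 shows "semigroup f t x = semigroup g t x"
 unfolding semigroup_def
 by (rule nn_integral_cong_AE, use AE_not_top[OF x t] in eventually_elim) (use fg in \<open>auto simp: val_def less_top[symmetric]\<close>)

lemma green_interior:
 assumes x: "0 < x" "x < top" and f: "f \<in> borelm"
 shows "green (%z. f z * alive z) x = (\<integral>\<^sup>+z. kern x z * f z \<partial>m)"
proof -
 have "green (%z. f z * alive z) x = green (%z. f z * indicator Rpos z) x"
  unfolding green_def
  by (rule nn_integral_cong, subst semigroup_interior[OF x, where g="%z. f z * indicator Rpos z"])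
   (auto simp: indicator_def zero_less_iff_neq_zero)
 then show ?thesis using green_formula[OF x f] by simp
qed

lemma pot_eq:
 assumes mu: "prob_on_pos mu" and [measurable]: "f \<in> borelm"
 shows "pot mu f = (\<integral>\<^sup>+z. U mu z * f z \<partial>m)"
proof -
 have "pot mu f = (\<integral>\<^sup>+x. (\<integral>\<^sup>+z. kern x z * f z \<partial>m) \<partial>mu)"
  unfolding pot_def
  by (rule nn_integral_cong_AE, use prob_on_posD(3)[OF mu] in eventually_elim) (simp add: proj(3) green_interior)
 then show ?thesis by (simp add: U_symmetric[OF mu])
qed

lemma kmeas_interior:
 assumes mu: "prob_on_pos mu"
 shows "AE z in kmeas mu t. 0 < z & z < top"
proof -
 have "(\<integral>\<^sup>+z. indicator {0, top} z \<partial>kmeas mu t) = (\<integral>\<^sup>+x. semigroup (%z. 0) (ennreal t) (proj x) \<partial>mu)"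
  by (subst nn_integral_kmeas[OF mu], simp, rule nn_integral_cong, rule semigroup_interior[OF proj(1,2)]) (auto simp: indicator_def)
 also have "... = 0" by (simp add: semigroup_def val_def)
 finally have "AE z in kmeas mu t. indicator {0, top} z = (0::ennreal)" by (subst (asm) nn_integral_0_iff_AE) auto
 then show ?thesis by eventually_elim (auto simp: indicator_def less_top[symmetric] zero_less_iff_neq_zero split: if_splits)
qed

lemma kmeas_markov:
 assumes mu: "prob_on_pos mu" and [measurable]: "f \<in> borelm" and t: "0 <= t" "0 <= u"
 shows "(\<integral>\<^sup>+z. f z \<partial>kmeas mu (u + t)) = (\<integral>\<^sup>+z. semigroup (%z. f z * alive z) (ennreal t) (proj z) \<partial>kmeas mu u)"
proof -
 let ?F = "%z. f z * alive z"
 have [measurable]: "?F \<in> borelm" by measurable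
 have "(\<integral>\<^sup>+z. f z \<partial>kmeas mu (u + t)) = (\<integral>\<^sup>+x. semigroup ?F (ennreal u + ennreal t) (proj x) \<partial>mu)"
  using t by (subst nn_integral_kmeas[OF mu]) (simp_all add: ennreal_plus)
 also have "... = (\<integral>\<^sup>+x. semigroup (%z. semigroup ?F (ennreal t) (proj z) * alive z) (ennreal u) (proj x) \<partial>mu)"
 proof (rule nn_integral_cong)
  fix x
  have "semigroup ?F (ennreal u + ennreal t) (proj x) =
   (\<integral>\<^sup>+w. (if ennreal u < life X w then semigroup ?F (ennreal t) (path (ennreal u) w) else 0) \<partial>law X (proj x))"
   by (rule markov[OF proj_state]) auto
  also have "... = semigroup (%z. semigroup ?F (ennreal t) (proj z) * alive z) (ennreal u) (proj x)"
   unfolding semigroup_def[of _ "ennreal u"]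
  proof (rule nn_integral_cong_AE, use AE_not_top[OF proj(1,2), of "ennreal u" x, OF ennreal_less_top] in eventually_elim)
   case (elim w)
   show ?case
   proof (cases "ennreal u < life X w")
    case True
    have *: "semigroup ?F (ennreal t) z = semigroup ?F (ennreal t) (proj z) * alive z" if "z ~= top" for z
     using that proj(3)[of z] semigroup_zero[of ?F "ennreal t"]
     by (cases "z = 0") (auto simp: less_top[symmetric] zero_less_iff_neq_zero)
    show ?thesis using True elim *[of "pos X (ennreal u) w"] by (simp add: val_def path_def)
   qed (simp add: val_def)
  qed
  finally show "semigroup ?F (ennreal u + ennreal t) (proj x) = semigroup (%z. semigroup ?F (ennreal t) (proj z) * alive z) (ennreal u) (proj x)" .
 qed
 also have "... = (\<integral>\<^sup>+z. semigroup ?F (ennreal t) (proj z) \<partial>kmeas mu u)"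
  by (rule nn_integral_kmeas[OF mu, symmetric]) measurable
 finally show ?thesis .
qed

lemma kmeas_finite:
 assumes mu: "prob_on_pos mu" shows "finite_measure (kmeas mu t)"
proof
 have "space (kmeas mu t) = UNIV" using sets_eq_imp_space_eq[OF sets_kmeas] by simp
 then show "emeasure (kmeas mu t) (space (kmeas mu t)) ~= \<infinity>" by (simp flip: tail_kmeas(1)[OF mu])
qed

text \<open>The Markov property at \<open>u\<close> turns the occupation after time \<open>u\<close>
  into the Green operator applied to the killed law at \<open>u\<close>.\<close>

lemma kmeas_green:
 assumes mu: "prob_on_pos mu" and [measurable]: "f \<in> borelm" and u: "0 <= u"
 shows "(\<integral>\<^sup>+t\<in>{0..}. (\<integral>\<^sup>+z. f z \<partial>kmeas mu (u + t)) \<partial>lborel) = (\<integral>\<^sup>+x. (\<integral>\<^sup>+z. kern x z * f z \<partial>m) \<partial>kmeas mu u)"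
proof -
 interpret K: finite_measure "kmeas mu u" by (rule kmeas_finite[OF mu])
 interpret P: pair_sigma_finite "kmeas mu u" lborel by standard
 have [measurable]: "(%z. f z * alive z) \<in> borelm" by measurable
 have "(\<integral>\<^sup>+t\<in>{0..}. (\<integral>\<^sup>+z. f z \<partial>kmeas mu (u + t)) \<partial>lborel) =
  (\<integral>\<^sup>+t. (\<integral>\<^sup>+x. semigroup (%z. f z * alive z) (ennreal t) (proj x) * indicator {0..} t \<partial>kmeas mu u) \<partial>lborel)"
 proof (rule nn_integral_cong)
  fix t show "(\<integral>\<^sup>+z. f z \<partial>kmeas mu (u + t)) * indicator {0..} t = (\<integral>\<^sup>+x. semigroup (%z. f z * alive z) (ennreal t) (proj x) * indicator {0..} t \<partial>kmeas mu u)"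
   by (cases "0 <= t") (simp_all add: kmeas_markov[OF mu _ _ u])
 qed
 also have "... = (\<integral>\<^sup>+x. (\<integral>\<^sup>+t. semigroup (%z. f z * alive z) (ennreal t) (proj x) * indicator {0..} t \<partial>lborel) \<partial>kmeas mu u)"
  by (rule P.Fubini'[of "%x t. semigroup (%z. f z * alive z) (ennreal t) (proj x) * indicator {0..} t"])
   (unfold case_prod_beta, measurable)
 also have "... = (\<integral>\<^sup>+x. green (%z. f z * alive z) (proj x) \<partial>kmeas mu u)" by (simp add: green_def)
 also have "... = (\<integral>\<^sup>+x. (\<integral>\<^sup>+z. kern x z * f z \<partial>m) \<partial>kmeas mu u)"
  by (rule nn_integral_cong_AE, use kmeas_interior[OF mu, of u] in eventually_elim) (simp add: proj(3) green_interior)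
 finally show ?thesis .
qed

lemma tail_measurable:
 assumes mu: "prob_on_pos mu" shows "tail X mu \<in> borelm"
proof -
 interpret pr: prob_space mu by (rule prob_on_posD[OF mu])
 note [measurable_cong] = prob_on_posD(2)[OF mu]
 have "tail X mu = (%t. enn2real (\<integral>\<^sup>+x. semigroup alive (ennreal t) (proj x) \<partial>mu))"
  using tail_kmeas(2)[OF mu] by (simp add: fun_eq_iff flip: tail_kmeas(4)[OF mu])
 then show ?thesis by simp
qed

lemma tail_antimono:
 assumes mu: "prob_on_pos mu" and "0 <= t" "t <= t'" shows "tail X mu t' <= tail X mu t"
proof -
 have "ennreal (tail X mu t') <= ennreal (tail X mu t)"
  unfolding tail_kmeas(4)[OF mu]
  by (intro nn_integral_mono alive_semigroup_antimono good_start_fin proj(2) ennreal_leI assms(3)) simp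
 then show ?thesis using tail_kmeas(2)[OF mu] by simp
qed

text \<open>This is \<open>E T_0^(k+1) / (k+1)!\<close>, so its index lags one behind that of
  \<open>norm_moment\<close>; see \<open>hit0_moment_Suc\<close>.\<close>

definition tail_moment :: "ennreal measure => nat => ennreal" where
 "tail_moment mu k = (\<integral>\<^sup>+t\<in>{0..}. ennreal (t ^ k / fact k) * ennreal (tail X mu t) \<partial>lborel)"

lemma power_integral:
 assumes "0 <= h"
 shows "(\<integral>\<^sup>+t. ennreal (t ^ k / fact k) * indicator {0..h} t \<partial>lborel) = ennreal (h ^ Suc k / fact (Suc k))"
proof -
 have "(\<integral>\<^sup>+t. ennreal (t ^ k / fact k) * indicator {0..h} t \<partial>lborel) = ennreal (h ^ Suc k / fact (Suc k) - 0 ^ Suc k / fact (Suc k))"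
 proof (rule nn_integral_FTC_Icc)
  show "((%t. t ^ Suc k / fact (Suc k)) has_real_derivative t ^ k / fact k) (at t)" for t :: real
  proof -
   have "((%t. t ^ Suc k / fact (Suc k)) has_real_derivative (real (Suc k) * t ^ k) / fact (Suc k)) (at t)"
    by (rule DERIV_cdivide) (use DERIV_pow[of "Suc k" t UNIV] in \<open>simp only: diff_Suc_Suc diff_zero\<close>)
   moreover have "(real (Suc k) * t ^ k) / fact (Suc k) = t ^ k / fact k"
    unfolding fact_Suc of_nat_mult by (subst mult_divide_mult_cancel_left) auto
   ultimately show ?thesis by simp
  qed
 qed (use assms in auto)
 then show ?thesis by simp
qed

text \<open>Layer cake formula: \<open>y^(k+1) / (k+1)!\<close> is the integral of
  \<open>t^k / k!\<close> over \<open>[0,y]\<close>, and \<open>T_0\<close> is finite almost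
  surely.\<close>

lemma hit0_moment_Suc:
 assumes mu: "prob_on_pos mu"
 shows "hit0_moment X mu (Suc k) = ennreal (fact (Suc k)) * tail_moment mu k"
proof -
 interpret L: prob_space "law_from X mu" by (rule law_from_facts(4)[OF mu])
 interpret P: pair_sigma_finite "law_from X mu" lborel by standard
 note [measurable_cong] = law_from_facts(1)[OF mu]
 have "(\<integral>\<^sup>+w. indicator {w\<in>Om. hit X 0 w = top} w \<partial>law_from X mu) = (\<integral>\<^sup>+x. 0 \<partial>mu)"
 proof (subst law_from_facts(3)[OF mu], measurable, rule nn_integral_cong)
  fix x
  have "(\<integral>\<^sup>+w. indicator {w\<in>Om. hit X 0 w = top} w \<partial>law X (proj x)) = (\<integral>\<^sup>+w. 0 \<partial>law X (proj x))"
   by (rule nn_integral_cong_AE, use good_start_AE[OF good_start_fin[OF proj(2)], of x] in eventually_elim)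
    (auto simp: good_def indicator_def)
  then show "(\<integral>\<^sup>+w. indicator {w\<in>Om. hit X 0 w = top} w \<partial>law X (proj x)) = 0" by simp
 qed
 also have "... = 0" by simp
 finally have "AE w in law_from X mu. indicator {w\<in>Om. hit X 0 w = top} w = (0::ennreal)"
  by (subst (asm) nn_integral_0_iff_AE) auto
 then have fin: "AE w in law_from X mu. hit X 0 w < top"
  using AE_space by eventually_elim (auto simp: law_from_facts(2)[OF mu] indicator_def less_top split: if_splits)
 have key: "(\<integral>\<^sup>+t. ennreal (t ^ k / fact k) * (if 0 <= t & ennreal t < y then 1 else 0) \<partial>lborel) = inverse (ennreal (fact (Suc k))) * y ^ Suc k"
  if y: "y < top" for y
 proof -
  obtain h where h: "y = ennreal h" "0 <= h" using y by (cases y) auto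
  have "(\<integral>\<^sup>+t. ennreal (t ^ k / fact k) * (if 0 <= t & ennreal t < y then 1 else 0) \<partial>lborel) = (\<integral>\<^sup>+t. ennreal (t ^ k / fact k) * indicator {0..h} t \<partial>lborel)"
   by (rule nn_integral_cong_AE, use AE_lborel_singleton[of h] in eventually_elim) (use h in \<open>auto simp: indicator_def ennreal_less_iff\<close>)
  also have "... = ennreal (h ^ Suc k / fact (Suc k))" by (rule power_integral[OF h(2)])
  also have "... = inverse (ennreal (fact (Suc k))) * y ^ Suc k"
   unfolding h(1) ennreal_power[OF h(2)] inverse_ennreal[OF fact_gt_zero]
   using h(2) by (subst ennreal_mult[symmetric]) (auto simp: field_simps simp del: fact_Suc power_Suc)
  finally show ?thesis .
 qed
 have "tail_moment mu k = (\<integral>\<^sup>+t. (\<integral>\<^sup>+w. ennreal (t ^ k / fact k) * (if 0 <= t & ennreal t < hit X 0 w then 1 else 0) \<partial>law_from X mu) \<partial>lborel)"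
  unfolding tail_moment_def
 proof (rule nn_integral_cong)
  fix t :: real
  have "(\<integral>\<^sup>+w. (if 0 <= t & ennreal t < hit X 0 w then 1 else 0) \<partial>law_from X mu) = (\<integral>\<^sup>+w. indicator {w\<in>Om. ennreal t < hit X 0 w} w * indicator {0..} t \<partial>law_from X mu)"
   by (rule nn_integral_cong) (auto simp: law_from_facts(2)[OF mu] indicator_def)
  also have "... = ennreal (tail X mu t) * indicator {0..} t"
   unfolding tail_def L.emeasure_eq_measure[symmetric] by (subst nn_integral_multc) (simp_all add: law_from_facts(1)[OF mu])
  finally show "ennreal (t ^ k / fact k) * ennreal (tail X mu t) * indicator {0..} t =
   (\<integral>\<^sup>+w. ennreal (t ^ k / fact k) * (if 0 <= t & ennreal t < hit X 0 w then 1 else 0) \<partial>law_from X mu)"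
   by (subst nn_integral_cmult) (simp_all add: mult.assoc)
 qed
 also have "... = (\<integral>\<^sup>+w. (\<integral>\<^sup>+t. ennreal (t ^ k / fact k) * (if 0 <= t & ennreal t < hit X 0 w then 1 else 0) \<partial>lborel) \<partial>law_from X mu)"
  by (rule P.Fubini'[of "%w t. ennreal (t ^ k / fact k) * (if 0 <= t & ennreal t < hit X 0 w then 1 else 0)"]) (unfold case_prod_beta, measurable)
 also have "... = (\<integral>\<^sup>+w. inverse (ennreal (fact (Suc k))) * hit X 0 w ^ Suc k \<partial>law_from X mu)"
  by (rule nn_integral_cong_AE, use fin in eventually_elim) (rule key)
 also have "... = inverse (ennreal (fact (Suc k))) * hit0_moment X mu (Suc k)"
  unfolding hit0_moment_def by (rule nn_integral_cmult) measurable
 finally have e: "tail_moment mu k = inverse (ennreal (fact (Suc k))) * hit0_moment X mu (Suc k)" .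
 have "ennreal (fact (Suc k)) * inverse (ennreal (fact (Suc k))) = 1"
  unfolding inverse_ennreal[OF fact_gt_zero] by (subst ennreal_mult[symmetric]) (auto simp del: fact_Suc)
 then show ?thesis unfolding e by (simp only: mult.assoc[symmetric] mult_1_left)
qed

lemma norm_moment_Suc:
 assumes mu: "prob_on_pos mu" shows "norm_moment X mu (Suc k) = enn2real (tail_moment mu k)"
 unfolding norm_moment_def hit0_moment_Suc[OF mu] enn2real_mult by (simp del: fact_Suc)

lemma tail_moment_0:
 assumes mu: "prob_on_pos mu"
 shows "tail_moment mu 0 = (\<integral>\<^sup>+z. U mu z \<partial>m)" "0 < tail_moment mu 0"
proof -
 note [measurable] = U_measurable[OF mu]
 have "tail_moment mu 0 = (\<integral>\<^sup>+t\<in>{0..}. (\<integral>\<^sup>+z. 1 \<partial>kmeas mu t) \<partial>lborel)"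
  unfolding tail_moment_def using sets_eq_imp_space_eq[OF sets_kmeas] by (simp add: tail_kmeas(1)[OF mu])
 also have "... = pot mu (%_. 1)" by (rule time_integral_kmeas[OF mu]) simp
 also have "... = (\<integral>\<^sup>+z. U mu z * 1 \<partial>m)" by (rule pot_eq[OF mu]) simp
 finally show e: "tail_moment mu 0 = (\<integral>\<^sup>+z. U mu z \<partial>m)" by simp
 have "tail_moment mu 0 ~= 0"
 proof
  assume "tail_moment mu 0 = 0"
  then have "AE z in m. U mu z = 0" unfolding e by (subst (asm) nn_integral_0_iff_AE) auto
  then have ae: "AE z in m. z \<notin> Rpos" by eventually_elim (use U_le_sig(2)[OF mu] in force)
  have "(\<integral>\<^sup>+z. indicator Rpos z \<partial>m) = (\<integral>\<^sup>+z. 0 \<partial>m)"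
   by (rule nn_integral_cong_AE, use ae in eventually_elim) (auto simp: indicator_def)
  then have "emeasure m Rpos = 0" by (simp add: sets_m)
  moreover have "0 < emeasure m Rpos" by (rule m_open_pos) (auto intro!: exI[of _ 1])
  ultimately show False by simp
 qed
 then show "0 < tail_moment mu 0" by (simp add: zero_less_iff_neq_zero)
qed

lemma U_zero: "z \<notin> Rpos ==> U mu z = 0"
proof -
 assume "z \<notin> Rpos"
 then have "kern x z = 0" for x unfolding kern_def by auto
 then show ?thesis by (simp add: U_def)
qed

text \<open>The time integral of the killed laws is the measure with density \<open>U mu\<close>,
  whose total mass is the mean of \<open>T_0\<close>; division by this mean gives a probability
  measure.\<close>

lemma renewal_eq:
 assumes mu: "prob_on_pos mu" and fin: "tail_moment mu 0 < top"
 shows "renewal X mu = density m (%z. inverse (tail_moment mu 0) * U mu z)" (is "_ = ?D")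
  "prob_on_pos (renewal X mu)"
  "!!f. f \<in> borelm ==> (\<integral>\<^sup>+z. f z \<partial>renewal X mu) = inverse (tail_moment mu 0) * pot mu f"
proof -
 note [measurable] = U_measurable[OF mu]
 have M1: "hit0_moment X mu 1 = tail_moment mu 0" using hit0_moment_Suc[OF mu, of 0] by simp
 have sD: "sets ?D = sets borel" "space ?D = UNIV" by (simp_all add: sets_m)
 have D: "(\<integral>\<^sup>+z. f z \<partial>?D) = inverse (tail_moment mu 0) * pot mu f" if [measurable]: "f \<in> borelm" for f
  by (subst nn_integral_density, measurable) (simp add: pot_eq[OF mu] mult.assoc nn_integral_cmult)
 have k: "(\<integral>\<^sup>+t\<in>{0..}. killed_law X mu t B \<partial>lborel) / hit0_moment X mu 1 = emeasure ?D B" if "B \<in> sets borel" for B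
 proof -
  have "(\<integral>\<^sup>+t\<in>{0..}. killed_law X mu t B \<partial>lborel) = (\<integral>\<^sup>+t\<in>{0..}. (\<integral>\<^sup>+z. indicator B z \<partial>kmeas mu t) \<partial>lborel)"
   using that by (simp add: killed_law_kmeas[OF mu])
  also have "... = pot mu (indicator B)" by (rule time_integral_kmeas[OF mu]) (use that in simp)
  finally show ?thesis using D[of "indicator B"] that by (simp only: M1 divide_ennreal_def nn_integral_indicator sD) (simp add: mult.commute sets_m)
 qed
 have "renewal X mu = measure_of UNIV (sets borel) (emeasure ?D)"
  unfolding renewal_def by (rule measure_of_eq) (auto simp: k sets.sigma_sets_eq[of borel, simplified] simp del: One_nat_def)
 also have "... = measure_of (space ?D) (sets ?D) (emeasure ?D)" by (simp only: sD)
 finally show R: "renewal X mu = ?D" by (simp only: measure_of_of_measure)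
 show "(\<integral>\<^sup>+z. f z \<partial>renewal X mu) = inverse (tail_moment mu 0) * pot mu f" if "f \<in> borelm" for f
  unfolding R by (rule D[OF that])
 have one: "inverse (tail_moment mu 0) * tail_moment mu 0 = 1"
  using tail_moment_0(2)[OF mu] fin by (metis ennreal_divide_self divide_ennreal_def mult.commute less_irrefl)
 
 have "emeasure ?D UNIV = inverse (tail_moment mu 0) * tail_moment mu 0"
  using D[of "%_. 1"] by (simp add: pot_eq[OF mu] tail_moment_0(1)[OF mu] sD)
 moreover have "emeasure ?D Rpos = inverse (tail_moment mu 0) * (\<integral>\<^sup>+z. U mu z * indicator Rpos z \<partial>m)"
  using D[of "indicator Rpos"] by (simp add: pot_eq[OF mu] sets_m)
 moreover have "(\<integral>\<^sup>+z. U mu z * indicator Rpos z \<partial>m) = tail_moment mu 0"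
  unfolding tail_moment_0(1)[OF mu] by (rule nn_integral_cong) (use U_zero[of _ mu] in \<open>auto simp: indicator_def\<close>)
 ultimately show "prob_on_pos (renewal X mu)"
  unfolding prob_on_pos_def R by (auto simp: one sD sets_m intro!: prob_spaceI)
qed

text \<open>By the Markov property, surviving another \<open>u\<close> from the killed law at time
  \<open>t\<close> has probability \<open>tail X mu (t + u)\<close>. So the new tail is the
  normalised integrated tail.\<close>

lemma tail_renewal:
 assumes mu: "prob_on_pos mu" and fin: "tail_moment mu 0 < top" and u: "0 <= u"
 shows "ennreal (tail X (renewal X mu) u) = inverse (tail_moment mu 0) * (\<integral>\<^sup>+t\<in>{0..}. ennreal (tail X mu (t + u)) \<partial>lborel)"
proof -
 note R = renewal_eq[OF assms(1,2)]
 have one: "(%z. 1 * alive z) = alive" by simp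
 have "ennreal (tail X (renewal X mu) u) = inverse (tail_moment mu 0) * pot mu (%z. semigroup alive (ennreal u) (proj z))"
  unfolding tail_kmeas(4)[OF R(2)] by (rule R(3)) measurable
 also have "pot mu (%z. semigroup alive (ennreal u) (proj z)) = (\<integral>\<^sup>+t\<in>{0..}. (\<integral>\<^sup>+z. semigroup alive (ennreal u) (proj z) \<partial>kmeas mu t) \<partial>lborel)"
  by (rule time_integral_kmeas[OF mu, symmetric]) measurable
 also have "... = (\<integral>\<^sup>+t\<in>{0..}. ennreal (tail X mu (t + u)) \<partial>lborel)"
 proof (rule nn_integral_cong)
  fix t :: real
  show "(\<integral>\<^sup>+z. semigroup alive (ennreal u) (proj z) \<partial>kmeas mu t) * indicator {0..} t = ennreal (tail X mu (t + u)) * indicator {0..} t"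
  proof (cases "0 <= t")
   case True
   have "(\<integral>\<^sup>+z. semigroup alive (ennreal u) (proj z) \<partial>kmeas mu t) = (\<integral>\<^sup>+z. 1 \<partial>kmeas mu (t + u))"
    using kmeas_markov[OF mu _ u True, of "%_. 1"] by (simp add: one)
   also have "... = ennreal (tail X mu (t + u))" using sets_eq_imp_space_eq[OF sets_kmeas] by (simp add: tail_kmeas(1)[OF mu])
   finally show ?thesis by simp
  qed simp
 qed
 finally show ?thesis .
qed

text \<open>Exchanging the order of integration over \<open>0 <= u <= v\<close> integrates
  \<open>u^k / k!\<close> and raises the order of the moment by one.\<close>

lemma tail_moment_renewal:
 assumes mu: "prob_on_pos mu" and fin: "tail_moment mu 0 < top"
 shows "tail_moment (renewal X mu) k = inverse (tail_moment mu 0) * tail_moment mu (Suc k)"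
proof -
 note [measurable] = tail_measurable[OF mu]
 let ?T = "%v. ennreal (tail X mu v)"
 have "tail_moment (renewal X mu) k = (\<integral>\<^sup>+u. inverse (tail_moment mu 0) * (\<integral>\<^sup>+v. ennreal (u ^ k / fact k) * ?T v * (if 0 <= u & u <= v then 1 else 0) \<partial>lborel) \<partial>lborel)"
  unfolding tail_moment_def[of "renewal X mu"]
 proof (rule nn_integral_cong)
  fix u :: real
  show "ennreal (u ^ k / fact k) * ennreal (tail X (renewal X mu) u) * indicator {0..} u =
   inverse (tail_moment mu 0) * (\<integral>\<^sup>+v. ennreal (u ^ k / fact k) * ?T v * (if 0 <= u & u <= v then 1 else 0) \<partial>lborel)"
  proof (cases "0 <= u")
   case True
   have "(\<integral>\<^sup>+v. ?T v * (if 0 <= u & u <= v then 1 else 0) \<partial>lborel) = (\<integral>\<^sup>+t. ?T (u + 1 * t) * (if 0 <= u & u <= u + 1 * t then 1 else 0) \<partial>lborel)"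
    by (subst nn_integral_real_affine[of _ 1 u]) auto
   also have "... = (\<integral>\<^sup>+t\<in>{0..}. ?T (t + u) \<partial>lborel)"
    by (rule nn_integral_cong) (use True in \<open>auto simp: indicator_def add.commute\<close>)
   finally have "(\<integral>\<^sup>+v. ?T v * (if 0 <= u & u <= v then 1 else 0) \<partial>lborel) = (\<integral>\<^sup>+t\<in>{0..}. ?T (t + u) \<partial>lborel)" .
   then have "ennreal (tail X (renewal X mu) u) = inverse (tail_moment mu 0) * (\<integral>\<^sup>+v. ?T v * (if 0 <= u & u <= v then 1 else 0) \<partial>lborel)"
    using tail_renewal[OF mu fin True] by simp
   moreover have "(\<integral>\<^sup>+v. ennreal (u ^ k / fact k) * ?T v * (if 0 <= u & u <= v then 1 else 0) \<partial>lborel) = ennreal (u ^ k / fact k) * (\<integral>\<^sup>+v. ?T v * (if 0 <= u & u <= v then 1 else 0) \<partial>lborel)"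
    by (subst nn_integral_cmult[symmetric]) (auto simp: mult.assoc)
   ultimately show ?thesis using True by (simp only: indicator_simps atLeast_iff mult_1_right mult_1_left mult_ac)
  qed simp
 qed
 also have "... = inverse (tail_moment mu 0) * (\<integral>\<^sup>+u. (\<integral>\<^sup>+v. ennreal (u ^ k / fact k) * ?T v * (if 0 <= u & u <= v then 1 else 0) \<partial>lborel) \<partial>lborel)"
  by (rule nn_integral_cmult) measurable
 also have "(\<integral>\<^sup>+u. (\<integral>\<^sup>+v. ennreal (u ^ k / fact k) * ?T v * (if 0 <= u & u <= v then 1 else 0) \<partial>lborel) \<partial>lborel) =
  (\<integral>\<^sup>+v. (\<integral>\<^sup>+u. ennreal (u ^ k / fact k) * ?T v * (if 0 <= u & u <= v then 1 else 0) \<partial>lborel) \<partial>lborel)"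
  by (rule lborel_pair.Fubini'[of "%v u. ennreal (u ^ k / fact k) * ?T v * (if 0 <= u & u <= v then 1 else 0)"]) (unfold case_prod_beta, measurable)
 also have "... = tail_moment mu (Suc k)"
  unfolding tail_moment_def
 proof (rule nn_integral_cong)
  fix v :: real
  have "(\<integral>\<^sup>+u. ennreal (u ^ k / fact k) * ?T v * (if 0 <= u & u <= v then 1 else 0) \<partial>lborel) = (\<integral>\<^sup>+u. ?T v * (ennreal (u ^ k / fact k) * indicator {0..v} u) \<partial>lborel)"
   by (rule nn_integral_cong) (auto simp: indicator_def mult_ac)
  also have "... = ?T v * (\<integral>\<^sup>+u. ennreal (u ^ k / fact k) * indicator {0..v} u \<partial>lborel)" by (rule nn_integral_cmult) measurable
  finally show "(\<integral>\<^sup>+u. ennreal (u ^ k / fact k) * ?T v * (if 0 <= u & u <= v then 1 else 0) \<partial>lborel) = ennreal (v ^ Suc k / fact (Suc k)) * ?T v * indicator {0..} v"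
   using power_integral[of v k] by (cases "0 <= v") (simp_all add: mult.commute del: fact_Suc power_Suc)
 qed
 finally show ?thesis .
qed

text \<open>Each transform divides by the current mean of \<open>T_0\<close>, and the product of the
  first \<open>n\<close> means is \<open>norm_moment X mu n\<close>. For \<open>k = 0\<close> the
  mean under the \<open>n\<close>-th iterate becomes a ratio of consecutive moments.\<close>

lemma renewal_iterate:
 assumes mu: "prob_on_pos mu" and fin: "!!k. tail_moment mu k < top"
 shows "prob_on_pos ((renewal X ^^ n) mu)" "!!k. tail_moment ((renewal X ^^ n) mu) k < top"
  "!!k. norm_moment X mu n * enn2real (tail_moment ((renewal X ^^ n) mu) k) = enn2real (tail_moment mu (n + k))"
proof -
 have "prob_on_pos ((renewal X ^^ n) mu) & (\<forall>k. tail_moment ((renewal X ^^ n) mu) k < top &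
  norm_moment X mu n * enn2real (tail_moment ((renewal X ^^ n) mu) k) = enn2real (tail_moment mu (n + k)))"
 proof (induction n)
  case 0
  interpret L: prob_space "law_from X mu" by (rule law_from_facts(4)[OF mu])
  have "norm_moment X mu 0 = 1" by (simp add: norm_moment_def hit0_moment_def L.emeasure_space_1)
  then show ?case using mu fin by simp
 next
  case (Suc n)
  let ?R = "(renewal X ^^ n) mu"
  from Suc have p: "prob_on_pos ?R" and f: "!!k. tail_moment ?R k < top"
   and e: "!!k. norm_moment X mu n * enn2real (tail_moment ?R k) = enn2real (tail_moment mu (n + k))" by auto
  note t = tail_moment_renewal[OF p f]
  have T0: "0 < enn2real (tail_moment ?R 0)" using tail_moment_0(2)[OF p] f by (simp add: enn2real_positive_iff)
  have it: "inverse (tail_moment ?R 0) < top"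
   using tail_moment_0(2)[OF p] f[of 0] by (cases "tail_moment ?R 0") (auto simp: inverse_ennreal)
  have ie: "enn2real (inverse (tail_moment ?R 0)) = 1 / enn2real (tail_moment ?R 0)"
   using tail_moment_0(2)[OF p] f[of 0] by (cases "tail_moment ?R 0") (auto simp: inverse_ennreal inverse_eq_divide)
  have "norm_moment X mu (Suc n) * enn2real (tail_moment (renewal X ?R) k) = enn2real (tail_moment mu (Suc n + k))" for k
  proof -
   have "norm_moment X mu (Suc n) * enn2real (tail_moment (renewal X ?R) k) =
    (norm_moment X mu n * enn2real (tail_moment ?R 0)) * (enn2real (tail_moment ?R (Suc k)) / enn2real (tail_moment ?R 0))"
    using e[of 0] by (simp add: norm_moment_Suc[OF mu] t enn2real_mult ie)
   also have "... = norm_moment X mu n * enn2real (tail_moment ?R (Suc k))" using T0 by simp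
   finally show ?thesis using e[of "Suc k"] by simp
  qed
  moreover have "tail_moment (renewal X ?R) k < top" for k
   unfolding t using it f[of "Suc k"] by (simp add: ennreal_mult_less_top)
  ultimately show ?case using renewal_eq(2)[OF p f] by simp
 qed
 then show "prob_on_pos ((renewal X ^^ n) mu)" "!!k. tail_moment ((renewal X ^^ n) mu) k < top"
  "!!k. norm_moment X mu n * enn2real (tail_moment ((renewal X ^^ n) mu) k) = enn2real (tail_moment mu (n + k))" by auto
qed

end

section \<open>Limits of ratios for decreasing real functions and their integrals\<close>

lemma ratio_limit_integral:
 fixes g :: "real => real"
 assumes anti: "!!x y. 0 <= x ==> x <= y ==> g y <= g x" and nonneg: "!!x. 0 <= g x" and [measurable]: "g \<in> borelm"
  and l: "0 < l" and lim: "!!h. 0 < h ==> ((%t. g (t + h) / g t) \<longlongrightarrow> exp (- l * h)) at_top"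
 shows "((%t. (LINT u:{0..}|lborel. g (t + u) / g t)) \<longlongrightarrow> 1 / l) at_top" "!!t. 0 <= t ==> 0 < g t"
  "\<forall>\<^sub>F t in at_top. set_integrable lborel {0..} (%u. g (t + u))"
proof -
 show gpos: "0 < g t" if t: "0 <= t" for t
 proof (rule ccontr)
  assume "\<not> 0 < g t"
  \<comment> \<open>A tail that vanishes once vanishes from then on, and the ratio
    \<open>0 / 0\<close> is 0 by convention, against a positive limit.\<close>
  then have "g u = 0" if "t <= u" for u using anti[OF t that] nonneg[of u] by simp
  then have "\<forall>\<^sub>F u in at_top. g (u + 1) / g u = 0" by (intro eventually_at_top_linorderI[of t]) simp
  then have "((%t. g (t + 1) / g t) \<longlongrightarrow> 0) at_top" by (rule tendsto_eventually)
  with lim[of 1] have "exp (- l * 1) = 0" by (intro tendsto_unique[OF trivial_limit_at_top_linorder]) auto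
  then show False by simp
 qed
 \<comment> \<open>Any number strictly between \<open>exp (- l)\<close> and 1 bounds the unit-step
   ratio eventually; monotonicity then gives an exponential majorant for dominated
   convergence.\<close>
 define q where "q = exp (- (l / 2))"
 have q: "0 < q" "q < 1" using l by (auto simp: q_def)
 have "\<forall>\<^sub>F t in at_top. g (t + 1) / g t < q"
  using lim[of 1] l by (intro order_tendstoD(2)) (auto simp: q_def)
 then obtain t0 where t0: "0 <= t0" "!!t. t0 <= t ==> g (t + 1) / g t < q"
  unfolding eventually_at_top_linorder by (meson max.cobounded1 max.cobounded2 order_trans)
 have step: "g (t + real k) <= q ^ k * g t" if "t0 <= t" for t k
 proof (induction k)
  case (Suc k)
  have "g (t + real k + 1) / g (t + real k) < q" using that by (intro t0) simp
  moreover have "0 < g (t + real k)" using that t0(1) by (intro gpos) simp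
  ultimately have "g (t + real k + 1) <= q * g (t + real k)" by (simp add: pos_divide_less_eq)
  also have "... <= q * (q ^ k * g t)" using Suc q by (intro mult_left_mono) auto
  finally show ?case by (simp add: algebra_simps)
 qed simp
 have dom: "g (t + u) / g t <= exp (l / 2) * exp (- (l / 2) * u)" if "t0 <= t" "0 <= u" for t u
 proof -
  define k where "k = nat \<lfloor>u\<rfloor>"
  have k: "real k <= u" "u < real k + 1" unfolding k_def using that by linarith+
  have "g (t + u) <= g (t + real k)" using k that t0 by (intro anti) auto
  also have "... <= q ^ k * g t" by (rule step[OF that(1)])
  finally have "g (t + u) / g t <= q ^ k" using gpos[of t] that t0 by (simp add: pos_divide_le_eq)
  also have "q ^ k = exp (- (l / 2) * real k)" unfolding q_def by (simp add: exp_of_nat_mult[symmetric] mult.commute)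
  also have "... <= exp (l / 2 + - (l / 2) * u)"
  proof -
   have "l / 2 * u <= l / 2 * (real k + 1)" using k l by (intro mult_left_mono) auto
   then show ?thesis by (simp add: algebra_simps)
  qed
  finally show ?thesis by (simp only: exp_add)
 qed
 have e0: "set_integrable lborel {0..} (%u. exp (- a * u))" "(LINT u:{0..}|lborel. exp (- a * u)) = 1 / a" if a: "0 < a" for a :: real
 proof -
  have hb: "has_bochner_integral lborel (%u. indicat_real {0..} u *\<^sub>R exp (- a * u)) (0 - (- exp (- a * 0) / a))"
  proof (rule has_bochner_integral_nn_integral)
   have "(\<integral>\<^sup>+u. ennreal (exp (- a * u)) * indicator {0..} u \<partial>lborel) = ennreal (0 - (- exp (- a * 0) / a))"
   proof (rule nn_integral_FTC_atLeast)
    show "((%u. - exp (- a * u) / a) \<longlongrightarrow> 0) at_top" using a by real_asymp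
    show "((%u. - exp (- a * u) / a) has_real_derivative exp (- a * u)) (at u)" for u
     using a by (auto intro!: derivative_eq_intros)
   qed auto
   moreover have "ennreal (indicat_real {0..} u *\<^sub>R exp (- a * u)) = ennreal (exp (- a * u)) * indicator {0..} u" for u
    by (auto simp: indicator_def)
   ultimately show "(\<integral>\<^sup>+u. ennreal (indicat_real {0..} u *\<^sub>R exp (- a * u)) \<partial>lborel) = ennreal (0 - (- exp (- a * 0) / a))"
    by (simp only:)
  qed (use a in auto)
  then show "set_integrable lborel {0..} (%u. exp (- a * u))" "(LINT u:{0..}|lborel. exp (- a * u)) = 1 / a"
   unfolding set_integrable_def set_lebesgue_integral_def by (auto simp: has_bochner_integral_iff)
 qed
 have wI: "integrable lborel (%u. indicat_real {0..} u *\<^sub>R (exp (l / 2) * exp (- (l / 2) * u)))"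
  using set_integrable_mult_right[OF e0(1)[of "l / 2"], of "exp (l / 2)"] l by (simp add: set_integrable_def)
 have bound: "norm (indicat_real {0..} u *\<^sub>R (g (t + u) / g t)) <= indicat_real {0..} u *\<^sub>R (exp (l / 2) * exp (- (l / 2) * u))" if "t0 <= t" for t u
  using dom[OF that, of u] nonneg[of "t + u"] nonneg[of t] by (cases "0 <= u") auto
 have "((%t. LINT u|lborel. indicat_real {0..} u *\<^sub>R (g (t + u) / g t)) \<longlongrightarrow> (LINT u|lborel. indicat_real {0..} u *\<^sub>R exp (- l * u))) at_top"
 proof (rule integral_dominated_convergence_at_top[OF _ _ wI])
  show "\<forall>\<^sub>F t in at_top. AE u in lborel. norm (indicat_real {0..} u *\<^sub>R (g (t + u) / g t)) <= indicat_real {0..} u *\<^sub>R (exp (l / 2) * exp (- (l / 2) * u))"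
   by (intro eventually_at_top_linorderI[of t0] AE_I2 bound)
  show "AE u in lborel. ((%t. indicat_real {0..} u *\<^sub>R (g (t + u) / g t)) \<longlongrightarrow> indicat_real {0..} u *\<^sub>R exp (- l * u)) at_top"
  proof (rule AE_I2)
   fix u :: real
   have "((%t. g (t + u) / g t) \<longlongrightarrow> exp (- l * u)) at_top" if "0 <= u"
   proof (cases "u = 0")
    case True
    have "\<forall>\<^sub>F t in at_top. g t / g t = 1" by (intro eventually_at_top_linorderI[of 0]) (use gpos in force)
    then show ?thesis using True by (auto intro: tendsto_eventually)
   qed (use lim that in auto)
   then show "((%t. indicat_real {0..} u *\<^sub>R (g (t + u) / g t)) \<longlongrightarrow> indicat_real {0..} u *\<^sub>R exp (- l * u)) at_top"
    by (cases "0 <= u") auto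
  qed
 qed measurable
 then show "((%t. (LINT u:{0..}|lborel. g (t + u) / g t)) \<longlongrightarrow> 1 / l) at_top"
  using e0(2)[OF l] by (simp add: set_lebesgue_integral_def)
 show "\<forall>\<^sub>F t in at_top. set_integrable lborel {0..} (%u. g (t + u))"
 proof (rule eventually_at_top_linorderI[of t0])
  fix t assume t: "t0 <= t"
  have "integrable lborel (%u. indicat_real {0..} u *\<^sub>R (g (t + u) / g t))"
   by (rule Bochner_Integration.integrable_bound[OF wI]) (measurable, use bound[OF t] in force)
  then have "integrable lborel (%u. g t * (indicat_real {0..} u *\<^sub>R (g (t + u) / g t)))" by (rule integrable_mult_right)
  then show "set_integrable lborel {0..} (%u. g (t + u))"
   using gpos[of t] t t0 by (simp add: set_integrable_def)
 qed
qed

text \<open>The weights \<open>t\<^sup>n / n!\<close> move all mass to infinity, so the ratio of the weighted integrals inherits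
 the limit of the ratio of the integrands.\<close>

lemma moment_ratio_limit:
 fixes g G :: "real => real" and a A :: "nat => real"
 assumes g: "!!t. 0 <= g t" "!!t. g t <= K" and G: "!!t. 0 <= t ==> 0 < G t" "!!t. G t <= K" "!!x y. 0 <= x ==> x <= y ==> G y <= G x"
  and [measurable]: "g \<in> borelm" "G \<in> borelm"
  and a: "!!n. has_bochner_integral lborel (%t. indicat_real {0..} t * (t ^ n / fact n * g t)) (a n)"
  and A: "!!n. has_bochner_integral lborel (%t. indicat_real {0..} t * (t ^ n / fact n * G t)) (A n)"
  and l: "0 < l" and lim: "((%t. g t / G t) \<longlongrightarrow> l) at_top"
 shows "(%n. a n / A n) ----> l"
proof (rule LIMSEQ_I)
 fix r :: real assume r: "0 < r"
 have "\<forall>\<^sub>F t in at_top. dist (g t / G t) l < r / 2" using lim r by (intro tendstoD) auto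
 then obtain t1 where t1: "!!t. t1 <= t ==> \<bar>g t / G t - l\<bar> < r / 2" by (auto simp: eventually_at_top_linorder dist_real_def)
 \<comment> \<open>Beyond \<open>T\<close> the ratio is within \<open>r / 2\<close> of its limit;
   positivity of \<open>T\<close> makes the powers comparable.\<close>
 define T where "T = max 1 t1"
 have T: "1 <= T" "t1 <= T" by (auto simp: T_def)
 have K: "0 <= K" using g[of 0] by linarith
 have near: "\<bar>g t - l * G t\<bar> <= r / 2 * G t" if "T <= t" for t
 proof -
  have p: "0 < G t" using that T by (intro G) auto
  have "\<bar>g t - l * G t\<bar> = \<bar>g t / G t - l\<bar> * G t" using p by (simp add: abs_mult[symmetric] field_simps)
  also have "... <= r / 2 * G t" using t1[of t] that T p by (intro mult_right_mono) auto
  finally show ?thesis .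
 qed
 have far: "\<bar>g t - l * G t\<bar> <= (1 + l) * K" if "0 <= t" for t
 proof -
  have "l * G t <= l * K" using G(2) l by (intro mult_left_mono) auto
  moreover have "0 <= l * G t" using G(1)[OF that] l by simp
  ultimately have "\<bar>g t - l * G t\<bar> <= K + l * K" using g[of t] by linarith
  then show ?thesis by (simp add: algebra_simps)
 qed
 have upper: "\<bar>a n - l * A n\<bar> <= (1 + l) * K * (T ^ n / fact n) * T + r / 2 * A n" for n
 proof -
  have c: "has_bochner_integral lborel (indicat_real {0..T}) T" using T has_bochner_integral_real_indicator[of "{0..T}" lborel] by simp
  have "\<bar>LINT t|lborel. indicat_real {0..} t * (t ^ n / fact n * (g t - l * G t))\<bar> \<le>
   (LINT t|lborel. (1 + l) * K * (T ^ n / fact n) * indicat_real {0..T} t + r / 2 * (indicat_real {0..} t * (t ^ n / fact n * G t)))"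
  proof (rule integral_abs_bound_integral)
   have "integrable lborel (%t. indicat_real {0..} t * (t ^ n / fact n * g t) - l * (indicat_real {0..} t * (t ^ n / fact n * G t)))"
    by (intro Bochner_Integration.integrable_diff integrable_mult_right) (use a[of n] A[of n] in \<open>simp_all only: has_bochner_integral_iff\<close>)
   then show "integrable lborel (%t. indicat_real {0..} t * (t ^ n / fact n * (g t - l * G t)))" by (simp add: algebra_simps)
   show "integrable lborel (%t. (1 + l) * K * (T ^ n / fact n) * indicat_real {0..T} t + r / 2 * (indicat_real {0..} t * (t ^ n / fact n * G t)))"
    by (intro Bochner_Integration.integrable_add integrable_mult_right) (use c A in \<open>auto simp: has_bochner_integral_iff\<close>)
   show "\<bar>indicat_real {0..} t * (t ^ n / fact n * (g t - l * G t))\<bar> \<le>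
    (1 + l) * K * (T ^ n / fact n) * indicat_real {0..T} t + r / 2 * (indicat_real {0..} t * (t ^ n / fact n * G t))" for t
   proof (cases "0 <= t")
    case True
    have w: "0 <= t ^ n / fact n" using True by simp
    have e: "\<bar>indicat_real {0..} t * (t ^ n / fact n * (g t - l * G t))\<bar> = t ^ n / fact n * \<bar>g t - l * G t\<bar>"
     using True by (simp add: abs_mult)
    have p: "0 <= r / 2 * (t ^ n / fact n * G t)" using G(1)[OF True] r True by simp
    show ?thesis
    proof (cases "t <= T")
     case le: True
     have "t ^ n / fact n * \<bar>g t - l * G t\<bar> <= T ^ n / fact n * ((1 + l) * K)"
      using far[OF True] True le by (intro mult_mono divide_right_mono power_mono) auto
     then show ?thesis using p True le unfolding e by (simp add: algebra_simps)
    next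
     case False
     have "t ^ n / fact n * \<bar>g t - l * G t\<bar> <= t ^ n / fact n * (r / 2 * G t)" using near[of t] False w by (intro mult_left_mono) auto
     then show ?thesis using False True unfolding e by (simp add: algebra_simps)
    qed
   qed auto
  qed
  also have "(LINT t|lborel. (1 + l) * K * (T ^ n / fact n) * indicat_real {0..T} t + r / 2 * (indicat_real {0..} t * (t ^ n / fact n * G t))) =
   (1 + l) * K * (T ^ n / fact n) * T + r / 2 * A n"
by (rule has_bochner_integral_integral_eq) (intro has_bochner_integral_add has_bochner_integral_mult_right c A)
  also have "(LINT t|lborel. indicat_real {0..} t * (t ^ n / fact n * (g t - l * G t))) =
   (LINT t|lborel. indicat_real {0..} t * (t ^ n / fact n * g t) - l * (indicat_real {0..} t * (t ^ n / fact n * G t)))"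
   by (rule Bochner_Integration.integral_cong) (auto simp: algebra_simps)
  also have "... = a n - l * A n"
   by (rule has_bochner_integral_integral_eq) (intro has_bochner_integral_diff has_bochner_integral_mult_right a A)
  finally show ?thesis .
 qed
 \<comment> \<open>The contribution of \<open>[2T,3T]\<close> to \<open>A n\<close> is at least of
   order \<open>(2T)^n / n!\<close>, while the uncontrolled part below \<open>T\<close> is of order
   \<open>T^n / n!\<close>; the quotient is of order \<open>2^(-n)\<close>.\<close>
 define ga where "ga = G (3 * T)"
 have ga: "0 < ga" unfolding ga_def using T by (intro G) auto
 have lower: "(2 * T) ^ n / fact n * ga * T <= A n" for n
 proof -
  have c: "has_bochner_integral lborel (indicat_real {2 * T..3 * T}) T" using T has_bochner_integral_real_indicator[of "{2 * T..3 * T}" lborel] by simp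
  have "(LINT t|lborel. ((2 * T) ^ n / fact n * ga) * indicat_real {2 * T..3 * T} t) <= (LINT t|lborel. indicat_real {0..} t * (t ^ n / fact n * G t))"
  proof (rule integral_mono)
   show "integrable lborel (%t. ((2 * T) ^ n / fact n * ga) * indicat_real {2 * T..3 * T} t)"
    by (intro integrable_mult_right) (use c in \<open>auto simp: has_bochner_integral_iff\<close>)
   show "integrable lborel (%t. indicat_real {0..} t * (t ^ n / fact n * G t))" using A by (auto simp: has_bochner_integral_iff)
   show "((2 * T) ^ n / fact n * ga) * indicat_real {2 * T..3 * T} t <= indicat_real {0..} t * (t ^ n / fact n * G t)" for t
   proof (cases "2 * T <= t & t <= 3 * T")
    case True
    then have "ga <= G t" unfolding ga_def using T by (intro G(3)) auto
    then have "(2 * T) ^ n / fact n * ga <= t ^ n / fact n * G t"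
     using True T ga by (intro mult_mono divide_right_mono power_mono) auto
    then show ?thesis using True T by simp
   next
    case False
    then show ?thesis using G(1)[of t] by (cases "0 <= t") auto
   qed
  qed
  then show ?thesis using c A[of n] by (simp add: has_bochner_integral_iff)
 qed
 have Apos: "0 < A n" for n
 proof -
  have "0 < (2 * T) ^ n / fact n * ga * T" using T ga by simp
  then show ?thesis using lower[of n] by linarith
 qed
 have est: "\<bar>a n / A n - l\<bar> <= (1 + l) * K / ga * (1 / 2) ^ n + r / 2" for n
 proof -
  have "\<bar>a n / A n - l\<bar> = \<bar>a n - l * A n\<bar> / A n" using Apos[of n] by (simp add: field_simps abs_mult[symmetric])
  also have "... <= ((1 + l) * K * (T ^ n / fact n) * T + r / 2 * A n) / A n" using Apos[of n] upper[of n] by (intro divide_right_mono) auto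
  also have "... = (1 + l) * K * (T ^ n / fact n) * T / A n + r / 2" using Apos[of n] by (simp add: add_divide_distrib)
  also have "(1 + l) * K * (T ^ n / fact n) * T / A n <= (1 + l) * K * (T ^ n / fact n) * T / ((2 * T) ^ n / fact n * ga * T)"
  proof (rule divide_left_mono[OF lower])
   show "0 < A n * ((2 * T) ^ n / fact n * ga * T)" using T ga Apos[of n] by simp
  qed (use T K l in simp)
  also have "... = (1 + l) * K / ga * (1 / 2) ^ n" using T ga by (simp add: field_simps power_mult_distrib)
  finally show ?thesis by simp
 qed
 have "(%n. (1 + l) * K / ga * (1 / 2) ^ n) ----> (1 + l) * K / ga * 0" by (intro tendsto_intros) auto
 then have "\<forall>\<^sub>F n in sequentially. (1 + l) * K / ga * (1 / 2) ^ n < r / 2" using r by (intro order_tendstoD(2)) auto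
 then obtain N where N: "!!n. N <= n ==> (1 + l) * K / ga * (1 / 2) ^ n < r / 2" by (auto simp: eventually_sequentially)
 show "\<exists>no. \<forall>n\<ge>no. norm (a n / A n - l) < r"
 proof (intro exI[of _ N] allI impI)
  fix n assume "N <= n"
  then show "norm (a n / A n - l) < r" using est[of n] N[of n] unfolding real_norm_def by linarith
 qed
qed

text \<open>Subdividing \<open>[t, t + h]\<close> into equal steps replaces the differential equation \<open>A' = - a\<close>,
 for which \<open>a\<close> would have to be continuous.\<close>

lemma survival_ratio_limit:
 fixes a A :: "real => real"
 assumes A: "!!t. 0 <= t ==> 0 < A t" "!!x y. 0 <= x ==> x <= y ==> A y <= A x"
  and nonneg: "!!t. 0 <= a t" and [measurable]: "a \<in> borelm"
  and inc: "!!t d. 0 <= t ==> 0 <= d ==> ennreal (A t) = (\<integral>\<^sup>+u. ennreal (a u) * indicator {t..<t + d} u \<partial>lborel) + ennreal (A (t + d))"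
  and l: "0 < l" and lim: "((%t. a t / A t) \<longlongrightarrow> l) at_top" and h: "0 < h"
 shows "((%t. A (t + h) / A t) \<longlongrightarrow> exp (- l * h)) at_top"
proof -
 \<comment> \<open>As \<open>A\<close> decreases and \<open>a u <= c * A u\<close>, a step of length
   \<open>d\<close> loses at most \<open>c * d * A t\<close>.\<close>
 have bounds: "\<forall>\<^sub>F t in at_top. (1 - c * d) <= A (t + d) / A t" if c: "l < c" and d: "0 < d" for c d
 proof -
  have "\<forall>\<^sub>F t in at_top. a t / A t < c" using lim c by (rule order_tendstoD(2))
  then obtain t1 where t1: "!!t. t1 <= t ==> a t / A t < c" by (auto simp: eventually_at_top_linorder)
  show ?thesis
  proof (rule eventually_at_top_linorderI[of "max 0 t1"])
   fix t assume t: "max 0 t1 <= t"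
   have At: "0 < A t" using t by (intro A) auto
   have "(\<integral>\<^sup>+u. ennreal (a u) * indicator {t..<t + d} u \<partial>lborel) <= (\<integral>\<^sup>+u. ennreal (c * A t) * indicator {t..<t + d} u \<partial>lborel)"
   proof (rule nn_integral_mono)
    fix u
    have "a u <= c * A t" if "t <= u"
    proof -
     have "a u <= c * A u" using t1[of u] that t A(1)[of u] by (simp add: pos_divide_less_eq)
     also have "... <= c * A t" using A(2)[of t u] that t c l by (intro mult_left_mono) auto
     finally show ?thesis .
    qed
    then show "ennreal (a u) * indicator {t..<t + d} u <= ennreal (c * A t) * indicator {t..<t + d} u"
     by (auto simp: indicator_def intro!: ennreal_leI)
   qed
   also have "... = ennreal (c * A t * d)" using d c l At by (simp add: nn_integral_cmult_indicator ennreal_mult[symmetric])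
   finally have "ennreal (A t) <= ennreal (c * A t * d) + ennreal (A (t + d))" using inc[of t d] t d by (simp add: add_right_mono)
   moreover have nn: "0 <= c * A t * d" "0 <= A (t + d)" using A(1)[of "t + d"] t d c l At by auto
   ultimately have "ennreal (A t) <= ennreal (c * A t * d + A (t + d))" by (simp only: ennreal_plus)
   then have "A t <= c * A t * d + A (t + d)" by (simp only: ennreal_le_iff add_nonneg_nonneg nn)
   then have "(1 - c * d) * A t <= A (t + d)" by (simp add: algebra_simps)
   then show "1 - c * d <= A (t + d) / A t" by (simp only: pos_le_divide_eq[OF At])
  qed
 qed
 \<comment> \<open>Conversely a step loses at least \<open>c * d * A (t + d)\<close>, which gives
   the factor \<open>1 / (1 + c * d)\<close>.\<close>
 have bounds2: "\<forall>\<^sub>F t in at_top. A (t + d) / A t <= 1 / (1 + c * d)" if c: "0 < c" "c < l" and d: "0 < d" for c d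
 proof -
  have "\<forall>\<^sub>F t in at_top. c < a t / A t" using lim c(2) by (rule order_tendstoD(1))
  then obtain t1 where t1: "!!t. t1 <= t ==> c < a t / A t" by (auto simp: eventually_at_top_linorder)
  show ?thesis
  proof (rule eventually_at_top_linorderI[of "max 0 t1"])
   fix t assume t: "max 0 t1 <= t"
   have At: "0 < A t" "0 < A (t + d)" using t d by (auto intro!: A(1))
   have "(\<integral>\<^sup>+u. ennreal (c * A (t + d)) * indicator {t..<t + d} u \<partial>lborel) <= (\<integral>\<^sup>+u. ennreal (a u) * indicator {t..<t + d} u \<partial>lborel)"
   proof (rule nn_integral_mono)
    fix u
    have "c * A (t + d) <= a u" if "t <= u" "u <= t + d"
    proof -
     have "c * A (t + d) <= c * A u" using A(2)[of u "t + d"] that t c l by (intro mult_left_mono) auto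
     also have "... <= a u" using t1[of u] that t A(1)[of u] by (simp add: pos_less_divide_eq)
     finally show ?thesis .
    qed
    then show "ennreal (c * A (t + d)) * indicator {t..<t + d} u <= ennreal (a u) * indicator {t..<t + d} u"
     by (auto simp: indicator_def intro!: ennreal_leI)
   qed
   moreover have "(\<integral>\<^sup>+u. ennreal (c * A (t + d)) * indicator {t..<t + d} u \<partial>lborel) = ennreal (c * A (t + d) * d)"
    using d c At by (simp add: nn_integral_cmult_indicator ennreal_mult[symmetric])
   ultimately have "ennreal (c * A (t + d) * d) + ennreal (A (t + d)) <= ennreal (A t)" using inc[of t d] t d by (simp add: add_right_mono)
   moreover have nn: "0 <= c * A (t + d) * d" "0 <= A (t + d)" using At c d by auto
   ultimately have "ennreal (c * A (t + d) * d + A (t + d)) <= ennreal (A t)" by (simp only: ennreal_plus)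
   then have "c * A (t + d) * d + A (t + d) <= A t" by (simp only: ennreal_le_iff less_imp_le[OF At(1)])
   then show "A (t + d) / A t <= 1 / (1 + c * d)" using At c d by (simp add: divide_simps algebra_simps add_pos_pos)
  qed
 qed
 have prod: "A (t + real N * d) / A t = (\<Prod>k<N. A (t + real k * d + d) / A (t + real k * d))" if "0 <= t" "0 < d" for t d N
 proof (induction N)
  case 0
  then show ?case using A(1)[OF that(1)] by simp
 next
  case (Suc N)
  have "0 < A (t + real N * d)" using that by (intro A(1)) auto
  then have "A (t + real (Suc N) * d) / A t = A (t + real N * d) / A t * (A (t + real N * d + d) / A (t + real N * d))" by (simp add: algebra_simps)
  then show ?case using Suc.IH by simp
 qed
 have shift: "\<forall>\<^sub>F t in at_top. \<forall>k<N. P (t + real k * d)" if ev: "\<forall>\<^sub>F t in at_top. P t" and d: "0 < d" for P d and N :: nat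
 proof -
  obtain t1 where t1: "!!t. t1 <= t ==> P t" using ev by (auto simp: eventually_at_top_linorder)
  show ?thesis
  proof (rule eventually_at_top_linorderI[of t1], intro allI impI)
   fix t and k :: nat assume "t1 <= t"
   moreover have "0 <= real k * d" using d by simp
   ultimately show "P (t + real k * d)" by (intro t1) linarith
  qed
 qed
 show ?thesis
 proof (rule order_tendstoI)
  fix y assume y: "y < exp (- l * h)"
  \<comment> \<open>Replacing \<open>l\<close> by a slightly larger \<open>c\<close> leaves room for
    both errors: the ratio at finite \<open>t\<close> and the finite number \<open>N\<close> of
    steps.\<close>
  have "((%c. exp (- c * h)) \<longlongrightarrow> exp (- l * h)) (at_right l)" by (intro tendsto_intros)
  then have "\<forall>\<^sub>F c in at_right l. y < exp (- c * h)" using y by (rule order_tendstoD(1))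
  then have "\<forall>\<^sub>F c in at_right l. y < exp (- c * h) & l < c"
   using eventually_at_right_less[of l] by eventually_elim simp
  then obtain c where c: "y < exp (- c * h)" "l < c" by (metis (mono_tags, lifting) eventually_happens trivial_limit_at_right_real)
  have "(%N. (1 + (- c * h) / real N) ^ N) ----> exp (- c * h)" by (rule tendsto_exp_limit_sequentially)
  then have "\<forall>\<^sub>F N in sequentially. y < (1 + (- c * h) / real N) ^ N" using c(1) by (rule order_tendstoD(1))
  \<comment> \<open>This makes \<open>1 - c * d\<close> nonnegative, so that the lower bounds of the
    factors may be multiplied.\<close>
  moreover have "\<forall>\<^sub>F N in sequentially. c * h + 1 < real N" by real_asymp
  ultimately obtain N where N: "y < (1 + (- c * h) / real N) ^ N" "c * h + 1 < real N"
   by (metis (mono_tags, lifting) eventually_conj eventually_happens sequentially_bot)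
  define d where "d = h / real N"
  have ch: "0 < c * h" using c l h by simp
  have N0: "0 < real N" using N(2) ch by linarith
  then have d: "0 < d" "real N * d = h" using h by (auto simp: d_def)
  have cd: "0 <= 1 - c * d" using N(2) ch N0 by (simp add: d_def field_simps)
  from shift[OF bounds[OF c(2) d(1)] d(1), of N] show "\<forall>\<^sub>F t in at_top. y < A (t + h) / A t"
   using eventually_ge_at_top[of 0]
  proof eventually_elim
   case (elim t)
   have "y < (\<Prod>k<N. 1 - c * d)" using N(1) by (simp add: d_def)
   also have "... <= (\<Prod>k<N. A (t + real k * d + d) / A (t + real k * d))" using elim cd by (intro prod_mono) auto
   also have "... = A (t + h) / A t" using prod[of t d N] elim d by simp
   finally show ?case .
  qed
 next
  fix y assume y: "exp (- l * h) < y"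
  have "((%c. exp (- c * h)) \<longlongrightarrow> exp (- l * h)) (at_left l)" by (intro tendsto_intros)
  then have "\<forall>\<^sub>F c in at_left l. exp (- c * h) < y" using y by (rule order_tendstoD(2))
  moreover have "\<forall>\<^sub>F c in at_left l. c \<in> {0<..<l}" by (rule eventually_at_leftI[OF _ l])
  ultimately obtain c where c: "exp (- c * h) < y" "0 < c" "c < l"
   by (metis (mono_tags, lifting) eventually_conj eventually_happens greaterThanLessThan_iff trivial_limit_at_left_real)
  have "(%N. inverse ((1 + (c * h) / real N) ^ N)) ----> inverse (exp (c * h))" by (intro tendsto_inverse tendsto_exp_limit_sequentially) simp
  then have "\<forall>\<^sub>F N in sequentially. inverse ((1 + (c * h) / real N) ^ N) < y" using c(1) by (intro order_tendstoD(2)) (auto simp: exp_minus)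
  moreover have "\<forall>\<^sub>F N in sequentially. 0 < N" by (rule eventually_gt_at_top)
  ultimately obtain N where N: "inverse ((1 + (c * h) / real N) ^ N) < y" "0 < N"
   by (metis (mono_tags, lifting) eventually_conj eventually_happens sequentially_bot)
  define d where "d = h / real N"
  have d: "0 < d" "real N * d = h" using h N by (auto simp: d_def)
  from shift[OF bounds2[OF c(2,3) d(1)] d(1), of N] show "\<forall>\<^sub>F t in at_top. A (t + h) / A t < y"
   using eventually_ge_at_top[of 0]
  proof eventually_elim
   case (elim t)
   have "A (t + h) / A t = (\<Prod>k<N. A (t + real k * d + d) / A (t + real k * d))" using prod[of t d N] elim d by simp
   also have "... <= (\<Prod>k<N. 1 / (1 + c * d))"
   proof (intro prod_mono conjI)
    fix k assume "k \<in> {..<N}"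
    then show "A (t + real k * d + d) / A (t + real k * d) <= 1 / (1 + c * d)" using elim by auto
    show "0 <= A (t + real k * d + d) / A (t + real k * d)" using elim d A(1)[of "t + real k * d + d"] A(1)[of "t + real k * d"]
     by (auto intro!: divide_nonneg_nonneg less_imp_le A(1) add_nonneg_nonneg)
   qed
   also have "... < y" using N(1) by (simp add: d_def power_one_over inverse_eq_divide)
   finally show ?case .
  qed
 qed
qed

section \<open>Tents, weak limits and the identification of the eigenvalue\<close>

locale eigen_process = natural_process +
 fixes l :: real and v :: "ennreal => real"
 assumes l: "0 < l" and v_bounded: "sig_bounded v"
  and v_eq: "!!y. 0 < y ==> y < top ==> v y = l * (sig y - primitive2 v y)"
  and v_slope: "((%y. v y / sig y) \<longlongrightarrow> l) (at_right 0)"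
  and v_zero: "!!z. z \<notin> Rpos ==> v z = 0"
  and nu_eq: "nu m s l = density m (%z. ennreal (v z))"
begin

lemma v_measurable [measurable]: "v \<in> borelm"
 using v_bounded by (simp add: sig_bounded_def)

lemma sets_nu [simp, measurable_cong]: "sets (nu m s l) = sets borel"
 by (simp add: nu_def sets_m)

lemma tent_measurable [measurable]: "0 < b ==> b < top ==> (%z. ennreal (tent b z)) \<in> borelm"
 using borel_measurable_continuous_Ioo[OF tent(1)] by (auto intro: measurable_compose)

text \<open>Since \<open>m\<close> has full support, \<open>(0,b)\<close> has positive mass, and the
  tent is positive there. Finiteness of the smaller integral permits the subtraction.\<close>

lemma tent_strict:
 assumes b: "0 < b" "b < top" and [measurable]: "p \<in> borelm" "q \<in> borelm"
  and less: "!!z. 0 < z ==> z < b ==> p z < q z" and fin: "(\<integral>\<^sup>+z. ennreal (tent b z) * p z \<partial>m) < top"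
 shows "(\<integral>\<^sup>+z. ennreal (tent b z) * p z \<partial>m) < (\<integral>\<^sup>+z. ennreal (tent b z) * q z \<partial>m)"
proof (rule ccontr)
 note [measurable] = tent_measurable[OF b]
 assume "\<not> ?thesis"
 then have ge: "(\<integral>\<^sup>+z. ennreal (tent b z) * q z \<partial>m) <= (\<integral>\<^sup>+z. ennreal (tent b z) * p z \<partial>m)" by simp
 have le: "ennreal (tent b z) * p z <= ennreal (tent b z) * q z" for z
 proof (cases "0 < z & z < b")
  case True
  then have "p z <= q z" using less[of z] by simp
  then show ?thesis by (rule mult_left_mono) simp
 next
  case False
  then have "b <= z \<or> z = 0" by (auto simp: not_less)
  then show ?thesis using tent(4)[OF b, of z] by simp
 qed
 have "(\<integral>\<^sup>+z. ennreal (tent b z) * q z - ennreal (tent b z) * p z \<partial>m) =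
  (\<integral>\<^sup>+z. ennreal (tent b z) * q z \<partial>m) - (\<integral>\<^sup>+z. ennreal (tent b z) * p z \<partial>m)"
  by (rule nn_integral_diff) (use fin le in auto)
 also have "... = 0" by (rule diff_eq_0_ennreal[OF order_le_less_trans[OF ge fin] ge])
 finally have ae: "AE z in m. ennreal (tent b z) * q z - ennreal (tent b z) * p z = 0"
  by (subst (asm) nn_integral_0_iff_AE) auto
 have "(\<integral>\<^sup>+z. indicator {0<..<b} z \<partial>m) = (\<integral>\<^sup>+z. 0 \<partial>m)"
 proof (rule nn_integral_cong_AE, use ae in eventually_elim)
  case (elim z)
  show ?case
  proof (cases "0 < z & z < b")
   case True
   then have t: "0 < ennreal (tent b z)" using tent(5)[OF b] by simp
   have "p z * ennreal (tent b z) < q z * ennreal (tent b z)"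
    by (rule ennreal_mult_strict_right_mono) (use less[of z] True t in auto)
   then have "ennreal (tent b z) * q z - ennreal (tent b z) * p z ~= 0"
    by (metis diff_gr0_ennreal less_irrefl mult.commute)
   with elim show ?thesis by simp
  qed auto
 qed
 then have "emeasure m {0<..<b} = 0" by (simp add: sets_m)
 moreover have "0 < emeasure m {0<..<b}"
  by (rule m_open_pos) (use b dense[OF b(1)] in \<open>auto intro: order_less_trans\<close>)
 ultimately show False by simp
qed

lemma sig_tent_finite:
 assumes b: "0 < b" "b < top"
 shows "(\<integral>\<^sup>+z. ennreal (tent b z) * ennreal (sig z) \<partial>m) < top"
proof -
 have "(\<integral>\<^sup>+z. ennreal (tent b z) * ennreal (sig z) \<partial>m) <= (\<integral>\<^sup>+z. ennreal (enn2real b) * (ennreal (sig z) * indicator {0<..<b} z) \<partial>m)"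
 proof (rule nn_integral_mono)
  fix z show "ennreal (tent b z) * ennreal (sig z) <= ennreal (enn2real b) * (ennreal (sig z) * indicator {0<..<b} z)"
   using tent(4)[OF b, of z] tent(3)[OF b, of z]
   by (cases "0 < z & z < b") (auto simp: not_less intro!: mult_right_mono ennreal_leI)
 qed
 also have "... = ennreal (enn2real b) * (\<integral>\<^sup>+z. ennreal (sig z) * indicator {0<..<b} z \<partial>m)" by (rule nn_integral_cmult) measurable
 also have "... < top" using scale_mass_finite[OF b(2)] by (simp add: ennreal_mult_less_top)
 finally show ?thesis .
qed

lemma LINT_enn:
 fixes f :: "ennreal => real"
 assumes c: "continuous_on Rpos f" and nonneg: "!!x. 0 < x ==> x < top ==> 0 <= f x" and s: "sets ka = sets borel"
 shows "(LINT x:Rpos|ka. f x) = enn2real (\<integral>\<^sup>+x. ennreal (f x) * indicator Rpos x \<partial>ka)"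
proof -
 note [measurable_cong] = s
 have [measurable]: "f \<in> borelm" by (rule borel_measurable_continuous_Ioo[OF c])
 have e: "ennreal (indicat_real Rpos x *\<^sub>R f x) = ennreal (f x) * indicator Rpos x" for x
  by (auto simp: indicator_def)
 have "(LINT x:Rpos|ka. f x) = enn2real (\<integral>\<^sup>+x. ennreal (indicat_real Rpos x *\<^sub>R f x) \<partial>ka)"
  unfolding set_lebesgue_integral_def
  by (rule integral_eq_nn_integral) (use nonneg in \<open>auto simp: indicator_def\<close>)
 then show ?thesis by (simp only: e)
qed

lemma LINT_prob:
 fixes f :: "ennreal => real"
 assumes c: "continuous_on Rpos f" and nonneg: "!!x. 0 < x ==> x < top ==> 0 <= f x" and ka: "prob_on_pos ka"
 shows "(LINT x:Rpos|ka. f x) = enn2real (\<integral>\<^sup>+x. ennreal (f x) \<partial>ka)"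
proof -
 have "(\<integral>\<^sup>+x. ennreal (f x) * indicator Rpos x \<partial>ka) = (\<integral>\<^sup>+x. ennreal (f x) \<partial>ka)"
  by (rule nn_integral_cong_AE, use prob_on_posD(3)[OF ka] in eventually_elim) auto
 then show ?thesis by (simp add: LINT_enn[OF c nonneg prob_on_posD(2)[OF ka]])
qed

text \<open>The Green potential of a tent. It is continuous and bounded, hence an admissible test
  function for weak convergence, and by symmetry of the kernel its integral against
  \<open>ka\<close> is that of the tent against the potential of \<open>ka\<close>.\<close>

definition gtent :: "ennreal => ennreal => real" where
 "gtent b x = enn2real (\<integral>\<^sup>+z. kern x z * ennreal (tent b z) \<partial>m)"

lemma gtent:
 assumes b: "0 < b" "b < top"
 shows "continuous_on Rpos (gtent b)" "\<exists>K\<ge>0. \<forall>x. 0 < x & x < top --> gtent b x <= K"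
  "0 < x ==> x < top ==> ennreal (gtent b x) = (\<integral>\<^sup>+z. kern x z * ennreal (tent b z) \<partial>m)"
proof -
 note [measurable] = tent_measurable[OF b]
 have t4: "b < z \<or> z = 0 ==> tent b z = 0" for z using tent(4)[OF b, of z] less_imp_le[of b z] by blast
 obtain C where C: "0 <= C" and bd: "!!x. x < top ==> green (%z. ennreal (tent b z)) x <= ennreal (enn2real b * C)"
 proof (rule green_compact_finite[OF b])
  fix C :: real
  assume C: "0 <= C" "!!ph K x. (!!z. 0 <= ph z) ==> (!!z. ph z <= K) ==> (!!z. b < z \<or> z = 0 ==> ph z = 0) ==> x < top ==>
   green (%z. ennreal (ph z)) x <= ennreal (K * C)"
  show thesis
  proof (rule that[OF C(1)])
   fix x :: ennreal assume "x < top"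
   then show "green (%z. ennreal (tent b z)) x <= ennreal (enn2real b * C)"
    by (intro C(2)) (use tent(2,3)[OF b] t4 in auto)
  qed
 qed
 have t: "ennreal (tent b z) * indicator Rpos z = ennreal (tent b z)" for z
  using tent(4)[OF b, of z] b by (cases "z = 0 \<or> z = top") (auto simp: indicator_def less_top[symmetric] zero_less_iff_neq_zero)
 have gr: "green (%z. ennreal (tent b z)) x = (\<integral>\<^sup>+z. kern x z * ennreal (tent b z) \<partial>m)" if "0 < x" "x < top" for x
  using green_formula[OF that, of "%z. ennreal (tent b z)"] by (simp add: t)
 have "continuous_on Rpos (%x. enn2real (green (%z. ennreal (tent b z)) x))"
  by (rule green_continuous[where K="enn2real b"]) (use bd tent(3)[OF b] in \<open>auto intro: order_le_less_trans[OF bd ennreal_less_top] ennreal_leI\<close>)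
 then show "continuous_on Rpos (gtent b)"
  by (rule continuous_on_eq) (simp add: gtent_def gr)
 show e: "ennreal (gtent b x) = (\<integral>\<^sup>+z. kern x z * ennreal (tent b z) \<partial>m)" if "0 < x" "x < top" for x
  unfolding gtent_def by (rule ennreal_enn2real) (use bd[OF that(2)] gr[OF that] in \<open>auto intro: order_le_less_trans\<close>)
 show "\<exists>K\<ge>0. \<forall>x. 0 < x & x < top --> gtent b x <= K"
 proof (intro exI[of _ "enn2real b * C"] conjI allI impI)
  fix x :: ennreal assume x: "0 < x & x < top"
  then have "ennreal (gtent b x) <= ennreal (enn2real b * C)" using bd[of x] gr[of x] e[of x] by simp
  then show "gtent b x <= enn2real b * C" using C by (subst (asm) ennreal_le_iff) auto
 qed (use C in auto)
qed

lemma gtent_integral: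
 assumes b: "0 < b" "b < top" and ka: "prob_on_pos ka"
 shows "(LINT x:Rpos|ka. gtent b x) = enn2real (\<integral>\<^sup>+z. U ka z * ennreal (tent b z) \<partial>m)"
  "0 < (\<integral>\<^sup>+z. U ka z * ennreal (tent b z) \<partial>m)" "(\<integral>\<^sup>+z. U ka z * ennreal (tent b z) \<partial>m) < top"
proof -
 note [measurable] = tent_measurable[OF b] U_measurable[OF ka]
 have "(\<integral>\<^sup>+x. ennreal (gtent b x) \<partial>ka) = (\<integral>\<^sup>+x. (\<integral>\<^sup>+z. kern x z * ennreal (tent b z) \<partial>m) \<partial>ka)"
  by (rule nn_integral_cong_AE, use prob_on_posD(3)[OF ka] in eventually_elim) (simp add: gtent(3)[OF b])
 also have "... = (\<integral>\<^sup>+z. U ka z * ennreal (tent b z) \<partial>m)" by (rule U_symmetric[OF ka]) measurable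
 finally show "(LINT x:Rpos|ka. gtent b x) = enn2real (\<integral>\<^sup>+z. U ka z * ennreal (tent b z) \<partial>m)"
  by (subst LINT_prob[OF gtent(1)[OF b] _ ka]) (auto simp: gtent_def)
 show "0 < (\<integral>\<^sup>+z. U ka z * ennreal (tent b z) \<partial>m)"
  using tent_strict[OF b, of "%_. 0" "U ka"] U_le_sig(2)[OF ka] b by (auto simp: mult.commute intro: order_less_trans)
 have "(\<integral>\<^sup>+z. U ka z * ennreal (tent b z) \<partial>m) <= (\<integral>\<^sup>+z. ennreal (tent b z) * ennreal (sig z) \<partial>m)"
 proof (rule nn_integral_mono)
  fix z show "U ka z * ennreal (tent b z) <= ennreal (tent b z) * ennreal (sig z)"
  proof (cases "0 < z & z < top")
   case True
   then have "U ka z <= ennreal (sig z)" using U_le_sig(1)[OF ka, of z] by simp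
   from mult_right_mono[OF this, of "ennreal (tent b z)"] show ?thesis by (simp add: mult.commute)
  qed (use U_zero[of z ka] in simp)
 qed
 also have "... < top" by (rule sig_tent_finite[OF b])
 finally show "(\<integral>\<^sup>+z. U ka z * ennreal (tent b z) \<partial>m) < top" .
qed

lemma nu_tent:
 assumes b: "0 < b" "b < top"
 shows "(LINT x:Rpos|nu m s l. tent b x) = enn2real (\<integral>\<^sup>+z. ennreal (tent b z) * ennreal (v z) \<partial>m)"
  "(\<integral>\<^sup>+z. ennreal (tent b z) * ennreal (v z) \<partial>m) < top"
proof -
 note [measurable] = tent_measurable[OF b]
 have t: "ennreal (tent b z) * indicator Rpos z = ennreal (tent b z)" for z
  using tent(4)[OF b, of z] b by (cases "z = 0 \<or> z = top") (auto simp: indicator_def less_top[symmetric] zero_less_iff_neq_zero)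
 show "(LINT x:Rpos|nu m s l. tent b x) = enn2real (\<integral>\<^sup>+z. ennreal (tent b z) * ennreal (v z) \<partial>m)"
 proof -
  have "(\<integral>\<^sup>+z. ennreal (tent b z) \<partial>nu m s l) = (\<integral>\<^sup>+z. ennreal (v z) * ennreal (tent b z) \<partial>m)"
   unfolding nu_eq by (rule nn_integral_density) auto
  then show ?thesis by (simp add: LINT_enn[OF tent(1)[OF b] tent(2)[OF b]] t mult.commute)
 qed
 obtain B where B: "0 <= B" "!!z. 0 < z ==> z <= b ==> \<bar>v z\<bar> <= B * sig z" using sig_boundedD[OF v_bounded b(2)] by blast
 have "(\<integral>\<^sup>+z. ennreal (tent b z) * ennreal (v z) \<partial>m) <= (\<integral>\<^sup>+z. ennreal B * (ennreal (tent b z) * ennreal (sig z)) \<partial>m)"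
 proof (rule nn_integral_mono)
  fix z show "ennreal (tent b z) * ennreal (v z) <= ennreal B * (ennreal (tent b z) * ennreal (sig z))"
  proof (cases "0 < z & z < b")
   case True
   then have "0 < sig z" using b by (intro sig_pos) (auto intro: order_less_trans)
   moreover have "ennreal (v z) <= ennreal (B * sig z)" using B(2)[of z] True less_imp_le[of z b] by (intro ennreal_leI) auto
   ultimately have "ennreal (v z) <= ennreal B * ennreal (sig z)" using B(1) by (simp add: ennreal_mult)
   from mult_left_mono[OF this, of "ennreal (tent b z)"] show ?thesis by (simp add: mult_ac)
  qed (use tent(4)[OF b, of z] in \<open>auto simp: not_less\<close>)
 qed
 also have "... = ennreal B * (\<integral>\<^sup>+z. ennreal (tent b z) * ennreal (sig z) \<partial>m)" by (rule nn_integral_cmult) measurable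
 also have "... < top" using sig_tent_finite[OF b] by (simp add: ennreal_mult_less_top)
 finally show "(\<integral>\<^sup>+z. ennreal (tent b z) * ennreal (v z) \<partial>m) < top" .
qed

text \<open>The three assumptions say that \<open>P\<close> holds in a neighbourhood of
  \<open>l\<close>, the limit of \<open>v / sig\<close> at 0.\<close>

lemma v_near_0:
 assumes "eventually P (at_right l)" "eventually P (at_left l)" "P l"
 obtains b where "0 < b" "b < top" "!!z. 0 < z ==> z < b ==> P (v z / sig z)"
proof -
 have "eventually P (nhds l)" using assms by (simp add: eventually_nhds_conv_at eventually_at_split)
 with v_slope have "\<forall>\<^sub>F z in at_right 0. P (v z / sig z)" by (auto simp: filterlim_iff)
 then have "\<forall>\<^sub>F z in at_right 0. P (v z / sig z) & 0 < z & z < top" using eventually_at_right_0 by eventually_elim simp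
 then obtain c where c: "0 < c" "!!z. 0 < z ==> z < c ==> P (v z / sig z)"
  by (subst (asm) eventually_at_right[of 0 top]) auto
 show ?thesis by (rule that[of "min c 1"]) (use c in \<open>auto simp: min_less_iff_disj\<close>)
qed

text \<open>Away from 0 the sign of \<open>v\<close> is left open here, and \<open>ennreal\<close>
  cuts off negative values. Near 0 the limit \<open>l > 0\<close> of \<open>v / sig\<close> makes
  \<open>v\<close> positive.\<close>

lemma nu_tent_pos: obtains b0 where "0 < b0" "b0 < top" "!!b. 0 < b ==> b <= b0 ==> 0 < (\<integral>\<^sup>+z. ennreal (tent b z) * ennreal (v z) \<partial>m)"
proof -
 have "\<forall>\<^sub>F x in nhds l. 0 < x" using l by (intro eventually_nhds_in_open[of "{0<..}", simplified]) auto
 then obtain b0 where b0: "0 < b0" "b0 < top" "!!z. 0 < z ==> z < b0 ==> 0 < v z / sig z"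
  by (metis (mono_tags, lifting) v_near_0[of "%x. 0 < x"] eventually_nhds_conv_at eventually_at_split)
 show ?thesis
 proof (rule that[OF b0(1,2)])
  fix b assume b: "0 < b" "b <= b0"
  then have bt: "b < top" using b0 by (auto intro: order_le_less_trans)
  have "0 < ennreal (v z)" if "0 < z" "z < b" for z
  proof -
   have "0 < v z / sig z" using b0(3)[of z] that b by auto
   moreover have "0 < sig z" using that bt by (intro sig_pos) (auto intro: order_less_trans)
   ultimately show ?thesis by (simp add: zero_less_divide_iff)
  qed
  then show "0 < (\<integral>\<^sup>+z. ennreal (tent b z) * ennreal (v z) \<partial>m)"
   using tent_strict[OF b(1) bt, of "%_. 0" "%z. ennreal (v z)"] by auto
 qed
qed

text \<open>Near \<open>0\<close> the two densities are asymptotic to \<open>l sig\<close> and to \<open>sig\<close>, so tents shrinking to \<open>0\<close>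
 read off the eigenvalue.\<close>

lemma eigenvalue_identification:
 assumes \<nu>: "prob_on_pos (nu m s l)" and c: "0 <= c" and b0: "0 < b0" "b0 < top"
  and eq: "!!b. 0 < b ==> b <= b0 ==>
   (\<integral>\<^sup>+z. ennreal (tent b z) * ennreal (v z) \<partial>m) = ennreal c * (\<integral>\<^sup>+z. U (nu m s l) z * ennreal (tent b z) \<partial>m)"
 shows "c = l"
proof -
 let ?U = "U (nu m s l)"
 interpret pr: prob_space "nu m s l" by (rule prob_on_posD[OF \<nu>])
 note [measurable] = U_measurable[OF \<nu>]
 have eq': "(\<integral>\<^sup>+z. ennreal (tent b z) * ennreal (v z) \<partial>m) = (\<integral>\<^sup>+z. ennreal (tent b z) * (ennreal c * ?U z) \<partial>m)" if b: "0 < b" "b <= b0" for b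
 proof -
  have [measurable]: "(%z. ennreal (tent b z)) \<in> borelm" by (rule tent_measurable) (use b b0 in \<open>auto intro: order_le_less_trans\<close>)
  show ?thesis unfolding eq[OF b] by (subst nn_integral_cmult[symmetric]) (auto simp: mult_ac)
 qed
 show ?thesis
 proof (rule ccontr)
  assume ne: "c ~= l"
  show False
  proof (cases "c < l")
   case True
   \<comment> \<open>For \<open>c < l\<close> the bound \<open>U <= sig\<close> suffices: near 0,
     \<open>c * U\<close> stays below \<open>c * sig\<close> and hence below
     \<open>v\<close>.\<close>
   have "\<forall>\<^sub>F x in nhds l. c < x" using True by (intro eventually_nhds_in_open[of "{c<..}", simplified]) auto
   then obtain b1 where b1: "0 < b1" "b1 < top" "!!z. 0 < z ==> z < b1 ==> c < v z / sig z"
    by (metis (mono_tags, lifting) v_near_0[of "%x. c < x"] eventually_nhds_conv_at eventually_at_split)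
   define b where "b = min b0 b1"
   have b: "0 < b" "b <= b0" "b < top" using b0 b1 by (auto simp: b_def min_less_iff_disj)
   have "(\<integral>\<^sup>+z. ennreal (tent b z) * (ennreal c * ?U z) \<partial>m) < (\<integral>\<^sup>+z. ennreal (tent b z) * ennreal (v z) \<partial>m)"
   proof (rule tent_strict[OF b(1,3)])
    fix z assume z: "0 < z" "z < b"
    then have zt: "z < top" "z < b1" using b b1 by (auto simp: b_def intro: order_less_trans)
    have "ennreal c * ?U z <= ennreal (c * sig z)"
     using mult_left_mono[OF U_le_sig(1)[OF \<nu> z(1) zt(1)], of "ennreal c"] c sig_pos[OF z(1) zt(1)] by (simp add: ennreal_mult)
    also have "... < ennreal (v z)"
     using b1(3)[OF z(1) zt(2)] c sig_pos[OF z(1) zt(1)] by (intro ennreal_lessI) (auto simp: pos_less_divide_eq intro: order_le_less_trans[of 0 "c * sig z"])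
    finally show "ennreal c * ?U z < ennreal (v z)" .
   qed (use eq'[OF b(1,2)] nu_tent(2)[OF b(1,3)] in auto)
   then show False using eq'[OF b(1,2)] by simp
  next
   case False
   \<comment> \<open>For \<open>c > l\<close> a lower bound on \<open>U\<close> is required. A set
     \<open>A n\<close> away from 0 carries more than the fraction \<open>c' / c\<close> of the
     mass, and for \<open>z\<close> below it the kernel is \<open>sig z\<close>; so
     \<open>c * U z\<close> exceeds \<open>c' * sig z\<close>, which in turn is at least
     \<open>v z\<close>.\<close>
   define c' where "c' = (l + c) / 2"
   have c': "l < c'" "c' < c" "0 < c'" using False ne l by (auto simp: c'_def)
   have "\<forall>\<^sub>F x in nhds l. x < c'" using c' by (intro eventually_nhds_in_open[of "{..<c'}", simplified]) auto
   then obtain b1 where b1: "0 < b1" "b1 < top" "!!z. 0 < z ==> z < b1 ==> v z / sig z < c'"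
    by (metis (mono_tags, lifting) v_near_0[of "%x. x < c'"] eventually_nhds_conv_at eventually_at_split)
   define A where "A n = {ennreal (1 / real (Suc n))..}" for n
   have inc: "incseq A" unfolding A_def by (intro monoI) (auto intro!: ennreal_leI simp: field_simps elim!: order_trans[rotated])
   have UA: "(\<Union>n. A n) = {0<..}"
   proof (rule set_eqI)
    fix x :: ennreal
    show "x \<in> (\<Union>n. A n) \<longleftrightarrow> x \<in> {0<..}"
    proof
     assume "x \<in> (\<Union>n. A n)"
     then obtain n where "ennreal (1 / real (Suc n)) <= x" by (auto simp: A_def)
     moreover have "0 < ennreal (1 / real (Suc n))" by simp
     ultimately have "0 < x" by (rule order_less_le_trans[rotated])
     then show "x \<in> {0<..}" by simp
    next
     assume "x \<in> {0<..}"
     then have "\<exists>n. ennreal (1 / real (Suc n)) <= x"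
     proof (cases x)
      case (real r)
      then have "0 < r" using \<open>x \<in> {0<..}\<close> by simp
      then obtain n where "inverse (real (Suc n)) < r" using reals_Archimedean by blast
      then show ?thesis using real by (intro exI[of _ n]) (auto intro!: ennreal_leI simp: inverse_eq_divide)
     qed simp
     then show "x \<in> (\<Union>n. A n)" by (auto simp: A_def)
    qed
   qed
   have "(%n. measure (nu m s l) (A n)) ----> measure (nu m s l) (\<Union>n. A n)"
    by (rule pr.finite_Lim_measure_incseq[OF _ inc]) (auto simp: A_def)
   moreover have "measure (nu m s l) (\<Union>n. A n) = 1"
    unfolding UA by (subst pr.prob_eq_1) (use prob_on_posD(3)[OF \<nu>] in \<open>auto elim: eventually_mono\<close>)
   ultimately have "\<forall>\<^sub>F n in sequentially. c' / c < measure (nu m s l) (A n)"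
    using c' by (intro order_tendstoD(1)) auto
   then obtain n where n: "c' / c < measure (nu m s l) (A n)" by (auto simp: eventually_sequentially)
   define \<delta> where "\<delta> = ennreal (1 / real (Suc n))"
   \<comment> \<open>The bound \<open>\<delta>\<close> is the left end of \<open>A n\<close>, so
     that every \<open>z < b\<close> lies below all points of \<open>A n\<close>.\<close>
   define b where "b = min \<delta> (min b0 b1)"
   have b: "0 < b" "b <= b0" "b < top" using b0 b1 by (auto simp: b_def \<delta>_def min_less_iff_disj min_le_iff_disj)
   have "(\<integral>\<^sup>+z. ennreal (tent b z) * ennreal (v z) \<partial>m) < (\<integral>\<^sup>+z. ennreal (tent b z) * (ennreal c * ?U z) \<partial>m)"
   proof (rule tent_strict[OF b(1,3)])
    fix z assume z: "0 < z" "z < b"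
    then have zt: "z < top" "z < b1" "z < \<delta>" using b b1 by (auto simp: b_def intro: order_less_trans)
    have sz: "0 < sig z" by (rule sig_pos[OF z(1) zt(1)])
    have "ennreal (v z) <= ennreal (c' * sig z)"
     using b1(3)[OF z(1) zt(2)] sz by (intro ennreal_leI) (simp add: pos_divide_less_eq)
    also have "... < ennreal (c * (sig z * measure (nu m s l) (A n)))"
     using n sz c' by (intro ennreal_lessI) (auto simp: field_simps intro!: mult_pos_pos order_less_trans[OF _ n])
    also have "... <= ennreal c * ?U z"
    proof -
     have "ennreal (sig z) * emeasure (nu m s l) (A n) = (\<integral>\<^sup>+x. ennreal (sig z) * indicator (A n) x \<partial>nu m s l)"
      by (subst nn_integral_cmult_indicator) (auto simp: A_def)
     also have "... <= ?U z" unfolding U_def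
     proof (rule nn_integral_mono_AE, use prob_on_posD(3)[OF \<nu>] in eventually_elim)
      case (elim x)
      show ?case
      proof (cases "x \<in> A n")
       case True
       then have "z <= x" using zt(3) unfolding A_def \<delta>_def[symmetric] by auto
       then have "sig z <= sig x" using elim z by (intro sig_mono) auto
       then show ?thesis using elim z zt True by (simp add: kern_def min_absorb2)
      qed simp
     qed
     finally have "ennreal c * (ennreal (sig z) * emeasure (nu m s l) (A n)) <= ennreal c * ?U z" by (rule mult_left_mono) simp
     then show ?thesis using c sz by (simp add: ennreal_mult pr.emeasure_eq_measure)
    qed
    finally show "ennreal (v z) < ennreal c * ?U z" .
   qed (use nu_tent(2)[OF b(1,3)] in auto)
   then show False using eq'[OF b(1,2)] by simp
  qed
 qed
qed

text \<open>The constant 1 is an admissible test function, so no mass is lost in the limit.\<close>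

lemma weak_limit_prob:
 assumes w: "weakly_tendsto ka (nu m s l) F" and F: "F ~= bot" and p: "\<forall>\<^sub>F i in F. prob_on_pos (ka i)"
 shows "prob_on_pos (nu m s l)"
proof -
 have one: "(LINT x:Rpos|ka. (1::real)) = measure ka Rpos" if "sets ka = sets borel" for ka :: "ennreal measure"
  using sets_eq_imp_space_eq[OF that] by (simp add: set_lebesgue_integral_def)
 have lim: "((%i. LINT x:Rpos|ka i. (1::real)) \<longlongrightarrow> (LINT x:Rpos|nu m s l. 1)) F"
  using w[unfolded weakly_tendsto_def, rule_format, of "%_. 1"] by (auto simp: bounded_iff)
 have "\<forall>\<^sub>F i in F. (LINT x:Rpos|ka i. (1::real)) = 1"
  using p by eventually_elim (simp add: one prob_on_pos_def measure_def)
 then have "((%i. LINT x:Rpos|ka i. (1::real)) \<longlongrightarrow> 1) F" by (rule tendsto_eventually)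
 from tendsto_unique[OF F lim this] have "(LINT x:Rpos|nu m s l. (1::real)) = 1" .
 then have "measure (nu m s l) Rpos = 1" by (simp add: one)
 \<comment> \<open>A set of infinite mass has \<open>measure\<close> 0, so the value 1 implies
   finiteness.\<close>
 moreover from this have "emeasure (nu m s l) Rpos ~= top" by (auto simp: measure_def)
 ultimately have e: "emeasure (nu m s l) Rpos = 1" by (simp add: emeasure_eq_ennreal_measure)
 have "emeasure (nu m s l) UNIV = emeasure (nu m s l) Rpos"
  unfolding nu_eq by (subst (1 2) emeasure_density) (auto simp: sets_m indicator_def v_zero intro!: nn_integral_cong)
 then have "prob_space (nu m s l)" using e sets_eq_imp_space_eq[OF sets_nu] by (intro prob_spaceI) simp
 then show ?thesis using e by (simp add: prob_on_pos_def)
qed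

lemma tent_limits:
 assumes w: "weakly_tendsto ka (nu m s l) F" and b: "0 < b" "b < top"
 shows "((%i. LINT x:Rpos|ka i. tent b x) \<longlongrightarrow> (LINT x:Rpos|nu m s l. tent b x)) F"
  "((%i. LINT x:Rpos|ka i. gtent b x) \<longlongrightarrow> (LINT x:Rpos|nu m s l. gtent b x)) F"
proof -
 have "bounded (tent b ` Rpos)" using tent(2,3)[OF b] by (auto simp: bounded_iff intro!: exI[of _ "enn2real b"])
 then show "((%i. LINT x:Rpos|ka i. tent b x) \<longlongrightarrow> (LINT x:Rpos|nu m s l. tent b x)) F"
  using w tent(1)[OF b] unfolding weakly_tendsto_def by blast
 obtain K where "!!x. 0 < x & x < top ==> gtent b x <= K" using gtent(2)[OF b] by blast
 then have "bounded (gtent b ` Rpos)" by (auto simp: bounded_iff gtent_def intro!: exI[of _ K])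
 then show "((%i. LINT x:Rpos|ka i. gtent b x) \<longlongrightarrow> (LINT x:Rpos|nu m s l. gtent b x)) F"
  using w gtent(1)[OF b] unfolding weakly_tendsto_def by blast
qed

end

section \<open>Renewal iterates and moment ratios\<close>

context eigen_process
begin

text \<open>From a starting point beyond \<open>R\<close> the mean of \<open>T_0\<close> is at least
  the integral of \<open>sig\<close> over \<open>(0,R)\<close>. At a natural boundary this integral
  grows without bound, so bounded means give tightness by a Markov inequality.\<close>

lemma far_mass:
 assumes ka: "prob_on_pos ka"
 shows "(\<integral>\<^sup>+z. ennreal (sig z) * indicator {0<..<R} z \<partial>m) * emeasure ka {R..} <= tail_moment ka 0"
proof -
 interpret pr: prob_space ka by (rule prob_on_posD[OF ka])
 note [measurable_cong] = prob_on_posD(2)[OF ka]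
 have "(\<integral>\<^sup>+z. ennreal (sig z) * indicator {0<..<R} z \<partial>m) * emeasure ka {R..} =
  (\<integral>\<^sup>+x. (\<integral>\<^sup>+z. ennreal (sig z) * indicator {0<..<R} z \<partial>m) * indicator {R..} x \<partial>ka)"
  by (subst nn_integral_cmult_indicator) (auto simp: prob_on_posD(2)[OF ka])
 also have "... <= (\<integral>\<^sup>+x. (\<integral>\<^sup>+z. kern x z * 1 \<partial>m) \<partial>ka)"
 proof (rule nn_integral_mono_AE, use prob_on_posD(3)[OF ka] in eventually_elim)
  case (elim x)
  show ?case
  proof (cases "R <= x")
   case True
   have "(\<integral>\<^sup>+z. ennreal (sig z) * indicator {0<..<R} z \<partial>m) <= (\<integral>\<^sup>+z. kern x z * 1 \<partial>m)"
   proof (rule nn_integral_mono)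
    fix z show "ennreal (sig z) * indicator {0<..<R} z <= kern x z * 1"
    proof (cases "0 < z & z < R")
     case zR: True
     then have "z <= x" using True order_less_le_trans[of z R x] by auto
     then have "sig z <= sig x" "z < top" using zR elim by (auto intro!: sig_mono intro: order_le_less_trans)
     then show ?thesis using zR elim by (simp add: kern_def min_absorb2)
    qed auto
   qed
   then show ?thesis using True by simp
  qed simp
 qed
 also have "... = (\<integral>\<^sup>+z. U ka z * 1 \<partial>m)" by (rule U_symmetric[OF ka]) measurable
 finally show ?thesis by (simp add: tail_moment_0(1)[OF ka])
qed

text \<open>The densities of the iterates converge pointwise by \<open>volterra_convergence\<close>.
  Tightness shows that the limit has mass 1, and Scheffe's lemma upgrades pointwise to
  \<open>L1\<close> convergence, which is stronger than weak convergence.\<close>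

lemma renewal_limit:
 assumes p: "!!n. prob_on_pos (ka n)" and fin: "!!n. tail_moment (ka n) 0 < top" and rec: "!!n. ka (Suc n) = renewal X (ka n)"
  and lim: "(%n. 1 / enn2real (tail_moment (ka n) 0)) ----> l"
 shows "weakly_tendsto ka (nu m s l) sequentially"
proof -
 define rt where "rt n = 1 / enn2real (tail_moment (ka n) 0)" for n
 define w where "w n z = rt n * enn2real (U (ka n) z)" for n z
 have rt: "rt ----> l" using lim by (simp add: rt_def[abs_def])
 have T: "0 < enn2real (tail_moment (ka n) 0)" for n
  using tail_moment_0(2)[OF p] fin by (simp add: enn2real_positive_iff)
 have rt0: "0 < rt n" for n using T by (simp add: rt_def)
 have inv: "inverse (tail_moment (ka n) 0) = ennreal (rt n)" for n
  using tail_moment_0(2)[OF p, of n] fin[of n] by (cases "tail_moment (ka n) 0") (auto simp: rt_def inverse_ennreal inverse_eq_divide)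
 have w0: "0 <= w n z" for n z using rt0[of n] by (simp add: w_def)
 have wz: "w n z = 0" if "z \<notin> Rpos" for n z using U_zero[OF that] by (simp add: w_def)
 have [measurable]: "w n \<in> borelm" for n unfolding w_def[abs_def] using U_measurable[OF p] by measurable
 have wsb: "sig_bounded (w n)" for n using U_sig_bounded(1)[OF p, of "rt n" n] rt0[of n] by (simp add: w_def[abs_def])
 \<comment> \<open>The initial law may have no density; hence \<open>w n\<close> belongs to the
   iterate \<open>Suc n\<close>, and the final limit is shifted back.\<close>
 have D: "ka (Suc n) = density m (%z. ennreal (w n z))" for n
  unfolding rec renewal_eq(1)[OF p fin] inv w_def using rt0[of n] by (intro density_U_real[OF p]) simp
 have wrec: "w (Suc n) y = rt (Suc n) * (sig y - primitive2 (w n) y)" if "0 < y" "y < top" for n y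
  using U_density[OF p D wsb w0 that] by (simp add: w_def[of "Suc n"])
 obtain \<Lambda> where \<Lambda>: "!!n. rt n <= \<Lambda>" "0 < \<Lambda>"
  using Bseq_def[of rt] convergent_imp_Bseq[OF convergentI[OF rt]] by (auto simp: abs_le_iff)
 have wle: "w n z <= \<Lambda> * sig z" if "0 < z" "z < top" for n z
 proof -
  have "w n z <= rt n * sig z" unfolding w_def using U_sig_bounded(2)[OF p _ that] rt0[of n] by simp
  also have "... <= \<Lambda> * sig z" using \<Lambda>(1) sig_pos[OF that] by (intro mult_right_mono) auto
  finally show ?thesis .
 qed
 have conv: "(%n. w n y) ----> v y" for y
 proof (cases "y \<in> Rpos")
  case True
  show ?thesis
  proof (rule volterra_convergence[OF l v_bounded v_eq _ wrec _ LIMSEQ_Suc[OF rt]])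
   show "\<exists>B. \<forall>n z. 0 < z & z <= y --> \<bar>w n z\<bar> <= B * sig z" if "y < top" for y
    using wle w0 that by (intro exI[of _ \<Lambda>]) (auto intro: order_le_less_trans)
  qed (use True in auto)
 qed (simp add: wz v_zero)
 \<comment> \<open>Nonnegativity of \<open>v\<close> is obtained as a limit of densities.\<close>
 have v0: "0 <= v y" for y by (rule LIMSEQ_le_const[OF conv]) (use w0 in auto)
 have mass: "(\<integral>\<^sup>+z. ennreal (w n z) \<partial>m) = 1" for n
 proof -
  interpret pr: prob_space "ka (Suc n)" by (rule prob_on_posD[OF p])
  have "(\<integral>\<^sup>+z. ennreal (w n z) \<partial>m) = emeasure (ka (Suc n)) (space (ka (Suc n)))" unfolding D by (simp add: emeasure_density)
  then show ?thesis by (simp only: pr.emeasure_space_1)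
 qed
 have vfin: "(\<integral>\<^sup>+z. ennreal (v z) \<partial>m) <= 1"
 proof -
  have "(\<integral>\<^sup>+z. ennreal (v z) \<partial>m) = (\<integral>\<^sup>+z. liminf (%n. ennreal (w n z)) \<partial>m)"
   by (rule nn_integral_cong, rule lim_imp_Liminf[symmetric]) (auto intro: conv)
  also have "... <= liminf (%n. \<integral>\<^sup>+z. ennreal (w n z) \<partial>m)" by (rule nn_integral_liminf) measurable
  also have "... = 1" by (simp add: mass Liminf_const)
  finally show ?thesis .
 qed
 have "\<exists>C. 0 < C & (\<forall>n. enn2real (tail_moment (ka n) 0) <= C)"
 proof -
  have "(%n. 1 / rt n) ----> 1 / l" using l by (intro tendsto_intros rt) auto
  from convergent_imp_Bseq[OF convergentI[OF this]] show ?thesis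
   unfolding Bseq_def by (auto simp: rt_def abs_le_iff)
 qed
 then obtain C where C: "0 < C" "!!n. enn2real (tail_moment (ka n) 0) <= C" by blast
 have tmC: "tail_moment (ka n) 0 <= ennreal C" for n
  using ennreal_leI[OF C(2)[of n]] fin[of n] by (simp add: ennreal_enn2real)
 \<comment> \<open>Fatou's lemma excludes only an excess of mass. For the converse the mass beyond a
   level \<open>R\<close> is small uniformly in \<open>n\<close>, and below \<open>R\<close> the
   bound \<open>\<Lambda> * sig\<close> allows dominated convergence.\<close>
 have vmass: "1 <= (\<integral>\<^sup>+z. ennreal (v z) \<partial>m)"
 proof (rule ennreal_le_epsilon)
  fix \<epsilon> :: real assume \<epsilon>: "0 < \<epsilon>"
  have "(%n. \<integral>\<^sup>+z. ennreal (sig z) * indicator {0<..<of_nat n} z \<partial>m) ----> (\<integral>\<^sup>+z. ennreal (sig z) * indicator Rpos z \<partial>m)"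
  proof (rule nn_integral_LIMSEQ)
   show "incseq (%n z. ennreal (sig z) * indicator {0<..<of_nat n} z)"
   proof (rule incseq_SucI, rule le_funI)
    fix n and z :: ennreal
    have "(of_nat n :: ennreal) <= of_nat (Suc n)" by (simp only: of_nat_le_iff)
    then have "indicator {0<..<of_nat n} z <= (indicator {0<..<of_nat (Suc n)} z :: ennreal)"
     by (intro indicator_leI) (auto intro: order_less_le_trans simp del: of_nat_Suc)
    then show "ennreal (sig z) * indicator {0<..<of_nat n} z <= ennreal (sig z) * indicator {0<..<of_nat (Suc n)} z"
     by (rule mult_left_mono) simp
   qed
   show "(%n. ennreal (sig z) * indicator {0<..<of_nat n} z) ----> ennreal (sig z) * indicator Rpos z" for z
   proof (rule tendsto_eventually)
    show "\<forall>\<^sub>F n in sequentially. ennreal (sig z) * indicator {0<..<of_nat n} z = ennreal (sig z) * indicator Rpos z"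
    proof (cases "z < top")
     case True
     then obtain N :: nat where N: "z < of_nat N" using ennreal_Ex_less_of_nat by blast
     have "z < of_nat n" if "N <= n" for n
     proof -
      have "(of_nat N :: ennreal) <= of_nat n" using that by simp
      with N show ?thesis by (rule order_less_le_trans)
     qed
     then show ?thesis unfolding eventually_sequentially by (intro exI[of _ N]) (auto simp: indicator_def True)
    next
     case False
     then have "z = top" using less_top[of z] by blast
     then show ?thesis by simp
    qed
   qed
  qed measurable
  \<comment> \<open>Here the natural boundary enters: the integral of \<open>sig\<close> over
    \<open>(0,R)\<close> exceeds \<open>C / \<epsilon>\<close> for large \<open>R\<close>.\<close>
  then have "\<forall>\<^sub>F n in sequentially. ennreal (C / \<epsilon>) < (\<integral>\<^sup>+z. ennreal (sig z) * indicator {0<..<of_nat n} z \<partial>m)"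
   by (rule order_tendstoD(1)) (simp add: natural)
  then obtain N :: nat where N: "ennreal (C / \<epsilon>) < (\<integral>\<^sup>+z. ennreal (sig z) * indicator {0<..<of_nat N} z \<partial>m)"
   by (auto simp: eventually_sequentially)
  define R :: ennreal where "R = of_nat N"
  have R: "R < top" by (simp add: R_def of_nat_less_top)
  have small: "emeasure (ka n) {R..} <= ennreal \<epsilon>" for n
  proof -
   have "ennreal (C / \<epsilon>) * emeasure (ka n) {R..} <= (\<integral>\<^sup>+z. ennreal (sig z) * indicator {0<..<R} z \<partial>m) * emeasure (ka n) {R..}"
    using N by (intro mult_right_mono) (auto simp: R_def)
   also have "... <= ennreal C" using far_mass[OF p] tmC by (rule order_trans)
   finally have 1: "ennreal (\<epsilon> / C) * (ennreal (C / \<epsilon>) * emeasure (ka n) {R..}) <= ennreal (\<epsilon> / C) * ennreal C"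
    by (rule mult_left_mono) simp
   have "ennreal (\<epsilon> / C) * ennreal (C / \<epsilon>) = 1" "ennreal (\<epsilon> / C) * ennreal C = ennreal \<epsilon>"
    using \<epsilon> C by (simp_all add: ennreal_mult[symmetric])
   then show ?thesis using 1 by (simp add: mult.assoc[symmetric])
  qed
  have near: "1 <= (\<integral>\<^sup>+z. ennreal (w n z) * indicator {0<..<R} z \<partial>m) + ennreal \<epsilon>" for n
  proof -
   have "(\<integral>\<^sup>+z. ennreal (w n z) \<partial>m) = (\<integral>\<^sup>+z. ennreal (w n z) * indicator {0<..<R} z + ennreal (w n z) * indicator {R..} z \<partial>m)"
   proof (rule nn_integral_cong)
    fix z show "ennreal (w n z) = ennreal (w n z) * indicator {0<..<R} z + ennreal (w n z) * indicator {R..} z"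
     using wz[of z n] by (cases "z = 0"; cases "z < R") (auto simp: not_less zero_less_iff_neq_zero)
   qed
   also have "... = (\<integral>\<^sup>+z. ennreal (w n z) * indicator {0<..<R} z \<partial>m) + (\<integral>\<^sup>+z. ennreal (w n z) * indicator {R..} z \<partial>m)"
    by (rule nn_integral_add) measurable
   also have "(\<integral>\<^sup>+z. ennreal (w n z) * indicator {R..} z \<partial>m) = emeasure (ka (Suc n)) {R..}"
    unfolding D by (subst emeasure_density) (auto simp: sets_m)
   finally show ?thesis using small[of "Suc n"] mass[of n] by (metis add_left_mono)
  qed
  have "(%n. (\<integral>\<^sup>+z. ennreal (w n z) * indicator {0<..<R} z \<partial>m)) ----> (\<integral>\<^sup>+z. ennreal (v z) * indicator {0<..<R} z \<partial>m)"
  proof (rule nn_integral_dominated_convergence[where w="%z. ennreal \<Lambda> * (ennreal (sig z) * indicator {0<..<R} z)"])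
   show "AE z in m. ennreal (w n z) * indicator {0<..<R} z <= ennreal \<Lambda> * (ennreal (sig z) * indicator {0<..<R} z)" for n
   proof (rule AE_I2)
    fix z show "ennreal (w n z) * indicator {0<..<R} z <= ennreal \<Lambda> * (ennreal (sig z) * indicator {0<..<R} z)"
    proof (cases "0 < z & z < R")
     case True
     then have "z < top" using R by auto
     then show ?thesis using True wle[of z n] sig_pos[of z] \<Lambda>(2) by (auto simp: ennreal_mult[symmetric] intro!: ennreal_leI)
    qed auto
   qed
   have "(\<integral>\<^sup>+z. ennreal \<Lambda> * (ennreal (sig z) * indicator {0<..<R} z) \<partial>m) = ennreal \<Lambda> * (\<integral>\<^sup>+z. ennreal (sig z) * indicator {0<..<R} z \<partial>m)"
    by (rule nn_integral_cmult) measurable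
   also have "... < \<infinity>" using scale_mass_finite[OF R] by (simp add: ennreal_mult_less_top)
   finally show "(\<integral>\<^sup>+z. ennreal \<Lambda> * (ennreal (sig z) * indicator {0<..<R} z) \<partial>m) < \<infinity>" .
   show "AE z in m. (%n. ennreal (w n z) * indicator {0<..<R} z) ----> ennreal (v z) * indicator {0<..<R} z"
   proof (rule AE_I2)
    fix z show "(%n. ennreal (w n z) * indicator {0<..<R} z) ----> ennreal (v z) * indicator {0<..<R} z"
     by (cases "z \<in> {0<..<R}") (simp_all add: conv tendsto_ennrealI del: greaterThanLessThan_iff)
   qed
  qed auto
  then have "(%n. (\<integral>\<^sup>+z. ennreal (w n z) * indicator {0<..<R} z \<partial>m) + ennreal \<epsilon>) ----> (\<integral>\<^sup>+z. ennreal (v z) * indicator {0<..<R} z \<partial>m) + ennreal \<epsilon>"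
   by (intro tendsto_add tendsto_const)
  then have "1 <= (\<integral>\<^sup>+z. ennreal (v z) * indicator {0<..<R} z \<partial>m) + ennreal \<epsilon>" by (rule LIMSEQ_le_const) (use near in auto)
  also have "... <= (\<integral>\<^sup>+z. ennreal (v z) \<partial>m) + ennreal \<epsilon>"
   by (intro add_right_mono nn_integral_mono) (auto simp: indicator_def)
  finally show "1 <= (\<integral>\<^sup>+z. ennreal (v z) \<partial>m) + ennreal \<epsilon>" .
 qed
 have vint: "integrable m v"
  by (rule integrableI_bounded) (use vfin v0 in \<open>auto simp: order_le_less_trans[OF vfin]\<close>)
 have wint: "integrable m (w n)" for n
  by (rule integrableI_bounded) (use mass[of n] w0 in auto)
 have sch: "(%n. \<integral>\<^sup>+z. ennreal (norm (w n z - v z)) \<partial>m) ----> 0"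
  by (rule Scheffe_lemma2) (use vint vmass v0 w0 mass conv in auto)
 have d: "(%n. LINT z|m. norm (w n z - v z)) ----> 0"
 proof -
  have "(LINT z|m. norm (w n z - v z)) = enn2real (\<integral>\<^sup>+z. ennreal (norm (w n z - v z)) \<partial>m)" for n
   by (rule integral_eq_nn_integral) auto
  moreover have "(%n. enn2real (\<integral>\<^sup>+z. ennreal (norm (w n z - v z)) \<partial>m)) ----> 0"
   by (rule tendsto_enn2real) (use sch in simp_all)
  ultimately show ?thesis by simp
 qed
 show ?thesis unfolding weakly_tendsto_def
 proof (intro allI impI, elim conjE)
  fix f :: "ennreal => real" assume c: "continuous_on Rpos f" and "bounded (f ` Rpos)"
  then have "\<exists>K. \<forall>x\<in>Rpos. \<bar>f x\<bar> <= K" by (auto simp: bounded_iff)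
  then obtain K where K: "!!x. x \<in> Rpos ==> \<bar>f x\<bar> <= K" by blast
  have K0: "0 <= K" using K[of 1] by simp
  have [measurable]: "f \<in> borelm" by (rule borel_measurable_continuous_Ioo[OF c])
  define F where "F x = indicat_real Rpos x * f x" for x
  have [measurable]: "F \<in> borelm" unfolding F_def[abs_def] by measurable
  have FK: "\<bar>F x\<bar> <= K" for x using K[of x] K0 by (cases "x \<in> Rpos") (auto simp: F_def)
  have den: "(LINT x:Rpos|density m (%z. ennreal (u z)). f x) = (LINT x|m. u x * F x)"
   if [measurable]: "u \<in> borelm" and "!!z. 0 <= u z" for u
   unfolding set_lebesgue_integral_def by (subst integral_density) (use that(2) in \<open>auto simp: F_def\<close>)
  have int: "integrable m (%x. u x * F x)" if "integrable m u" for u :: "ennreal => real"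
  proof (rule Bochner_Integration.integrable_bound)
   show "integrable m (%x. K * u x)" using that by (rule integrable_mult_right)
   show "AE x in m. norm (u x * F x) <= norm (K * u x)"
    using FK K0 by (auto simp: abs_mult mult.commute intro!: mult_right_mono)
   show "(%x. u x * F x) \<in> borel_measurable m" using that by measurable
  qed
  have bd: "\<bar>(LINT x|m. w n x * F x) - (LINT x|m. v x * F x)\<bar> <= K * (LINT z|m. norm (w n z - v z))" for n
  proof -
   have "(LINT x|m. w n x * F x) - (LINT x|m. v x * F x) = (LINT x|m. w n x * F x - v x * F x)"
    by (rule Bochner_Integration.integral_diff[symmetric]) (intro int wint vint)+
   also have "\<bar>...\<bar> <= (LINT x|m. \<bar>w n x * F x - v x * F x\<bar>)" by (rule integral_abs_bound)
   also have "... <= (LINT z|m. K * norm (w n z - v z))"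
   proof (rule integral_mono)
    show "integrable m (%x. \<bar>w n x * F x - v x * F x\<bar>)"
     using Bochner_Integration.integrable_diff[OF int[OF wint[of n]] int[OF vint]] by (rule integrable_abs)
    show "integrable m (%x. K * norm (w n x - v x))"
     using integrable_norm[OF Bochner_Integration.integrable_diff[OF wint[of n] vint]] by (rule integrable_mult_right)
    show "\<bar>w n x * F x - v x * F x\<bar> <= K * norm (w n x - v x)" for x
     using mult_right_mono[OF FK[of x], of "\<bar>w n x - v x\<bar>"] by (simp add: abs_mult[symmetric] algebra_simps)
   qed
   finally show ?thesis by simp
  qed
  have "(%n. (LINT x|m. w n x * F x) - (LINT x|m. v x * F x)) ----> 0"
  proof (rule Lim_null_comparison)
   show "\<forall>\<^sub>F n in sequentially. norm ((LINT x|m. w n x * F x) - (LINT x|m. v x * F x)) <= K * (LINT z|m. norm (w n z - v z))"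
    using bd by (intro always_eventually allI) (simp only: real_norm_def)
   show "(%n. K * (LINT z|m. norm (w n z - v z))) ----> 0" using tendsto_mult_right_zero[OF d] .
  qed
  then have "(%n. LINT x|m. w n x * F x) ----> (LINT x|m. v x * F x)" by (rule LIM_zero_cancel)
  then have "(%n. LINT x:Rpos|ka (Suc n). f x) ----> (LINT x:Rpos|nu m s l. f x)"
   unfolding D nu_eq by (simp add: den w0 v0)
  then show "(%n. LINT x:Rpos|ka n. f x) ----> (LINT x:Rpos|nu m s l. f x)" by (rule LIMSEQ_imp_Suc)
 qed
qed

text \<open>Both sides of \<open>step\<close> converge under weak convergence, so the reciprocal
  means converge, for every tent to the same number \<open>c\<close>. Shrinking tents then identify
  \<open>c\<close> by \<open>eigenvalue_identification\<close>.\<close>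

lemma renewal_limit_converse:
 assumes p: "!!n. prob_on_pos (ka n)" and fin: "!!n. tail_moment (ka n) 0 < top" and rec: "!!n. ka (Suc n) = renewal X (ka n)"
  and w: "weakly_tendsto ka (nu m s l) sequentially"
 shows "(%n. 1 / enn2real (tail_moment (ka n) 0)) ----> l"
proof -
 define rt where "rt n = 1 / enn2real (tail_moment (ka n) 0)" for n
 have \<nu>: "prob_on_pos (nu m s l)" by (rule weak_limit_prob[OF w]) (use p in auto)
 have rt0: "0 <= rt n" for n by (simp add: rt_def)
 define al where "al b = (\<integral>\<^sup>+z. ennreal (tent b z) * ennreal (v z) \<partial>m)" for b
 define ga where "ga b = (\<integral>\<^sup>+z. U (nu m s l) z * ennreal (tent b z) \<partial>m)" for b
 have lim: "rt ----> enn2real (al b) / enn2real (ga b)" if b: "0 < b" "b < top" for b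
 proof -
  note [measurable] = tent_measurable[OF b]
  note g = gtent_integral[OF b]
  \<comment> \<open>The renewal transform followed by the tent is the potential of the tent, up to
    the normalising mean.\<close>
  have step: "(LINT x:Rpos|ka (Suc n). tent b x) = rt n * (LINT x:Rpos|ka n. gtent b x)" for n
  proof -
   have inv: "enn2real (inverse (tail_moment (ka n) 0)) = rt n"
    using tail_moment_0(2)[OF p, of n] fin[of n] by (cases "tail_moment (ka n) 0") (auto simp: rt_def inverse_ennreal inverse_eq_divide)
   have "(LINT x:Rpos|ka (Suc n). tent b x) = enn2real (inverse (tail_moment (ka n) 0) * pot (ka n) (%z. ennreal (tent b z)))"
    using LINT_prob[OF tent(1)[OF b] tent(2)[OF b] p[of "Suc n"]] renewal_eq(3)[OF p fin, of "%z. ennreal (tent b z)" n] by (simp add: rec)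
   then show ?thesis by (simp add: enn2real_mult inv pot_eq[OF p] g(1)[OF p])
  qed
  have pos: "0 < (LINT x:Rpos|ka n. gtent b x)" for n
   using g(2,3)[OF p[of n]] by (simp add: g(1)[OF p] enn2real_positive_iff)
  have ga: "0 < enn2real (ga b)" using g(2,3)[OF \<nu>] by (simp add: ga_def enn2real_positive_iff)
  have "(%n. (LINT x:Rpos|ka (Suc n). tent b x) / (LINT x:Rpos|ka n. gtent b x)) ----> enn2real (al b) / enn2real (ga b)"
  proof (rule tendsto_divide)
   show "(%n. LINT x:Rpos|ka (Suc n). tent b x) ----> enn2real (al b)"
    using LIMSEQ_Suc[OF tent_limits(1)[OF w b]] by (simp add: nu_tent(1)[OF b] al_def)
   show "(%n. LINT x:Rpos|ka n. gtent b x) ----> enn2real (ga b)"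
    using tent_limits(2)[OF w b] by (simp add: g(1)[OF \<nu>] ga_def)
  qed (use ga in simp)
  moreover have "(LINT x:Rpos|ka (Suc n). tent b x) / (LINT x:Rpos|ka n. gtent b x) = rt n" for n
   using pos[of n] by (simp add: step)
  ultimately show ?thesis by simp
 qed
 define c where "c = enn2real (al 1) / enn2real (ga 1)"
 have "c = l"
 proof (rule eigenvalue_identification[OF \<nu>, of c 1])
  show "0 <= c" by (simp add: c_def)
  fix b :: ennreal assume b: "0 < b" "b <= 1"
  then have bt: "b < top" by (auto intro: order_le_less_trans)
  note g = gtent_integral(2,3)[OF b(1) bt \<nu>]
  have e: "c = enn2real (al b) / enn2real (ga b)" unfolding c_def by (rule LIMSEQ_unique[OF lim lim]) (use b bt in auto)
  have "0 < enn2real (ga b)" using g by (simp add: ga_def enn2real_positive_iff)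
  then have "enn2real (al b) = c * enn2real (ga b)" using e by simp
  moreover have "0 <= c" by (simp add: c_def)
  ultimately have "ennreal (enn2real (al b)) = ennreal c * ennreal (enn2real (ga b))" by (simp only: ennreal_mult enn2real_nonneg)
  moreover have "al b < top" "ga b < top" using nu_tent(2)[OF b(1) bt] g by (auto simp: al_def ga_def)
  ultimately show "(\<integral>\<^sup>+z. ennreal (tent b z) * ennreal (v z) \<partial>m) = ennreal c * (\<integral>\<^sup>+z. U (nu m s l) z * ennreal (tent b z) \<partial>m)"
   by (simp add: al_def[symmetric] ga_def[symmetric])
 qed auto
 then show ?thesis using lim[of 1] by (simp add: c_def rt_def[abs_def])
qed

end


section \<open>From tail ratios to moment ratios\<close>

lemma (in natural_process) tail_moment_bochner:
 assumes mu: "prob_on_pos mu" and fin: "tail_moment mu n < top"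
 shows "has_bochner_integral lborel (%t. indicat_real {0..} t * (t ^ n / fact n * tail X mu t)) (enn2real (tail_moment mu n))"
proof (rule has_bochner_integral_nn_integral)
 note [measurable] = tail_measurable[OF mu]
 show "(%t. indicat_real {0..} t * (t ^ n / fact n * tail X mu t)) \<in> borel_measurable lborel" by measurable
 show "AE t in lborel. 0 <= indicat_real {0..} t * (t ^ n / fact n * tail X mu t)"
  by (rule AE_I2) (auto simp: indicator_def tail_kmeas(2)[OF mu])
 have "(\<integral>\<^sup>+t. ennreal (indicat_real {0..} t * (t ^ n / fact n * tail X mu t)) \<partial>lborel) = tail_moment mu n"
  unfolding tail_moment_def
 proof (rule nn_integral_cong)
  fix t :: real
  show "ennreal (indicat_real {0..} t * (t ^ n / fact n * tail X mu t)) = ennreal (t ^ n / fact n) * ennreal (tail X mu t) * indicator {0..} t"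
  proof (cases "0 <= t")
   case True
   then show ?thesis using ennreal_mult[of "t ^ n / fact n" "tail X mu t"] tail_kmeas(2)[OF mu] by simp
  qed simp
 qed
 then show "(\<integral>\<^sup>+t. ennreal (indicat_real {0..} t * (t ^ n / fact n * tail X mu t)) \<partial>lborel) = ennreal (enn2real (tail_moment mu n))"
  using fin by simp
qed simp

text \<open>The moments of \<open>mu\<close> and of its renewal transform are integrals of the tails
  \<open>g\<close> and \<open>G\<close> against the same weights, and \<open>G\<close> is the
  integrated \<open>g\<close> divided by the mean \<open>M\<close>. The tail ratios give
  \<open>g / G\<close> the limit \<open>M * l\<close>, \<open>moment_ratio_limit\<close> transfers
  it to the integrals, and the shift of moments under the transform removes
  \<open>M\<close>.\<close>

lemma (in natural_process) moment_ratio_of_tail_ratio: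
 assumes mu: "prob_on_pos mu" and fin: "!!k. tail_moment mu k < top" and l: "0 < l"
  and lim: "!!h. 0 < h ==> ((%t. tail X mu (t + h) / tail X mu t) \<longlongrightarrow> exp (- l * h)) at_top"
 shows "(%n. norm_moment X mu (Suc n) / norm_moment X mu (Suc (Suc n))) ----> l"
proof -
 define g where "g = tail X mu"
 define G where "G = tail X (renewal X mu)"
 define M where "M = enn2real (tail_moment mu 0)"
 have M: "0 < M" using tail_moment_0(2)[OF mu] fin by (simp add: M_def enn2real_positive_iff)
 have iM: "inverse (tail_moment mu 0) = ennreal (1 / M)"
  using tail_moment_0(2)[OF mu] fin[of 0] by (cases "tail_moment mu 0") (auto simp: M_def inverse_ennreal inverse_eq_divide)
 have R: "prob_on_pos (renewal X mu)" by (rule renewal_eq(2)[OF mu fin])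
 have [measurable]: "g \<in> borelm" "G \<in> borelm"
  unfolding g_def G_def by (rule tail_measurable, rule mu, rule tail_measurable, rule R)
 have g0: "0 <= g t" "g t <= 1" for t using tail_kmeas(2,3)[OF mu] by (auto simp: g_def)
 note rl = ratio_limit_integral[of g l, OF tail_antimono[OF mu, folded g_def] g0(1) _ l lim[folded g_def]]
 have r1: "((%t. (LINT u:{0..}|lborel. g (t + u) / g t)) \<longlongrightarrow> 1 / l) at_top" and r2: "!!t. 0 <= t ==> 0 < g t"
  using rl(1,2) by auto
 have eqG: "(LINT u:{0..}|lborel. g (t + u) / g t) = M * G t / g t" if t: "0 <= t" for t
 proof -
  have "ennreal (G t) = ennreal (1 / M) * (\<integral>\<^sup>+u\<in>{0..}. ennreal (g (u + t)) \<partial>lborel)"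
   unfolding G_def g_def tail_renewal[OF mu fin t] iM ..
  then have "enn2real (ennreal (G t)) = enn2real (ennreal (1 / M)) * enn2real (\<integral>\<^sup>+u\<in>{0..}. ennreal (g (u + t)) \<partial>lborel)"
   by (simp only: enn2real_mult)
  then have "M * G t = enn2real (\<integral>\<^sup>+u\<in>{0..}. ennreal (g (u + t)) \<partial>lborel)"
   using M tail_kmeas(2)[OF R, of t] by (simp add: G_def)
  moreover have "(LINT u:{0..}|lborel. g (t + u)) = enn2real (\<integral>\<^sup>+u. ennreal (indicat_real {0..} u *\<^sub>R g (t + u)) \<partial>lborel)"
   unfolding set_lebesgue_integral_def by (rule integral_eq_nn_integral) (use g0 in \<open>auto simp: indicator_def\<close>)
  moreover have "(\<integral>\<^sup>+u. ennreal (indicat_real {0..} u *\<^sub>R g (t + u)) \<partial>lborel) = (\<integral>\<^sup>+u\<in>{0..}. ennreal (g (u + t)) \<partial>lborel)"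
   by (rule nn_integral_cong) (auto simp: indicator_def add.commute)
  ultimately show ?thesis by simp
 qed
 have lim2: "((%t. M * G t / g t) \<longlongrightarrow> 1 / l) at_top"
  by (rule Lim_transform_eventually[OF r1]) (intro eventually_at_top_linorderI[of 0] eqG)
 have Gpos: "0 < G t" if t: "0 <= t" for t
 proof -
  have "\<forall>\<^sub>F u in at_top. 0 < M * G u / g u" using order_tendstoD(1)[OF lim2, of 0] l by simp
  then have "\<forall>\<^sub>F u in at_top. 0 < M * G u / g u & t <= u" using eventually_ge_at_top[of t] by eventually_elim simp
  then obtain u where u: "0 < M * G u / g u" "t <= u" using eventually_happens[of _ "at_top :: real filter"] by auto
  have "0 < G u" using u M r2[of u] t by (simp add: zero_less_divide_iff zero_less_mult_iff)
  also have "G u <= G t" unfolding G_def by (rule tail_antimono[OF R t u(2)])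
  finally show ?thesis .
 qed
 have "((%t. M / (M * G t / g t)) \<longlongrightarrow> M / (1 / l)) at_top" using l by (intro tendsto_divide tendsto_const lim2) auto
 then have "((%t. g t / G t) \<longlongrightarrow> M * l) at_top" using M by simp
 then have lim3: "((%t. g t / G t) \<longlongrightarrow> M * l) at_top" .
 have finR: "tail_moment (renewal X mu) k < top" for k
  using renewal_iterate(2)[OF mu fin, where n="Suc 0" and k=k] by simp
 have "(%n. enn2real (tail_moment mu n) / enn2real (tail_moment (renewal X mu) n)) ----> M * l"
 proof (rule moment_ratio_limit[OF g0 Gpos])
  show "G t <= 1" for t unfolding G_def by (rule tail_kmeas(3)[OF R])
  show "G y <= G x" if "0 <= x" "x <= y" for x y unfolding G_def by (rule tail_antimono[OF R that])
  show "has_bochner_integral lborel (%t. indicat_real {0..} t * (t ^ n / fact n * g t)) (enn2real (tail_moment mu n))" for n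
   unfolding g_def by (rule tail_moment_bochner[OF mu fin])
  show "has_bochner_integral lborel (%t. indicat_real {0..} t * (t ^ n / fact n * G t)) (enn2real (tail_moment (renewal X mu) n))" for n
   unfolding G_def by (rule tail_moment_bochner[OF R finR])
  show "0 < M * l" using M l by simp
 qed (assumption | fact)+
 then have "(%n. 1 / M * (enn2real (tail_moment mu n) / enn2real (tail_moment (renewal X mu) n))) ----> 1 / M * (M * l)"
  by (rule tendsto_mult_left)
 moreover have "1 / M * (enn2real (tail_moment mu n) / enn2real (tail_moment (renewal X mu) n)) = norm_moment X mu (Suc n) / norm_moment X mu (Suc (Suc n))" for n
  using M by (simp add: tail_moment_renewal[OF mu fin] norm_moment_Suc[OF mu] enn2real_mult iM)
 ultimately show ?thesis using M by simp
qed

section \<open>From conditioned laws to tail ratios\<close>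

context eigen_process
begin

lemma nn_integral_cond_law:
 assumes mu: "prob_on_pos mu" and pos: "0 < tail X mu t" and [measurable]: "f \<in> borelm"
 shows "(\<integral>\<^sup>+x. f x \<partial>cond_law X mu t) = ennreal (1 / tail X mu t) * (\<integral>\<^sup>+x. f x \<partial>kmeas mu t)"
 unfolding cond_law_eq[OF mu] inverse_ennreal[OF pos]
 by (subst nn_integral_scale_measure) (auto simp: inverse_eq_divide)

lemma cond_law_prob:
 assumes mu: "prob_on_pos mu" and pos: "0 < tail X mu t"
 shows "prob_on_pos (cond_law X mu t)"
proof -
 have s: "sets (cond_law X mu t) = sets borel" unfolding cond_law_eq[OF mu] by simp
 have sp: "space (cond_law X mu t) = UNIV" "space (kmeas mu t) = UNIV" using sets_eq_imp_space_eq[OF s] sets_eq_imp_space_eq[OF sets_kmeas] by auto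
 have i: "emeasure (kmeas mu t) Rpos = emeasure (kmeas mu t) UNIV"
  by (rule emeasure_eq_AE, use kmeas_interior[OF mu, of t] in eventually_elim) auto
 have e: "emeasure (cond_law X mu t) B = ennreal (1 / tail X mu t) * emeasure (kmeas mu t) B" if "B \<in> sets borel" for B
  using nn_integral_cond_law[OF assms, of "indicator B"] that s by simp
 have "ennreal (1 / tail X mu t) * ennreal (tail X mu t) = 1" using pos by (simp add: ennreal_mult[symmetric])
 then have "emeasure (cond_law X mu t) UNIV = 1" "emeasure (cond_law X mu t) Rpos = 1"
  by (simp_all add: e i flip: tail_kmeas(1)[OF mu])
 then show ?thesis using s sp by (auto simp: prob_on_pos_def intro!: prob_spaceI)
qed

lemma kmeas_bounded:
 assumes mu: "prob_on_pos mu" and K: "!!x. 0 < x ==> x < top ==> f x <= K"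
 shows "(\<integral>\<^sup>+x. ennreal (f x) \<partial>kmeas mu t) < top"
proof -
 have "(\<integral>\<^sup>+x. ennreal (f x) \<partial>kmeas mu t) <= (\<integral>\<^sup>+x. ennreal K \<partial>kmeas mu t)"
  by (rule nn_integral_mono_AE, use kmeas_interior[OF mu, of t] in eventually_elim) (use K in \<open>auto intro: ennreal_leI\<close>)
 also have "... < top" using sets_eq_imp_space_eq[OF sets_kmeas] by (simp add: ennreal_mult_less_top flip: tail_kmeas(1)[OF mu])
 finally show ?thesis .
qed

text \<open>Once the tail vanishes, the conditioned law is the zero measure by the conventions for
  \<open>0 / 0\<close>, and its weak limit would give no mass to a small tent, against the
  positivity of \<open>v\<close> near 0.\<close>

lemma tail_positive:
 assumes mu: "prob_on_pos mu" and w: "weakly_tendsto (cond_law X mu) (nu m s l) at_top" and t: "0 <= t"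
 shows "0 < tail X mu t"
proof (rule ccontr)
 assume "\<not> 0 < tail X mu t"
 then have z: "tail X mu u = 0" if "t <= u" for u
  using tail_antimono[OF mu t that] tail_kmeas(2)[OF mu, of u] by simp
 obtain b where b: "0 < b" "b < top" and p: "0 < (\<integral>\<^sup>+z. ennreal (tent b z) * ennreal (v z) \<partial>m)"
  using nu_tent_pos by (metis order_refl)
 have "(LINT x:Rpos|cond_law X mu u. tent b x) = 0" if u: "t <= u" for u
 proof -
  note [measurable] = tent_measurable[OF b]
  have s: "sets (cond_law X mu u) = sets borel" unfolding cond_law_eq[OF mu] by simp
  have "emeasure (kmeas mu u) (space (kmeas mu u)) = 0"
   using z[OF u] sets_eq_imp_space_eq[OF sets_kmeas] by (simp flip: tail_kmeas(1)[OF mu])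
  then have "AE x in kmeas mu u. ennreal (tent b x) * indicator Rpos x = 0" by (rule emeasure_0_AE)
  then have "(\<integral>\<^sup>+x. ennreal (tent b x) * indicator Rpos x \<partial>kmeas mu u) = 0"
   by (subst nn_integral_0_iff_AE) measurable
  then have "(\<integral>\<^sup>+x. ennreal (tent b x) * indicator Rpos x \<partial>cond_law X mu u) = 0"
   unfolding cond_law_eq[OF mu] by (subst nn_integral_scale_measure) auto
  then show ?thesis using LINT_enn[OF tent(1)[OF b] tent(2)[OF b] s] by simp
 qed
 then have "((%u. LINT x:Rpos|cond_law X mu u. tent b x) \<longlongrightarrow> 0) at_top"
  by (intro tendsto_eventually eventually_at_top_linorderI[of t])
 from tendsto_unique[OF trivial_limit_at_top_linorder this tent_limits(1)[OF w b]]
 have "enn2real (\<integral>\<^sup>+z. ennreal (tent b z) * ennreal (v z) \<partial>m) = 0" by (simp add: nu_tent(1)[OF b])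
 moreover have "0 < enn2real (\<integral>\<^sup>+z. ennreal (tent b z) * ennreal (v z) \<partial>m)"
  using p nu_tent(2)[OF b] by (simp add: enn2real_positive_iff)
 ultimately show False by simp
qed

text \<open>Let \<open>a\<close> and \<open>A\<close> be the integrals of the tent and of its
  potential against the killed laws. Weak convergence gives \<open>a / A\<close> the limit
  \<open>al / ga\<close>, and \<open>A\<close> is the integral of \<open>a\<close> over later times,
  so \<open>A\<close> decays at this rate. The tail follows, because \<open>A / tail\<close> has the
  positive limit \<open>ga\<close>.\<close>

lemma tail_ratio_of_tent:
 assumes mu: "prob_on_pos mu" and w: "weakly_tendsto (cond_law X mu) (nu m s l) at_top"
  and b: "0 < b" "b < top" and pos: "0 < (\<integral>\<^sup>+z. ennreal (tent b z) * ennreal (v z) \<partial>m)" and h: "0 < h"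
 shows "((%t. tail X mu (t + h) / tail X mu t) \<longlongrightarrow>
  exp (- (enn2real (\<integral>\<^sup>+z. ennreal (tent b z) * ennreal (v z) \<partial>m) / enn2real (\<integral>\<^sup>+z. U (nu m s l) z * ennreal (tent b z) \<partial>m)) * h)) at_top"
  and "prob_on_pos (nu m s l)"
proof -
 note [measurable] = tent_measurable[OF b] borel_measurable_continuous_Ioo[OF gtent(1)[OF b]]
 note tp = tail_positive[OF mu w]
 show \<nu>: "prob_on_pos (nu m s l)"
  by (rule weak_limit_prob[OF w]) (auto intro!: eventually_at_top_linorderI[of 0] cond_law_prob[OF mu] tp)
 define al where "al = enn2real (\<integral>\<^sup>+z. ennreal (tent b z) * ennreal (v z) \<partial>m)"
 define ga where "ga = enn2real (\<integral>\<^sup>+z. U (nu m s l) z * ennreal (tent b z) \<partial>m)"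
 have al0: "0 < al" using pos nu_tent(2)[OF b] by (simp add: al_def enn2real_positive_iff)
 have ga0: "0 < ga" using gtent_integral(2,3)[OF b \<nu>] by (simp add: ga_def enn2real_positive_iff)
 define a where "a t = enn2real (\<integral>\<^sup>+x. ennreal (tent b x) \<partial>kmeas mu t)" for t
 define A where "A t = enn2real (\<integral>\<^sup>+x. ennreal (gtent b x) \<partial>kmeas mu t)" for t
 obtain K where K: "!!x. 0 < x & x < top ==> gtent b x <= K" using gtent(2)[OF b] by blast
 have a_enn: "ennreal (a t) = (\<integral>\<^sup>+x. ennreal (tent b x) \<partial>kmeas mu t)" for t
  unfolding a_def by (rule ennreal_enn2real) (rule kmeas_bounded[OF mu tent(3)[OF b]])
 have A_enn: "ennreal (A t) = (\<integral>\<^sup>+x. ennreal (gtent b x) \<partial>kmeas mu t)" for t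
  unfolding A_def by (rule ennreal_enn2real) (rule kmeas_bounded[OF mu], use K in auto)
 have ca: "(LINT x:Rpos|cond_law X mu t. tent b x) = a t / tail X mu t" if "0 <= t" for t
  using LINT_prob[OF tent(1)[OF b] tent(2)[OF b] cond_law_prob[OF mu tp[OF that]]] tp[OF that]
  by (simp add: nn_integral_cond_law[OF mu tp[OF that]] enn2real_mult a_def)
 have cA: "(LINT x:Rpos|cond_law X mu t. gtent b x) = A t / tail X mu t" if "0 <= t" for t
 proof -
  have "0 <= gtent b x" for x by (simp add: gtent_def)
  then show ?thesis
   using LINT_prob[OF gtent(1)[OF b] _ cond_law_prob[OF mu tp[OF that]]] tp[OF that]
   by (simp add: nn_integral_cond_law[OF mu tp[OF that]] enn2real_mult A_def)
 qed
 have lima: "((%t. a t / tail X mu t) \<longlongrightarrow> al) at_top"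
  using tent_limits(1)[OF w b] unfolding nu_tent(1)[OF b] al_def[symmetric]
  by (rule Lim_transform_eventually) (intro eventually_at_top_linorderI[of 0] ca)
 have limA: "((%t. A t / tail X mu t) \<longlongrightarrow> ga) at_top"
  using tent_limits(2)[OF w b] unfolding gtent_integral(1)[OF b \<nu>] ga_def[symmetric]
  by (rule Lim_transform_eventually) (intro eventually_at_top_linorderI[of 0] cA)
 have A0: "0 < A t" if t: "0 <= t" for t
 proof -
  note C = cond_law_prob[OF mu tp[OF t]]
  have "0 < (LINT x:Rpos|cond_law X mu t. gtent b x)"
   unfolding gtent_integral(1)[OF b C] using gtent_integral(2,3)[OF b C] by (simp add: enn2real_positive_iff)
  then show ?thesis unfolding cA[OF t] using tp[OF t] by (simp add: zero_less_divide_iff)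
 qed
 have [measurable]: "a \<in> borelm"
 proof -
  interpret pr: prob_space mu by (rule prob_on_posD[OF mu])
  note [measurable_cong] = prob_on_posD(2)[OF mu]
  have [measurable]: "(%z. ennreal (tent b z) * alive z) \<in> borelm" by measurable
  have "a = (%t. enn2real (\<integral>\<^sup>+x. semigroup (%z. ennreal (tent b z) * alive z) (ennreal t) (proj x) \<partial>mu))"
   unfolding a_def[abs_def] by (simp add: nn_integral_kmeas[OF mu])
  then show ?thesis by simp
 qed
 \<comment> \<open>The integrated form of \<open>A' = - a\<close>, from
   \<open>kmeas_green\<close>.\<close>
 have Aint: "ennreal (A t) = (\<integral>\<^sup>+u. ennreal (a u) * indicator {t..} u \<partial>lborel)" if t: "0 <= t" for t
 proof -
  have "ennreal (A t) = (\<integral>\<^sup>+x. (\<integral>\<^sup>+z. kern x z * ennreal (tent b z) \<partial>m) \<partial>kmeas mu t)"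
   unfolding A_enn by (rule nn_integral_cong_AE, use kmeas_interior[OF mu, of t] in eventually_elim) (simp add: gtent(3)[OF b])
  also have "... = (\<integral>\<^sup>+r\<in>{0..}. ennreal (a (t + r)) \<partial>lborel)"
   unfolding a_enn by (rule kmeas_green[OF mu _ t, symmetric]) measurable
  also have "... = (\<integral>\<^sup>+r. ennreal (a (t + 1 * r)) * indicator {t..} (t + 1 * r) \<partial>lborel)"
   by (rule nn_integral_cong) (auto simp: indicator_def)
  also have "... = (\<integral>\<^sup>+u. ennreal (a u) * indicator {t..} u \<partial>lborel)"
   by (subst nn_integral_real_affine[of "%u. ennreal (a u) * indicator {t..} u" 1 t]) auto
  finally show ?thesis .
 qed
 have Aanti: "A y <= A x" if "0 <= x" "x <= y" for x y
 proof -
  have "ennreal (A y) <= ennreal (A x)"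
   unfolding Aint[OF that(1)] Aint[OF order_trans[OF that]]
   by (rule nn_integral_mono) (use that in \<open>auto simp: indicator_def\<close>)
  then show ?thesis using A0[OF that(1)] by simp
 qed
 have inc: "ennreal (A t) = (\<integral>\<^sup>+u. ennreal (a u) * indicator {t..<t + d} u \<partial>lborel) + ennreal (A (t + d))" if td: "0 <= t" "0 <= d" for t d
 proof -
  have td': "0 <= t + d" using td by simp
  have "(\<integral>\<^sup>+u. ennreal (a u) * indicator {t..} u \<partial>lborel) = (\<integral>\<^sup>+u. ennreal (a u) * indicator {t..<t + d} u + ennreal (a u) * indicator {t + d..} u \<partial>lborel)"
   by (rule nn_integral_cong) (use td in \<open>auto simp: indicator_def\<close>)
  also have "... = (\<integral>\<^sup>+u. ennreal (a u) * indicator {t..<t + d} u \<partial>lborel) + (\<integral>\<^sup>+u. ennreal (a u) * indicator {t + d..} u \<partial>lborel)"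
   by (rule nn_integral_add) measurable
  finally show ?thesis unfolding Aint[OF td(1)] Aint[OF td'] .
 qed
 have "((%t. (a t / tail X mu t) / (A t / tail X mu t)) \<longlongrightarrow> al / ga) at_top"
  using ga0 by (intro tendsto_divide lima limA) auto
 then have limaA: "((%t. a t / A t) \<longlongrightarrow> al / ga) at_top"
 proof (rule Lim_transform_eventually, intro eventually_at_top_linorderI[of 0])
  fix t :: real assume "0 <= t"
  then show "(a t / tail X mu t) / (A t / tail X mu t) = a t / A t" using tp[of t] by simp
 qed
 have sr: "((%t. A (t + h) / A t) \<longlongrightarrow> exp (- (al / ga) * h)) at_top"
 proof (rule survival_ratio_limit[where a=a and A=A, OF A0 Aanti _ _ inc _ _ h])
  show "0 <= a t" for t by (simp add: a_def)
  show "0 < al / ga" using al0 ga0 by simp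
 qed (assumption | fact)+
 have limAh: "((%t. A (t + h) / tail X mu (t + h)) \<longlongrightarrow> ga) at_top"
  by (rule filterlim_compose[OF limA]) real_asymp
 have "((%t. (A (t + h) / A t) * (A t / tail X mu t) / (A (t + h) / tail X mu (t + h))) \<longlongrightarrow> exp (- (al / ga) * h) * ga / ga) at_top"
  using ga0 by (intro tendsto_divide tendsto_mult sr limA limAh) auto
 then have "((%t. tail X mu (t + h) / tail X mu t) \<longlongrightarrow> exp (- (al / ga) * h) * ga / ga) at_top"
 proof (rule Lim_transform_eventually, intro eventually_at_top_linorderI[of 0])
  fix t :: real assume t: "0 <= t"
  then show "(A (t + h) / A t) * (A t / tail X mu t) / (A (t + h) / tail X mu (t + h)) = tail X mu (t + h) / tail X mu t"
   using A0[OF t] A0[of "t + h"] tp[OF t] tp[of "t + h"] h by simp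
 qed
 then show "((%t. tail X mu (t + h) / tail X mu t) \<longlongrightarrow>
  exp (- (enn2real (\<integral>\<^sup>+z. ennreal (tent b z) * ennreal (v z) \<partial>m) / enn2real (\<integral>\<^sup>+z. U (nu m s l) z * ennreal (tent b z) \<partial>m)) * h)) at_top"
  using ga0 by (simp add: al_def[symmetric] ga_def[symmetric])
qed

text \<open>The tail ratio does not involve the tent, so the rate \<open>al b / ga b\<close> is the
  same for all small \<open>b\<close>, and \<open>eigenvalue_identification\<close> applies.\<close>

lemma tail_ratio_of_weak_limit:
 assumes mu: "prob_on_pos mu" and w: "weakly_tendsto (cond_law X mu) (nu m s l) at_top" and h: "0 < h"
 shows "((%t. tail X mu (t + h) / tail X mu t) \<longlongrightarrow> exp (- l * h)) at_top"
proof -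
 define al where "al b = (\<integral>\<^sup>+z. ennreal (tent b z) * ennreal (v z) \<partial>m)" for b
 define ga where "ga b = (\<integral>\<^sup>+z. U (nu m s l) z * ennreal (tent b z) \<partial>m)" for b
 obtain b0 where b0: "0 < b0" "b0 < top" and pos: "!!b. 0 < b ==> b <= b0 ==> 0 < al b"
  unfolding al_def using nu_tent_pos by blast
 have lim: "((%t. tail X mu (t + h) / tail X mu t) \<longlongrightarrow> exp (- (enn2real (al b) / enn2real (ga b)) * h)) at_top"
  and \<nu>: "prob_on_pos (nu m s l)" if b: "0 < b" "b <= b0" for b
 proof -
  have "b < top" using b b0 by (auto intro: order_le_less_trans)
  from tail_ratio_of_tent[OF mu w b(1) this pos[OF b, unfolded al_def] h]
  show "((%t. tail X mu (t + h) / tail X mu t) \<longlongrightarrow> exp (- (enn2real (al b) / enn2real (ga b)) * h)) at_top" "prob_on_pos (nu m s l)"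
   unfolding al_def ga_def by blast+
 qed
 define c where "c = enn2real (al b0) / enn2real (ga b0)"
 have "c = l"
 proof (rule eigenvalue_identification[OF \<nu>[OF b0(1) order_refl] _ b0])
  show "0 <= c" by (simp add: c_def)
  fix b assume b: "0 < b" "b <= b0"
  then have bt: "b < top" using b0 by (auto intro: order_le_less_trans)
  note g = gtent_integral(2,3)[OF b(1) bt \<nu>[OF b]]
  have "exp (- c * h) = exp (- (enn2real (al b) / enn2real (ga b)) * h)"
   unfolding c_def by (rule tendsto_unique[OF trivial_limit_at_top_linorder lim[OF b0(1) order_refl] lim[OF b]])
  \<comment> \<open>Since \<open>h\<close> is positive, equal exponentials have equal rates.\<close>
  then have e: "c = enn2real (al b) / enn2real (ga b)" using h by (simp only: exp_inj_iff mult_cancel_right neg_equal_iff_equal) simp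
  have "0 < enn2real (ga b)" using g by (simp add: ga_def enn2real_positive_iff)
  then have "enn2real (al b) = c * enn2real (ga b)" using e by simp
  moreover have "0 <= c" by (simp add: c_def)
  ultimately have "ennreal (enn2real (al b)) = ennreal c * ennreal (enn2real (ga b))" by (simp only: ennreal_mult enn2real_nonneg)
  moreover have "al b < top" "ga b < top" using nu_tent(2)[OF b(1) bt] g by (auto simp: al_def ga_def)
  ultimately show "(\<integral>\<^sup>+z. ennreal (tent b z) * ennreal (v z) \<partial>m) = ennreal c * (\<integral>\<^sup>+z. U (nu m s l) z * ennreal (tent b z) \<partial>m)"
   by (simp add: al_def[symmetric] ga_def[symmetric])
 qed
 then show ?thesis using lim[OF b0(1) order_refl] by (simp add: c_def)
qed

end

section \<open>Existence of the eigenfunction and assembly of the implications\<close>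

lemma (in natural_process) eigen_process_exists:
 assumes l: "0 < l"
 shows "\<exists>v. eigen_process X m s l v"
proof -
 obtain v where v: "sig_bounded v" "!!y. 0 < y ==> y < top ==> v y = l * (sig y - primitive2 v y)"
  "!!y. l * psi m s (- l) y = (if y \<in> Rpos then v y else 0)" "((%y. v y / sig y) \<longlongrightarrow> l) (at_right 0)"
  using psi_properties[OF l] by blast
 \<comment> \<open>\<open>psi\<close> is 0 off \<open>(0,\<infinity>)\<close> by convention, whereas
   the Volterra solution is arbitrary there; the extension by 0 makes \<open>v'\<close> the density
   of \<open>nu\<close> everywhere.\<close>
 define v' where "v' y = (if y \<in> Rpos then v y else 0)" for y
 have [measurable]: "v \<in> borelm" using v(1) by (simp add: sig_bounded_def)
 have "v' = (%y. indicat_real Rpos y * v y)" by (auto simp: v'_def indicator_def fun_eq_iff)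
 then have m: "v' \<in> borelm" by simp
 have sb: "sig_bounded v'"
  unfolding sig_bounded_def
 proof (intro conjI m allI impI)
  fix y :: ennreal assume y: "y < top"
  obtain B where "!!z. 0 < z ==> z <= y ==> \<bar>v z\<bar> <= B * sig z" using sig_boundedD[OF v(1) y] by blast
  then show "\<exists>B. \<forall>z. 0 < z & z <= y --> \<bar>v' z\<bar> <= B * sig z"
   using y by (intro exI[of _ B]) (auto simp: v'_def intro: order_le_less_trans)
 qed
 have dp: "primitive2 v' y = primitive2 v y" if "y < top" for y
  unfolding primitive2_def set_lebesgue_integral_def
  by (rule Bochner_Integration.integral_cong) (use that in \<open>auto simp: v'_def indicator_def intro: order_le_less_trans\<close>)
 have "eigen_process X m s l v'"
 proof unfold_locales
  show "0 < l" by fact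
  show "sig_bounded v'" by fact
  show "v' y = l * (sig y - primitive2 v' y)" if "0 < y" "y < top" for y
   using v(2)[OF that] that by (simp add: dp v'_def)
  show "((%y. v' y / sig y) \<longlongrightarrow> l) (at_right 0)"
   by (rule Lim_transform_eventually[OF v(4)], use eventually_at_right_0 in eventually_elim) (simp add: v'_def)
  show "v' z = 0" if "z \<notin> Rpos" for z using that by (simp only: v'_def if_False)
  show "nu m s l = density m (%z. ennreal (v' z))" by (simp only: nu_def v(3) v'_def)
 qed
 then show ?thesis by blast
qed

theorem theorem1p3:
  fixes X :: "'w process" and m :: "ennreal measure" and s :: "ennreal \<Rightarrow> real"
    and \<mu> :: "ennreal measure" and l :: real
  assumes "dmds_diffusion m s X"
    and "irreducible_diffusion X"
    and "stopped_at_zero X"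
    and "\<And>x. 0 < x \<Longrightarrow> x < top \<Longrightarrow>
           emeasure (law X x) {om\<in>space (events X). hit X 0 om < top} = 1"
    and "infinite {\<nu>. qsd X \<nu>}"
    and "prob_on_pos \<mu>"
    and "\<And>n. n \<ge> 1 \<Longrightarrow> hit0_moment X \<mu> n < top"
    and "0 < l" and "l \<le> spectral_bottom m s"
  shows "(weakly_tendsto (cond_law X \<mu>) (nu m s l) at_top \<longrightarrow>
            (\<forall>h>0. ((\<lambda>t. tail X \<mu> (t + h) / tail X \<mu> t) \<longlongrightarrow> exp (- l * h)) at_top)) \<and>
         ((\<forall>h>0. ((\<lambda>t. tail X \<mu> (t + h) / tail X \<mu> t) \<longlongrightarrow> exp (- l * h)) at_top) \<longrightarrow>
            ((\<lambda>n. norm_moment X \<mu> (n - 1) / norm_moment X \<mu> n) \<longlonglongrightarrow> l)) \<and>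
         (((\<lambda>n. norm_moment X \<mu> (n - 1) / norm_moment X \<mu> n) \<longlonglongrightarrow> l) \<longleftrightarrow>
            weakly_tendsto (\<lambda>n. (renewal X ^^ n) \<mu>) (nu m s l) sequentially)"
proof -
  have "dmds_process X m s"
    by unfold_locales (use assms(1,3,4) in \<open>auto simp: dmds_diffusion_def\<close>)
  then interpret dmds_process X m s .
  interpret natural_process X m s
    by unfold_locales (rule natural_boundary[OF assms(5)])
  obtain v where "eigen_process X m s l v" using eigen_process_exists[OF assms(8)] by blast
  then interpret eigen_process X m s l v .
  note \<mu> = assms(6)
  have fin: "tail_moment \<mu> k < top" for k
  proof -
    have "hit0_moment X \<mu> (Suc k) < top" by (rule assms(7)) simp
    then have "tail_moment \<mu> k \<noteq> top"
      unfolding hit0_moment_Suc[OF \<mu>] by (auto simp: ennreal_mult_top simp del: fact_Suc)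
    then show ?thesis by (simp add: less_top)
  qed
  note it = renewal_iterate[OF \<mu> fin]
  \<comment> \<open>The ratio at \<open>n = 0\<close> has the truncated index
    \<open>0 - 1 = 0\<close>; dropping this term does not change the limit.\<close>
  have shift: "((\<lambda>n. norm_moment X \<mu> (n - 1) / norm_moment X \<mu> n) \<longlonglongrightarrow> l) \<longleftrightarrow>
    (\<lambda>n. norm_moment X \<mu> n / norm_moment X \<mu> (Suc n)) \<longlonglongrightarrow> l"
    using filterlim_sequentially_Suc[of "\<lambda>n. norm_moment X \<mu> (n - 1) / norm_moment X \<mu> n" "nhds l"] by simp
  have step: "norm_moment X \<mu> n * enn2real (tail_moment ((renewal X ^^ n) \<mu>) 0) = norm_moment X \<mu> (Suc n)" for n
    using it(3)[of n 0] by (simp add: norm_moment_Suc[OF \<mu>])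
  have T: "0 < enn2real (tail_moment ((renewal X ^^ n) \<mu>) 0)" for n
    using tail_moment_0(2)[OF it(1)] it(2) by (simp add: enn2real_positive_iff)
  have pos: "0 < norm_moment X \<mu> n" for n
  proof (induction n)
    case 0
    interpret L: prob_space "law_from X \<mu>" by (rule law_from_facts(4)[OF \<mu>])
    show ?case by (simp add: norm_moment_def hit0_moment_def L.emeasure_space_1)
  next
    case (Suc n)
    then show ?case unfolding step[of n, symmetric] using T by simp
  qed
  \<comment> \<open>The reciprocal mean of \<open>T_0\<close> under the \<open>n\<close>-th iterate
    is the \<open>n\<close>-th moment ratio, so convergence of these ratios is exactly the condition
    in \<open>renewal_limit\<close> and its converse.\<close>
  have ratio: "1 / enn2real (tail_moment ((renewal X ^^ n) \<mu>) 0) = norm_moment X \<mu> n / norm_moment X \<mu> (Suc n)" for n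
    using pos[of n] by (simp add: step[symmetric])
  have "(\<lambda>n. norm_moment X \<mu> n / norm_moment X \<mu> (Suc n)) \<longlonglongrightarrow> l" if "\<forall>h>0. ((\<lambda>t. tail X \<mu> (t + h) / tail X \<mu> t) \<longlongrightarrow> exp (- l * h)) at_top"
    by (rule LIMSEQ_imp_Suc, rule moment_ratio_of_tail_ratio[OF \<mu> fin assms(8)]) (use that in blast)
  moreover have "(\<lambda>n. norm_moment X \<mu> n / norm_moment X \<mu> (Suc n)) \<longlonglongrightarrow> l \<longleftrightarrow> weakly_tendsto (\<lambda>n. (renewal X ^^ n) \<mu>) (nu m s l) sequentially"
    using renewal_limit[of "\<lambda>n. (renewal X ^^ n) \<mu>"] renewal_limit_converse[of "\<lambda>n. (renewal X ^^ n) \<mu>"] it(1,2)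
    by (auto simp: ratio)
  ultimately show ?thesis
    using tail_ratio_of_weak_limit[OF \<mu>] unfolding shift by blast
qed

end
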